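(* Let $p\ge2$ be an integer, $s_1\in\{0,1,\dots,3p-1\}$, $s_2\in\{0,1,\dots,p-1\}$, $\boldsymbol s=(s_1,s_2)$, and let $\widehat\psi^{[A_2]}_{p,\boldsymbol s}(\tau,w)$, $\psi^{[A_2]}_{p,\boldsymbol s}(\tau)$ be as in the context ($\tau,w\in\mathbb H$, $\tau\neq w$). (1) We have $$\widehat\psi^{[A_2]}_{p,\boldsymbol s}(\tau+1,w+1)=e^{\frac{2\pi i}{3p}(s_1^2+s_1s_2+s_2^2)}\,\widehat\psi^{[A_2]}_{p,\boldsymbol s}(\tau,w),$$ $$\widehat\psi^{[A_2]}_{p,\boldsymbol s}\left(-\frac1\tau,-\frac1w\right)=-\frac{i\tau}{p\sqrt3}\sum_{r_1=0}^{3p-1}\sum_{r_2=0}^{p-1}e^{-\frac{2\pi i}{3p}(2r_1s_1+r_2s_1+r_1s_2+2r_2s_2)}\,\widehat\psi^{[A_2]}_{p,\boldsymbol r}(\tau,w).$$ (2) We have $$\psi^{[A_2]}_{p,\boldsymbol s}(\tau)=\frac13\delta_{\boldsymbol s=\boldsymbol 0}+\sum_{\boldsymbol n\in\mathbb Z^2+\boldsymbol{\mu_2}(\boldsymbol s)}\operatorname{sgn}(n_1)\operatorname{sgn}(n_2)\,q^{pQ_2(\boldsymbol n)}.$$ (3) We have $$\widehat\psi^{[A_2]}_{p,\boldsymbol s}(\tau,w)=\sqrt{6p}\int_\tau^w\frac{h_{p,\boldsymbol s}(\tau,w_1)}{\sqrt{i(w_1-\tau)}}dw_1+\frac13\Theta^{[A_2]}_{\boldsymbol{\mu_2}(\boldsymbol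 s)}(\tau),$$ where $$h_{p,\boldsymbol s}(\tau,w):=\sum_{\delta\in\{0,1\}}\left(\vartheta^{[1]}_{3p,2s_1+s_2+3p\delta}(w)\,\widehat\psi^{[A_1]}_{p,s_2-p\delta}(\tau,w)+\vartheta^{[1]}_{3p,2s_2+s_1+3p\delta}(w)\,\widehat\psi^{[A_1]}_{p,s_1-p\delta}(\tau,w)\right).$$ In summary, $\psi^{[A_2]}_{p,\boldsymbol s}$ forms (as a vector indexed by $\boldsymbol s$) a vector-valued false modular form of depth two and weight one, with modular completion $\widehat\psi^{[A_2]}_{p,\boldsymbol s}$.
   Context: $\mathbb H$ is the upper half-plane, $q=e^{2\pi i\tau}$; square roots are principal values; $\operatorname{sgn}(0)=0$; $\delta_{\mathcal S}=1$ if $\mathcal S$ holds, else $0$. The limit $w\to\tau+i\infty$ is along the vertical line through $\tau$. Integrals $\int_\tau^w$ are along the hyperbolic geodesic from $\tau$ to $w$. Root lattice $A_2$: identified with $\mathbb Z^2$ via coordinates with respect to simple roots $\boldsymbol{\alpha_1},\boldsymbol{\alpha_2}$; $B_2(\boldsymbol{\alpha_j},\boldsymbol{\alpha_j})=2$, $B_2(\boldsymbol{\alpha_1},\boldsymbol{\alpha_2})=-1$, so $Q_2(\boldsymbol n)=\frac12B_2(\boldsymbol n,\boldsymbol n)=n_1^2+n_2^2-n_1n_2$. Fundamental weights: $\boldsymbol{\beta_1}=\frac23\boldsymbol{\alpha_1}+\frac13\boldsymbol{\alpha_2}$, $\boldsymbol{\beta_2}=\frac13\boldsymbol{\alpha_1}+\frac23\boldsymbol{\alpha_2}$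 (so $B_2(\boldsymbol{\alpha_j},\boldsymbol{\beta_k})=\delta_{j,k}$), and $\boldsymbol{\mu_2}(\boldsymbol s)=\frac{s_1}p\boldsymbol{\beta_1}+\frac{s_2}p\boldsymbol{\beta_2}=\left(\frac{2s_1+s_2}{3p},\frac{s_1+2s_2}{3p}\right)$. Generalized error function: for a positive definite quadratic form $Q(\boldsymbol x)=\frac12\boldsymbol x^TA\boldsymbol x$ on $\mathbb R^n$ with bilinear form $B(\boldsymbol x,\boldsymbol y)=\boldsymbol x^TA\boldsymbol y$ and linearly independent $M=(\boldsymbol{m_1},\dots,\boldsymbol{m_r})$, $E_{Q,M}(\boldsymbol x):=\det(A)^{\frac12}\int_{\mathbb R^n}\prod_{j}\operatorname{sgn}(B(\boldsymbol{m_j},\boldsymbol y))e^{-2\pi Q(\boldsymbol y-\boldsymbol x)}d^n\boldsymbol y$, $\boldsymbol x\in\mathbb C^n$. Then $$\widehat\psi^{[A_2]}_{p,\boldsymbol s}(\tau,w):=\sum_{\boldsymbol n\in\mathbb Z^2+\boldsymbol{\mu_2}(\boldsymbol s)}E_{pQ_2,(\boldsymbol{\beta_1},\boldsymbol{\beta_2})}\left(-i\sqrt{i(w-\tau)}\,\boldsymbol n\right)q^{pQ_2(\boldsymbol n)},\qquad\psi^{[A_2]}_{p,\boldsymbol s}(\tau):=\lim_{w\to\tau+i\infty}\widehat\psi^{[A_2]}_{p,\boldsymbol s}(\tau,w),$$ $$\Theta^{[A_2]}_{\boldsymbol\mu}(\tau):=\sum_{\boldsymbol n\in\mathbb Z^2+\boldsymbol\mu}q^{pQ_2(\boldsymbol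 n)},\qquad\widehat\psi^{[A_1]}_{p,s}(\tau,w):=\sum_{n\in\mathbb Z+\frac s{2p}}\operatorname{erf}\left(-i\sqrt{2\pi ip(w-\tau)}\,n\right)q^{pn^2},\qquad\vartheta^{[1]}_{m,r}(\tau):=\sum_{n\in\mathbb Z+\frac r{2m}}n\,q^{mn^2}.$$ False modular forms. Let $\mathfrak M_k$ ($k\in\frac12\mathbb Z$) be the space of weakly holomorphic modular forms of weight $k$ (possibly on a finite-index subgroup of $\mathrm{SL}_2(\mathbb Z)$ and/or vector-valued with a multiplier system). Define recursively $\mathfrak F_k^d$ (false modular forms of weight $k$, depth $d$) and $\widehat{\mathfrak F}_k^d$ (their modular completions): $\mathfrak F_k^0=\widehat{\mathfrak F}_k^0=\mathfrak M_k$; for $d\ge1$, $f\in\mathfrak F_k^d$ is a (possibly vector-valued) holomorphic function on $\mathbb H$ with an associated completion $\widehat f(\tau,w)\in\widehat{\mathfrak F}_k^d$ such that: (a) for some $\ell\in\{0,1\}$, $(i(w-\tau))^{\ell/2}\widehat f(\tau,w)$ is holomorphic on $\{(\tau,w)\in\mathbb H^2:\tau\ne w\}$; (b) $\lim_{w\to\tau+i\infty}\widehat f(\tau,w)=f(\tau)$; (c) $\widehat f\left(\frac{a\tau+b}{c\tau+d'},\frac{aw+b}{cw+d'}\right)=\chi_{\tau,w}(\gamma)^{\ell}(c\tau+d')^k\rho(\gamma)\widehat f(\tau,w)$ for $\gamma=\begin{pmatrix}a&b\\c&d'\end{pmatrix}$ in $\mathrm{SL}_2(\mathbb Z)$ (or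 a subgroup), with a multiplier system $\rho$ and $\chi_{\tau,w}(\gamma)=\sqrt{\frac{i(w-\tau)}{(c\tau+d')(cw+d')}}\frac{\sqrt{c\tau+d'}\sqrt{cw+d'}}{\sqrt{i(w-\tau)}}\in\{\pm1\}$; (d) (componentwise) $\partial_w\widehat f(\tau,w)$ is a finite sum $\sum_j(i(w-\tau))^{r_j}\widehat g_j(\tau,w)h_j(w)$ with $\widehat g_j\in\widehat{\mathfrak F}^{d-1}_{k+r_j}$, $h_j\in\mathfrak M_{2+r_j}$. *)

theory Defs
  imports "HOL-Complex_Analysis.Complex_Analysis" "HOL-Algebra.Coset"
begin

definition uhp :: "complex set" where
  "uhp = {z. Im z > 0}"

text \<open>\<open>qpow \<tau> x\<close> is $q^x$ with $q = e^{2\pi i\tau}$.\<close>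

definition qpow :: "complex \<Rightarrow> real \<Rightarrow> complex" where
  "qpow \<tau> x = exp (2 * of_real pi * \<i> * of_real x * \<tau>)"

definition cerf :: "complex \<Rightarrow> complex" where
  "cerf z = 2 / of_real (sqrt pi) * contour_integral (linepath 0 z) (\<lambda>t. exp (- (t ^ 2)))"

text \<open>The hyperbolic geodesic segment: a vertical segment, or the arc of the circle centred at the
  real point equidistant from both end points.\<close>

definition geodesic :: "complex \<Rightarrow> complex \<Rightarrow> real \<Rightarrow> complex" where
  "geodesic \<tau> w =
     (if Re \<tau> = Re w then linepath \<tau> w
      else let c = of_real (((cmod w)\<^sup>2 - (cmod \<tau>)\<^sup>2) / (2 * (Re w - Re \<tau>)))
           in part_circlepath c (cmod (\<tau> - c)) (Arg (\<tau> - c)) (Arg (w - c)))"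


section \<open>Quadratic forms and generalized error functions\<close>

text \<open>Polymorphic, because the form is evaluated at real and at complex vectors; for complex
  vectors it is the complex bilinear (not Hermitian) extension.\<close>

definition quad_form :: "real^'n^'n \<Rightarrow> 'a::real_field^'n \<Rightarrow> 'a" where
  "quad_form A x = (\<Sum>i\<in>UNIV. \<Sum>j\<in>UNIV. of_real (A $ i $ j) * x $ i * x $ j) / 2"

definition bilin_form :: "real^'n^'n \<Rightarrow> real^'n \<Rightarrow> real^'n \<Rightarrow> real" where
  "bilin_form A x y = x \<bullet> (A *v y)"

text \<open>Meant for positive definite symmetric \<open>A\<close> and linearly independent \<open>M\<close>.\<close>

definition gen_error :: "real^'n^'n \<Rightarrow> (real^'n) list \<Rightarrow> complex^'n \<Rightarrow> complex" where
  "gen_error A M x =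
     of_real (sqrt (det A)) *
     (LINT y|lborel. of_real (\<Prod>m\<leftarrow>M. sgn (bilin_form A m y)) *
        exp (- 2 * of_real pi * quad_form A ((\<chi> i. of_real (y $ i)) - x)))"


section \<open>The functions attached to $A_1$ and $A_2$\<close>

text \<open>Elements of the $A_2$ root lattice and its rational span are given by their coordinates with
  respect to the simple roots.\<close>

definition A2_gram :: "real^2^2" where
  "A2_gram = vector [vector [2, -1], vector [-1, 2]]"

abbreviation Q2 :: "real^2 \<Rightarrow> real" where
  "Q2 \<equiv> quad_form A2_gram"

definition beta1 :: "real^2" where
  "beta1 = vector [2/3, 1/3]"

definition beta2 :: "real^2" where
  "beta2 = vector [1/3, 2/3]"

definition mu2 :: "nat \<Rightarrow> int \<times> int \<Rightarrow> real^2" where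
  "mu2 p s = (of_int (fst s) / of_nat p) *\<^sub>R beta1 + (of_int (snd s) / of_nat p) *\<^sub>R beta2"

definition int_coset :: "real \<Rightarrow> real set" where
  "int_coset x = {n. n - x \<in> \<int>}"

definition int2_coset :: "real^2 \<Rightarrow> (real^2) set" where
  "int2_coset \<mu> = {n. \<forall>j. n $ j - \<mu> $ j \<in> \<int>}"

definition psihat_A2 :: "nat \<Rightarrow> int \<times> int \<Rightarrow> complex \<Rightarrow> complex \<Rightarrow> complex" where
  "psihat_A2 p s \<tau> w =
     (\<Sum>\<^sub>\<infinity>n\<in>int2_coset (mu2 p s).
        gen_error (of_nat p *\<^sub>R A2_gram) [beta1, beta2]
          (\<chi> j. - \<i> * csqrt (\<i> * (w - \<tau>)) * of_real (n $ j)) *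
        qpow \<tau> (of_nat p * Q2 n))"

definition psi_A2 :: "nat \<Rightarrow> int \<times> int \<Rightarrow> complex \<Rightarrow> complex" where
  "psi_A2 p s \<tau> = Lim at_top (\<lambda>t::real. psihat_A2 p s \<tau> (\<tau> + \<i> * of_real t))"

definition Theta_A2 :: "nat \<Rightarrow> real^2 \<Rightarrow> complex \<Rightarrow> complex" where
  "Theta_A2 p \<mu> \<tau> = (\<Sum>\<^sub>\<infinity>n\<in>int2_coset \<mu>. qpow \<tau> (of_nat p * Q2 n))"

definition psihat_A1 :: "nat \<Rightarrow> int \<Rightarrow> complex \<Rightarrow> complex \<Rightarrow> complex" where
  "psihat_A1 p s \<tau> w =
     (\<Sum>\<^sub>\<infinity>n\<in>int_coset (of_int s / (2 * of_nat p)).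
        cerf (- \<i> * csqrt (2 * of_real pi * \<i> * of_nat p * (w - \<tau>)) * of_real n) *
        qpow \<tau> (of_nat p * n\<^sup>2))"

definition theta1 :: "nat \<Rightarrow> int \<Rightarrow> complex \<Rightarrow> complex" where
  "theta1 m r \<tau> =
     (\<Sum>\<^sub>\<infinity>n\<in>int_coset (of_int r / (2 * of_nat m)). of_real n * qpow \<tau> (of_nat m * n\<^sup>2))"

definition h_A2 :: "nat \<Rightarrow> int \<times> int \<Rightarrow> complex \<Rightarrow> complex \<Rightarrow> complex" where
  "h_A2 p s \<tau> w =
     (\<Sum>\<delta>\<in>{0, 1}.
        theta1 (3 * p) (2 * fst s + snd s + 3 * int p * \<delta>) w * psihat_A1 p (snd s - int p * \<delta>) \<tau> w +
        theta1 (3 * p) (2 * snd s + fst s + 3 * int p * \<delta>) w * psihat_A1 p (fst s - int p * \<delta>) \<tau> w)"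


text \<open>The labels \<open>s = (s\<^sub>1, s\<^sub>2)\<close>; they represent $\frac1p A_2^*$ modulo $A_2$ under \<open>mu2 p\<close>.\<close>

definition A2_labels :: "nat \<Rightarrow> (int \<times> int) set" where
  "A2_labels p = {0..3 * int p - 1} \<times> {0..int p - 1}"


section \<open>The modular group and multiplier systems\<close>

definition SL2Z :: "(int^2^2) monoid" where
  "SL2Z = \<lparr>carrier = {A. det A = 1}, mult = (**), one = mat 1\<rparr>"

definition fin_index_subgroup :: "(int^2^2) set \<Rightarrow> bool" where
  "fin_index_subgroup \<Gamma> \<longleftrightarrow> subgroup \<Gamma> SL2Z \<and> finite (rcosets\<^bsub>SL2Z\<^esub> \<Gamma>)"

definition jfac :: "int^2^2 \<Rightarrow> complex \<Rightarrow> complex" where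
  "jfac \<gamma> \<tau> = of_int (\<gamma> $ 2 $ 1) * \<tau> + of_int (\<gamma> $ 2 $ 2)"

definition moeb :: "int^2^2 \<Rightarrow> complex \<Rightarrow> complex" where
  "moeb \<gamma> \<tau> = (of_int (\<gamma> $ 1 $ 1) * \<tau> + of_int (\<gamma> $ 1 $ 2)) / jfac \<gamma> \<tau>"

text \<open>The principal power $(c\tau+d)^k$.\<close>

definition jpow :: "int^2^2 \<Rightarrow> real \<Rightarrow> complex \<Rightarrow> complex" where
  "jpow \<gamma> k \<tau> = jfac \<gamma> \<tau> powr of_real k"

definition chi_fac :: "int^2^2 \<Rightarrow> complex \<Rightarrow> complex \<Rightarrow> complex" where
  "chi_fac \<gamma> \<tau> w =
     csqrt (\<i> * (w - \<tau>) / (jfac \<gamma> \<tau> * jfac \<gamma> w)) *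
     (csqrt (jfac \<gamma> \<tau>) * csqrt (jfac \<gamma> w) / csqrt (\<i> * (w - \<tau>)))"

text \<open>Components of vector-valued forms are labelled by the elements of a finite set of pairs of
  integers. Every finite index set embeds there, so any dimension is allowed; scalar forms are those
  with a one-element label set.\<close>

type_synonym label = "int \<times> int"

text \<open>A (matrix-valued) multiplier system of weight \<open>k\<close>: unitary, which for scalars is the
  classical requirement of absolute value 1, and such that $(c\tau+d)^k\rho(\gamma)$ is a cocycle.
  As \<open>k\<close> may be a half-integer, \<open>\<rho>\<close> itself need not be a homomorphism.\<close>

definition multiplier_system ::
  "real \<Rightarrow> (int^2^2) set \<Rightarrow> label set \<Rightarrow> (int^2^2 \<Rightarrow> label \<Rightarrow> label \<Rightarrow> complex) \<Rightarrow> bool" where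
  "multiplier_system k \<Gamma> I \<rho> \<longleftrightarrow>
     (\<forall>\<gamma>\<in>\<Gamma>. \<forall>i\<in>I. \<forall>j\<in>I. (\<Sum>l\<in>I. \<rho> \<gamma> i l * cnj (\<rho> \<gamma> j l)) = of_bool (i = j)) \<and>
     (\<forall>\<gamma>\<in>\<Gamma>. \<forall>\<gamma>'\<in>\<Gamma>. \<forall>\<tau>\<in>uhp. \<forall>i\<in>I. \<forall>j\<in>I.
        jpow (\<gamma> ** \<gamma>') k \<tau> * \<rho> (\<gamma> ** \<gamma>') i j =
        jpow \<gamma> k (moeb \<gamma>' \<tau>) * jpow \<gamma>' k \<tau> * (\<Sum>l\<in>I. \<rho> \<gamma> i l * \<rho> \<gamma>' l j))"


section \<open>False modular forms\<close>

text \<open>The space $\mathfrak M_k$. The last condition says that all poles are at the cusps: at every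
  cusp the form grows at most exponentially in the imaginary part.\<close>

definition weakly_holomorphic_form :: "real \<Rightarrow> label set \<Rightarrow> (label \<Rightarrow> complex \<Rightarrow> complex) \<Rightarrow> bool" where
  "weakly_holomorphic_form k I f \<longleftrightarrow>
     2 * k \<in> \<int> \<and> finite I \<and>
     (\<forall>i\<in>I. f i holomorphic_on uhp) \<and>
     (\<exists>\<Gamma> \<rho>. fin_index_subgroup \<Gamma> \<and> multiplier_system k \<Gamma> I \<rho> \<and>
        (\<forall>\<gamma>\<in>\<Gamma>. \<forall>i\<in>I. \<forall>\<tau>\<in>uhp.
           f i (moeb \<gamma> \<tau>) = jpow \<gamma> k \<tau> * (\<Sum>j\<in>I. \<rho> \<gamma> i j * f j \<tau>))) \<and>
     (\<forall>\<gamma>\<in>carrier SL2Z. \<forall>i\<in>I. \<exists>C N. \<forall>\<tau>. Im \<tau> \<ge> 1 \<longrightarrow>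
        cmod (f i (moeb \<gamma> \<tau>) / jpow \<gamma> k \<tau>) \<le> C * exp (N * Im \<tau>))"

text \<open>Holomorphy in two variables: complex linear total derivative.\<close>

definition holomorphic2_on :: "(complex \<Rightarrow> complex \<Rightarrow> complex) \<Rightarrow> (complex \<times> complex) set \<Rightarrow> bool" where
  "holomorphic2_on F S \<longleftrightarrow>
     (\<forall>z\<in>S. \<exists>a b. ((\<lambda>(\<tau>, w). F \<tau> w) has_derivative (\<lambda>(u, v). a * u + b * v)) (at z within S))"

text \<open>\<open>false_modular_form d k I f F\<close> says that the vector \<open>f\<close> with components labelled by \<open>I\<close>
  belongs to $\mathfrak F_k^d$, with modular completion \<open>F\<close> in $\widehat{\mathfrak F}_k^d$.
  In the differential equation, \<open>G m (a m)\<close> and \<open>H m (b m)\<close> are components of possibly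
  vector-valued forms \<open>G m\<close> and \<open>H m\<close>. It is stated off the branch cut
  $w \in \tau + i\mathbb R_{>0}$ of the principal powers of $i(w-\tau)$, across which \<open>F\<close> is
  discontinuous when \<open>l = 1\<close>; on the cut it carries no further information, since all functions
  involved are continuous up to the cut from the side $\mathrm{Re}(w) \ge \mathrm{Re}(\tau)$.\<close>

primrec false_modular_form ::
  "nat \<Rightarrow> real \<Rightarrow> label set \<Rightarrow> (label \<Rightarrow> complex \<Rightarrow> complex) \<Rightarrow>
   (label \<Rightarrow> complex \<Rightarrow> complex \<Rightarrow> complex) \<Rightarrow> bool" where
  "false_modular_form 0 k I f F \<longleftrightarrow>
     weakly_holomorphic_form k I f \<and> (\<forall>i\<in>I. \<forall>\<tau>\<in>uhp. \<forall>w\<in>uhp. F i \<tau> w = f i \<tau>)"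
| "false_modular_form (Suc d) k I f F \<longleftrightarrow>
     2 * k \<in> \<int> \<and> finite I \<and>
     (\<forall>i\<in>I. f i holomorphic_on uhp) \<and>
     (\<exists>l\<in>{0, 1::nat}.
        (\<forall>i\<in>I. holomorphic2_on (\<lambda>\<tau> w. csqrt (\<i> * (w - \<tau>)) ^ l * F i \<tau> w)
                  {(\<tau>, w). \<tau> \<in> uhp \<and> w \<in> uhp \<and> \<tau> \<noteq> w}) \<and>
        (\<exists>\<Gamma> \<rho>. fin_index_subgroup \<Gamma> \<and> multiplier_system k \<Gamma> I \<rho> \<and>
           (\<forall>\<gamma>\<in>\<Gamma>. \<forall>i\<in>I. \<forall>\<tau>\<in>uhp. \<forall>w\<in>uhp. \<tau> \<noteq> w \<longrightarrow>
              F i (moeb \<gamma> \<tau>) (moeb \<gamma> w) =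
                chi_fac \<gamma> \<tau> w ^ l * jpow \<gamma> k \<tau> * (\<Sum>j\<in>I. \<rho> \<gamma> i j * F j \<tau> w)))) \<and>
     (\<forall>i\<in>I. \<forall>\<tau>\<in>uhp. ((\<lambda>t::real. F i \<tau> (\<tau> + \<i> * of_real t)) \<longlongrightarrow> f i \<tau>) at_top) \<and>
     (\<forall>i\<in>I. \<exists>(N::nat) r A G a B H b.
        (\<forall>m<N. (\<exists>g. false_modular_form d (k + r m) (A m) g (G m)) \<and> a m \<in> A m \<and>
               weakly_holomorphic_form (2 + r m) (B m) (H m) \<and> b m \<in> B m) \<and>
        (\<forall>\<tau>\<in>uhp. \<forall>w\<in>uhp. \<i> * (w - \<tau>) \<notin> \<real>\<^sub>\<le>\<^sub>0 \<longrightarrow>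
           ((\<lambda>w. F i \<tau> w) has_field_derivative
              (\<Sum>m<N. (\<i> * (w - \<tau>)) powr of_real (r m) * G m (a m) \<tau> w * H m (b m) w)) (at w)))"

end

theory Submission
  imports Defs "HOL-Probability.Characteristic_Functions"
begin

text \<open>The proof rests on one reformulation: up to elementary factors, everything is a theta series, and a
theta series in one variable transforms under inversion by Poisson summation.

\<^item> Along a line through the origin the error function of the form $p Q_2$ is an entire function of the
square of the parameter (\<open>A2E_even\<close>). Its derivative is a sum of two products of a Gaussian and an
ordinary error function (\<open>A2E_has_field_derivative\<close>), and its value at $0$ is $1/3$ by a rotation symmetry of the $A_2$ form
(\<open>integral_sgn2_gauss2_0\<close>). So \<open>psihat_A2 p s \<tau> w\<close> is jointly holomorphic on all of $\mathbb H^2$,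
without branch cut, and equals $\frac13\Theta$ on the diagonal.

\<^item> In the coordinates $n_1/2$ and $n_2 - n_1/2$ the form $p Q_2$ is the sum of $3p N^2$ and $p m^2$,
and the cosets of $A_2$ split into two cosets of a product lattice (\<open>has_sum_int2_split\<close>). Hence the
$w$-derivative of \<open>psihat_A2\<close> is a sum of products of \<open>theta1 (3p)\<close> in $w$ and of \<open>phi p\<close>, the
completion \<open>psihat_A1 p\<close> without its factor $\sqrt{i(w-\tau)}$. Integrating from the diagonal along a
geodesic gives the integral formula (\<open>psihat_A2_integral\<close>), and letting $w \to \tau + i\infty$ under the
sum gives \<open>psi_A2_eq\<close>.

\<^item> Inversion is proved first for the Jacobi theta function (\<open>jt_S\<close>). Its derivative at $z = 0$ is
\<open>theta1\<close>. The function \<open>phi\<close> satisfies $\varphi + 2(w-\tau)\varphi_w = \vartheta(w)$, an equation with only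
one solution that is regular at $w = \tau$, so \<open>phi\<close> inherits the transformation (\<open>phi_S\<close>). In rank two,
both sides of the inversion formula have the same $w$-derivative and the same value at $w = \tau$
(\<open>psihat_A2_S\<close>). The sums over residues modulo $6p$ and $2p$ combine to a sum over the $3p^2$ labels by
\<open>A2_split_fourier\<close>.

\<^item> As a false modular form, \<open>psihat_A2\<close> has to transform under every $\gamma$ in the modular group, by
unitary matrices that satisfy the cocycle relation of a multiplier system. Since $S$ and $T$ generate,
some matrix exists for every $\gamma$ (\<open>rank1_rep_exists\<close>, \<open>rank2_rep_exists\<close>). The components of
\<open>psihat_A2\<close> are linearly dependent (the labels $s$ and $-s$ give the same function) and do not determine this matrix. Therefore theta functions with
real characteristics are carried along: they transform by the same matrices and are linearly
independent (\<open>th_independent\<close>, \<open>Th2_independent\<close>), so the matrices are unique and the cocycle relation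
follows (\<open>rho1_mult\<close>, \<open>rho2_mult\<close>).\<close>

(* Matrix and vector entries use the same infix symbol as coefficients of power series. *)
no_notation fps_nth (infixl "$" 75)

section \<open>Locally dominated series\<close>

text \<open>The hypothesis of the Weierstrass test, required only near every point: the series below are theta
series, whose terms are bounded uniformly on compact sets but not on the whole half-plane.\<close>

definition locally_dominated :: "'n set \<Rightarrow> 'a::topological_space set \<Rightarrow> ('n \<Rightarrow> 'a \<Rightarrow> 'b::real_normed_vector) \<Rightarrow> bool" where
  "locally_dominated A X f \<longleftrightarrow>
     (\<forall>x\<in>X. \<exists>U M. open U \<and> x \<in> U \<and> M summable_on A \<and> (\<forall>n\<in>A. \<forall>y\<in>U \<inter> X. norm (f n y) \<le> M n))"

lemma locally_dominatedE:
  assumes "locally_dominated A X f" "x \<in> X"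
  obtains U M where "open U" "x \<in> U" "M summable_on A" "\<And>n y. n \<in> A \<Longrightarrow> y \<in> U \<inter> X \<Longrightarrow> norm (f n y) \<le> M n"
  using bspec[OF assms(1)[unfolded locally_dominated_def] assms(2)] by (elim exE conjE) (auto intro: that)

lemma continuous_on_infsum:
  fixes f :: "'n \<Rightarrow> 'a::t2_space \<Rightarrow> 'b::banach"
  assumes cont: "\<And>n. n \<in> A \<Longrightarrow> continuous_on X (f n)" and dom: "locally_dominated A X f"
  shows "continuous_on X (\<lambda>x. \<Sum>\<^sub>\<infinity>n\<in>A. f n x)"
  unfolding continuous_on_eq_continuous_within
proof
  fix x assume x: "x \<in> X"
  obtain U M where U: "open U" "x \<in> U" "M summable_on A" "\<And>n y. n \<in> A \<Longrightarrow> y \<in> U \<inter> X \<Longrightarrow> norm (f n y) \<le> M n"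
    using locally_dominatedE[OF dom x] by metis
  have "uniform_limit (U \<inter> X) (\<lambda>F y. \<Sum>n\<in>F. f n y) (\<lambda>y. \<Sum>\<^sub>\<infinity>n\<in>A. f n y) (finite_subsets_at_top A)"
    by (rule Weierstrass_m_test_general[OF U(4,3)])
  then have "continuous_on (U \<inter> X) (\<lambda>y. \<Sum>\<^sub>\<infinity>n\<in>A. f n y)"
  proof (rule uniform_limit_theorem[rotated])
    show "\<forall>\<^sub>F F in finite_subsets_at_top A. continuous_on (U \<inter> X) (\<lambda>y. \<Sum>n\<in>F. f n y)"
      by (rule eventually_finite_subsets_at_top_weakI)
         (auto intro!: continuous_on_sum continuous_on_subset[OF cont])
  qed auto
  then have "continuous (at x within (U \<inter> X)) (\<lambda>y. \<Sum>\<^sub>\<infinity>n\<in>A. f n y)"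
    using x U by (simp add: continuous_on_eq_continuous_within)
  moreover have "at x within (U \<inter> X) = at x within X"
    by (rule at_within_nhd[OF \<open>x \<in> U\<close> \<open>open U\<close>]) auto
  ultimately show "continuous (at x within X) (\<lambda>y. \<Sum>\<^sub>\<infinity>n\<in>A. f n y)" by simp
qed

lemma locally_dominated_summable:
  fixes f :: "'n \<Rightarrow> 'a::topological_space \<Rightarrow> 'b::banach"
  assumes "locally_dominated A X f" "x \<in> X"
  shows "(\<lambda>n. f n x) summable_on A"
proof -
  obtain U M where "x \<in> U" "M summable_on A" "\<And>n y. n \<in> A \<Longrightarrow> y \<in> U \<inter> X \<Longrightarrow> norm (f n y) \<le> M n"
    using locally_dominatedE[OF assms] by metis
  then have "M summable_on A" "\<And>n. n \<in> A \<Longrightarrow> norm (f n x) \<le> M n"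
    using assms(2) by auto
  then show ?thesis by (rule abs_summable_summable[OF Infinite_Sum.abs_summable_on_comparison_test'])
qed

lemma has_field_derivative_infsum:
  fixes f :: "'n \<Rightarrow> complex \<Rightarrow> complex"
  assumes X: "open X" and dom: "locally_dominated A X f" and z: "z \<in> X"
    and der: "\<And>n z. n \<in> A \<Longrightarrow> z \<in> X \<Longrightarrow> (f n has_field_derivative f' n z) (at z)"
  shows "((\<lambda>z. \<Sum>\<^sub>\<infinity>n\<in>A. f n z) has_field_derivative (\<Sum>\<^sub>\<infinity>n\<in>A. f' n z)) (at z)"
    and "(\<lambda>n. f' n z) summable_on A"
proof -
  obtain U M where U: "open U" "z \<in> U" "M summable_on A" "\<And>n y. n \<in> A \<Longrightarrow> y \<in> U \<inter> X \<Longrightarrow> norm (f n y) \<le> M n"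
    using locally_dominatedE[OF dom z] by metis
  obtain r where r: "r > 0" "cball z r \<subseteq> U \<inter> X"
    using open_contains_cball[of "U \<inter> X"] X U z by blast
  have ul: "uniform_limit (cball z r) (\<lambda>F y. \<Sum>n\<in>F. f n y) (\<lambda>y. \<Sum>\<^sub>\<infinity>n\<in>A. f n y) (finite_subsets_at_top A)"
    using r(2) by (intro Weierstrass_m_test_general[OF _ U(3)] U(4)) auto
  have cont: "continuous_on (cball z r) (f n)" if "n \<in> A" for n
    using der[OF that] r by (intro continuous_at_imp_continuous_on ballI DERIV_isCont) blast
  have ev: "\<forall>\<^sub>F F in finite_subsets_at_top A. continuous_on (cball z r) (\<lambda>y. \<Sum>n\<in>F. f n y) \<and>
      (\<forall>w\<in>ball z r. ((\<lambda>y. \<Sum>n\<in>F. f n y) has_field_derivative (\<Sum>n\<in>F. f' n w)) (at w))"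
  proof (rule eventually_finite_subsets_at_top_weakI, intro conjI ballI)
    fix F assume F: "finite F" "F \<subseteq> A"
    show "continuous_on (cball z r) (\<lambda>y. \<Sum>n\<in>F. f n y)"
      using F by (intro continuous_on_sum cont) auto
    fix w assume w: "w \<in> ball z r"
    show "((\<lambda>y. \<Sum>n\<in>F. f n y) has_field_derivative (\<Sum>n\<in>F. f' n w)) (at w)"
      using F w r by (intro derivative_intros der) auto
  qed
  obtain g' where g': "\<And>w. w \<in> ball z r \<Longrightarrow> ((\<lambda>y. \<Sum>\<^sub>\<infinity>n\<in>A. f n y) has_field_derivative (g' w)) (at w)
       \<and> ((\<lambda>F. \<Sum>n\<in>F. f' n w) \<longlongrightarrow> g' w) (finite_subsets_at_top A)"
    using has_complex_derivative_uniform_limit[OF ev ul _ r(1)] by auto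
  have "((\<lambda>n. f' n z) has_sum g' z) A"
    using g'[of z] r unfolding has_sum_def by auto
  then show "(\<lambda>n. f' n z) summable_on A" "((\<lambda>z. \<Sum>\<^sub>\<infinity>n\<in>A. f n z) has_field_derivative (\<Sum>\<^sub>\<infinity>n\<in>A. f' n z)) (at z)"
    using g'[of z] r infsumI[of "\<lambda>n. f' n z"] by (auto simp: summable_on_def)
qed

lemma holomorphic_infsum:
  fixes f :: "'n \<Rightarrow> complex \<Rightarrow> complex"
  assumes "open X" "locally_dominated A X f" "\<And>n. n \<in> A \<Longrightarrow> f n holomorphic_on X"
  shows "(\<lambda>z. \<Sum>\<^sub>\<infinity>n\<in>A. f n z) holomorphic_on X"
  unfolding holomorphic_on_open[OF assms(1)]
  using has_field_derivative_infsum(1)[OF assms(1,2), where f' = "\<lambda>n. deriv (f n)"]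
    holomorphic_derivI[OF assms(3,1)] by blast

text \<open>Dominated convergence for unordered sums (Tannery's theorem): a finite partial sum approximates
the sums for all relevant \<open>x\<close> and the sum of the limits at the same time.\<close>

lemma tendsto_infsum_dominated:
  fixes f :: "'n \<Rightarrow> 'a \<Rightarrow> 'b::banach"
  assumes lim: "\<And>n. n \<in> A \<Longrightarrow> (f n \<longlongrightarrow> l n) F"
    and dom: "\<forall>\<^sub>F x in F. \<forall>n\<in>A. norm (f n x) \<le> M n" and M: "M summable_on A" and F: "F \<noteq> bot"
  shows "((\<lambda>x. \<Sum>\<^sub>\<infinity>n\<in>A. f n x) \<longlongrightarrow> (\<Sum>\<^sub>\<infinity>n\<in>A. l n)) F"
proof (rule tendstoI)
  fix e :: real assume e: "e > 0"
  define Y where "Y = {x. \<forall>n\<in>A. norm (f n x) \<le> M n}"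
  have lM: "norm (l n) \<le> M n" if "n \<in> A" for n
    using tendsto_norm[OF lim[OF that]] by (rule tendsto_upperbound)
       (use dom that F in \<open>auto elim: eventually_mono\<close>)
  \<comment> \<open>The limit functions satisfy the same bound; the one-point domain makes the second sum an instance of the same test.\<close>
  have u1: "uniform_limit Y (\<lambda>X y. \<Sum>n\<in>X. f n y) (\<lambda>y. \<Sum>\<^sub>\<infinity>n\<in>A. f n y) (finite_subsets_at_top A)"
    by (rule Weierstrass_m_test_general[OF _ M]) (auto simp: Y_def)
  have u2: "uniform_limit UNIV (\<lambda>X y. \<Sum>n\<in>X. l n) (\<lambda>y::unit. \<Sum>\<^sub>\<infinity>n\<in>A. l n) (finite_subsets_at_top A)"
    by (rule Weierstrass_m_test_general[OF _ M]) (auto simp: lM)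
  have "\<forall>\<^sub>F X in finite_subsets_at_top A. finite X \<and> X \<subseteq> A \<and> (\<forall>y\<in>Y. dist (\<Sum>n\<in>X. f n y) (\<Sum>\<^sub>\<infinity>n\<in>A. f n y) < e / 3)
     \<and> dist (\<Sum>n\<in>X. l n) (\<Sum>\<^sub>\<infinity>n\<in>A. l n) < e / 3"
    using uniform_limitD[OF u1, of "e/3"] uniform_limitD[OF u2, of "e/3"] e
    by (intro eventually_conj) (auto intro: eventually_finite_subsets_at_top_weakI)
  from eventually_happens'[OF finite_subsets_at_top_neq_bot this]
  obtain X where X': "finite X \<and> X \<subseteq> A \<and> (\<forall>y\<in>Y. dist (\<Sum>n\<in>X. f n y) (\<Sum>\<^sub>\<infinity>n\<in>A. f n y) < e / 3) \<and>
     dist (\<Sum>n\<in>X. l n) (\<Sum>\<^sub>\<infinity>n\<in>A. l n) < e / 3" ..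
  then have X: "finite X" "X \<subseteq> A" "\<And>y. y \<in> Y \<Longrightarrow> dist (\<Sum>n\<in>X. f n y) (\<Sum>\<^sub>\<infinity>n\<in>A. f n y) < e / 3"
     "dist (\<Sum>n\<in>X. l n) (\<Sum>\<^sub>\<infinity>n\<in>A. l n) < e / 3" by auto
  have "((\<lambda>x. \<Sum>n\<in>X. f n x) \<longlongrightarrow> (\<Sum>n\<in>X. l n)) F"
    using X by (intro tendsto_sum lim) auto
  then have "\<forall>\<^sub>F x in F. dist (\<Sum>n\<in>X. f n x) (\<Sum>n\<in>X. l n) < e / 3"
    using e by (intro tendstoD) auto
  moreover have "\<forall>\<^sub>F x in F. x \<in> Y" using dom by (simp add: Y_def)
  ultimately show "\<forall>\<^sub>F x in F. dist (\<Sum>\<^sub>\<infinity>n\<in>A. f n x) (\<Sum>\<^sub>\<infinity>n\<in>A. l n) < e"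
  proof eventually_elim
    case (elim x)
    have "dist (\<Sum>\<^sub>\<infinity>n\<in>A. f n x) (\<Sum>\<^sub>\<infinity>n\<in>A. l n) \<le> dist (\<Sum>n\<in>X. f n x) (\<Sum>\<^sub>\<infinity>n\<in>A. f n x) +
        (dist (\<Sum>n\<in>X. f n x) (\<Sum>n\<in>X. l n) + dist (\<Sum>n\<in>X. l n) (\<Sum>\<^sub>\<infinity>n\<in>A. l n))"
      by (meson add_left_mono dist_triangle dist_triangle3 order_trans)
    then show ?case using elim X(3)[OF elim(2)] X(4) by linarith
  qed
qed

section \<open>Joint holomorphy from separate holomorphy\<close>

text \<open>Cauchy's formula on a fixed circle writes the partial derivative in \<open>y\<close> as an integral of \<open>F\<close>, which
depends continuously on both variables. One continuous and one existing partial derivative give a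
total derivative.\<close>

lemma holomorphic2_on_Osgood:
  assumes U: "open U" and V: "open V"
    and cont: "continuous_on (U \<times> V) (\<lambda>(x, y). F x y)"
    and hx: "\<And>y. y \<in> V \<Longrightarrow> (\<lambda>x. F x y) holomorphic_on U"
    and hy: "\<And>x. x \<in> U \<Longrightarrow> (\<lambda>y. F x y) holomorphic_on V"
    and S: "S \<subseteq> U \<times> V"
  shows "holomorphic2_on F S"
  unfolding holomorphic2_on_def
proof
  fix z assume "z \<in> S"
  then obtain x0 y0 where z: "z = (x0, y0)" "x0 \<in> U" "y0 \<in> V" using S by (cases z) auto
  obtain r where r: "r > 0" "cball y0 r \<subseteq> V" using V z open_contains_cball by blast
  define Y where "Y = ball y0 r"
  define D where "D = (\<lambda>x y. 1 / (2 * of_real pi * \<i>) * contour_integral (circlepath y0 r) (\<lambda>u. F x u / (u - y)^2))"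
  have Y: "y0 \<in> Y" "convex Y" "open Y" "Y \<subseteq> V" using r by (auto simp: Y_def)
  have Dd: "((\<lambda>y. F x y) has_field_derivative D x y) (at y)" if "x \<in> U" "y \<in> Y" for x y
    unfolding D_def
  proof (rule Cauchy_derivative_integral_circlepath(2))
    show "continuous_on (cball y0 r) (F x)" "F x holomorphic_on ball y0 r" "y \<in> ball y0 r"
      using r that by (auto simp: Y_def intro!: holomorphic_on_imp_continuous_on holomorphic_on_subset[OF hy[OF that(1)]])
  qed
  have Dc: "continuous_on (U \<times> Y) (\<lambda>(x, y). D x y)"
  proof -
    have "continuous_on ((U \<times> Y) \<times> cbox 0 (2*pi)) ((\<lambda>(x, y). F x y) \<circ> (\<lambda>q. (fst (fst q), y0 + of_real r * cis (snd q))))"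
    proof (rule continuous_on_compose)
      show "continuous_on ((U \<times> Y) \<times> cbox 0 (2*pi)) (\<lambda>q. (fst (fst q), y0 + of_real r * cis (snd q)))"
        by (intro continuous_intros)
      have "y0 + of_real r * cis t \<in> V" for t
        by (rule subsetD[OF r(2)]) (use r in \<open>simp add: dist_norm norm_mult\<close>)
      then show "continuous_on ((\<lambda>q. (fst (fst q), y0 + of_real r * cis (snd q))) ` ((U \<times> Y) \<times> cbox 0 (2*pi))) (\<lambda>(x, y). F x y)"
        by (intro continuous_on_subset[OF cont]) auto
    qed
    then have c1: "continuous_on ((U \<times> Y) \<times> cbox 0 (2*pi)) (\<lambda>q. F (fst (fst q)) (y0 + of_real r * cis (snd q)))"
      by (simp add: o_def)
    have ne: "y0 + of_real r * cis t - y \<noteq> 0" if "y \<in> Y" for t y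
    proof
      assume "y0 + of_real r * cis t - y = 0"
      then have "y - y0 = of_real r * cis t" by (simp add: algebra_simps)
      then have "norm (y - y0) = r" using r by (simp add: norm_mult)
      then have "dist y0 y = r" by (simp add: dist_norm norm_minus_commute)
      then show False using that by (simp add: Y_def)
    qed
    have "continuous_on (U \<times> Y) (\<lambda>q. integral (cbox 0 (2*pi))
        (\<lambda>t. F (fst q) (y0 + of_real r * cis t) / (y0 + of_real r * cis t - snd q)^2 * of_real r * \<i> * cis t))"
    proof (rule integral_continuous_on_param, unfold case_prod_unfold)
      show "continuous_on ((U \<times> Y) \<times> cbox 0 (2*pi)) (\<lambda>q. F (fst (fst q)) (y0 + of_real r * cis (snd q)) /
         (y0 + of_real r * cis (snd q) - snd (fst q))^2 * of_real r * \<i> * cis (snd q))"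
        by (intro continuous_intros c1) (use ne in auto)
    qed
    then have "continuous_on (U \<times> Y) (\<lambda>q. 1 / (2 * of_real pi * \<i>) * integral (cbox 0 (2*pi))
        (\<lambda>t. F (fst q) (y0 + of_real r * cis t) / (y0 + of_real r * cis t - snd q)^2 * of_real r * \<i> * cis t))"
      by (intro continuous_intros)
    then show ?thesis
      by (simp add: D_def circlepath_def contour_integral_part_circlepath_eq case_prod_unfold)
  qed
  have "((\<lambda>(x, y). F x y) has_derivative (\<lambda>(tx, ty). deriv (\<lambda>x. F x y0) x0 * tx + blinfun_mult_right (D x0 y0) ty)) (at (x0, y0) within U \<times> Y)"
  proof (rule has_derivative_partialsI)
    have "((\<lambda>x. F x y0) has_field_derivative deriv (\<lambda>x. F x y0) x0) (at x0 within U)"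
      using holomorphic_derivI[OF hx[OF z(3)] U z(2)] .
    then show "((\<lambda>x. F x y0) has_derivative (*) (deriv (\<lambda>x. F x y0) x0)) (at x0 within U)"
      by (simp add: has_field_derivative_def)
    show "((\<lambda>y. F x y) has_derivative blinfun_apply (blinfun_mult_right (D x y))) (at y within Y)" if "x \<in> U" "y \<in> Y" for x y
      using Dd[OF that] has_field_derivative_at_within unfolding has_field_derivative_def
      by (auto intro: has_derivative_at_withinI)
    have "continuous_on (U \<times> Y) (\<lambda>q. blinfun_mult_right (D (fst q) (snd q)))"
      using Dc by (intro continuous_intros) (simp add: case_prod_unfold)
    then show "continuous (at (x0, y0) within U \<times> Y) (\<lambda>(x, y). blinfun_mult_right (D x y))"
      using z Y by (simp add: continuous_on_eq_continuous_within case_prod_unfold)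
  qed (use Y in auto)
  then have "((\<lambda>(x, y). F x y) has_derivative (\<lambda>(tx, ty). deriv (\<lambda>x. F x y0) x0 * tx + D x0 y0 * ty)) (at (x0, y0))"
    using at_within_open[of "(x0,y0)" "U \<times> Y"] U Y z by (simp add: open_Times)
  then show "\<exists>a b. ((\<lambda>(\<tau>, w). F \<tau> w) has_derivative (\<lambda>(u, v). a * u + b * v)) (at z within S)"
    unfolding z(1) by (blast intro: has_derivative_at_withinI)
qed

section \<open>Gaussian sums over cosets of the integers\<close>

lemma summable_on_exp_minus_abs_int: "(\<lambda>k::int. exp (- \<bar>of_int k :: real\<bar>)) summable_on UNIV"
proof -
  have nat: "(\<lambda>n::nat. exp (- real n)) summable_on UNIV"
  proof (rule norm_summable_imp_summable_on)
    have "(\<lambda>n::nat. norm (exp (- real n))) = (\<lambda>n. exp (-1) ^ n)"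
      by (rule ext) (simp add: exp_of_nat_mult[symmetric])
    then show "summable (\<lambda>n::nat. norm (exp (- real n)))"
      by (simp add: summable_geometric)
  qed
  have "(\<lambda>k::int. exp (- \<bar>of_int k :: real\<bar>)) summable_on range int"
    by (subst summable_on_reindex) (use nat in \<open>auto simp: o_def\<close>)
  moreover have "(\<lambda>k::int. exp (- \<bar>of_int k :: real\<bar>)) summable_on range (\<lambda>n. - int n)"
    by (subst summable_on_reindex) (use nat in \<open>auto simp: o_def inj_on_def\<close>)
  ultimately have "(\<lambda>k::int. exp (- \<bar>of_int k :: real\<bar>)) summable_on (range int \<union> range (\<lambda>n. - int n))"
    by (rule summable_on_union)
  moreover have "k \<in> range int \<union> range (\<lambda>n. - int n)" for k
    by (cases k rule: int_cases2) auto
  then have "range int \<union> range (\<lambda>n. - int n) = UNIV" by auto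
  ultimately show ?thesis by simp
qed

lemma bij_betw_int_coset: "bij_betw (\<lambda>k::int. of_int k + x) UNIV (int_coset x)"
proof -
  have "n - x \<in> \<int> \<longleftrightarrow> (\<exists>k::int. n = of_int k + x)" for n :: real
    unfolding Ints_def image_def by (simp add: diff_eq_eq)
  then have "range (\<lambda>k::int. of_int k + x) = int_coset x"
    unfolding int_coset_def image_def by simp
  then show ?thesis by (simp add: bij_betw_def inj_on_def)
qed

text \<open>Completing the square bounds $b|n| - cn^2$ by a constant minus $|n|$.\<close>

lemma summable_on_gauss_int_coset:
  assumes c: "c > 0"
  shows "(\<lambda>n. exp (b * \<bar>n\<bar> - c * n\<^sup>2)) summable_on int_coset x"
proof -
  define K where "K = (b + 1)\<^sup>2 / (4 * c) + \<bar>x\<bar>"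
  have le: "exp (b * \<bar>n\<bar> - c * n\<^sup>2) \<le> exp K * exp (- \<bar>of_int k :: real\<bar>)" if n: "n = of_int k + x" for n k
  proof -
    have "0 \<le> (2 * c * \<bar>n\<bar> - (b + 1))\<^sup>2 / (4 * c)" using c by simp
    also have "\<dots> = c * n\<^sup>2 - (b + 1) * \<bar>n\<bar> + (b + 1)\<^sup>2 / (4 * c)"
      using c by (simp add: power2_diff field_simps power2_eq_square)
    finally have "b * \<bar>n\<bar> - c * n\<^sup>2 \<le> K - \<bar>of_int k\<bar>"
      using n unfolding K_def by (simp add: algebra_simps)
    then show ?thesis by (simp flip: exp_add)
  qed
  have "(\<lambda>k::int. exp K * exp (- \<bar>of_int k :: real\<bar>)) summable_on UNIV"
    by (intro summable_on_cmult_right summable_on_exp_minus_abs_int)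
  then have "(\<lambda>k::int. exp (b * \<bar>of_int k + x\<bar> - c * (of_int k + x)\<^sup>2)) summable_on UNIV"
    by (rule summable_on_comparison_test) (use le in auto)
  then show ?thesis
    using summable_on_reindex_bij_betw[OF bij_betw_int_coset[of x], of "\<lambda>n. exp (b * \<bar>n\<bar> - c * n\<^sup>2)"]
    by (simp add: o_def)
qed

lemma int_coset_shift: "y - x \<in> \<int> \<Longrightarrow> int_coset x = int_coset y"
  unfolding int_coset_def
proof (rule Collect_cong)
  fix n assume d: "y - x \<in> \<int>"
  have "n - y \<in> \<int>" if "n - x \<in> \<int>" using Ints_diff[OF that d] by simp
  moreover have "n - x \<in> \<int>" if "n - y \<in> \<int>" using Ints_add[OF that d] by simp
  ultimately show "n - x \<in> \<int> \<longleftrightarrow> n - y \<in> \<int>" by auto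
qed

lemma int_coset_dvd:
  assumes "m > 0" "2 * int m dvd s - r"
  shows "int_coset (of_int s / (2 * of_nat m)) = int_coset (of_int r / (2 * of_nat m))"
proof (rule int_coset_shift)
  obtain k where "s - r = 2 * int m * k" using assms(2) by (rule dvdE)
  then have "s = r + 2 * int m * k" by simp
  then have "of_int r / (2 * of_nat m) - of_int s / (2 * of_nat m) = (of_int (- k) :: real)"
    using assms by (simp add: field_simps)
  then show "of_int r / (2 * of_nat m) - of_int s / (2 * of_nat m) \<in> (\<int> :: real set)" by (metis Ints_of_int)
qed

lemma locally_dominated_compose:
  assumes "locally_dominated A X f" "continuous_on Y g" "g ` Y \<subseteq> X"
  shows "locally_dominated A Y (\<lambda>n y. f n (g y))"
  unfolding locally_dominated_def
proof
  fix y assume y: "y \<in> Y"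
  then have gy: "g y \<in> X" using assms by auto
  obtain U M where U: "open U" "g y \<in> U" "M summable_on A" "\<And>n x. n \<in> A \<Longrightarrow> x \<in> U \<inter> X \<Longrightarrow> norm (f n x) \<le> M n"
    using locally_dominatedE[OF assms(1) gy] by metis
  obtain V where V: "open V" "V \<inter> Y = g -` U \<inter> Y"
    using assms(2) U(1) unfolding continuous_on_open_invariant by auto
  have "y \<in> V" using y U(2) V(2) by auto
  moreover have "\<forall>n\<in>A. \<forall>y'\<in>V \<inter> Y. norm (f n (g y')) \<le> M n"
  proof (intro ballI)
    fix n y' assume "n \<in> A" "y' \<in> V \<inter> Y"
    then show "norm (f n (g y')) \<le> M n" using V(2) assms(3) by (intro U(4)) auto
  qed
  ultimately show "\<exists>U M. open U \<and> y \<in> U \<and> M summable_on A \<and> (\<forall>n\<in>A. \<forall>y\<in>U \<inter> Y. norm (f n (g y)) \<le> M n)"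
    using V(1) U(3) by metis
qed

text \<open>On a product of half-planes $\mathrm{Im} > c > 0$ theta series are dominated uniformly, and these
products exhaust $\mathbb H^2$.\<close>

lemma locally_dominated_uhp2:
  assumes "\<And>c. c > 0 \<Longrightarrow> M c summable_on A"
    and "\<And>c n \<tau> w. c > 0 \<Longrightarrow> n \<in> A \<Longrightarrow> Im \<tau> > c \<Longrightarrow> Im w > c \<Longrightarrow> norm (f n (\<tau>, w)) \<le> M c n"
  shows "locally_dominated A (uhp \<times> uhp) f"
  unfolding locally_dominated_def
proof
  fix q assume q: "q \<in> uhp \<times> uhp"
  define c where "c = min (Im (fst q)) (Im (snd q)) / 2"
  define U where "U = {\<tau>. Im \<tau> > c} \<times> {w. Im w > c}"
  have c: "c > 0" "c < Im (fst q)" "c < Im (snd q)" using q by (auto simp: c_def uhp_def)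
  have "open U" unfolding U_def by (intro open_Times open_halfspace_Im_gt)
  moreover have "q \<in> U" using c by (simp add: U_def mem_Times_iff)
  moreover have "\<forall>n\<in>A. \<forall>y\<in>U \<inter> uhp \<times> uhp. norm (f n y) \<le> M c n"
    using assms(2)[OF c(1)] by (auto simp: U_def)
  ultimately show "\<exists>U M. open U \<and> q \<in> U \<and> M summable_on A \<and> (\<forall>n\<in>A. \<forall>y\<in>U \<inter> uhp \<times> uhp. norm (f n y) \<le> M n)"
    using assms(1)[OF c(1)] by metis
qed

lemma open_uhp: "open uhp" unfolding uhp_def by (rule open_halfspace_Im_gt)
lemma convex_uhp: "convex uhp" unfolding uhp_def by (rule convex_halfspace_Im_gt)
lemma connected_uhp: "connected uhp" by (rule convex_connected[OF convex_uhp])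

lemma norm_qpow: "norm (qpow \<tau> x) = exp (- 2 * pi * x * Im \<tau>)"
  by (simp add: qpow_def)

lemma qpow_nz [simp]: "qpow \<tau> x \<noteq> 0" by (simp add: qpow_def)

section \<open>The error function divided by its argument\<close>

text \<open>The substitution $t \mapsto tz$ in the error integral gives $\mathrm{erf}(z) = \frac{2}{\sqrt\pi}\, z\,
\mathrm{eg}(-z^2)$. So \<open>eg\<close> is the entire even part of the error function, as a function of $-z^2$; it
removes the square roots from the completions.\<close>

definition eg :: "complex \<Rightarrow> complex" where
  "eg x = integral {0..1} (\<lambda>t::real. exp (of_real (t\<^sup>2) * x))"

lemma eg_has_field_derivative:
  "(eg has_field_derivative integral {0..1} (\<lambda>t::real. of_real (t\<^sup>2) * exp (of_real (t\<^sup>2) * x))) (at x)"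
proof -
  have "((\<lambda>x. integral (cbox 0 1) (\<lambda>t::real. exp (of_real (t\<^sup>2) * x))) has_field_derivative
        integral (cbox 0 1) (\<lambda>t::real. of_real (t\<^sup>2) * exp (of_real (t\<^sup>2) * x))) (at x within UNIV)"
  proof (rule leibniz_rule_field_derivative)
    show "((\<lambda>x. exp (of_real (t\<^sup>2) * x)) has_field_derivative of_real (t\<^sup>2) * exp (of_real (t\<^sup>2) * x)) (at x within UNIV)"
      for x :: complex and t :: real
      by (auto intro!: derivative_eq_intros)
    show "(\<lambda>t. exp (of_real (t\<^sup>2) * x)) integrable_on cbox 0 1" for x :: complex
      by (intro integrable_continuous continuous_intros)
    show "continuous_on (UNIV \<times> cbox 0 1) (\<lambda>(x::complex, t). of_real (t\<^sup>2) * exp (of_real (t\<^sup>2) * x))"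
      unfolding case_prod_unfold by (intro continuous_intros)
  qed auto
  then show ?thesis by (simp add: eg_def[abs_def])
qed

text \<open>Integrate $\frac{d}{dt}\,(t e^{t^2 x})$ from $0$ to $1$.\<close>

lemma eg_ode:
  obtains d where "(eg has_field_derivative d) (at x)" "eg x + 2 * x * d = exp x"
proof
  let ?d = "integral {0..1} (\<lambda>t::real. of_real (t\<^sup>2) * exp (of_real (t\<^sup>2) * x))"
  show "(eg has_field_derivative ?d) (at x)" by (rule eg_has_field_derivative)
  have "((\<lambda>t::real. exp (of_real (t\<^sup>2) * x) + 2 * x * (of_real (t\<^sup>2) * exp (of_real (t\<^sup>2) * x)))
      has_integral (eg x + 2 * x * ?d)) {0..1}"
    unfolding eg_def
    by (intro has_integral_add has_integral_mult_right integrable_integral integrable_continuous_real continuous_intros)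
  moreover have "((\<lambda>t::real. exp (of_real (t\<^sup>2) * x) + 2 * x * (of_real (t\<^sup>2) * exp (of_real (t\<^sup>2) * x)))
      has_integral (of_real 1 * exp (of_real (1\<^sup>2) * x) - of_real 0 * exp (of_real (0\<^sup>2) * x))) {0..1}"
  proof (rule fundamental_theorem_of_calculus)
    fix t :: real
    have "((\<lambda>z. z * exp (z\<^sup>2 * x)) has_field_derivative
        (exp (of_real (t\<^sup>2) * x) + 2 * x * (of_real (t\<^sup>2) * exp (of_real (t\<^sup>2) * x)))) (at (of_real t))"
    proof -
      have "((\<lambda>z. z\<^sup>2 * x) has_field_derivative 2 * of_real t * x) (at (of_real t))"
        by (auto intro!: derivative_eq_intros)
      from DERIV_mult[OF DERIV_ident DERIV_chain2[where f = exp, OF DERIV_exp this]]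
      show ?thesis by (simp add: power2_eq_square mult_ac)
    qed
    from has_vector_derivative_real_field[OF this] show "((\<lambda>t. of_real t * exp (of_real (t\<^sup>2) * x)) has_vector_derivative
        (exp (of_real (t\<^sup>2) * x) + 2 * x * (of_real (t\<^sup>2) * exp (of_real (t\<^sup>2) * x)))) (at t within {0..1})"
      by simp
  qed auto
  ultimately have "eg x + 2 * x * ?d = of_real 1 * exp (of_real (1\<^sup>2) * x) - of_real 0 * exp (of_real (0\<^sup>2) * x)"
    by (rule has_integral_unique)
  then show "eg x + 2 * x * ?d = exp x" by simp
qed

lemma eg_holomorphic: "eg holomorphic_on S"
  unfolding holomorphic_on_def field_differentiable_def
  using eg_has_field_derivative has_field_derivative_at_within by blast

lemma norm_eg_le: "norm (eg x) \<le> exp (max 0 (Re x))"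
proof -
  have "norm (eg x) \<le> exp (max 0 (Re x)) * measure lborel (cbox 0 (1::real))"
    unfolding eg_def
  proof (rule has_integral_bound)
    show "((\<lambda>t::real. exp (of_real (t\<^sup>2) * x)) has_integral integral {0..1} (\<lambda>t::real. exp (of_real (t\<^sup>2) * x))) (cbox 0 1)"
      unfolding box_real by (intro integrable_integral integrable_continuous_real continuous_intros)
    fix t :: real assume t: "t \<in> cbox 0 1"
    then have "t\<^sup>2 \<le> 1" "0 \<le> t\<^sup>2" by (auto simp: power2_eq_square mult_le_one)
    have "t\<^sup>2 * Re x \<le> t\<^sup>2 * max 0 (Re x)"
      by (intro mult_left_mono) auto
    also have "\<dots> \<le> 1 * max 0 (Re x)"
      using \<open>t\<^sup>2 \<le> 1\<close> by (intro mult_right_mono) auto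
    finally have "t\<^sup>2 * Re x \<le> max 0 (Re x)" by simp
    then show "norm (exp (of_real (t\<^sup>2) * x)) \<le> exp (max 0 (Re x))" by simp
  qed auto
  then show ?thesis by simp
qed

lemma cerf_eq_eg: "cerf z = 2 / of_real (sqrt pi) * (z * eg (- (z\<^sup>2)))"
proof -
  have "contour_integral (linepath 0 z) (\<lambda>t. exp (- (t ^ 2))) = integral {0..1} (\<lambda>x. exp (- ((linepath 0 z x)\<^sup>2)) * z)"
    by (simp add: contour_integral_integral)
  also have "\<dots> = integral {0..1} (\<lambda>t::real. exp (of_real (t\<^sup>2) * - (z\<^sup>2)) * z)"
    by (simp add: linepath_def scaleR_conv_of_real power_mult_distrib)
  also have "\<dots> = z * eg (- (z\<^sup>2))"
    unfolding eg_def by simp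
  finally show ?thesis unfolding cerf_def by simp
qed

lemma cerf_0 [simp]: "cerf 0 = 0" by (simp add: cerf_eq_eg)
lemma cerf_has_field_derivative:
  "(cerf has_field_derivative 2 / of_real (sqrt pi) * exp (- (z\<^sup>2))) (at z)"
proof -
  obtain d where d: "(eg has_field_derivative d) (at (- (z\<^sup>2)))" "eg (- (z\<^sup>2)) + 2 * - (z\<^sup>2) * d = exp (- (z\<^sup>2))"
    by (rule eg_ode)
  have "((\<lambda>z. - (z\<^sup>2)) has_field_derivative - (2 * z)) (at z)"
    by (auto intro!: derivative_eq_intros)
  from DERIV_chain2[where f = eg, OF d(1) this]
  have "((\<lambda>z. eg (- (z\<^sup>2))) has_field_derivative d * (- (2 * z))) (at z)" .
  from DERIV_cmult[OF DERIV_mult[OF DERIV_ident this], of "2 / of_real (sqrt pi)"]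
  have "((\<lambda>z. 2 / of_real (sqrt pi) * (z * eg (- (z\<^sup>2)))) has_field_derivative
      2 / of_real (sqrt pi) * (eg (- (z\<^sup>2)) + 2 * - (z\<^sup>2) * d)) (at z)"
    by (simp add: power2_eq_square mult_ac)
  then show ?thesis unfolding d(2) cerf_eq_eg[abs_def] .
qed

section \<open>The rank one completion and its differential equation\<close>

definition e2 :: "complex \<Rightarrow> complex" where
  "e2 x = exp (2 * of_real pi * \<i> * x)"

lemma e2_add: "e2 (x + y) = e2 x * e2 y" by (simp add: e2_def exp_add[symmetric] algebra_simps)
lemma e2_0 [simp]: "e2 0 = 1" by (simp add: e2_def)
lemma e2_nz [simp]: "e2 x \<noteq> 0" by (simp add: e2_def)
lemma e2_of_int [simp]: "e2 (of_int k) = 1"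
  using exp_integer_2pi[of "of_int k"] by (simp add: e2_def mult_ac)
lemma norm_e2: "norm (e2 x) = exp (- 2 * pi * Im x)" by (simp add: e2_def)
lemma qpow_e2: "qpow \<tau> x = e2 (of_real x * \<tau>)" by (simp add: qpow_def e2_def mult_ac)

lemma e2_has_field_derivative: "(e2 has_field_derivative 2 * of_real pi * \<i> * e2 x) (at x)"
  unfolding e2_def[abs_def] by (auto intro!: derivative_eq_intros)

lemma abs_le_exp_abs: "\<bar>x :: real\<bar> \<le> exp \<bar>x\<bar>"
  using exp_ge_add_one_self[of "\<bar>x\<bar>"] by linarith

text \<open>The growth of \<open>eg\<close> for $\mathrm{Im}\, w < \mathrm{Im}\,\tau$ is compensated exactly by the decay of
$q^{n^2}$, so that the product decays like the slower of $q^{n^2}$ and the same power at $w$.\<close>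

lemma eg_qpow_bound:
  assumes "a \<ge> 0" "Im \<tau> > c" "Im w > c"
  shows "norm (eg (of_real a * (\<i> * (w - \<tau>)))) * exp (- a * Im \<tau>) \<le> exp (- a * c)"
proof -
  have "norm (eg (of_real a * (\<i> * (w - \<tau>)))) \<le> exp (max 0 (a * (Im \<tau> - Im w)))"
    using norm_eg_le[of "of_real a * (\<i> * (w - \<tau>))"] by simp
  then have "norm (eg (of_real a * (\<i> * (w - \<tau>)))) * exp (- a * Im \<tau>) \<le>
     exp (max 0 (a * (Im \<tau> - Im w))) * exp (- a * Im \<tau>)"
    by (rule mult_right_mono) simp
  also have "\<dots> = exp (max 0 (a * (Im \<tau> - Im w)) - a * Im \<tau>)"
    by (simp add: exp_diff exp_minus field_simps)
  also have "max 0 (a * (Im \<tau> - Im w)) - a * Im \<tau> \<le> - a * c"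
  proof -
    have "a * c \<le> a * Im \<tau>" "a * c \<le> a * Im w" using assms by (auto intro!: mult_left_mono)
    then show ?thesis by (simp add: algebra_simps max_def)
  qed
  finally show ?thesis by simp
qed

definition phi_term :: "nat \<Rightarrow> real \<Rightarrow> complex \<Rightarrow> complex \<Rightarrow> complex" where
  "phi_term p n \<tau> w = of_real n * eg (of_real (2 * pi * p * n\<^sup>2) * (\<i> * (w - \<tau>))) * qpow \<tau> (of_nat p * n\<^sup>2)"

text \<open>The completion \<open>psihat_A1\<close> divided by $-2i\sqrt{2p}\sqrt{i(w-\tau)}$, see \<open>psihat_A1_eq_phi\<close>.
It is single valued and holomorphic across the branch cut and at $w = \tau$.\<close>

definition phi :: "nat \<Rightarrow> int \<Rightarrow> complex \<Rightarrow> complex \<Rightarrow> complex" where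
  "phi p s \<tau> w = (\<Sum>\<^sub>\<infinity>n\<in>int_coset (of_int s / (2 * of_nat p)). phi_term p n \<tau> w)"

lemma norm_phi_term_le:
  assumes "Im \<tau> > c" "Im w > c"
  shows "norm (phi_term p n \<tau> w) \<le> exp (1 * \<bar>n\<bar> - (2 * pi * p * c) * n\<^sup>2)"
proof -
  let ?a = "2 * pi * p * n\<^sup>2"
  have "norm (phi_term p n \<tau> w) = \<bar>n\<bar> * (norm (eg (of_real ?a * (\<i> * (w - \<tau>)))) * exp (- ?a * Im \<tau>))"
    by (simp add: phi_term_def norm_mult norm_qpow mult_ac)
  also have "\<dots> \<le> exp \<bar>n\<bar> * exp (- ?a * c)"
    using assms abs_le_exp_abs by (intro mult_mono eg_qpow_bound) auto
  also have "\<dots> = exp (1 * \<bar>n\<bar> - (2 * pi * p * c) * n\<^sup>2)"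
    by (simp add: exp_diff exp_minus field_simps)
  finally show ?thesis .
qed

lemma phi_term_dominated:
  assumes "p > 0"
  shows "locally_dominated (int_coset x) (uhp \<times> uhp) (\<lambda>n q. phi_term p n (fst q) (snd q))"
proof (rule locally_dominated_uhp2)
  show "(\<lambda>n. exp (1 * \<bar>n\<bar> - (2 * pi * p * c) * n\<^sup>2)) summable_on int_coset x" if "c > 0" for c
    using that assms by (intro summable_on_gauss_int_coset) auto
  show "norm (phi_term p n (fst (\<tau>, w)) (snd (\<tau>, w))) \<le> exp (1 * \<bar>n\<bar> - (2 * pi * p * c) * n\<^sup>2)"
    if "Im \<tau> > c" "Im w > c" for c n \<tau> w
    using norm_phi_term_le[OF that] by simp
qed

lemma locally_dominated_slice1:
  assumes "locally_dominated A (uhp \<times> uhp) (\<lambda>n q. f n (fst q) (snd q))" "w \<in> uhp"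
  shows "locally_dominated A uhp (\<lambda>n \<tau>. f n \<tau> w)"
  by (rule locally_dominated_compose[OF assms(1), of uhp "\<lambda>\<tau>. (\<tau>, w)", unfolded fst_conv snd_conv])
     (use assms(2) in \<open>auto intro!: continuous_intros\<close>)

lemma locally_dominated_slice2:
  assumes "locally_dominated A (uhp \<times> uhp) (\<lambda>n q. f n (fst q) (snd q))" "\<tau> \<in> uhp"
  shows "locally_dominated A uhp (\<lambda>n w. f n \<tau> w)"
  by (rule locally_dominated_compose[OF assms(1), of uhp "\<lambda>w. (\<tau>, w)", unfolded fst_conv snd_conv])
     (use assms(2) in \<open>auto intro!: continuous_intros\<close>)

lemma qpow_holomorphic: "(\<lambda>\<tau>. qpow \<tau> x) holomorphic_on S"
  unfolding qpow_def by (intro holomorphic_intros)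

lemma eg_compose_holomorphic: "f holomorphic_on S \<Longrightarrow> (\<lambda>x. eg (f x)) holomorphic_on S"
  using holomorphic_on_compose_gen[OF _ eg_holomorphic[of UNIV], of f S] by (simp add: o_def)

lemma eg_continuous: "continuous_on S f \<Longrightarrow> continuous_on S (\<lambda>x. eg (f x))"
  by (rule continuous_on_compose2[OF holomorphic_on_imp_continuous_on[OF eg_holomorphic[of UNIV]]]) auto

lemma qpow_continuous: "continuous_on S f \<Longrightarrow> continuous_on S (\<lambda>x. qpow (f x) a)"
  unfolding qpow_def by (intro continuous_intros)

lemma phi_continuous:
  assumes "p > 0"
  shows "continuous_on (uhp \<times> uhp) (\<lambda>(\<tau>, w). phi p s \<tau> w)"
  unfolding phi_def case_prod_unfold
  by (intro continuous_on_infsum phi_term_dominated assms, unfold phi_term_def)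
     (intro continuous_intros eg_continuous qpow_continuous)

lemma phi_holomorphic:
  assumes "p > 0"
  shows "w \<in> uhp \<Longrightarrow> (\<lambda>\<tau>. phi p s \<tau> w) holomorphic_on uhp"
    and "\<tau> \<in> uhp \<Longrightarrow> (\<lambda>w. phi p s \<tau> w) holomorphic_on uhp"
proof -
  show "(\<lambda>\<tau>. phi p s \<tau> w) holomorphic_on uhp" if "w \<in> uhp"
    unfolding phi_def
  proof (rule holomorphic_infsum[OF open_uhp locally_dominated_slice1[OF phi_term_dominated[OF assms] that]])
    show "(\<lambda>\<tau>. phi_term p n \<tau> w) holomorphic_on uhp" for n
      unfolding phi_term_def by (intro holomorphic_intros eg_compose_holomorphic qpow_holomorphic)
  qed
  show "(\<lambda>w. phi p s \<tau> w) holomorphic_on uhp" if "\<tau> \<in> uhp"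
    unfolding phi_def
  proof (rule holomorphic_infsum[OF open_uhp locally_dominated_slice2[OF phi_term_dominated[OF assms] that]])
    show "(\<lambda>w. phi_term p n \<tau> w) holomorphic_on uhp" for n
      unfolding phi_term_def by (intro holomorphic_intros eg_compose_holomorphic)
  qed
qed

lemma csqrt_of_real_mult:
  assumes "c > 0" shows "csqrt (of_real c * z) = of_real (sqrt c) * csqrt z"
proof (rule csqrt_unique)
  show "(of_real (sqrt c) * csqrt z)\<^sup>2 = of_real c * z"
    using assms by (simp add: power_mult_distrib flip: of_real_power)
  show "0 < Re (of_real (sqrt c) * csqrt z) \<or> Re (of_real (sqrt c) * csqrt z) = 0 \<and> 0 \<le> Im (of_real (sqrt c) * csqrt z)"
    using csqrt_principal[of z] assms by (auto simp del: csqrt.simps)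
qed

lemma psihat_A1_eq_phi:
  assumes "p > 0"
  shows "psihat_A1 p s \<tau> w = - 2 * \<i> * of_real (sqrt (2 * p)) * csqrt (\<i> * (w - \<tau>)) * phi p s \<tau> w"
proof -
  let ?u = "csqrt (\<i> * (w - \<tau>))"
  have cs: "csqrt (2 * of_real pi * \<i> * of_nat p * (w - \<tau>)) = of_real (sqrt (2 * pi * p)) * ?u"
    using csqrt_of_real_mult[of "2 * pi * p" "\<i> * (w - \<tau>)"] assms by (simp add: mult_ac)
  have "cerf (- \<i> * csqrt (2 * of_real pi * \<i> * of_nat p * (w - \<tau>)) * of_real n) * qpow \<tau> (of_nat p * n\<^sup>2) =
     - 2 * \<i> * of_real (sqrt (2 * p)) * ?u * phi_term p n \<tau> w" for n
  proof -
    have r: "(complex_of_real (sqrt (2 * pi * p)))\<^sup>2 = of_real (2 * pi * p)"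
      by (simp flip: of_real_power)
    have sq: "- ((- \<i> * (of_real (sqrt (2 * pi * p)) * ?u) * of_real n)\<^sup>2) = of_real (2 * pi * p * n\<^sup>2) * (\<i> * (w - \<tau>))"
      by (simp add: power_mult_distrib r)
    have sp: "of_real (sqrt (2 * pi * p)) = (of_real (sqrt pi) * of_real (sqrt (2 * p)) :: complex)"
      by (simp add: real_sqrt_mult mult_ac)
    define E where "E = eg (of_real (2 * pi * p * n\<^sup>2) * (\<i> * (w - \<tau>)))"
    define U where "U = ?u"
    show ?thesis
      unfolding cs cerf_eq_eg phi_term_def
      unfolding sq
      unfolding E_def[symmetric]
      unfolding U_def[symmetric] sp by (simp add: field_simps)
  qed
  then have "psihat_A1 p s \<tau> w = (\<Sum>\<^sub>\<infinity>n\<in>int_coset (of_int s / (2 * of_nat p)).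
     - 2 * \<i> * of_real (sqrt (2 * p)) * ?u * phi_term p n \<tau> w)"
    unfolding psihat_A1_def by (rule infsum_cong)
  then show ?thesis
    unfolding phi_def infsum_cmult_right' .
qed

text \<open>Termwise this is \<open>eg_ode\<close>. On the diagonal it forces $\varphi(\tau,\tau) = \vartheta(\tau)$, and two
solutions differ by a multiple of $(w-\tau)^{-1/2}$, so regularity at $w = \tau$ selects one.\<close>

lemma phi_ode:
  assumes p: "p > 0" and \<tau>: "\<tau> \<in> uhp" and w: "w \<in> uhp"
  obtains d where "((\<lambda>w. phi p s \<tau> w) has_field_derivative d) (at w)"
    "phi p s \<tau> w + 2 * (w - \<tau>) * d = theta1 p s w"
proof
  let ?A = "int_coset (of_int s / (2 * of_nat p))"
  define a where "a = (\<lambda>n. 2 * pi * p * n\<^sup>2)"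
  define f' where "f' = (\<lambda>n w. of_real n * (deriv eg (of_real (a n) * (\<i> * (w - \<tau>))) * (of_real (a n) * \<i>)) * qpow \<tau> (of_nat p * n\<^sup>2))"
  have eg': "(eg has_field_derivative deriv eg x) (at x)" for x
    unfolding DERIV_imp_deriv[OF eg_has_field_derivative] by (rule eg_has_field_derivative)
  have ode: "eg x + 2 * x * deriv eg x = exp x" for x
  proof -
    obtain d where d: "(eg has_field_derivative d) (at x)" "eg x + 2 * x * d = exp x" by (rule eg_ode)
    show ?thesis unfolding DERIV_imp_deriv[OF d(1)] by (rule d(2))
  qed
  have dom: "locally_dominated ?A uhp (\<lambda>n w. phi_term p n \<tau> w)"
    by (rule locally_dominated_slice2[OF phi_term_dominated[OF p] \<tau>])
  have der: "((\<lambda>w. phi_term p n \<tau> w) has_field_derivative f' n w) (at w)" for n w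
  proof -
    have "((\<lambda>w. of_real (a n) * (\<i> * (w - \<tau>))) has_field_derivative of_real (a n) * \<i>) (at w)"
      by (auto intro!: derivative_eq_intros)
    from DERIV_cmult_right[OF DERIV_cmult[OF DERIV_chain2[where f = eg, OF eg' this], of "of_real n"], of "qpow \<tau> (of_nat p * n\<^sup>2)"]
    show ?thesis unfolding phi_term_def f'_def a_def .
  qed
  note D = has_field_derivative_infsum[OF open_uhp dom w der]
  show "((\<lambda>w. phi p s \<tau> w) has_field_derivative (\<Sum>\<^sub>\<infinity>n\<in>?A. f' n w)) (at w)"
    unfolding phi_def by (rule D(1))
  have "phi p s \<tau> w + 2 * (w - \<tau>) * (\<Sum>\<^sub>\<infinity>n\<in>?A. f' n w) = (\<Sum>\<^sub>\<infinity>n\<in>?A. phi_term p n \<tau> w + 2 * (w - \<tau>) * f' n w)"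
    unfolding phi_def
    by (subst infsum_add[OF locally_dominated_summable[OF dom w] summable_on_cmult_right[OF D(2)]])
       (simp add: infsum_cmult_right')
  also have "\<dots> = (\<Sum>\<^sub>\<infinity>n\<in>?A. of_real n * qpow w (of_nat p * n\<^sup>2))"
  proof (rule infsum_cong)
    fix n
    let ?x = "of_real (a n) * (\<i> * (w - \<tau>))"
    have "phi_term p n \<tau> w + 2 * (w - \<tau>) * f' n w = of_real n * (eg ?x + 2 * ?x * deriv eg ?x) * qpow \<tau> (of_nat p * n\<^sup>2)"
      unfolding phi_term_def f'_def a_def by (simp add: algebra_simps)
    also have "\<dots> = of_real n * (exp ?x * qpow \<tau> (of_nat p * n\<^sup>2))"
      unfolding ode by (simp add: mult_ac)
    also have "exp ?x * qpow \<tau> (of_nat p * n\<^sup>2) = qpow w (of_nat p * n\<^sup>2)"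
      unfolding qpow_def a_def by (simp add: exp_add[symmetric] algebra_simps)
    finally show "phi_term p n \<tau> w + 2 * (w - \<tau>) * f' n w = of_real n * qpow w (of_nat p * n\<^sup>2)" .
  qed
  finally show "phi p s \<tau> w + 2 * (w - \<tau>) * (\<Sum>\<^sub>\<infinity>n\<in>?A. f' n w) = theta1 p s w"
    by (simp add: theta1_def)
qed

lemma not_nonpos_Reals_csqrt:
  assumes "z \<notin> \<real>\<^sub>\<le>\<^sub>0"
  shows "z powr (of_real (-1/2)) = 1 / csqrt z" "csqrt z \<noteq> 0" "z \<noteq> 0"
proof -
  show z: "z \<noteq> 0" using assms by auto
  then show "csqrt z \<noteq> 0" by simp
  have "z powr (of_real (-1/2)) = inverse (z powr (1/2))"
    using powr_minus[of z "1/2"] by simp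
  then show "z powr (of_real (-1/2)) = 1 / csqrt z"
    by (simp add: csqrt_conv_powr inverse_eq_divide del: csqrt.simps)
qed

text \<open>The equation for \<open>phi\<close> says that $\sqrt{w-\tau}\,\varphi$ has derivative
$\vartheta(w) / (2\sqrt{w-\tau})$.\<close>

lemma psihat_A1_has_field_derivative:
  assumes p: "p > 0" and \<tau>: "\<tau> \<in> uhp" and w: "w \<in> uhp" and cut: "\<i> * (w - \<tau>) \<notin> \<real>\<^sub>\<le>\<^sub>0"
  shows "((\<lambda>w. psihat_A1 p s \<tau> w) has_field_derivative
     of_real (sqrt (2 * p)) * (\<i> * (w - \<tau>)) powr (of_real (-1/2)) * theta1 p s w) (at w)"
proof -
  obtain d where d: "((\<lambda>w. phi p s \<tau> w) has_field_derivative d) (at w)"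
    "phi p s \<tau> w + 2 * (w - \<tau>) * d = theta1 p s w"
    by (rule phi_ode[OF p \<tau> w])
  let ?u = "csqrt (\<i> * (w - \<tau>))"
  note u = not_nonpos_Reals_csqrt[OF cut]
  have "((\<lambda>w. \<i> * (w - \<tau>)) has_field_derivative \<i>) (at w)" by (auto intro!: derivative_eq_intros)
  from DERIV_chain2[where f = csqrt, OF has_field_derivative_csqrt[OF cut] this]
  have u': "((\<lambda>w. csqrt (\<i> * (w - \<tau>))) has_field_derivative inverse (2 * ?u) * \<i>) (at w)" .
  have "((\<lambda>w. - 2 * \<i> * of_real (sqrt (2 * p)) * (csqrt (\<i> * (w - \<tau>)) * phi p s \<tau> w)) has_field_derivative
      - 2 * \<i> * of_real (sqrt (2 * p)) * (inverse (2 * ?u) * \<i> * phi p s \<tau> w + d * ?u)) (at w)"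
    by (rule DERIV_cmult[OF DERIV_mult[OF u' d(1)]])
  moreover have "- 2 * \<i> * of_real (sqrt (2 * p)) * (inverse (2 * ?u) * \<i> * phi p s \<tau> w + d * ?u) =
     of_real (sqrt (2 * p)) * (1 / ?u) * (phi p s \<tau> w + 2 * (?u\<^sup>2 / \<i>) * d)"
    using u(2) by (simp add: field_simps power2_eq_square del: csqrt.simps)
  moreover have "?u\<^sup>2 / \<i> = w - \<tau>" by (simp del: csqrt.simps)
  ultimately show ?thesis
    unfolding psihat_A1_eq_phi[OF p] u(1) using d(2) by (simp add: mult_ac del: csqrt.simps)
qed

section \<open>Jacobi theta functions\<close>

definition jt_term :: "nat \<Rightarrow> real \<Rightarrow> complex \<Rightarrow> complex \<Rightarrow> complex" where
  "jt_term m n \<tau> z = e2 (of_nat m * (of_real n)\<^sup>2 * \<tau> + 2 * of_nat m * of_real n * z)"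

text \<open>The Jacobi theta function $\vartheta_{m,s}(\tau,z)$ of index \<open>m\<close>. It serves as generating function:
its value at $z = 0$ is the theta constant and its $z$-derivative is proportional to \<open>theta1\<close>.\<close>

definition jt :: "nat \<Rightarrow> int \<Rightarrow> complex \<Rightarrow> complex \<Rightarrow> complex" where
  "jt m s \<tau> z = (\<Sum>\<^sub>\<infinity>n\<in>int_coset (of_int s / (2 * of_nat m)). jt_term m n \<tau> z)"

lemma norm_jt_term_le:
  assumes "Im \<tau> \<ge> c" "norm z \<le> R"
  shows "norm (jt_term m n \<tau> z) \<le> exp ((4 * pi * m * R) * \<bar>n\<bar> - (2 * pi * m * c) * n\<^sup>2)"
proof -
  have "norm (jt_term m n \<tau> z) = exp (- 4 * pi * m * (n * Im z) - 2 * pi * m * (n\<^sup>2 * Im \<tau>))"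
    by (simp add: jt_term_def norm_e2 algebra_simps flip: of_real_power)
  also have "- (n * Im z) \<le> \<bar>n\<bar> * R"
  proof -
    have "- (n * Im z) \<le> \<bar>n\<bar> * \<bar>Im z\<bar>" by (simp add: abs_mult[symmetric])
    also have "\<dots> \<le> \<bar>n\<bar> * R" using assms(2) abs_Im_le_cmod[of z] by (intro mult_left_mono) auto
    finally show ?thesis .
  qed
  then have "- 4 * pi * m * (n * Im z) - 2 * pi * m * (n\<^sup>2 * Im \<tau>) \<le> 4 * pi * m * (\<bar>n\<bar> * R) - 2 * pi * m * (n\<^sup>2 * c)"
  proof -
    assume "- (n * Im z) \<le> \<bar>n\<bar> * R"
    then have "4 * pi * m * (- (n * Im z)) \<le> 4 * pi * m * (\<bar>n\<bar> * R)"
      by (intro mult_left_mono) auto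
    moreover have "2 * pi * m * (n\<^sup>2 * c) \<le> 2 * pi * m * (n\<^sup>2 * Im \<tau>)"
      using assms(1) by (intro mult_left_mono) auto
    ultimately show ?thesis by linarith
  qed
  then have "exp (- 4 * pi * m * (n * Im z) - 2 * pi * m * (n\<^sup>2 * Im \<tau>)) \<le> exp ((4 * pi * m * R) * \<bar>n\<bar> - (2 * pi * m * c) * n\<^sup>2)"
    by (simp add: mult_ac)
  finally show ?thesis .
qed

lemma jt_term_dominated:
  assumes "m > 0"
  shows "locally_dominated (int_coset x) (uhp \<times> UNIV) (\<lambda>n q. jt_term m n (fst q) (snd q))"
  unfolding locally_dominated_def
proof
  fix q :: "complex \<times> complex" assume q: "q \<in> uhp \<times> UNIV"
  define c where "c = Im (fst q) / 2"
  define R where "R = norm (snd q) + 1"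
  define U where "U = {\<tau>. Im \<tau> > c} \<times> ball (0::complex) R"
  define M where "M = (\<lambda>n. exp ((4 * pi * m * R) * \<bar>n\<bar> - (2 * pi * m * c) * n\<^sup>2))"
  have c: "c > 0" "c < Im (fst q)" using q by (auto simp: c_def uhp_def)
  have "open U" unfolding U_def by (intro open_Times open_halfspace_Im_gt open_ball)
  moreover have "q \<in> U" using c by (simp add: U_def mem_Times_iff R_def)
  moreover have "M summable_on int_coset x"
    unfolding M_def using c assms by (intro summable_on_gauss_int_coset) auto
  moreover have "\<forall>n\<in>int_coset x. \<forall>y\<in>U \<inter> uhp \<times> UNIV. norm (jt_term m n (fst y) (snd y)) \<le> M n"
    unfolding M_def by (intro ballI norm_jt_term_le) (auto simp: U_def)
  ultimately show "\<exists>U M. open U \<and> q \<in> U \<and> M summable_on int_coset x \<and>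
      (\<forall>n\<in>int_coset x. \<forall>y\<in>U \<inter> uhp \<times> UNIV. norm (jt_term m n (fst y) (snd y)) \<le> M n)"
    by (intro exI[of _ U] exI[of _ M] conjI)
qed

lemma jt_dom2: "m > 0 \<Longrightarrow> \<tau> \<in> uhp \<Longrightarrow> locally_dominated (int_coset x) UNIV (\<lambda>n z. jt_term m n \<tau> z)"
  by (rule locally_dominated_compose[OF jt_term_dominated, of m UNIV "\<lambda>z. (\<tau>, z)" x, unfolded fst_conv snd_conv])
     (auto intro!: continuous_intros)

lemma jt_term_holomorphic: "f holomorphic_on S \<Longrightarrow> g holomorphic_on S \<Longrightarrow> (\<lambda>x. jt_term m n (f x) (g x)) holomorphic_on S"
  unfolding jt_term_def e2_def by (intro holomorphic_intros)

lemma jt_summable: "m > 0 \<Longrightarrow> \<tau> \<in> uhp \<Longrightarrow> (\<lambda>n. jt_term m n \<tau> z) summable_on int_coset x"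
  using locally_dominated_summable[OF jt_dom2, of m \<tau> z x] by simp

lemma jt_term_deriv:
  "((\<lambda>z. jt_term m n \<tau> z) has_field_derivative 4 * of_real pi * \<i> * of_nat m * (of_real n * jt_term m n \<tau> z)) (at z)"
proof -
  have "((\<lambda>z. of_nat m * (of_real n)\<^sup>2 * \<tau> + 2 * of_nat m * of_real n * z) has_field_derivative 2 * of_nat m * of_real n) (at z)"
    by (auto intro!: derivative_eq_intros)
  from DERIV_chain2[where f = e2, OF e2_has_field_derivative this]
  show ?thesis unfolding jt_term_def by (simp add: mult_ac)
qed

lemma jt_term_0: "jt_term m n \<tau> 0 = qpow \<tau> (of_nat m * n\<^sup>2)"
  by (simp add: jt_term_def qpow_e2)

lemma jt_deriv_0:
  assumes "m > 0" "\<tau> \<in> uhp"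
  shows "((\<lambda>z. jt m s \<tau> z) has_field_derivative 4 * of_real pi * \<i> * of_nat m * theta1 m s \<tau>) (at 0)"
proof -
  have "((\<lambda>z. jt m s \<tau> z) has_field_derivative
     (\<Sum>\<^sub>\<infinity>n\<in>int_coset (of_int s / (2 * of_nat m)). 4 * of_real pi * \<i> * of_nat m * (of_real n * jt_term m n \<tau> 0))) (at 0)"
    unfolding jt_def by (rule has_field_derivative_infsum(1)[OF open_UNIV jt_dom2[OF assms] UNIV_I jt_term_deriv])
  then show ?thesis unfolding infsum_cmult_right' jt_term_0 theta1_def .
qed

lemma theta1_dominated:
  assumes "m > 0"
  shows "locally_dominated (int_coset x) uhp (\<lambda>n \<tau>. of_real n * qpow \<tau> (of_nat m * n\<^sup>2))"
proof -
  have "locally_dominated (int_coset x) (uhp \<times> uhp) (\<lambda>n q. of_real n * qpow (fst q) (of_nat m * n\<^sup>2))"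
  proof (rule locally_dominated_uhp2)
    show "(\<lambda>n. exp (1 * \<bar>n\<bar> - (2 * pi * m * c) * n\<^sup>2)) summable_on int_coset x" if "c > 0" for c
      using that assms by (intro summable_on_gauss_int_coset) auto
    show "norm (of_real n * qpow (fst (\<tau>, w)) (of_nat m * n\<^sup>2)) \<le> exp (1 * \<bar>n\<bar> - (2 * pi * m * c) * n\<^sup>2)"
      if "Im \<tau> > c" for c n \<tau> and w :: complex
    proof -
      have "norm (of_real n * qpow (fst (\<tau>, w)) (of_nat m * n\<^sup>2)) = \<bar>n\<bar> * exp (- (2 * pi * m * Im \<tau> * n\<^sup>2))"
        by (simp add: norm_mult norm_qpow mult_ac)
      also have "\<dots> \<le> exp \<bar>n\<bar> * exp (- (2 * pi * m * c * n\<^sup>2))"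
        using that by (intro mult_mono abs_le_exp_abs) (auto intro!: mult_right_mono mult_left_mono)
      also have "\<dots> = exp (1 * \<bar>n\<bar> - (2 * pi * m * c) * n\<^sup>2)"
        by (simp add: exp_diff exp_minus field_simps)
      finally show ?thesis .
    qed
  qed
  note dom = this
  show ?thesis
    by (rule locally_dominated_compose[OF dom, of uhp "\<lambda>\<tau>. (\<tau>, \<tau>)", unfolded fst_conv])
       (auto intro!: continuous_intros)
qed

lemma theta1_holomorphic: "m > 0 \<Longrightarrow> theta1 m s holomorphic_on uhp"
  unfolding theta1_def[abs_def]
  by (intro holomorphic_infsum open_uhp theta1_dominated holomorphic_intros qpow_holomorphic)

lemma jt_dvd: "m > 0 \<Longrightarrow> 2 * int m dvd s - r \<Longrightarrow> jt m s = jt m r"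
  unfolding jt_def[abs_def] by (simp add: int_coset_dvd[of m s r])
lemma phi_dvd: "m > 0 \<Longrightarrow> 2 * int m dvd s - r \<Longrightarrow> phi m s = phi m r"
  unfolding phi_def[abs_def] by (simp add: int_coset_dvd[of m s r])
lemma theta1_dvd: "m > 0 \<Longrightarrow> 2 * int m dvd s - r \<Longrightarrow> theta1 m s = theta1 m r"
  unfolding theta1_def[abs_def] by (simp add: int_coset_dvd[of m s r])
lemma psihat_A1_dvd: "m > 0 \<Longrightarrow> 2 * int m dvd s - r \<Longrightarrow> psihat_A1 m s = psihat_A1 m r"
  unfolding psihat_A1_def[abs_def] by (simp add: int_coset_dvd[of m s r])

abbreviation T1 :: "nat \<Rightarrow> int \<Rightarrow> complex" where
  "T1 m s \<equiv> e2 (of_int (s\<^sup>2) / (4 * of_nat m))"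

text \<open>For $n = k + s/2m$ the exponent $m n^2$ is $s^2/4m$ up to the integer $mk^2 + ks$.\<close>

lemma qpow_shift:
  assumes "m > 0" "n \<in> int_coset (of_int s / (2 * of_nat m))"
  shows "qpow (\<tau> + 1) (of_nat m * n\<^sup>2) = T1 m s * qpow \<tau> (of_nat m * n\<^sup>2)"
proof -
  obtain k :: int where k: "n - of_int s / (2 * of_nat m) = of_int k"
    using assms(2) by (auto simp: int_coset_def elim: Ints_cases)
  then have n: "n = of_int k + of_int s / (2 * of_nat m)" by (simp add: algebra_simps)
  have "of_nat m * n\<^sup>2 = of_int (int m * k\<^sup>2 + k * s) + of_int (s\<^sup>2) / (4 * of_nat m)"
    unfolding n using assms(1) by (simp add: power2_eq_square field_simps)
  then have "complex_of_real (of_nat m * n\<^sup>2) = of_real (of_int (int m * k\<^sup>2 + k * s) + of_int (s\<^sup>2) / (4 * of_nat m))"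
    by (rule arg_cong)
  also have "\<dots> = of_int (int m * k\<^sup>2 + k * s) + of_int (s\<^sup>2) / (4 * of_nat m)"
    by simp
  finally have "complex_of_real (of_nat m * n\<^sup>2) = of_int (int m * k\<^sup>2 + k * s) + of_int (s\<^sup>2) / (4 * of_nat m)" .
  then have "e2 (of_real (of_nat m * n\<^sup>2)) = T1 m s"
    by (simp only: e2_add e2_of_int mult_1_left)
  then show ?thesis unfolding qpow_e2 by (simp add: distrib_left e2_add)
qed

lemma jt_T: "m > 0 \<Longrightarrow> jt m s (\<tau> + 1) z = T1 m s * jt m s \<tau> z"
proof -
  assume m: "m > 0"
  have "jt_term m n (\<tau> + 1) z = T1 m s * jt_term m n \<tau> z"
    if "n \<in> int_coset (of_int s / (2 * of_nat m))" for n
  proof -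
    have "jt_term m n \<tau> z = qpow \<tau> (of_nat m * n\<^sup>2) * e2 (2 * of_nat m * of_real n * z)" for \<tau>
      by (simp add: jt_term_def qpow_e2 e2_add)
    then show ?thesis using qpow_shift[OF m that] by simp
  qed
  then show ?thesis unfolding jt_def by (subst infsum_cmult_right'[symmetric]) (rule infsum_cong)
qed

lemma theta1_T: "m > 0 \<Longrightarrow> theta1 m s (\<tau> + 1) = T1 m s * theta1 m s \<tau>"
  unfolding theta1_def by (subst infsum_cmult_right'[symmetric]) (rule infsum_cong, simp add: qpow_shift)

lemma phi_T: "m > 0 \<Longrightarrow> phi m s (\<tau> + 1) (w + 1) = T1 m s * phi m s \<tau> w"
  unfolding phi_def phi_term_def
  by (subst infsum_cmult_right'[symmetric]) (rule infsum_cong, simp add: qpow_shift)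

section \<open>Gaussian integrals against a sign\<close>

text \<open>A common bound for the derivatives bounds the difference quotients by the mean value inequality, and
dominated convergence applies.\<close>

lemma has_field_derivative_integral_dominated:
  fixes f :: "complex \<Rightarrow> 'a \<Rightarrow> complex"
  assumes r: "r > 0"
    and int: "\<And>z. z \<in> ball z0 r \<Longrightarrow> integrable M (f z)"
    and der: "\<And>z x. z \<in> ball z0 r \<Longrightarrow> x \<in> space M \<Longrightarrow> ((\<lambda>z. f z x) has_field_derivative f' z x) (at z)"
    and bd: "\<And>z x. z \<in> ball z0 r \<Longrightarrow> x \<in> space M \<Longrightarrow> norm (f' z x) \<le> g x"
    and g: "integrable M g" and f'm: "f' z0 \<in> borel_measurable M"
  shows "((\<lambda>z. LINT x|M. f z x) has_field_derivative (LINT x|M. f' z0 x)) (at z0)"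
proof -
  define F where "F = (\<lambda>z. LINT x|M. f z x)"
  have "((\<lambda>z. (F z - F z0) / (z - z0)) \<longlongrightarrow> (LINT x|M. f' z0 x)) (at z0 within ball z0 r)"
    unfolding tendsto_at_iff_sequentially
  proof (intro allI impI)
    fix X :: "nat \<Rightarrow> complex" assume X: "\<forall>i. X i \<in> ball z0 r - {z0}" "X \<longlonglongrightarrow> z0"
    have z0: "z0 \<in> ball z0 r" using r by simp
    have eq: "(F (X i) - F z0) / (X i - z0) = (LINT x|M. (f (X i) x - f z0 x) / (X i - z0))" for i
      unfolding F_def using X(1) z0 by (simp add: int)
    have "(\<lambda>i. LINT x|M. (f (X i) x - f z0 x) / (X i - z0)) \<longlonglongrightarrow> (LINT x|M. f' z0 x)"
    proof (rule integral_dominated_convergence[where w = g])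
      show "(\<lambda>x. (f (X i) x - f z0 x) / (X i - z0)) \<in> borel_measurable M" for i
        using int[of "X i"] int[OF z0] X(1) by (intro borel_measurable_divide borel_measurable_diff borel_measurable_integrable) auto
      show "AE x in M. (\<lambda>i. (f (X i) x - f z0 x) / (X i - z0)) \<longlonglongrightarrow> f' z0 x"
      proof (rule AE_I2)
        fix x assume x: "x \<in> space M"
        have "((\<lambda>z. (f z x - f z0 x) / (z - z0)) \<longlongrightarrow> f' z0 x) (at z0)"
          using der[OF z0 x] by (simp add: has_field_derivative_iff)
        then have "((\<lambda>z. (f z x - f z0 x) / (z - z0)) \<circ> X) \<longlonglongrightarrow> f' z0 x"
          unfolding tendsto_at_iff_sequentially using X by (auto simp: o_def)
        then show "(\<lambda>i. (f (X i) x - f z0 x) / (X i - z0)) \<longlonglongrightarrow> f' z0 x" by (simp add: o_def)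
      qed
      show "AE x in M. norm ((f (X i) x - f z0 x) / (X i - z0)) \<le> g x" for i
      proof (rule AE_I2)
        fix x assume x: "x \<in> space M"
        have "norm (f (X i) x - f z0 x) \<le> g x * norm (X i - z0)"
        proof (rule field_differentiable_bound[where f = "\<lambda>z. f z x" and f' = "\<lambda>z. f' z x" and S = "ball z0 r"])
          show "((\<lambda>z. f z x) has_field_derivative f' z x) (at z within ball z0 r)" if "z \<in> ball z0 r" for z
            using der[OF that x] by (rule has_field_derivative_at_within)
        qed (use X(1) z0 bd x in auto)
        then show "norm ((f (X i) x - f z0 x) / (X i - z0)) \<le> g x"
          using X(1)[rule_format, of i] by (simp add: norm_divide divide_le_eq)
      qed
    qed (use f'm g in auto)
    then show "((\<lambda>z. (F z - F z0) / (z - z0)) \<circ> X) \<longlonglongrightarrow> (LINT x|M. f' z0 x)"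
      by (simp add: o_def eq)
  qed
  moreover have "at z0 within ball z0 r = at z0" using r by (intro at_within_open) auto
  ultimately show ?thesis unfolding has_field_derivative_iff F_def[symmetric] by simp
qed

lemma has_bochner_integral_gauss:
  assumes "a > 0"
  shows "has_bochner_integral lborel (\<lambda>x. exp (- a * (x - \<mu>)\<^sup>2) :: real) (sqrt (pi / a))"
proof -
  have s: "1 / sqrt (2 * a) > 0" using assms by simp
  have eq: "sqrt (pi / a) * normal_density \<mu> (1 / sqrt (2 * a)) x = exp (- a * (x - \<mu>)\<^sup>2)" for x
    using assms by (simp add: normal_density_def power_divide real_sqrt_divide field_simps)
  have "has_bochner_integral lborel (\<lambda>x. sqrt (pi / a) * normal_density \<mu> (1 / sqrt (2 * a)) x) (sqrt (pi / a) * 1)"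
    using s integral_normal_density[OF s, of \<mu>] integrable_normal_density[OF s, of \<mu>]
    by (intro has_bochner_integral_mult_right) (simp add: has_bochner_integral_iff)
  then show ?thesis unfolding eq by simp
qed

lemma integrable_gauss:
  fixes a b :: real
  assumes "a > 0"
  shows "integrable lborel (\<lambda>x::real. exp (b * \<bar>x\<bar> - a * x\<^sup>2))"
proof (rule Bochner_Integration.integrable_bound)
  show "integrable lborel (\<lambda>x. exp (b\<^sup>2 / (2 * a)) * exp (- (a / 2) * (x - 0)\<^sup>2))"
    using has_bochner_integral_gauss[of "a / 2" 0] assms
    by (intro integrable_mult_right) (auto simp: has_bochner_integral_iff)
  show "AE x in lborel. norm (exp (b * \<bar>x\<bar> - a * x\<^sup>2)) \<le> norm (exp (b\<^sup>2 / (2 * a)) * exp (- (a / 2) * (x - 0)\<^sup>2))"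
  proof (rule AE_I2)
    fix x :: real
    have "0 \<le> (a * \<bar>x\<bar> - b)\<^sup>2 / (2 * a)" using assms by simp
    also have "\<dots> = b\<^sup>2 / (2 * a) + (a / 2) * x\<^sup>2 - b * \<bar>x\<bar>"
      using assms by (simp add: power2_diff power_mult_distrib) (simp add: field_simps power2_eq_square)
    finally show "norm (exp (b * \<bar>x\<bar> - a * x\<^sup>2)) \<le> norm (exp (b\<^sup>2 / (2 * a)) * exp (- (a / 2) * (x - 0)\<^sup>2))"
      by (simp flip: exp_add)
  qed
qed auto

text \<open>The sign splits the integral into two half-lines; on each one the fundamental theorem of calculus
leaves the boundary value at $0$.\<close>

lemma integral_sgn_deriv:
  fixes h h' :: "real \<Rightarrow> complex"
  assumes der: "\<And>x. (h has_vector_derivative h' x) (at x)" and cont: "continuous_on UNIV h'"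
    and int: "integrable lborel h'"
    and lim: "(h \<longlongrightarrow> 0) at_top" "(h \<longlongrightarrow> 0) at_bot"
  shows "(LINT y|lborel. of_real (sgn y) * h' y) = - 2 * h 0"
proof -
  have isc: "isCont h' x" for x using cont by (simp add: continuous_on_eq_continuous_at)
  have hc: "isCont h x" for x using has_vector_derivative_continuous[OF der] by simp
  have set: "set_integrable lborel A h'" if "A \<in> sets borel" for A
    using integrable_mult_indicator[OF _ int, of A] that unfolding set_integrable_def by simp
  have "(LBINT x=ereal 0..\<infinity>. h' x) = 0 - h 0"
  proof (rule interval_integral_FTC_integrable)
    show "((h \<circ> real_of_ereal) \<longlongrightarrow> h 0) (at_right (ereal 0))"
      unfolding ereal_tendsto_simps using hc[of 0] unfolding isCont_def by (rule filterlim_mono[OF _ order_refl at_le]) simp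
    show "((h \<circ> real_of_ereal) \<longlongrightarrow> 0) (at_left \<infinity>)"
      unfolding ereal_tendsto_simps by (rule lim)
  qed (use der isc set in auto)
  then have p: "(LINT x:{0<..}|lborel. h' x) = - h 0"
    by (simp add: interval_integral_to_infinity_eq)
  have "(LBINT x=-\<infinity>..ereal 0. h' x) = h 0 - 0"
  proof (rule interval_integral_FTC_integrable)
    show "((h \<circ> real_of_ereal) \<longlongrightarrow> h 0) (at_left (ereal 0))"
      unfolding ereal_tendsto_simps using hc[of 0] unfolding isCont_def by (rule filterlim_mono[OF _ order_refl at_le]) simp
    show "((h \<circ> real_of_ereal) \<longlongrightarrow> 0) (at_right (-\<infinity>))"
      unfolding ereal_tendsto_simps by (rule lim)
  qed (use der isc set in auto)
  then have n: "(LINT x:{..<0}|lborel. h' x) = h 0"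
    by (simp add: interval_lebesgue_integral_def einterval_def lessThan_def)
  have "(LINT y|lborel. of_real (sgn y) * h' y) = (LINT y|lborel. indicator {0<..} y *\<^sub>R h' y - indicator {..<0} y *\<^sub>R h' y)"
    by (intro Bochner_Integration.integral_cong) (auto simp: sgn_if)
  also have "\<dots> = (LINT x:{0<..}|lborel. h' x) - (LINT x:{..<0}|lborel. h' x)"
    unfolding set_lebesgue_integral_def
    using set[of "{0<..}"] set[of "{..<0}"] by (intro Bochner_Integration.integral_diff) (auto simp: set_integrable_def)
  finally show ?thesis using p n by simp
qed

abbreviation gauss1 :: "real \<Rightarrow> complex \<Rightarrow> real \<Rightarrow> complex" where
  "gauss1 a c y \<equiv> exp (- of_real a * (of_real y - c)\<^sup>2)"

lemma norm_gauss_shift_le: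
  fixes c :: complex
  assumes "a \<ge> 0" "norm c \<le> R"
  shows "norm (gauss1 a c y) \<le> exp (a * R\<^sup>2) * exp (2 * a * R * \<bar>y\<bar> - a * y\<^sup>2)"
proof -
  have R: "\<bar>Re c\<bar> \<le> R" "\<bar>Im c\<bar> \<le> R"
    using assms abs_Re_le_cmod[of c] abs_Im_le_cmod[of c] by auto
  have "Re ((of_real y - c)\<^sup>2) = y\<^sup>2 - 2 * (y * Re c) + (Re c)\<^sup>2 - (Im c)\<^sup>2"
    by (simp add: power2_eq_square algebra_simps)
  moreover have "y * Re c \<le> \<bar>y\<bar> * R"
  proof -
    have "y * Re c \<le> \<bar>y\<bar> * \<bar>Re c\<bar>" by (simp add: abs_mult[symmetric])
    also have "\<dots> \<le> \<bar>y\<bar> * R" using R by (intro mult_left_mono) auto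
    finally show ?thesis .
  qed
  moreover have "(Im c)\<^sup>2 \<le> R\<^sup>2" using R(2) by (simp add: abs_le_square_iff[symmetric])
  ultimately have "- Re ((of_real y - c)\<^sup>2) \<le> R\<^sup>2 + 2 * (\<bar>y\<bar> * R) - y\<^sup>2"
    using zero_le_power2[of "Re c"] by linarith
  then have "a * - Re ((of_real y - c)\<^sup>2) \<le> a * (R\<^sup>2 + 2 * (\<bar>y\<bar> * R) - y\<^sup>2)"
    using assms(1) by (rule mult_left_mono)
  then show ?thesis by (simp add: exp_add[symmetric] algebra_simps)
qed

lemma integrable_sgn_gauss_poly:
  fixes c :: complex
  assumes a: "a > 0"
  shows "integrable lborel (\<lambda>y. of_real (sgn y) * gauss1 a c y)"
    and "integrable lborel (\<lambda>y. 2 * of_real a * (of_real y - c) * gauss1 a c y)"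
proof -
  let ?R = "norm c"
  have i1: "integrable lborel (\<lambda>y. exp (a * ?R\<^sup>2) * exp (2 * a * ?R * \<bar>y\<bar> - a * y\<^sup>2))"
    by (intro integrable_mult_right integrable_gauss a)
  show "integrable lborel (\<lambda>y. of_real (sgn y) * gauss1 a c y)"
  proof (rule Bochner_Integration.integrable_bound[OF i1])
    show "AE y in lborel. norm (of_real (sgn y) * gauss1 a c y) \<le> norm (exp (a * ?R\<^sup>2) * exp (2 * a * ?R * \<bar>y\<bar> - a * y\<^sup>2))"
    proof (rule AE_I2)
      fix y
      have "norm (of_real (sgn y) * gauss1 a c y) \<le> norm (gauss1 a c y)"
        by (auto simp: sgn_if norm_mult)
      then show "norm (of_real (sgn y) * gauss1 a c y) \<le> norm (exp (a * ?R\<^sup>2) * exp (2 * a * ?R * \<bar>y\<bar> - a * y\<^sup>2))"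
        using norm_gauss_shift_le[of a c ?R y] a by simp
    qed
  qed auto
  have i2: "integrable lborel (\<lambda>y. (2 * a * exp (a * ?R\<^sup>2 + ?R)) * exp ((2 * a * ?R + 1) * \<bar>y\<bar> - a * y\<^sup>2))"
    by (intro integrable_mult_right integrable_gauss a)
  show "integrable lborel (\<lambda>y. 2 * of_real a * (of_real y - c) * gauss1 a c y)"
  proof (rule Bochner_Integration.integrable_bound[OF i2])
    show "AE y in lborel. norm (2 * of_real a * (of_real y - c) * gauss1 a c y) \<le> norm ((2 * a * exp (a * ?R\<^sup>2 + ?R)) * exp ((2 * a * ?R + 1) * \<bar>y\<bar> - a * y\<^sup>2))"
    proof (rule AE_I2)
      fix y
      have "norm (of_real y - c) \<le> \<bar>y\<bar> + ?R" by (rule order_trans[OF norm_triangle_ineq4]) simp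
      also have "\<dots> \<le> exp (\<bar>y\<bar> + ?R)" using exp_ge_add_one_self[of "\<bar>y\<bar> + ?R"] by linarith
      finally have "2 * a * norm (of_real y - c) * norm (gauss1 a c y) \<le>
        2 * a * exp (\<bar>y\<bar> + ?R) * (exp (a * ?R\<^sup>2) * exp (2 * a * ?R * \<bar>y\<bar> - a * y\<^sup>2))"
        using norm_gauss_shift_le[of a c ?R y] a by (intro mult_mono) auto
      also have "\<dots> = (2 * a * exp (a * ?R\<^sup>2 + ?R)) * exp ((2 * a * ?R + 1) * \<bar>y\<bar> - a * y\<^sup>2)"
        by (simp add: exp_add exp_diff algebra_simps)
      finally show "norm (2 * of_real a * (of_real y - c) * gauss1 a c y) \<le> norm ((2 * a * exp (a * ?R\<^sup>2 + ?R)) * exp ((2 * a * ?R + 1) * \<bar>y\<bar> - a * y\<^sup>2))"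
        using a by (simp add: norm_mult)
    qed
  qed auto
qed

lemma gauss_shift_limit:
  fixes c :: complex
  assumes a: "a > 0"
  shows "((\<lambda>y::real. gauss1 a c y) \<longlongrightarrow> 0) at_top"
    and "((\<lambda>y::real. gauss1 a c y) \<longlongrightarrow> 0) at_bot"
proof -
  let ?R = "norm c"
  have "((\<lambda>y. exp (a * ?R\<^sup>2) * exp (2 * a * ?R * y - a * y\<^sup>2)) \<longlongrightarrow> 0) at_top"
    using a by real_asymp
  moreover have "\<forall>\<^sub>F y in at_top. norm (gauss1 a c y) \<le> exp (a * ?R\<^sup>2) * exp (2 * a * ?R * y - a * y\<^sup>2)"
    using eventually_ge_at_top[of 0]
  proof eventually_elim
    case (elim y) then show ?case using norm_gauss_shift_le[of a c ?R y] a by simp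
  qed
  ultimately show "((\<lambda>y::real. gauss1 a c y) \<longlongrightarrow> 0) at_top"
    by (rule Lim_null_comparison[rotated])
  have "((\<lambda>y. exp (a * ?R\<^sup>2) * exp (2 * a * ?R * (-y) - a * y\<^sup>2)) \<longlongrightarrow> 0) at_bot"
    using a by real_asymp
  moreover have "\<forall>\<^sub>F y in at_bot. norm (gauss1 a c y) \<le> exp (a * ?R\<^sup>2) * exp (2 * a * ?R * (-y) - a * y\<^sup>2)"
    using eventually_le_at_bot[of 0]
  proof eventually_elim
    case (elim y) then show ?case using norm_gauss_shift_le[of a c ?R y] a by simp
  qed
  ultimately show "((\<lambda>y::real. gauss1 a c y) \<longlongrightarrow> 0) at_bot"
    by (rule Lim_null_comparison[rotated])
qed

lemma gauss_shift_deriv: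
  fixes c :: complex
  shows
  "((\<lambda>y::real. gauss1 a c y) has_vector_derivative
     - (2 * of_real a * (of_real y - c) * gauss1 a c y)) (at y)"
proof -
  have "((\<lambda>z. - of_real a * (z - c)\<^sup>2) has_field_derivative - of_real a * (2 * (of_real y - c))) (at (of_real y))"
    by (auto intro!: derivative_eq_intros)
  from has_vector_derivative_real_field[OF DERIV_chain2[where f = exp, OF DERIV_exp this]]
  show ?thesis by (simp add: mult_ac)
qed

text \<open>Both sides are differentiable in \<open>c\<close> with the same derivative, by \<open>integral_sgn_deriv\<close> on the left, and
both vanish at $c = 0$.\<close>

lemma integral_sgn_gauss:
  fixes c :: complex
  assumes a: "a > 0"
  shows "(LINT y|lborel. of_real (sgn y) * gauss1 a c y) = of_real (sqrt (pi / a)) * cerf (of_real (sqrt a) * c)"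
proof -
  define F where "F = (\<lambda>c::complex. LINT y|lborel. of_real (sgn y) * gauss1 a c y)"
  have F': "(F has_field_derivative 2 * exp (- of_real a * c\<^sup>2)) (at c)" for c
  proof -
    define R where "R = norm c + 1"
    have "(F has_field_derivative (LINT y|lborel. of_real (sgn y) * (2 * of_real a * (of_real y - c) * gauss1 a c y))) (at c)"
      unfolding F_def
    proof (rule has_field_derivative_integral_dominated[where r = 1 and
          g = "\<lambda>y. (2 * a * exp (a * R\<^sup>2 + R)) * exp ((2 * a * R + 1) * \<bar>y\<bar> - a * y\<^sup>2)" and
          f = "\<lambda>c y. of_real (sgn y) * gauss1 a c y" and
          f' = "\<lambda>c y. of_real (sgn y) * (2 * of_real a * (of_real y - c) * gauss1 a c y)"])
      show "integrable lborel (\<lambda>y. of_real (sgn y) * gauss1 a z y)" for z :: complex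
        by (rule integrable_sgn_gauss_poly[OF a])
      show "integrable lborel (\<lambda>y. (2 * a * exp (a * R\<^sup>2 + R)) * exp ((2 * a * R + 1) * \<bar>y\<bar> - a * y\<^sup>2))"
        by (intro integrable_mult_right integrable_gauss a)
      show "((\<lambda>z. of_real (sgn y) * gauss1 a z y) has_field_derivative of_real (sgn y) * (2 * of_real a * (of_real y - z) * gauss1 a z y)) (at z)" for y :: real and z :: complex
      proof -
        have "((\<lambda>z. - of_real a * (of_real y - z)\<^sup>2) has_field_derivative 2 * of_real a * (of_real y - z)) (at z)"
          by (auto intro!: derivative_eq_intros simp: algebra_simps)
        from DERIV_cmult[OF DERIV_chain2[where f = exp, OF DERIV_exp this], of "of_real (sgn y)"]
        show ?thesis by (simp add: mult_ac)
      qed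
      show "norm (of_real (sgn y) * (2 * of_real a * (of_real y - z) * gauss1 a z y)) \<le>
           (2 * a * exp (a * R\<^sup>2 + R)) * exp ((2 * a * R + 1) * \<bar>y\<bar> - a * y\<^sup>2)" if "z \<in> ball c 1" for z and y :: real
      proof -
        have zR: "norm z \<le> R"
          using that norm_triangle_sub[of z c] by (simp add: R_def dist_norm norm_minus_commute)
        have "norm (of_real y - z) \<le> \<bar>y\<bar> + norm z" by (rule order_trans[OF norm_triangle_ineq4]) simp
        also have "\<dots> \<le> exp (\<bar>y\<bar> + R)" using exp_ge_add_one_self[of "\<bar>y\<bar> + R"] zR by linarith
        finally have "2 * a * norm (of_real y - z) * norm (gauss1 a z y) \<le>
          2 * a * exp (\<bar>y\<bar> + R) * (exp (a * R\<^sup>2) * exp (2 * a * R * \<bar>y\<bar> - a * y\<^sup>2))"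
          using norm_gauss_shift_le[of a z R y] a zR by (intro mult_mono) auto
        also have "\<dots> = (2 * a * exp (a * R\<^sup>2 + R)) * exp ((2 * a * R + 1) * \<bar>y\<bar> - a * y\<^sup>2)"
          by (simp add: exp_add exp_diff algebra_simps)
        finally have "norm (2 * of_real a * (of_real y - z) * gauss1 a z y) \<le>
           (2 * a * exp (a * R\<^sup>2 + R)) * exp ((2 * a * R + 1) * \<bar>y\<bar> - a * y\<^sup>2)" using a by (simp add: norm_mult)
        moreover have "norm (of_real (sgn y) * x) \<le> norm x" for x :: complex
          by (auto simp: sgn_if norm_mult)
        ultimately show ?thesis by (meson order_trans)
      qed
    qed auto
    moreover have "(LINT y|lborel. of_real (sgn y) * - (2 * of_real a * (of_real y - c) * gauss1 a c y))
       = - 2 * gauss1 a c 0"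
    proof (rule integral_sgn_deriv[OF gauss_shift_deriv])
      show "continuous_on UNIV (\<lambda>y::real. - (2 * of_real a * (of_real y - c) * gauss1 a c y))"
        by (intro continuous_intros)
      show "integrable lborel (\<lambda>y::real. - (2 * of_real a * (of_real y - c) * gauss1 a c y))"
        by (intro Bochner_Integration.integrable_minus integrable_sgn_gauss_poly a)
    qed (rule gauss_shift_limit[OF a])+
    ultimately show ?thesis by simp
  qed
  have E': "((\<lambda>c. of_real (sqrt (pi / a)) * cerf (of_real (sqrt a) * c)) has_field_derivative 2 * exp (- of_real a * c\<^sup>2)) (at c)" for c
  proof -
    have "((\<lambda>c. of_real (sqrt a) * c) has_field_derivative of_real (sqrt a)) (at c)"
      by (auto intro!: derivative_eq_intros)
    from DERIV_cmult[OF DERIV_chain2[where f = cerf, OF cerf_has_field_derivative this], of "of_real (sqrt (pi / a))"]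
    have "((\<lambda>c. of_real (sqrt (pi / a)) * cerf (of_real (sqrt a) * c)) has_field_derivative
       of_real (sqrt (pi / a)) * (2 / of_real (sqrt pi) * exp (- ((of_real (sqrt a) * c)\<^sup>2)) * of_real (sqrt a))) (at c)" .
    moreover have "of_real (sqrt (pi / a)) * (2 / of_real (sqrt pi) * exp (- ((of_real (sqrt a) * c)\<^sup>2)) * of_real (sqrt a)) = 2 * exp (- of_real a * c\<^sup>2)"
    proof -
      have "(complex_of_real (sqrt a))\<^sup>2 = of_real a" using a by (simp flip: of_real_power)
      then have "exp (- ((of_real (sqrt a) * c)\<^sup>2)) = exp (- of_real a * c\<^sup>2)" by (simp add: power_mult_distrib)
      then show ?thesis using a by (simp add: real_sqrt_divide)
    qed
    ultimately show ?thesis by simp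
  qed
  have "F 0 = 0"
  proof -
    have "F 0 = (LINT y|lborel. of_real (sgn (0 + -1 * y)) * exp (- of_real a * (of_real (0 + -1 * y) - 0)\<^sup>2))"
      unfolding F_def by (subst lborel_integral_real_affine[where c = "-1" and t = 0]) auto
    also have "\<dots> = - F 0"
      unfolding F_def by (subst Bochner_Integration.integral_minus[symmetric], rule Bochner_Integration.integral_cong)
        (auto simp: sgn_if)
    finally show ?thesis by simp
  qed
  define H where "H = (\<lambda>c. F c - of_real (sqrt (pi / a)) * cerf (of_real (sqrt a) * c))"
  have "(H has_field_derivative 0) (at c within UNIV)" for c
    unfolding H_def using DERIV_diff[OF F' E'] by simp
  then obtain k where k: "\<And>c. c \<in> UNIV \<Longrightarrow> H c = k"
    using has_field_derivative_zero_constant[OF convex_UNIV, of H] by blast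
  have "H c = H 0" using k by simp
  moreover have "H 0 = 0" unfolding H_def using \<open>F 0 = 0\<close> by simp
  ultimately show ?thesis unfolding H_def F_def by simp
qed

lemma norm_cerf_real_le: "norm (cerf (of_real x)) \<le> 1"
proof -
  have 1: "of_real (sqrt pi) * cerf (of_real x) = (LINT y|lborel. of_real (sgn y) * exp (- of_real 1 * (of_real y - of_real x)\<^sup>2))"
    using integral_sgn_gauss[of 1 "of_real x"] by simp
  have "norm (of_real (sqrt pi) * cerf (of_real x)) \<le> (LINT y|lborel. exp (- 1 * (y - x)\<^sup>2))"
    unfolding 1
  proof (rule order_trans[OF integral_norm_bound integral_mono])
    show "integrable lborel (\<lambda>y. norm (of_real (sgn y) * exp (- of_real 1 * (of_real y - complex_of_real x)\<^sup>2)))"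
      by (intro integrable_norm integrable_sgn_gauss_poly) simp
    show "integrable lborel (\<lambda>y. exp (- 1 * (y - x)\<^sup>2))"
      using has_bochner_integral_gauss[of 1 x] by (simp add: has_bochner_integral_iff)
    show "norm (of_real (sgn y) * exp (- of_real 1 * (of_real y - complex_of_real x)\<^sup>2)) \<le> exp (- 1 * (y - x)\<^sup>2)" for y
      by (auto simp: norm_mult sgn_if simp flip: of_real_diff of_real_power)
  qed
  also have "\<dots> = sqrt pi"
    using has_bochner_integral_gauss[of 1 x] by (simp add: has_bochner_integral_iff)
  finally show ?thesis by (simp add: norm_mult)
qed

lemma tendsto_sgn_shift:
  "((\<lambda>t. sgn (y + sqrt t * n)) \<longlongrightarrow> (if n = 0 then sgn y else sgn n)) at_top"
proof (cases "n = 0")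
  case False
  have "\<forall>\<^sub>F t in at_top. sgn (y + sqrt t * n) = sgn n"
  proof (cases "n > 0")
    case True
    then have "filterlim (\<lambda>t. y + sqrt t * n) at_top at_top" by real_asymp
    then have "\<forall>\<^sub>F t in at_top. y + sqrt t * n > 0" by (rule filterlim_at_top_dense[THEN iffD1, rule_format])
    then show ?thesis using True by (auto elim!: eventually_mono)
  next
    case n: False
    with False have n: "n < 0" by simp
    then have "filterlim (\<lambda>t. y + sqrt t * n) at_bot at_top" by real_asymp
    then have "\<forall>\<^sub>F t in at_top. y + sqrt t * n < 0" by (rule filterlim_at_bot_dense[THEN iffD1, rule_format])
    then show ?thesis using n by (auto elim!: eventually_mono)
  qed
  then show ?thesis using False by (simp add: tendsto_eventually)
qed auto

lemma tendsto_cerf_real: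
  assumes c: "c > 0"
  shows "((\<lambda>t. cerf (of_real (sqrt (c * t) * n))) \<longlongrightarrow> of_real (sgn n)) at_top"
proof (cases "n = 0")
  case False
  have eq: "of_real (sqrt pi) * cerf (of_real (sqrt (c * t) * n)) =
      (LINT y|lborel. of_real (sgn (y + sqrt t * (sqrt c * n))) * exp (- (of_real y)\<^sup>2))" for t
  proof -
    let ?x = "sqrt (c * t) * n"
    have "of_real (sqrt pi) * cerf (of_real ?x) = (LINT y|lborel. of_real (sgn y) * exp (- of_real 1 * (of_real y - of_real ?x)\<^sup>2))"
      using integral_sgn_gauss[of 1 "of_real ?x"] by simp
    also have "\<dots> = (LINT y|lborel. of_real (sgn (?x + 1 * y)) * exp (- of_real 1 * (of_real (?x + 1 * y) - of_real ?x)\<^sup>2))"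
      by (subst lborel_integral_real_affine[where c = 1 and t = ?x]) auto
    finally show ?thesis by (simp add: add_ac mult_ac real_sqrt_mult)
  qed
  have L: "((\<lambda>t. LINT y|lborel. of_real (sgn (y + sqrt t * (sqrt c * n))) * exp (- (of_real y)\<^sup>2))
     \<longlongrightarrow> (LINT y|lborel. of_real (sgn n) * exp (- (complex_of_real y)\<^sup>2))) at_top"
  proof (rule integral_dominated_convergence_at_top[where w = "\<lambda>y. exp (- 1 * (y - 0)\<^sup>2)"])
    show "integrable lborel (\<lambda>y. exp (- 1 * (y - 0)\<^sup>2) :: real)"
      using has_bochner_integral_gauss[of 1 0] by (simp add: has_bochner_integral_iff)
    show "AE y in lborel. ((\<lambda>t. of_real (sgn (y + sqrt t * (sqrt c * n))) * exp (- (complex_of_real y)\<^sup>2)) \<longlongrightarrow> of_real (sgn n) * exp (- (of_real y)\<^sup>2)) at_top"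
    proof (rule AE_I2)
      fix y :: real
      have "((\<lambda>t. sgn (y + sqrt t * (sqrt c * n))) \<longlongrightarrow> sgn n) at_top"
        using tendsto_sgn_shift[of y "sqrt c * n"] False c by (simp add: sgn_mult)
      then show "((\<lambda>t. of_real (sgn (y + sqrt t * (sqrt c * n))) * exp (- (complex_of_real y)\<^sup>2)) \<longlongrightarrow> of_real (sgn n) * exp (- (of_real y)\<^sup>2)) at_top"
        by (intro tendsto_mult tendsto_of_real tendsto_const)
    qed
    show "\<forall>\<^sub>F t in at_top. AE y in lborel. norm (of_real (sgn (y + sqrt t * (sqrt c * n))) * exp (- (complex_of_real y)\<^sup>2)) \<le> exp (- 1 * (y - 0)\<^sup>2)"
      by (intro always_eventually allI AE_I2) (auto simp: norm_mult sgn_if simp flip: of_real_power)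
  qed auto
  have L': "(LINT y|lborel. of_real (sgn n) * exp (- (complex_of_real y)\<^sup>2)) = of_real (sqrt pi) * of_real (sgn n)"
  proof -
    have "(LINT y|lborel. complex_of_real (exp (- 1 * (y - 0)\<^sup>2))) = of_real (sqrt (pi / 1))"
      using has_bochner_integral_gauss[of 1 0] unfolding has_bochner_integral_iff integral_complex_of_real by simp
    then show ?thesis by (simp flip: exp_of_real)
  qed
  have "((\<lambda>t. of_real (sqrt pi) * cerf (of_real (sqrt (c * t) * n))) \<longlongrightarrow> of_real (sqrt pi) * of_real (sgn n)) at_top"
    unfolding eq using L unfolding L' .
  then have "((\<lambda>t. (of_real (sqrt pi) * cerf (of_real (sqrt (c * t) * n))) / of_real (sqrt pi)) \<longlongrightarrow> (of_real (sqrt pi) * of_real (sgn n)) / of_real (sqrt pi)) at_top"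
    by (intro tendsto_divide tendsto_const) auto
  then show ?thesis by simp
qed simp

section \<open>The generalized error function of $A_2$\<close>

lemma measurable_vector2: "(\<lambda>y::real\<times>real. vector [fst y, snd y] :: real^2) \<in> borel_measurable borel"
proof -
  have V: "(\<lambda>y. vector [fst y, snd y] :: real^2) = (\<lambda>y. fst y *\<^sub>R axis 1 1 + snd y *\<^sub>R axis 2 1)"
    by (auto simp: fun_eq_iff vec_eq_iff forall_2 vector_2 axis_def)
  show ?thesis unfolding V by (intro borel_measurable_continuous_onI continuous_intros)
qed

text \<open>Identifies the plane of the definition with a product, so that Fubini's theorem applies.\<close>

lemma lborel_real2: "(lborel :: (real^2) measure) = distr lborel borel (\<lambda>y. vector [fst y, snd y])"
proof (rule lborel_eqI)
  have meas: "(\<lambda>y::real\<times>real. vector [fst y, snd y] :: real^2) \<in> measurable lborel borel"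
    using measurable_vector2 by simp
  fix l u :: "real^2" assume lu: "\<And>b. b \<in> Basis \<Longrightarrow> l \<bullet> b \<le> u \<bullet> b"
  have Basis: "(Basis :: (real^2) set) = {axis 1 1, axis 2 1}"
    by (auto simp: Basis_vec_def UNIV_2)
  have ne: "axis 1 1 \<noteq> (axis 2 1 :: real^2)" by (simp add: axis_eq_axis)
  have le: "l $ 1 \<le> u $ 1" "l $ 2 \<le> u $ 2"
    using lu[of "axis 1 1"] lu[of "axis 2 1"] by (auto simp: Basis inner_axis)
  have pre: "(\<lambda>y. vector [fst y, snd y] :: real^2) -` box l u \<inter> space lborel = {l$1<..<u$1} \<times> {l$2<..<u$2}"
    by (auto simp: mem_box_cart forall_2 vector_2)
  have "emeasure (distr lborel borel (\<lambda>y. vector [fst y, snd y])) (box l u) = emeasure (lborel \<Otimes>\<^sub>M lborel) ({l$1<..<u$1} \<times> {l$2<..<u$2})"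
    by (subst emeasure_distr[OF meas]) (auto simp: pre lborel_prod simp del: space_lborel)
  also have "\<dots> = ennreal (u$1 - l$1) * ennreal (u$2 - l$2)"
    using le by (subst lborel.emeasure_pair_measure_Times) auto
  also have "\<dots> = ennreal (\<Prod>b\<in>Basis. (u - l) \<bullet> b)"
    using ne le by (simp add: Basis inner_axis ennreal_mult)
  finally show "emeasure (distr lborel borel (\<lambda>y. vector [fst y, snd y])) (box l u) = ennreal (\<Prod>b\<in>Basis. (u - l) \<bullet> b)" .
qed simp

text \<open>The $A_2$ form at complex arguments. In these coordinates the linear forms $B(\beta_j, \cdot)$ are the
coordinate functions, whence the plain signs in \<open>sgn2\<close>.\<close>

definition qc :: "complex \<Rightarrow> complex \<Rightarrow> complex" where "qc a b = a\<^sup>2 + b\<^sup>2 - a * b"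

definition gauss2 :: "nat \<Rightarrow> complex \<Rightarrow> complex \<Rightarrow> real \<times> real \<Rightarrow> complex" where
  "gauss2 p x1 x2 y = exp (- 2 * of_real pi * of_nat p * qc (of_real (fst y) - x1) (of_real (snd y) - x2))"

definition sgn2 :: "real \<times> real \<Rightarrow> complex" where
  "sgn2 y = of_real (sgn (fst y) * sgn (snd y))"

lemma gauss2_continuous: "continuous_on S f \<Longrightarrow> continuous_on S (\<lambda>x. gauss2 p x1 x2 (f x))"
  unfolding gauss2_def qc_def by (intro continuous_intros)

lemma gauss2_measurable [measurable]: "gauss2 p x1 x2 \<in> borel_measurable borel"
  using gauss2_continuous[of UNIV "\<lambda>y. y" p x1 x2] by (intro borel_measurable_continuous_onI) auto

lemma sgn2_measurable [measurable]: "sgn2 \<in> borel_measurable borel"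
proof -
  have "sgn2 \<in> borel_measurable (borel \<Otimes>\<^sub>M borel)" unfolding sgn2_def by measurable
  then show ?thesis by (simp add: borel_prod)
qed

lemma gen_error_A2:
  assumes "p > 0"
  shows "gen_error (of_nat p *\<^sub>R A2_gram) [beta1, beta2] x =
    of_real (sqrt 3 * p) * (LINT y|lborel. sgn2 y * gauss2 p (x $ 1) (x $ 2) y)"
proof -
  have det: "sqrt (det (of_nat p *\<^sub>R A2_gram)) = sqrt 3 * p"
    by (simp add: det_2 A2_gram_def vector_2 real_sqrt_mult flip: power2_eq_square)
  have b1: "bilin_form (of_nat p *\<^sub>R A2_gram) beta1 y = p * y $ 1" for y
    by (simp add: bilin_form_def beta1_def A2_gram_def inner_vec_def matrix_vector_mult_def sum_2 vector_2 algebra_simps)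
  have b2: "bilin_form (of_nat p *\<^sub>R A2_gram) beta2 y = p * y $ 2" for y
    by (simp add: bilin_form_def beta2_def A2_gram_def inner_vec_def matrix_vector_mult_def sum_2 vector_2 algebra_simps)
  have q: "quad_form (of_nat p *\<^sub>R A2_gram) z = of_nat p * qc (z $ 1) (z $ 2)" for z :: "complex^2"
    by (simp add: quad_form_def A2_gram_def qc_def sum_2 vector_2 power2_eq_square field_simps)
  have sg: "sgn (real p * a) = sgn a" for a using assms by (simp add: sgn_mult)
  define f where "f = (\<lambda>y::real^2. sgn2 (y $ 1, y $ 2) * gauss2 p (x $ 1) (x $ 2) (y $ 1, y $ 2))"
  have "gen_error (of_nat p *\<^sub>R A2_gram) [beta1, beta2] x = of_real (sqrt 3 * p) * (LINT y|lborel. f y)"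
    unfolding gen_error_def det f_def sgn2_def gauss2_def
    by (simp add: b1 b2 q sg mult_ac)
  also have "(LINT y|lborel. f y) = (LINT y|distr lborel borel (\<lambda>y. vector [fst y, snd y]). f y)"
    by (simp add: lborel_real2)
  also have "\<dots> = (LINT y|lborel. f (vector [fst y, snd y]))"
  proof (rule integral_distr)
    show "(\<lambda>y::real\<times>real. vector [fst y, snd y] :: real^2) \<in> measurable lborel borel"
      using measurable_vector2 by simp
    have c: "(\<lambda>y::real^2. (y $ 1, y $ 2)) \<in> borel_measurable borel"
      by (intro borel_measurable_continuous_onI continuous_intros)
    show "f \<in> borel_measurable borel"
      unfolding f_def using measurable_compose[OF c sgn2_measurable] measurable_compose[OF c gauss2_measurable]
      by (intro borel_measurable_times)
  qed
  finally show ?thesis by (simp add: f_def vector_2)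
qed

lemma integrable_product_lborel:
  fixes g1 g2 :: "real \<Rightarrow> real"
  assumes "integrable lborel g1" "integrable lborel g2"
  shows "integrable lborel (\<lambda>y. g1 (fst y) * g2 (snd y))"
proof -
  have [measurable]: "g1 \<in> borel_measurable borel" "g2 \<in> borel_measurable borel"
    using assms by (auto dest: borel_measurable_integrable)
  have "integrable (lborel \<Otimes>\<^sub>M lborel) (\<lambda>y. g1 (fst y) * g2 (snd y))"
  proof (rule lborel_pair.Fubini_integrable)
    show "integrable lborel (\<lambda>x. LINT y|lborel. norm (g1 (fst (x, y)) * g2 (snd (x, y))))"
      using assms by (simp add: abs_mult integrable_abs)
    show "AE x in lborel. integrable lborel (\<lambda>y. g1 (fst (x, y)) * g2 (snd (x, y)))"
      using assms by simp
  qed measurable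
  then show ?thesis by (simp add: lborel_prod)
qed

lemma integrable2I:
  fixes f :: "real \<times> real \<Rightarrow> complex"
  assumes "f \<in> borel_measurable borel" "\<And>y. norm (f y) \<le> C * (g1 (fst y) * g2 (snd y))"
    "integrable lborel g1" "integrable lborel g2"
  shows "integrable lborel f"
proof (rule Bochner_Integration.integrable_bound)
  show "integrable lborel (\<lambda>y. C * (g1 (fst y) * g2 (snd y)))"
    by (intro integrable_mult_right integrable_product_lborel assms)
  show "AE y in lborel. norm (f y) \<le> norm (C * (g1 (fst y) * g2 (snd y)))"
    by (rule AE_I2, rule order_trans[OF assms(2)]) (simp only: real_norm_def abs_ge_self)
qed (use assms(1) in simp)

lemma integral2_iter:
  fixes f :: "real \<times> real \<Rightarrow> complex"
  assumes "integrable lborel f"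
  shows "(LINT y|lborel. f y) = (LINT b|lborel. LINT a|lborel. f (a, b))"
    and "(LINT y|lborel. f y) = (LINT a|lborel. LINT b|lborel. f (a, b))"
proof -
  have i: "integrable (lborel \<Otimes>\<^sub>M lborel) f" using assms by (simp add: lborel_prod)
  show "(LINT y|lborel. f y) = (LINT b|lborel. LINT a|lborel. f (a, b))"
    using lborel_pair.integral_snd[of "\<lambda>a b. f (a, b)"] i by (simp add: lborel_prod)
  show "(LINT y|lborel. f y) = (LINT a|lborel. LINT b|lborel. f (a, b))"
    using lborel_pair.integral_fst'[OF i] by (simp add: lborel_prod)
qed

lemma norm_gauss2_le:
  assumes "norm x1 \<le> R" "norm x2 \<le> R"
  shows "norm (gauss2 p x1 x2 y) \<le> exp (6 * pi * p * R\<^sup>2) *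
    (exp (2 * pi * p * R * \<bar>fst y\<bar> - pi * p * (fst y)\<^sup>2) * exp (2 * pi * p * R * \<bar>snd y\<bar> - pi * p * (snd y)\<^sup>2))"
proof -
  define u where "u = fst y - Re x1"
  define v where "v = snd y - Re x2"
  define b where "b = Im x1"
  define d where "d = Im x2"
  have Re: "Re (qc (of_real (fst y) - x1) (of_real (snd y) - x2)) = (u\<^sup>2 + v\<^sup>2 - u * v) - (b\<^sup>2 + d\<^sup>2 - b * d)"
    by (simp add: qc_def u_def v_def b_def d_def power2_eq_square algebra_simps)
  have R: "\<bar>Re x1\<bar> \<le> R" "\<bar>Im x1\<bar> \<le> R" "\<bar>Re x2\<bar> \<le> R" "\<bar>Im x2\<bar> \<le> R"
    using assms abs_Re_le_cmod[of x1] abs_Im_le_cmod[of x1] abs_Re_le_cmod[of x2] abs_Im_le_cmod[of x2] by auto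
  have sq: "(a - r)\<^sup>2 \<ge> a\<^sup>2 - 2 * (R * \<bar>a\<bar>)" if "\<bar>r\<bar> \<le> R" for a r :: real
  proof -
    have "a * r \<le> \<bar>a\<bar> * \<bar>r\<bar>" by (simp add: abs_mult[symmetric])
    also have "\<dots> \<le> \<bar>a\<bar> * R" using that by (intro mult_left_mono) auto
    finally have "a * r \<le> R * \<bar>a\<bar>" by (simp add: mult_ac)
    moreover have "(a - r)\<^sup>2 = a\<^sup>2 - 2 * (a * r) + r\<^sup>2" by (simp add: power2_diff)
    ultimately show ?thesis using zero_le_power2[of r] by argo
  qed
  have 1: "u\<^sup>2 + v\<^sup>2 - u * v \<ge> (u\<^sup>2 + v\<^sup>2) / 2"
    using zero_le_power2[of "u - v"] by (simp add: power2_diff)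
  have "b\<^sup>2 \<le> R\<^sup>2" "d\<^sup>2 \<le> R\<^sup>2" using R by (auto simp: b_def d_def abs_le_square_iff[symmetric])
  moreover have "- (b * d) \<le> (b\<^sup>2 + d\<^sup>2) / 2" using zero_le_power2[of "b + d"] by (simp add: power2_sum)
  ultimately have 2: "b\<^sup>2 + d\<^sup>2 - b * d \<le> 3 * R\<^sup>2" by argo
  have 3: "u\<^sup>2 \<ge> (fst y)\<^sup>2 - 2 * (R * \<bar>fst y\<bar>)" "v\<^sup>2 \<ge> (snd y)\<^sup>2 - 2 * (R * \<bar>snd y\<bar>)"
    unfolding u_def v_def using sq R by auto
  have "- Re (qc (of_real (fst y) - x1) (of_real (snd y) - x2)) \<le> 3 * R\<^sup>2 + (R * \<bar>fst y\<bar> - (fst y)\<^sup>2 / 2) + (R * \<bar>snd y\<bar> - (snd y)\<^sup>2 / 2)"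
    using 1 2 3 unfolding Re by argo
  then have "(2 * pi * p) * - Re (qc (of_real (fst y) - x1) (of_real (snd y) - x2)) \<le>
     (2 * pi * p) * (3 * R\<^sup>2 + (R * \<bar>fst y\<bar> - (fst y)\<^sup>2 / 2) + (R * \<bar>snd y\<bar> - (snd y)\<^sup>2 / 2))"
    by (rule mult_left_mono) simp
  then show ?thesis by (simp add: gauss2_def exp_add[symmetric] algebra_simps)
qed

lemma integrable_gauss2:
  assumes p: "p > 0" and m: "F \<in> borel_measurable borel" and F: "\<And>y. norm (F y) \<le> 1"
  shows "integrable lborel (\<lambda>y. F y * gauss2 p x1 x2 y)"
proof -
  define R where "R = max (norm x1) (norm x2)"
  show ?thesis
  proof (rule integrable2I)
    show "(\<lambda>y. F y * gauss2 p x1 x2 y) \<in> borel_measurable borel" using m by measurable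
    show "norm (F y * gauss2 p x1 x2 y) \<le> exp (6 * pi * p * R\<^sup>2) *
        ((\<lambda>a. exp (2 * pi * p * R * \<bar>a\<bar> - pi * p * a\<^sup>2)) (fst y) * (\<lambda>a. exp (2 * pi * p * R * \<bar>a\<bar> - pi * p * a\<^sup>2)) (snd y))" for y
    proof -
      have "norm (F y * gauss2 p x1 x2 y) \<le> 1 * norm (gauss2 p x1 x2 y)"
        unfolding norm_mult using F by (intro mult_right_mono) auto
      then show ?thesis using norm_gauss2_le[of x1 R x2 p y] by (simp add: R_def)
    qed
  qed (use p in \<open>auto intro!: integrable_gauss\<close>)
qed

lemma norm_sgn2_le: "norm (sgn2 y) \<le> 1"
  by (auto simp: sgn2_def sgn_if norm_mult)

lemma norm_lin_gauss2_le:
  assumes x: "norm x1 \<le> R" "norm x2 \<le> R"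
  shows "norm ((2 * (of_real (fst y) - x1) - (of_real (snd y) - x2)) * gauss2 p x1 x2 y) \<le>
      (2 * exp (2 * R) * exp (6 * pi * p * R\<^sup>2)) * (exp ((2 * pi * p * R + 1) * \<bar>fst y\<bar> - pi * p * (fst y)\<^sup>2) * exp ((2 * pi * p * R + 1) * \<bar>snd y\<bar> - pi * p * (snd y)\<^sup>2))"
    and "norm ((2 * (of_real (snd y) - x2) - (of_real (fst y) - x1)) * gauss2 p x1 x2 y) \<le>
      (2 * exp (2 * R) * exp (6 * pi * p * R\<^sup>2)) * (exp ((2 * pi * p * R + 1) * \<bar>fst y\<bar> - pi * p * (fst y)\<^sup>2) * exp ((2 * pi * p * R + 1) * \<bar>snd y\<bar> - pi * p * (snd y)\<^sup>2))"
proof -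
  have n: "norm (of_real (fst y) - x1) \<le> \<bar>fst y\<bar> + R" "norm (of_real (snd y) - x2) \<le> \<bar>snd y\<bar> + R"
    using norm_triangle_ineq4[of "of_real (fst y)" x1] norm_triangle_ineq4[of "of_real (snd y)" x2] x by auto
  have e: "\<bar>fst y\<bar> + \<bar>snd y\<bar> + 2 * R \<le> exp (\<bar>fst y\<bar> + \<bar>snd y\<bar> + 2 * R)"
    using exp_ge_add_one_self[of "\<bar>fst y\<bar> + \<bar>snd y\<bar> + 2 * R"] by linarith
  have R: "R \<ge> 0" by (rule order_trans[OF norm_ge_zero x(1)])
  have key: "norm (L * gauss2 p x1 x2 y) \<le>
      (2 * exp (2 * R) * exp (6 * pi * p * R\<^sup>2)) * (exp ((2 * pi * p * R + 1) * \<bar>fst y\<bar> - pi * p * (fst y)\<^sup>2) * exp ((2 * pi * p * R + 1) * \<bar>snd y\<bar> - pi * p * (snd y)\<^sup>2))"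
    if "norm L \<le> 2 * (\<bar>fst y\<bar> + \<bar>snd y\<bar> + 2 * R)" for L
  proof -
    have "norm L \<le> 2 * exp (\<bar>fst y\<bar> + \<bar>snd y\<bar> + 2 * R)" using that e by argo
    then have "norm L * norm (gauss2 p x1 x2 y) \<le> (2 * exp (\<bar>fst y\<bar> + \<bar>snd y\<bar> + 2 * R)) * (exp (6 * pi * p * R\<^sup>2) *
    (exp (2 * pi * p * R * \<bar>fst y\<bar> - pi * p * (fst y)\<^sup>2) * exp (2 * pi * p * R * \<bar>snd y\<bar> - pi * p * (snd y)\<^sup>2)))"
      by (intro mult_mono norm_gauss2_le x) auto
    also have "\<dots> = (2 * exp (2 * R) * exp (6 * pi * p * R\<^sup>2)) * (exp ((2 * pi * p * R + 1) * \<bar>fst y\<bar> - pi * p * (fst y)\<^sup>2) * exp ((2 * pi * p * R + 1) * \<bar>snd y\<bar> - pi * p * (snd y)\<^sup>2))"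
      by (simp add: exp_add exp_diff algebra_simps)
    finally show ?thesis by (simp add: norm_mult)
  qed
  have n2: "norm (2 * a - b :: complex) \<le> 2 * norm a + norm b" for a b
    using norm_triangle_ineq4[of "2 * a" b] by (simp add: norm_mult)
  show "norm ((2 * (of_real (fst y) - x1) - (of_real (snd y) - x2)) * gauss2 p x1 x2 y) \<le>
      (2 * exp (2 * R) * exp (6 * pi * p * R\<^sup>2)) * (exp ((2 * pi * p * R + 1) * \<bar>fst y\<bar> - pi * p * (fst y)\<^sup>2) * exp ((2 * pi * p * R + 1) * \<bar>snd y\<bar> - pi * p * (snd y)\<^sup>2))"
    by (rule key, rule order_trans[OF n2]) (use n R in argo)
  show "norm ((2 * (of_real (snd y) - x2) - (of_real (fst y) - x1)) * gauss2 p x1 x2 y) \<le>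
      (2 * exp (2 * R) * exp (6 * pi * p * R\<^sup>2)) * (exp ((2 * pi * p * R + 1) * \<bar>fst y\<bar> - pi * p * (fst y)\<^sup>2) * exp ((2 * pi * p * R + 1) * \<bar>snd y\<bar> - pi * p * (snd y)\<^sup>2))"
    by (rule key, rule order_trans[OF n2]) (use n R in argo)
qed

text \<open>The integrands of the partial derivatives of the error function.\<close>

lemma integrable_lin_gauss2:
  assumes p: "p > 0"
  shows "integrable lborel (\<lambda>y. sgn2 y * ((2 * (of_real (fst y) - x1) - (of_real (snd y) - x2)) * gauss2 p x1 x2 y))"
    and "integrable lborel (\<lambda>y. sgn2 y * ((2 * (of_real (snd y) - x2) - (of_real (fst y) - x1)) * gauss2 p x1 x2 y))"
proof -
  define R where "R = max (norm x1) (norm x2)"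
  have x: "norm x1 \<le> R" "norm x2 \<le> R" by (auto simp: R_def)
  define g where "g = (\<lambda>a. exp ((2 * pi * p * R + 1) * \<bar>a\<bar> - pi * p * a\<^sup>2))"
  have g: "integrable lborel g" unfolding g_def using p by (intro integrable_gauss) auto
  have n: "norm (sgn2 y * L) \<le> norm L" for y L
    unfolding norm_mult using norm_sgn2_le[of y] by (simp add: mult_left_le_one_le)
  have m: "(\<lambda>y. sgn2 y * h y) \<in> borel_measurable borel" if "continuous_on UNIV h" for h
    using that by (intro borel_measurable_times sgn2_measurable borel_measurable_continuous_onI)
  show "integrable lborel (\<lambda>y. sgn2 y * ((2 * (of_real (fst y) - x1) - (of_real (snd y) - x2)) * gauss2 p x1 x2 y))"
    by (rule integrable2I[where C = "2 * exp (2 * R) * exp (6 * pi * p * R\<^sup>2)", OF m order_trans[OF n] g g])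
       (intro continuous_intros gauss2_continuous, unfold g_def, rule norm_lin_gauss2_le(1)[OF x])
  show "integrable lborel (\<lambda>y. sgn2 y * ((2 * (of_real (snd y) - x2) - (of_real (fst y) - x1)) * gauss2 p x1 x2 y))"
    by (rule integrable2I[where C = "2 * exp (2 * R) * exp (6 * pi * p * R\<^sup>2)", OF m order_trans[OF n] g g])
       (intro continuous_intros gauss2_continuous, unfold g_def, rule norm_lin_gauss2_le(2)[OF x])
qed

lemma integral_sgn_gauss_deriv:
  fixes c :: complex
  assumes a: "a > 0"
  shows "(LINT y|lborel. of_real (sgn y) * (2 * of_real a * (of_real y - c) * gauss1 a c y))
       = 2 * exp (- of_real a * c\<^sup>2)"
proof -
  have "(LINT y|lborel. of_real (sgn y) * - (2 * of_real a * (of_real y - c) * gauss1 a c y))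
       = - 2 * gauss1 a c 0"
  proof (rule integral_sgn_deriv[OF gauss_shift_deriv])
    show "continuous_on UNIV (\<lambda>y::real. - (2 * of_real a * (of_real y - c) * gauss1 a c y))"
      by (intro continuous_intros)
    show "integrable lborel (\<lambda>y::real. - (2 * of_real a * (of_real y - c) * gauss1 a c y))"
      by (intro Bochner_Integration.integrable_minus integrable_sgn_gauss_poly a)
  qed (rule gauss_shift_limit[OF a])+
  then show ?thesis by simp
qed

text \<open>Completing the square in the first coordinate; the two exponents belong to the lines $A_1(3)$
and $A_1$ into which the lattice will be split.\<close>

lemma gauss2_split:
  "gauss2 p x1 x2 (a, b) = exp (- of_real (3/2 * pi * p) * (of_real b - x2)\<^sup>2) *
     exp (- of_real (2 * pi * p) * (of_real a - (x1 + (of_real b - x2) / 2))\<^sup>2)"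
  unfolding gauss2_def qc_def exp_add[symmetric]
  by (rule arg_cong[where f = exp]) (simp add: power2_eq_square field_simps)

lemma gauss2_swap: "gauss2 p x1 x2 (a, b) = gauss2 p x2 x1 (b, a)"
  by (simp add: gauss2_def qc_def mult_ac add_ac)

text \<open>The linear factor is the derivative of the exponent in the first coordinate. Integrating this
coordinate first replaces the Gaussian by its value on the line $y_1 = 0$; what remains is the one
dimensional error integral.\<close>

lemma integral_sgn2_lin1:
  assumes p: "p > 0"
  shows "(LINT y|lborel. sgn2 y * ((2 * (of_real (fst y) - x1) - (of_real (snd y) - x2)) * gauss2 p x1 x2 y)) =
     of_real (sqrt (1 / (2 * p)) / (pi * p)) * (exp (- of_real (3/2 * pi * p) * x1\<^sup>2) * cerf (of_real (sqrt (2 * pi * p)) * (x2 - x1 / 2)))"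
proof -
  let ?a = "2 * pi * p"
  have a: "?a > 0" using p by simp
  have inner: "(LINT a|lborel. sgn2 (a, b) * ((2 * (of_real a - x1) - (of_real b - x2)) * gauss2 p x1 x2 (a, b))) =
     of_real (1 / (pi * p)) * exp (- of_real (3/2 * pi * p) * x1\<^sup>2) * (of_real (sgn b) * exp (- of_real ?a * (of_real b - (x2 - x1 / 2))\<^sup>2))" for b
  proof -
    let ?c = "x1 + (of_real b - x2) / 2"
    let ?k = "of_real (sgn b) * exp (- of_real (3/2 * pi * p) * (of_real b - x2)\<^sup>2) / of_real ?a"
    have "(LINT a|lborel. sgn2 (a, b) * ((2 * (of_real a - x1) - (of_real b - x2)) * gauss2 p x1 x2 (a, b))) =
       (LINT a|lborel. ?k * (of_real (sgn a) * (2 * of_real ?a * (of_real a - ?c) * exp (- of_real ?a * (of_real a - ?c)\<^sup>2))))"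
    proof (rule Bochner_Integration.integral_cong[OF refl])
      fix a :: real
      define E1 where "E1 = exp (- of_real (3/2 * pi * p) * (of_real b - x2)\<^sup>2)"
      define E2 where "E2 = exp (- of_real ?a * (of_real a - ?c)\<^sup>2)"
      have d: "2 * (of_real a - ?c) = 2 * (of_real a - x1) - (of_real b - x2)" by (simp add: field_simps)
      have r: "of_real (sgn b) * E1 / k * (of_real (sgn a) * (2 * k * d * E2)) = of_real (sgn a) * of_real (sgn b) * ((2 * d) * (E1 * E2))"
        if "k \<noteq> 0" for k d :: complex
        using that by (simp add: field_simps)
      have ne: "complex_of_real ?a \<noteq> 0" using p by simp
      show "sgn2 (a, b) * ((2 * (of_real a - x1) - (of_real b - x2)) * gauss2 p x1 x2 (a, b)) =
         ?k * (of_real (sgn a) * (2 * of_real ?a * (of_real a - ?c) * exp (- of_real ?a * (of_real a - ?c)\<^sup>2)))"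
        unfolding gauss2_split sgn2_def E1_def[symmetric] E2_def[symmetric] fst_conv snd_conv of_real_mult[of "sgn a" "sgn b"]
        unfolding r[OF ne] d ..
    qed
    also have "\<dots> = ?k * (2 * exp (- of_real ?a * ?c\<^sup>2))"
      by (simp only: Bochner_Integration.integral_mult_right_zero integral_sgn_gauss_deriv[OF a])
    also have "\<dots> = of_real (1 / (pi * p)) * (of_real (sgn b) * (exp (- of_real (3/2 * pi * p) * (of_real b - x2)\<^sup>2) * exp (- of_real ?a * ?c\<^sup>2)))"
    proof -
      have r: "S * E / k * (2 * F) = 2 / k * (S * (E * F))" for S E F k :: complex by simp
      have k: "2 / complex_of_real ?a = of_real (1 / (pi * p))" by simp
      show ?thesis unfolding r k ..
    qed
    also have "exp (- of_real (3/2 * pi * p) * (of_real b - x2)\<^sup>2) * exp (- of_real ?a * ?c\<^sup>2) =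
        exp (- of_real (3/2 * pi * p) * x1\<^sup>2) * exp (- of_real ?a * (of_real b - (x2 - x1 / 2))\<^sup>2)"
      unfolding exp_add[symmetric] by (rule arg_cong[where f = exp]) (simp add: power2_eq_square field_simps)
    finally show ?thesis by (simp add: mult_ac)
  qed
  have "(LINT y|lborel. sgn2 y * ((2 * (of_real (fst y) - x1) - (of_real (snd y) - x2)) * gauss2 p x1 x2 y)) =
     (LINT b|lborel. of_real (1 / (pi * p)) * exp (- of_real (3/2 * pi * p) * x1\<^sup>2) * (of_real (sgn b) * exp (- of_real ?a * (of_real b - (x2 - x1 / 2))\<^sup>2)))"
    unfolding integral2_iter(1)[OF integrable_lin_gauss2(1)[OF p]] by (simp only: fst_conv snd_conv inner)
  also have "\<dots> = of_real (1 / (pi * p)) * exp (- of_real (3/2 * pi * p) * x1\<^sup>2) * (of_real (sqrt (pi / ?a)) * cerf (of_real (sqrt ?a) * (x2 - x1 / 2)))"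
    by (simp only: Bochner_Integration.integral_mult_right_zero integral_sgn_gauss[OF a])
  also have "pi / ?a = 1 / (2 * p)" using p by simp
  finally show ?thesis by (simp add: mult_ac)
qed

lemma integral2_swap:
  fixes f :: "real \<times> real \<Rightarrow> complex"
  assumes i: "integrable lborel f" and j: "integrable lborel (\<lambda>y. f (snd y, fst y))"
  shows "(LINT y|lborel. f y) = (LINT y|lborel. f (snd y, fst y))"
  unfolding integral2_iter(1)[OF i] integral2_iter(2)[OF j] by simp

lemma integral_sgn2_lin2:
  assumes p: "p > 0"
  shows "(LINT y|lborel. sgn2 y * ((2 * (of_real (snd y) - x2) - (of_real (fst y) - x1)) * gauss2 p x1 x2 y)) =
     of_real (sqrt (1 / (2 * p)) / (pi * p)) * (exp (- of_real (3/2 * pi * p) * x2\<^sup>2) * cerf (of_real (sqrt (2 * pi * p)) * (x1 - x2 / 2)))"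
proof -
  have eq: "sgn2 (snd y, fst y) * ((2 * (of_real (snd (snd y, fst y)) - x2) - (of_real (fst (snd y, fst y)) - x1)) * gauss2 p x1 x2 (snd y, fst y)) =
     sgn2 y * ((2 * (of_real (fst y) - x2) - (of_real (snd y) - x1)) * gauss2 p x2 x1 y)" for y :: "real \<times> real"
    using gauss2_swap[of p x1 x2 "snd y" "fst y"] by (simp add: sgn2_def mult_ac)
  show ?thesis
    using integral2_swap[OF integrable_lin_gauss2(2)[OF p], of x2 x1] integrable_lin_gauss2(1)[OF p, of x2 x1]
      integral_sgn2_lin1[OF p, of x2 x1]
    unfolding eq by simp
qed

text \<open>The error function of $pQ_2$ at the point $z n$, for a real vector \<open>n\<close>.\<close>

definition A2E :: "nat \<Rightarrow> real \<Rightarrow> real \<Rightarrow> complex \<Rightarrow> complex" where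
  "A2E p n1 n2 z = of_real (sqrt 3 * p) * (LINT y|lborel. sgn2 y * gauss2 p (z * of_real n1) (z * of_real n2) y)"

lemma A2E_has_field_derivative:
  assumes p: "p > 0"
  shows "(A2E p n1 n2 has_field_derivative of_real (sqrt (6 * p)) *
     (of_real n1 * (exp (- of_real (3/2 * pi * p) * (z * of_real n1)\<^sup>2) * cerf (of_real (sqrt (2 * pi * p)) * (z * of_real n2 - z * of_real n1 / 2))) +
      of_real n2 * (exp (- of_real (3/2 * pi * p) * (z * of_real n2)\<^sup>2) * cerf (of_real (sqrt (2 * pi * p)) * (z * of_real n1 - z * of_real n2 / 2))))) (at z)"
proof -
  define L1 where "L1 = (\<lambda>z y. (2 * (of_real (fst y) - z * of_real n1) - (of_real (snd y) - z * of_real n2)) * gauss2 p (z * of_real n1) (z * of_real n2) y)"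
  define L2 where "L2 = (\<lambda>z y. (2 * (of_real (snd y) - z * of_real n2) - (of_real (fst y) - z * of_real n1)) * gauss2 p (z * of_real n1) (z * of_real n2) y)"
  define f' where "f' = (\<lambda>z y. of_real (2 * pi * p) * (of_real n1 * (sgn2 y * L1 z y) + of_real n2 * (sgn2 y * L2 z y)))"
  define R where "R = (norm z + 1) * (\<bar>n1\<bar> + \<bar>n2\<bar>)"
  define g where "g = (\<lambda>a. exp ((2 * pi * p * R + 1) * \<bar>a\<bar> - pi * p * a\<^sup>2))"
  define C where "C = 2 * pi * p * ((\<bar>n1\<bar> + \<bar>n2\<bar>) * (2 * exp (2 * R) * exp (6 * pi * p * R\<^sup>2)))"
  have ints: "integrable lborel (\<lambda>y. sgn2 y * L1 z y)" "integrable lborel (\<lambda>y. sgn2 y * L2 z y)" for z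
    unfolding L1_def L2_def by (intro integrable_lin_gauss2 p)+
  have "((\<lambda>z. LINT y|lborel. sgn2 y * gauss2 p (z * of_real n1) (z * of_real n2) y) has_field_derivative (LINT y|lborel. f' z y)) (at z)"
  proof (rule has_field_derivative_integral_dominated[where r = 1 and g = "\<lambda>y. C * (g (fst y) * g (snd y))"])
    show "integrable lborel (\<lambda>y. sgn2 y * gauss2 p (z * of_real n1) (z * of_real n2) y)" for z
      by (intro integrable_gauss2 p norm_sgn2_le) measurable
    show "integrable lborel (\<lambda>y. C * (g (fst y) * g (snd y)))"
      unfolding g_def using p by (intro integrable_mult_right integrable_product_lborel integrable_gauss) auto
    show "f' z \<in> borel_measurable lborel"
      unfolding f'_def by (intro borel_measurable_integrable integrable_mult_right Bochner_Integration.integrable_add ints)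
    show "((\<lambda>z. sgn2 y * gauss2 p (z * of_real n1) (z * of_real n2) y) has_field_derivative f' z y) (at z)" for z y
    proof -
      let ?A = "of_real (fst y) :: complex" and ?B = "of_real (snd y) :: complex"
      have "((\<lambda>z. - 2 * of_real pi * of_nat p * qc (?A - z * of_real n1) (?B - z * of_real n2)) has_field_derivative
         of_real (2 * pi * p) * (of_real n1 * (2 * (?A - z * of_real n1) - (?B - z * of_real n2)) + of_real n2 * (2 * (?B - z * of_real n2) - (?A - z * of_real n1)))) (at z)"
      proof -
        have l: "((\<lambda>z. A - z * of_real n) has_field_derivative - of_real n) (at z)" for A :: complex and n :: real
          by (auto intro!: derivative_eq_intros)
        have s: "((\<lambda>z. (A - z * of_real n)\<^sup>2) has_field_derivative 2 * (- of_real n * (A - z * of_real n))) (at z)" for A :: complex and n :: real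
          unfolding power2_eq_square by (rule DERIV_cong[OF DERIV_mult[OF l l]]) (simp add: algebra_simps)
        from DERIV_cmult[OF DERIV_diff[OF DERIV_add[OF s s] DERIV_mult[OF l l]], of "- 2 * of_real pi * of_nat p" ?A n1 ?B n2 ?A n1 ?B n2]
        show ?thesis unfolding qc_def by (rule DERIV_cong) (simp add: algebra_simps)
      qed
      from DERIV_cmult[OF DERIV_chain2[where f = exp, OF DERIV_exp this], of "sgn2 y"]
      show ?thesis unfolding f'_def L1_def L2_def gauss2_def by (simp add: algebra_simps)
    qed
    fix z' :: complex and y :: "real \<times> real" assume z': "z' \<in> ball z 1"
    have "norm z' \<le> norm z + 1" using z' norm_triangle_sub[of z' z] by (simp add: dist_norm norm_minus_commute)
    then have x: "norm (z' * of_real n1) \<le> R" "norm (z' * of_real n2) \<le> R"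
      unfolding R_def norm_mult by (intro mult_mono; simp)+
    have n: "norm (sgn2 y * L) \<le> norm L" for L
      unfolding norm_mult using norm_sgn2_le[of y] by (simp add: mult_left_le_one_le)
    let ?B = "(2 * exp (2 * R) * exp (6 * pi * p * R\<^sup>2)) * (g (fst y) * g (snd y))"
    have b: "norm (sgn2 y * L1 z' y) \<le> ?B" "norm (sgn2 y * L2 z' y) \<le> ?B"
      unfolding L1_def L2_def g_def by (rule order_trans[OF n norm_lin_gauss2_le(1)[OF x]], rule order_trans[OF n norm_lin_gauss2_le(2)[OF x]])
    have "norm (f' z' y) = 2 * pi * p * norm (of_real n1 * (sgn2 y * L1 z' y) + of_real n2 * (sgn2 y * L2 z' y))"
      unfolding f'_def norm_mult[of "of_real (2 * pi * p)"] norm_of_real by simp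
    also have "\<dots> \<le> 2 * pi * p * (\<bar>n1\<bar> * ?B + \<bar>n2\<bar> * ?B)"
    proof (rule mult_left_mono)
      have "norm (of_real n1 * (sgn2 y * L1 z' y) + of_real n2 * (sgn2 y * L2 z' y)) \<le> \<bar>n1\<bar> * norm (sgn2 y * L1 z' y) + \<bar>n2\<bar> * norm (sgn2 y * L2 z' y)"
        by (rule order_trans[OF norm_triangle_ineq]) (simp add: norm_mult)
      also have "\<dots> \<le> \<bar>n1\<bar> * ?B + \<bar>n2\<bar> * ?B"
        by (intro add_mono mult_left_mono b) auto
      finally show "norm (of_real n1 * (sgn2 y * L1 z' y) + of_real n2 * (sgn2 y * L2 z' y)) \<le> \<bar>n1\<bar> * ?B + \<bar>n2\<bar> * ?B" .
    qed simp
    also have "\<dots> = C * (g (fst y) * g (snd y))" unfolding C_def by (simp add: algebra_simps)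
    finally show "norm (f' z' y) \<le> C * (g (fst y) * g (snd y))" .
  qed simp
  from DERIV_cmult[OF this, of "of_real (sqrt 3 * p)"]
  have D: "(A2E p n1 n2 has_field_derivative of_real (sqrt 3 * p) * (LINT y|lborel. f' z y)) (at z)"
    unfolding A2E_def .
  have I: "(LINT y|lborel. f' z y) = of_real (2 * pi * p) * (of_real n1 * (LINT y|lborel. sgn2 y * L1 z y) + of_real n2 * (LINT y|lborel. sgn2 y * L2 z y))"
    unfolding f'_def using ints[of z] by simp
  have c: "sqrt 3 * p * (2 * pi * p) * (sqrt (1 / (2 * p)) / (pi * p)) = sqrt (6 * p)"
  proof -
    have "sqrt (6 * p) = sqrt 3 * (sqrt (2 * p))" by (simp flip: real_sqrt_mult)
    moreover have "2 * p * sqrt (1 / (2 * p)) = sqrt (2 * p)"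
      using p by (simp add: real_sqrt_divide real_div_sqrt)
    ultimately show ?thesis using p by (simp add: field_simps)
  qed
  have "of_real (sqrt 3 * p) * (LINT y|lborel. f' z y) = of_real (sqrt 3 * p * (2 * pi * p) * (sqrt (1 / (2 * p)) / (pi * p))) *
     (of_real n1 * (exp (- of_real (3/2 * pi * p) * (z * of_real n1)\<^sup>2) * cerf (of_real (sqrt (2 * pi * p)) * (z * of_real n2 - z * of_real n1 / 2))) +
      of_real n2 * (exp (- of_real (3/2 * pi * p) * (z * of_real n2)\<^sup>2) * cerf (of_real (sqrt (2 * pi * p)) * (z * of_real n1 - z * of_real n2 / 2))))"
  proof -
    have r: "a * (b * (m1 * (k * X1) + m2 * (k * X2))) = (a * b * k) * (m1 * X1 + m2 * X2)" for a b m1 m2 k X1 X2 :: complex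
      by (simp add: algebra_simps)
    show ?thesis
      unfolding I L1_def L2_def integral_sgn2_lin1[OF p] integral_sgn2_lin2[OF p] r of_real_mult of_nat_mult of_nat_numeral ..
  qed
  with D show ?thesis unfolding c by simp
qed

lemma integral_gauss_complex:
  assumes "a > 0"
  shows "(LINT x|lborel. exp (- of_real a * (of_real x - of_real \<mu>)\<^sup>2) :: complex) = of_real (sqrt (pi / a))"
proof -
  have "(LINT x|lborel. complex_of_real (exp (- a * (x - \<mu>)\<^sup>2))) = of_real (sqrt (pi / a))"
    using has_bochner_integral_gauss[OF assms, of \<mu>] unfolding has_bochner_integral_iff integral_complex_of_real by simp
  moreover have eq: "complex_of_real (exp (- a * (x - \<mu>)\<^sup>2)) = exp (- of_real a * (of_real x - of_real \<mu>)\<^sup>2)" for x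
    by (simp flip: exp_of_real)
  ultimately show ?thesis by (simp only: eq)
qed

lemma integral_gauss2_real:
  assumes p: "p > 0"
  shows "(LINT y|lborel. gauss2 p (of_real c1) (of_real c2) y) = of_real (1 / (sqrt 3 * p))"
proof -
  have i: "integrable lborel (\<lambda>y. gauss2 p (of_real c1) (of_real c2) y)"
    using integrable_gauss2[OF p, of "\<lambda>_. 1" "of_real c1" "of_real c2"] by simp
  have inner: "(LINT a|lborel. gauss2 p (of_real c1) (of_real c2) (a, b)) = exp (- of_real (3/2 * pi * p) * (of_real b - of_real c2)\<^sup>2) * of_real (sqrt (pi / (2 * pi * p)))" for b
  proof -
    have c: "of_real c1 + (of_real b - of_real c2) / 2 = complex_of_real (c1 + (b - c2) / 2)" by simp
    show ?thesis
      unfolding gauss2_split c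
      by (simp only: Bochner_Integration.integral_mult_right_zero) (subst integral_gauss_complex; use p in simp)
  qed
  have "(LINT y|lborel. gauss2 p (of_real c1) (of_real c2) y) = (LINT b|lborel. exp (- of_real (3/2 * pi * p) * (of_real b - of_real c2)\<^sup>2)) * of_real (sqrt (pi / (2 * pi * p)))"
    unfolding integral2_iter(1)[OF i] inner by (simp only: Bochner_Integration.integral_mult_left_zero)
  also have "\<dots> = of_real (sqrt (pi / (3/2 * pi * p)) * sqrt (pi / (2 * pi * p)))"
    using p by (subst integral_gauss_complex) auto
  also have "sqrt (pi / (3/2 * pi * p)) * sqrt (pi / (2 * pi * p)) = 1 / (sqrt 3 * p)"
  proof -
    have "sqrt (pi / (3/2 * pi * p)) * sqrt (pi / (2 * pi * p)) = sqrt ((2 / (3 * p)) * (1 / (2 * p)))"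
      using p by (simp flip: real_sqrt_mult)
    also have "(2 / (3 * p)) * (1 / (2 * p)) = 1 / (3 * real p ^ 2)" using p by (simp add: power2_eq_square)
    also have "sqrt (1 / (3 * real p ^ 2)) = 1 / (sqrt 3 * p)" by (simp add: real_sqrt_divide real_sqrt_mult)
    finally show ?thesis .
  qed
  finally show ?thesis .
qed

text \<open>$(a, b) \mapsto (a - b, a)$ is an isometry of order six of the $A_2$ form.\<close>

lemma gauss2_rotate: "gauss2 p 0 0 (a, b) = gauss2 p 0 0 (a - b, a)"
  unfolding gauss2_def qc_def by (rule arg_cong[where f = exp]) (simp add: power2_eq_square algebra_simps)

lemma measurable_rotate:
  assumes "F \<in> borel_measurable borel"
  shows "(\<lambda>y::real\<times>real. F (fst y - snd y, fst y)) \<in> borel_measurable borel"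
  by (rule measurable_compose[OF borel_measurable_continuous_onI assms]) (intro continuous_intros)

lemma integral_rotate:
  assumes p: "p > 0" and m: "F \<in> borel_measurable borel" and F: "\<And>y. norm (F y) \<le> 1"
  shows "(LINT y|lborel. F y * gauss2 p 0 0 y) = (LINT y|lborel. F (fst y - snd y, fst y) * gauss2 p 0 0 y)"
proof -
  have i1: "integrable lborel (\<lambda>y. F y * gauss2 p 0 0 y)" by (rule integrable_gauss2[OF p m F])
  have i2: "integrable lborel (\<lambda>y. F (fst y - snd y, fst y) * gauss2 p 0 0 y)"
    by (rule integrable_gauss2[OF p measurable_rotate[OF m] F])
  have "(LINT b|lborel. F (a - b, a) * gauss2 p 0 0 (a, b)) = (LINT v|lborel. F (v, a) * gauss2 p 0 0 (v, a))" for a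
  proof -
    have "(LINT v|lborel. F (v, a) * gauss2 p 0 0 (v, a)) = \<bar>- 1\<bar> *\<^sub>R (LINT b|lborel. F (a + - 1 * b, a) * gauss2 p 0 0 (a + - 1 * b, a))"
      by (rule lborel_integral_real_affine) simp
    then show ?thesis using gauss2_rotate[of p a] by simp
  qed
  then show ?thesis
    unfolding integral2_iter(1)[OF i1] integral2_iter(2)[OF i2] by simp
qed

text \<open>Three rotated copies of the sign product add up to $1$ almost everywhere, because the two
coordinate lines and their images cut the plane into six congruent sectors. Hence the integral
is a third of the full Gaussian integral. This is where the $\frac13$ of the theorem comes from.\<close>

lemma integral_sgn2_gauss2_0:
  assumes p: "p > 0"
  shows "(LINT y|lborel. sgn2 y * gauss2 p 0 0 y) = of_real (1 / (3 * (sqrt 3 * p)))"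
proof -
  define K1 where "K1 = (\<lambda>y::real\<times>real. sgn2 (fst y - snd y, fst y))"
  define K2 where "K2 = (\<lambda>y::real\<times>real. K1 (fst y - snd y, fst y))"
  have m: "K1 \<in> borel_measurable borel" "K2 \<in> borel_measurable borel"
    unfolding K1_def K2_def by (intro measurable_rotate sgn2_measurable)+
  have n: "norm (K1 y) \<le> 1" "norm (K2 y) \<le> 1" for y
    unfolding K1_def K2_def by (rule norm_sgn2_le)+
  have 1: "(LINT y|lborel. sgn2 y * gauss2 p 0 0 y) = (LINT y|lborel. K1 y * gauss2 p 0 0 y)"
    unfolding K1_def by (rule integral_rotate[OF p sgn2_measurable norm_sgn2_le])
  have 2: "(LINT y|lborel. K1 y * gauss2 p 0 0 y) = (LINT y|lborel. K2 y * gauss2 p 0 0 y)"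
    unfolding K2_def by (rule integral_rotate[OF p m(1) n(1)])
  \<comment> \<open>At a point on one of the lines two of the three products vanish and the third is $1$.\<close>
  have one: "sgn2 y + K1 y + K2 y = 1" if "y \<noteq> 0" for y
  proof -
    obtain a b where y: "y = (a, b)" by (cases y)
    have "sgn a * sgn b + sgn (a - b) * sgn a + sgn (- b) * sgn (a - b) = 1"
      using that unfolding y by (auto simp: sgn_if zero_prod_def)
    then have "complex_of_real (sgn a * sgn b + sgn (a - b) * sgn a + sgn (- b) * sgn (a - b)) = of_real 1" by (rule arg_cong)
    then show ?thesis unfolding y K2_def K1_def sgn2_def by simp
  qed
  have "(LINT y|lborel. sgn2 y * gauss2 p 0 0 y) + (LINT y|lborel. K1 y * gauss2 p 0 0 y) + (LINT y|lborel. K2 y * gauss2 p 0 0 y)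
     = (LINT y|lborel. sgn2 y * gauss2 p 0 0 y + K1 y * gauss2 p 0 0 y + K2 y * gauss2 p 0 0 y)"
    by (simp add: integrable_gauss2[OF p] sgn2_measurable norm_sgn2_le m n)
  also have "\<dots> = (LINT y|lborel. gauss2 p 0 0 y)"
  proof (rule integral_cong_AE)
    show "AE y in lborel. sgn2 y * gauss2 p 0 0 y + K1 y * gauss2 p 0 0 y + K2 y * gauss2 p 0 0 y = gauss2 p 0 0 y"
      using AE_lborel_singleton[of 0] by eventually_elim (simp add: one flip: distrib_right)
  qed (use m in measurable)
  also have "\<dots> = of_real (1 / (sqrt 3 * p))" using integral_gauss2_real[OF p, of 0 0] by simp
  finally have "3 * (LINT y|lborel. sgn2 y * gauss2 p 0 0 y) = of_real (1 / (sqrt 3 * p))"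
    unfolding 2[symmetric] 1[symmetric] by simp
  note three = this
  have "X = Y / 3" if "3 * X = Y" for X Y :: complex using that by auto
  from this[OF three] have "(LINT y|lborel. sgn2 y * gauss2 p 0 0 y) = of_real (1 / (sqrt 3 * p)) / 3" .
  then show ?thesis by simp
qed

lemma A2E_0: "p > 0 \<Longrightarrow> A2E p n1 n2 0 = 1 / 3"
  unfolding A2E_def by (simp add: integral_sgn2_gauss2_0)

lemma integral_sgn_fst:
  assumes p: "p > 0"
  shows "(LINT y|lborel. of_real (sgn (fst y)) * gauss2 p 0 0 y) = 0" "(LINT y|lborel. of_real (sgn (snd y)) * gauss2 p 0 0 y) = 0"
proof -
  have odd: "(LINT y|lborel. F y * gauss2 p 0 0 y) = 0"
    if m: "F \<in> borel_measurable borel" and F: "\<And>y. norm (F y) \<le> 1" and odd: "\<And>y. F (- fst y, - snd y) = - F y" for F :: "real \<times> real \<Rightarrow> complex"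
  proof -
    have "(LINT y|lborel. F y * gauss2 p 0 0 y) = (LINT y|lborel. F (fst y - snd y, fst y) * gauss2 p 0 0 y)"
      by (rule integral_rotate[OF p m F])
    also have "\<dots> = (LINT y|lborel. F (fst y - snd y - fst y, fst y - snd y) * gauss2 p 0 0 y)"
      using integral_rotate[OF p measurable_rotate[OF m] F] by simp
    also have "\<dots> = (LINT y|lborel. F (fst y - snd y - fst y - (fst y - snd y), fst y - snd y - fst y) * gauss2 p 0 0 y)"
      using integral_rotate[OF p measurable_rotate[OF measurable_rotate[OF m]] F] by simp
    also have "\<dots> = (LINT y|lborel. - (F y * gauss2 p 0 0 y))"
      by (intro Bochner_Integration.integral_cong refl) (simp add: odd)
    finally show ?thesis by simp
  qed
  have mf: "(\<lambda>y::real\<times>real. complex_of_real (sgn (fst y))) \<in> borel_measurable borel"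
    "(\<lambda>y::real\<times>real. complex_of_real (sgn (snd y))) \<in> borel_measurable borel"
  proof -
    have "(\<lambda>y::real\<times>real. complex_of_real (sgn (fst y))) \<in> borel_measurable (borel \<Otimes>\<^sub>M borel)"
      "(\<lambda>y::real\<times>real. complex_of_real (sgn (snd y))) \<in> borel_measurable (borel \<Otimes>\<^sub>M borel)" by measurable
    then show "(\<lambda>y::real\<times>real. complex_of_real (sgn (fst y))) \<in> borel_measurable borel"
    "(\<lambda>y::real\<times>real. complex_of_real (sgn (snd y))) \<in> borel_measurable borel" by (simp_all add: borel_prod)
  qed
  show "(LINT y|lborel. of_real (sgn (fst y)) * gauss2 p 0 0 y) = 0"
    by (rule odd[OF mf(1)]) (auto simp: sgn_if)
  show "(LINT y|lborel. of_real (sgn (snd y)) * gauss2 p 0 0 y) = 0"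
    by (rule odd[OF mf(2)]) (auto simp: sgn_if)
qed

lemma norm_gauss2_real: "complex_of_real (norm (gauss2 p (of_real c1) (of_real c2) y)) = gauss2 p (of_real c1) (of_real c2) y"
proof -
  have "gauss2 p (of_real c1) (of_real c2) y = of_real (exp (- 2 * pi * p * ((fst y - c1)\<^sup>2 + (snd y - c2)\<^sup>2 - (fst y - c1) * (snd y - c2))))"
    by (simp add: gauss2_def qc_def flip: exp_of_real)
  then show ?thesis by simp
qed

lemma norm_A2E_real_le:
  assumes p: "p > 0"
  shows "norm (A2E p n1 n2 (of_real t)) \<le> 1"
proof -
  let ?g = "gauss2 p (of_real t * of_real n1) (of_real t * of_real n2)"
  have i: "integrable lborel ?g" using integrable_gauss2[OF p, of "\<lambda>_. 1"] by simp
  have "complex_of_real (LINT y|lborel. norm (?g y)) = (LINT y|lborel. complex_of_real (norm (?g y)))"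
    by (rule integral_complex_of_real[symmetric])
  also have "\<dots> = of_real (1 / (sqrt 3 * p))"
    using integral_gauss2_real[OF p, of "t * n1" "t * n2"] norm_gauss2_real[of p "t * n1" "t * n2"] by simp
  finally have n: "(LINT y|lborel. norm (?g y)) = 1 / (sqrt 3 * p)" using of_real_eq_iff by blast
  have "norm (LINT y|lborel. sgn2 y * ?g y) \<le> (LINT y|lborel. norm (?g y))"
  proof (rule order_trans[OF integral_norm_bound integral_mono])
    show "integrable lborel (\<lambda>y. norm (sgn2 y * ?g y))"
      by (intro integrable_norm integrable_gauss2 p sgn2_measurable norm_sgn2_le)
    show "norm (sgn2 y * ?g y) \<le> norm (?g y)" for y
      unfolding norm_mult using norm_sgn2_le[of y] by (simp add: mult_left_le_one_le)
  qed (intro integrable_norm i)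
  then have "sqrt 3 * p * norm (LINT y|lborel. sgn2 y * ?g y) \<le> sqrt 3 * p * (1 / (sqrt 3 * p))"
    unfolding n by (intro mult_left_mono) auto
  also have "\<dots> = 1" using p by simp
  finally show ?thesis unfolding A2E_def norm_mult norm_of_real by simp
qed

text \<open>At real arguments translation invariance moves the shift into the signs, which are bounded. So the
function is bounded by $1$ and its limit is found under the integral.\<close>

lemma A2E_shift:
  assumes p: "p > 0"
  shows "A2E p n1 n2 (of_real t) = of_real (sqrt 3 * p) * (LINT y|lborel. sgn2 (fst y + t * n1, snd y + t * n2) * gauss2 p 0 0 y)"
proof -
  let ?f = "\<lambda>y. sgn2 y * gauss2 p (of_real t * of_real n1) (of_real t * of_real n2) y"
  have m: "?f \<in> borel_measurable borel" by measurable
  have "(LINT y|lborel. ?f y) = (LINT y|distr lborel borel ((+) (t * n1, t * n2)). ?f y)"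
    unfolding lborel_distr_plus ..
  also have "\<dots> = (LINT y|lborel. ?f ((t * n1, t * n2) + y))"
    by (rule integral_distr) (use m in auto)
  also have "\<dots> = (LINT y|lborel. sgn2 (fst y + t * n1, snd y + t * n2) * gauss2 p 0 0 y)"
    by (intro Bochner_Integration.integral_cong refl) (simp add: sgn2_def gauss2_def add_ac)
  finally show ?thesis unfolding A2E_def by simp
qed

text \<open>After the shift a nonvanishing coordinate determines the sign in the limit. If exactly one
coordinate vanishes, the remaining sign integrates to $0$, which agrees with $\mathrm{sgn}(0) = 0$; if
both vanish, the value is the one at $0$.\<close>

lemma tendsto_A2E:
  assumes p: "p > 0"
  shows "((\<lambda>t. A2E p n1 n2 (of_real (sqrt t))) \<longlongrightarrow> (if n1 = 0 \<and> n2 = 0 then 1 / 3 else of_real (sgn n1 * sgn n2))) at_top"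
proof -
  define s where "s = (\<lambda>n y::real. if n = 0 then sgn y else sgn n :: real)"
  have "((\<lambda>t. LINT y|lborel. sgn2 (fst y + sqrt t * n1, snd y + sqrt t * n2) * gauss2 p 0 0 y) \<longlongrightarrow>
     (LINT y|lborel. of_real (s n1 (fst y) * s n2 (snd y)) * gauss2 p 0 0 y)) at_top"
  proof (rule integral_dominated_convergence_at_top[where w = "\<lambda>y. norm (gauss2 p 0 0 y)"])
    show "integrable lborel (\<lambda>y. norm (gauss2 p 0 0 y))"
      using integrable_gauss2[OF p, of "\<lambda>_. 1" 0 0] by simp
    show "AE y in lborel. ((\<lambda>t. sgn2 (fst y + sqrt t * n1, snd y + sqrt t * n2) * gauss2 p 0 0 y) \<longlongrightarrow> of_real (s n1 (fst y) * s n2 (snd y)) * gauss2 p 0 0 y) at_top"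
      unfolding sgn2_def fst_conv snd_conv s_def
      by (intro AE_I2 tendsto_mult tendsto_of_real tendsto_const tendsto_sgn_shift)
    show "\<forall>\<^sub>F t in at_top. AE y in lborel. norm (sgn2 (fst y + sqrt t * n1, snd y + sqrt t * n2) * gauss2 p 0 0 y) \<le> norm (gauss2 p 0 0 y)"
      unfolding norm_mult by (intro always_eventually allI AE_I2 mult_left_le_one_le norm_sgn2_le) auto
    have s_meas: "s n \<in> borel_measurable borel" for n
      unfolding s_def by (cases "n = 0") auto
    have "(\<lambda>y. complex_of_real (s n1 (fst y) * s n2 (snd y))) \<in> borel_measurable (borel \<Otimes>\<^sub>M borel)"
      using s_meas[of n1] s_meas[of n2] by measurable
    then have "(\<lambda>y. complex_of_real (s n1 (fst y) * s n2 (snd y))) \<in> borel_measurable borel"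
      by (simp add: borel_prod)
    then show "(\<lambda>y. of_real (s n1 (fst y) * s n2 (snd y)) * gauss2 p 0 0 y) \<in> borel_measurable lborel"
      by measurable
    show "(\<lambda>y. sgn2 (fst y + sqrt t * n1, snd y + sqrt t * n2) * gauss2 p 0 0 y) \<in> borel_measurable lborel" for t
    proof -
      have "(\<lambda>y::real\<times>real. sgn2 (fst y + sqrt t * n1, snd y + sqrt t * n2)) \<in> borel_measurable borel"
        by (rule measurable_compose[OF borel_measurable_continuous_onI sgn2_measurable]) (intro continuous_intros)
      then show ?thesis by measurable
    qed
  qed
  then have L: "((\<lambda>t. A2E p n1 n2 (of_real (sqrt t))) \<longlongrightarrow> of_real (sqrt 3 * p) * (LINT y|lborel. of_real (s n1 (fst y) * s n2 (snd y)) * gauss2 p 0 0 y)) at_top"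
    unfolding A2E_shift[OF p] by (intro tendsto_mult tendsto_const)
  have "of_real (sqrt 3 * p) * (LINT y|lborel. of_real (s n1 (fst y) * s n2 (snd y)) * gauss2 p 0 0 y) = (if n1 = 0 \<and> n2 = 0 then 1 / 3 else of_real (sgn n1 * sgn n2))"
  proof (cases "n1 = 0"; cases "n2 = 0")
    assume n: "n1 = 0" "n2 = 0"
    then show ?thesis using integral_sgn2_gauss2_0[OF p] p unfolding s_def sgn2_def by simp
  next
    assume n: "n1 = 0" "n2 \<noteq> 0"
    then have "of_real (s n1 (fst y) * s n2 (snd y)) * gauss2 p 0 0 y = of_real (sgn n2) * (of_real (sgn (fst y)) * gauss2 p 0 0 y)" for y
      by (simp add: s_def)
    then show ?thesis using integral_sgn_fst(1)[OF p] n by (simp only: Bochner_Integration.integral_mult_right_zero) simp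
  next
    assume n: "n1 \<noteq> 0" "n2 = 0"
    then have "of_real (s n1 (fst y) * s n2 (snd y)) * gauss2 p 0 0 y = of_real (sgn n1) * (of_real (sgn (snd y)) * gauss2 p 0 0 y)" for y
      by (simp add: s_def)
    then show ?thesis using integral_sgn_fst(2)[OF p] n by (simp only: Bochner_Integration.integral_mult_right_zero) simp
  next
    assume n: "n1 \<noteq> 0" "n2 \<noteq> 0"
    then have "of_real (s n1 (fst y) * s n2 (snd y)) * gauss2 p 0 0 y = of_real (sgn n1 * sgn n2) * gauss2 p 0 0 y" for y
      by (simp add: s_def)
    then show ?thesis using integral_gauss2_real[OF p, of 0 0] n p by (simp only: Bochner_Integration.integral_mult_right_zero) simp
  qed
  with L show ?thesis by simp
qed

section \<open>The error function of $A_2$ as a function of the squared argument\<close>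

text \<open>The derivative of the error function with respect to $x = -z^2$, obtained from
\<open>A2E_has_field_derivative\<close> by the substitution $\mathrm{erf}(z) = \frac{2}{\sqrt\pi}\, z\,\mathrm{eg}(-z^2)$.\<close>

definition A2D :: "nat \<Rightarrow> real \<Rightarrow> real \<Rightarrow> complex \<Rightarrow> complex" where
  "A2D p n1 n2 x = - of_real (2 * sqrt 3 * p) *
     (of_real (n1 * (n2 - n1 / 2)) * (exp (of_real (3/2 * pi * p * n1\<^sup>2) * x) * eg (of_real (2 * pi * p * (n2 - n1 / 2)\<^sup>2) * x)) +
      of_real (n2 * (n1 - n2 / 2)) * (exp (of_real (3/2 * pi * p * n2\<^sup>2) * x) * eg (of_real (2 * pi * p * (n1 - n2 / 2)\<^sup>2) * x)))"

lemma A2D_holomorphic: "A2D p n1 n2 holomorphic_on S"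
  unfolding A2D_def[abs_def] by (intro holomorphic_intros eg_compose_holomorphic)

text \<open>\<open>G\<close> is the primitive of the entire function \<open>A2D\<close> with the right value at $0$. Both functions of \<open>z\<close>
have the same derivative.\<close>

lemma A2E_even:
  assumes p: "p > 0"
  obtains G where "\<And>x. (G has_field_derivative A2D p n1 n2 x) (at x)" "\<And>z. A2E p n1 n2 z = G (- (z\<^sup>2))"
proof -
  obtain G0 where G0: "\<And>x. (G0 has_field_derivative A2D p n1 n2 x) (at x)"
    using holomorphic_convex_primitive'[OF _ _ A2D_holomorphic[of p n1 n2 UNIV]] by auto
  define G where "G = (\<lambda>x. G0 x - G0 0 + 1 / 3)"
  have G: "(G has_field_derivative A2D p n1 n2 x) (at x)" for x
    unfolding G_def using DERIV_add[OF DERIV_diff[OF G0[of x] DERIV_const[of "G0 0"]] DERIV_const[of "1/3"]] by simp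
  have cst: "of_real (sqrt (6 * p)) * (2 / of_real (sqrt pi)) * of_real (sqrt (2 * pi * p)) = (of_real (4 * sqrt 3 * p) :: complex)"
  proof -
    have "sqrt (6 * p) * (2 / sqrt pi) * sqrt (2 * pi * p) = 2 * (sqrt (6 * p) * sqrt (2 * p))"
      by (simp add: real_sqrt_mult)
    also have "sqrt (6 * p) * sqrt (2 * p) = sqrt 3 * (sqrt (2 * p) * sqrt (2 * p))"
      by (simp add: real_sqrt_mult[of 3 "2 * p", simplified])
    also have "\<dots> = sqrt 3 * (2 * p)" by simp
    finally have "sqrt (6 * p) * (2 / sqrt pi) * sqrt (2 * pi * p) = 4 * sqrt 3 * p" by simp
    then have "complex_of_real (sqrt (6 * p) * (2 / sqrt pi) * sqrt (2 * pi * p)) = of_real (4 * sqrt 3 * p)" by (rule arg_cong)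
    then show ?thesis by simp
  qed
  have DE: "(A2E p n1 n2 has_field_derivative A2D p n1 n2 (- (z\<^sup>2)) * - (2 * z)) (at z)" for z
  proof -
    have c: "cerf (of_real (sqrt (2 * pi * p)) * (z * of_real b - z * of_real a / 2)) =
       2 / of_real (sqrt pi) * of_real (sqrt (2 * pi * p)) * (z * of_real (b - a / 2)) * eg (of_real (2 * pi * p * (b - a / 2)\<^sup>2) * - (z\<^sup>2))" for a b :: real
    proof -
      have r: "(complex_of_real (sqrt (2 * pi * p)))\<^sup>2 = of_real (2 * pi * p)"
        by (simp flip: of_real_power)
      have z: "z * of_real b - z * of_real a / 2 = z * of_real (b - a / 2)" by (simp add: field_simps)
      have sq: "- ((of_real (sqrt (2 * pi * p)) * (z * of_real (b - a / 2)))\<^sup>2) = of_real (2 * pi * p * (b - a / 2)\<^sup>2) * - (z\<^sup>2)"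
        unfolding power_mult_distrib r by (simp add: mult_ac)
      show ?thesis unfolding z cerf_eq_eg sq by (simp only: mult_ac)
    qed
    have e: "exp (- of_real (3/2 * pi * p) * (z * of_real a)\<^sup>2) = exp (of_real (3/2 * pi * p * a\<^sup>2) * - (z\<^sup>2))" for a :: real
      by (rule arg_cong[where f = exp]) (simp add: power_mult_distrib)
    have r: "K * (a * (E * (k * s * (z * m) * F)) + b * (E' * (k * s * (z * m') * F'))) = (K * k * s) * z * ((a * m) * (E * F) + (b * m') * (E' * F'))"
      for K a b E F E' F' k s m m' :: complex by (simp add: algebra_simps)
    have r2: "of_real (4 * sqrt 3 * p) * z * X = (- of_real (2 * sqrt 3 * p) * X) * - (2 * z)" for X by simp
    show ?thesis
      using A2E_has_field_derivative[OF p, of n1 n2 z] unfolding c e r cst r2 A2D_def of_real_mult[of n1] of_real_mult[of n2] .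
  qed
  have DG: "((\<lambda>z. G (- (z\<^sup>2))) has_field_derivative A2D p n1 n2 (- (z\<^sup>2)) * - (2 * z)) (at z)" for z
    by (rule DERIV_chain2[where f = G, OF G]) (auto intro!: derivative_eq_intros)
  have "((\<lambda>z. A2E p n1 n2 z - G (- (z\<^sup>2))) has_field_derivative 0) (at z within UNIV)" for z
    using DERIV_diff[OF DE DG] by simp
  then obtain k where k: "\<And>z. z \<in> UNIV \<Longrightarrow> A2E p n1 n2 z - G (- (z\<^sup>2)) = k"
    using has_field_derivative_zero_constant[OF convex_UNIV, of "\<lambda>z. A2E p n1 n2 z - G (- (z\<^sup>2))"] by blast
  have "A2E p n1 n2 0 = G (- (0\<^sup>2))" by (simp add: A2E_0[OF p] G_def)
  then have "A2E p n1 n2 z = G (- (z\<^sup>2))" for z using k[of 0] k[of z] by simp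
  with G show ?thesis by (rule that)
qed

text \<open>At $x = i(w-\tau)$ this is the coefficient in the definition of \<open>psihat_A2\<close>. The choice of the square
root does not matter since \<open>A2E\<close> is even.\<close>

definition gE :: "nat \<Rightarrow> real \<Rightarrow> real \<Rightarrow> complex \<Rightarrow> complex" where
  "gE p n1 n2 x = A2E p n1 n2 (- \<i> * csqrt x)"

lemma gE_has_field_derivative:
  assumes p: "p > 0"
  shows "(gE p n1 n2 has_field_derivative A2D p n1 n2 x) (at x)" and "gE p n1 n2 0 = 1 / 3"
proof -
  obtain G where G: "\<And>x. (G has_field_derivative A2D p n1 n2 x) (at x)" "\<And>z. A2E p n1 n2 z = G (- (z\<^sup>2))"
    using A2E_even[OF p, of n1 n2] by metis
  have "gE p n1 n2 x = G x" for x unfolding gE_def G(2) by (simp add: power_mult_distrib)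
  then have "gE p n1 n2 = G" by (rule ext)
  then show "(gE p n1 n2 has_field_derivative A2D p n1 n2 x) (at x)" using G(1) by simp
  show "gE p n1 n2 0 = 1 / 3" by (simp add: gE_def A2E_0[OF p])
qed

definition Qr :: "real \<Rightarrow> real \<Rightarrow> real" where "Qr a b = a\<^sup>2 + b\<^sup>2 - a * b"

lemma norm_A2D_le:
  assumes "Re x \<le> M" "0 \<le> M"
  shows "norm (A2D p n1 n2 x) \<le> 4 * sqrt 3 * p * (\<bar>n1\<bar> + \<bar>n2\<bar>)\<^sup>2 * exp (2 * pi * p * Qr n1 n2 * M)"
proof -
  have t: "norm (of_real (a * (b - a / 2)) * (exp (of_real (3/2 * pi * p * a\<^sup>2) * x) * eg (of_real (2 * pi * p * (b - a / 2)\<^sup>2) * x)))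
     \<le> (\<bar>a\<bar> + \<bar>b\<bar>)\<^sup>2 * exp (2 * pi * p * Qr a b * M)" for a b :: real
  proof -
    have "norm (exp (of_real (3/2 * pi * p * a\<^sup>2) * x)) \<le> exp (3/2 * pi * p * a\<^sup>2 * M)"
      using mult_left_mono[OF assms(1), of "3/2 * pi * p * a\<^sup>2"] by simp
    moreover have "norm (eg (of_real (2 * pi * p * (b - a / 2)\<^sup>2) * x)) \<le> exp (2 * pi * p * (b - a / 2)\<^sup>2 * M)"
    proof (rule order_trans[OF norm_eg_le])
      have "2 * pi * p * (b - a / 2)\<^sup>2 * Re x \<le> 2 * pi * p * (b - a / 2)\<^sup>2 * M"
        using assms by (intro mult_left_mono) auto
      moreover have "0 \<le> 2 * pi * p * (b - a / 2)\<^sup>2 * M" using assms by simp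
      ultimately show "exp (max 0 (Re (of_real (2 * pi * p * (b - a / 2)\<^sup>2) * x))) \<le> exp (2 * pi * p * (b - a / 2)\<^sup>2 * M)"
        by simp
    qed
    ultimately have "norm (exp (of_real (3/2 * pi * p * a\<^sup>2) * x)) * norm (eg (of_real (2 * pi * p * (b - a / 2)\<^sup>2) * x)) \<le>
       exp (3/2 * pi * p * a\<^sup>2 * M) * exp (2 * pi * p * (b - a / 2)\<^sup>2 * M)"
      by (intro mult_mono) auto
    also have "\<dots> = exp (2 * pi * p * Qr a b * M)"
      unfolding exp_add[symmetric] by (rule arg_cong[where f = exp]) (simp add: Qr_def power2_eq_square field_simps)
    finally have e: "norm (exp (of_real (3/2 * pi * p * a\<^sup>2) * x)) * norm (eg (of_real (2 * pi * p * (b - a / 2)\<^sup>2) * x)) \<le> exp (2 * pi * p * Qr a b * M)" .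
    have "\<bar>a * (b - a / 2)\<bar> = \<bar>a\<bar> * \<bar>b - a / 2\<bar>" by (rule abs_mult)
    also have "\<dots> \<le> (\<bar>a\<bar> + \<bar>b\<bar>) * (\<bar>a\<bar> + \<bar>b\<bar>)" by (intro mult_mono) auto
    finally have "\<bar>a * (b - a / 2)\<bar> \<le> (\<bar>a\<bar> + \<bar>b\<bar>)\<^sup>2" by (simp add: power2_eq_square)
    with e show ?thesis unfolding norm_mult norm_of_real by (intro mult_mono) auto
  qed
  have "norm (A2D p n1 n2 x) \<le> 2 * sqrt 3 * p * ((\<bar>n1\<bar> + \<bar>n2\<bar>)\<^sup>2 * exp (2 * pi * p * Qr n1 n2 * M) + (\<bar>n2\<bar> + \<bar>n1\<bar>)\<^sup>2 * exp (2 * pi * p * Qr n2 n1 * M))"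
    unfolding A2D_def norm_mult[of "- of_real (2 * sqrt 3 * p)"] norm_minus_cancel norm_of_real
    by (intro mult_mono order_trans[OF norm_triangle_ineq] add_mono t) auto
  also have "\<dots> = 4 * sqrt 3 * p * (\<bar>n1\<bar> + \<bar>n2\<bar>)\<^sup>2 * exp (2 * pi * p * Qr n1 n2 * M)"
    by (simp add: Qr_def algebra_simps)
  finally show ?thesis .
qed

text \<open>Integrating the bound for the derivative along the segment from $0$, which stays in the half-plane
$\mathrm{Re} \le \max(0, \mathrm{Re}\, x)$.\<close>

lemma norm_gE_le:
  assumes p: "p > 0"
  shows "norm (gE p n1 n2 x) \<le> 1 / 3 + norm x * (4 * sqrt 3 * p * (\<bar>n1\<bar> + \<bar>n2\<bar>)\<^sup>2 * exp (2 * pi * p * Qr n1 n2 * max 0 (Re x)))"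
proof -
  let ?M = "max 0 (Re x)"
  have "norm (gE p n1 n2 x - gE p n1 n2 0) \<le> (4 * sqrt 3 * p * (\<bar>n1\<bar> + \<bar>n2\<bar>)\<^sup>2 * exp (2 * pi * p * Qr n1 n2 * ?M)) * norm (x - 0)"
  proof (rule field_differentiable_bound[where S = "{z. Re z \<le> ?M}"])
    show "convex {z. Re z \<le> ?M}" by (rule convex_halfspace_Re_le)
    show "(gE p n1 n2 has_field_derivative A2D p n1 n2 z) (at z within {z. Re z \<le> ?M})" for z
      by (rule has_field_derivative_at_within[OF gE_has_field_derivative(1)[OF p]])
    show "norm (A2D p n1 n2 z) \<le> 4 * sqrt 3 * p * (\<bar>n1\<bar> + \<bar>n2\<bar>)\<^sup>2 * exp (2 * pi * p * Qr n1 n2 * ?M)" if "z \<in> {z. Re z \<le> ?M}" for z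
      using that by (intro norm_A2D_le) auto
  qed auto
  then have "norm (gE p n1 n2 x - 1 / 3) \<le> norm x * (4 * sqrt 3 * p * (\<bar>n1\<bar> + \<bar>n2\<bar>)\<^sup>2 * exp (2 * pi * p * Qr n1 n2 * ?M))"
    by (simp add: gE_has_field_derivative(2)[OF p] mult_ac)
  moreover have "norm (gE p n1 n2 x) \<le> norm (1 / 3 :: complex) + norm (gE p n1 n2 x - 1 / 3)"
    using norm_triangle_ineq[of "1/3" "gE p n1 n2 x - 1/3"] by simp
  ultimately show ?thesis by simp
qed

section \<open>The completed series of $A_2$\<close>

lemma bij_betw_int2_coset:
  "bij_betw (\<lambda>q. vector [fst q, snd q] :: real^2) (int_coset (\<mu> $ 1) \<times> int_coset (\<mu> $ 2)) (int2_coset \<mu>)"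
  unfolding bij_betw_def
proof
  show "inj_on (\<lambda>q. vector [fst q, snd q] :: real^2) (int_coset (\<mu> $ 1) \<times> int_coset (\<mu> $ 2))"
    by (auto simp: inj_on_def vec_eq_iff forall_2 vector_2)
  have "x \<in> (\<lambda>q. vector [fst q, snd q] :: real^2) ` (int_coset (\<mu> $ 1) \<times> int_coset (\<mu> $ 2))" if "x \<in> int2_coset \<mu>" for x
  proof (rule image_eqI)
    show "x = vector [fst (x $ 1, x $ 2), snd (x $ 1, x $ 2)]" by (simp add: vec_eq_iff forall_2 vector_2)
    show "(x $ 1, x $ 2) \<in> int_coset (\<mu> $ 1) \<times> int_coset (\<mu> $ 2)"
      using that by (simp add: int2_coset_def int_coset_def)
  qed
  moreover have "(\<lambda>q. vector [fst q, snd q] :: real^2) ` (int_coset (\<mu> $ 1) \<times> int_coset (\<mu> $ 2)) \<subseteq> int2_coset \<mu>"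
    by (auto simp: int2_coset_def int_coset_def forall_2 vector_2)
  ultimately show "(\<lambda>q. vector [fst q, snd q] :: real^2) ` (int_coset (\<mu> $ 1) \<times> int_coset (\<mu> $ 2)) = int2_coset \<mu>"
    by auto
qed

lemma has_sum_product:
  fixes f :: "'a \<Rightarrow> 'c::{real_normed_field, banach}" and g :: "'b \<Rightarrow> 'c"
  assumes f: "(\<lambda>x. norm (f x)) summable_on A" and g: "(\<lambda>x. norm (g x)) summable_on B"
  shows "((\<lambda>q. f (fst q) * g (snd q)) has_sum (infsum f A * infsum g B)) (A \<times> B)"
    and "(\<lambda>q. norm (f (fst q) * g (snd q))) summable_on (A \<times> B)"
proof -
  have gs: "(g has_sum infsum g B) B" by (rule has_sum_infsum[OF abs_summable_summable[OF g]])
  have fs: "(f has_sum infsum f A) A" by (rule has_sum_infsum[OF abs_summable_summable[OF f]])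
  have "(\<lambda>q. norm (f (fst q) * g (snd q))) summable_on (Sigma A (\<lambda>_. B))"
  proof (rule summable_on_SigmaI)
    show "((\<lambda>y. norm (f (fst (x, y)) * g (snd (x, y)))) has_sum norm (f x) * infsum (\<lambda>x. norm (g x)) B) B" for x
      using has_sum_cmult_right[OF has_sum_infsum[OF g], of "norm (f x)"] by (simp add: norm_mult)
    show "(\<lambda>x. norm (f x) * infsum (\<lambda>x. norm (g x)) B) summable_on A"
      by (intro summable_on_cmult_left f)
  qed auto
  then show s: "(\<lambda>q. norm (f (fst q) * g (snd q))) summable_on (A \<times> B)" .
  show "((\<lambda>q. f (fst q) * g (snd q)) has_sum (infsum f A * infsum g B)) (A \<times> B)"
  proof (rule has_sum_SigmaI)
    show "((\<lambda>y. f (fst (x, y)) * g (snd (x, y))) has_sum f x * infsum g B) B" for x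
      using has_sum_cmult_right[OF gs, of "f x"] by simp
    show "((\<lambda>x. f x * infsum g B) has_sum infsum f A * infsum g B) A"
      by (rule has_sum_cmult_left[OF fs])
    show "(\<lambda>q. f (fst q) * g (snd q)) summable_on (A \<times> B)" by (rule abs_summable_summable[OF s])
  qed
qed

lemma summable_on_gauss_int2_coset:
  assumes c: "c > 0"
  shows "(\<lambda>n. exp (b * (\<bar>n $ 1\<bar> + \<bar>n $ 2\<bar>) - c * ((n $ 1)\<^sup>2 + (n $ 2)\<^sup>2))) summable_on int2_coset \<mu>"
proof -
  have "(\<lambda>q. norm (exp (b * \<bar>fst q\<bar> - c * (fst q)\<^sup>2) * exp (b * \<bar>snd q\<bar> - c * (snd q)\<^sup>2))) summable_on (int_coset (\<mu> $ 1) \<times> int_coset (\<mu> $ 2))"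
    by (rule has_sum_product(2)) (use summable_on_gauss_int_coset[OF c] in auto)
  also have "(\<lambda>q. norm (exp (b * \<bar>fst q\<bar> - c * (fst q)\<^sup>2) * exp (b * \<bar>snd q\<bar> - c * (snd q)\<^sup>2))) =
     (\<lambda>q. (\<lambda>n::real^2. exp (b * (\<bar>n $ 1\<bar> + \<bar>n $ 2\<bar>) - c * ((n $ 1)\<^sup>2 + (n $ 2)\<^sup>2))) (vector [fst q, snd q]))"
    by (rule ext) (simp add: vector_2 exp_add[symmetric] algebra_simps)
  finally show ?thesis
    by (rule summable_on_reindex_bij_betw[OF bij_betw_int2_coset[of \<mu>], THEN iffD1])
qed

lemma locally_dominated_uhp2_bounded:
  assumes "\<And>c R. c > 0 \<Longrightarrow> M c R summable_on A"
    and "\<And>c R n \<tau> w. c > 0 \<Longrightarrow> n \<in> A \<Longrightarrow> Im \<tau> > c \<Longrightarrow> Im w > c \<Longrightarrow> norm \<tau> < R \<Longrightarrow> norm w < R \<Longrightarrow> norm (f n (\<tau>, w)) \<le> M c R n"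
  shows "locally_dominated A (uhp \<times> uhp) f"
  unfolding locally_dominated_def
proof
  fix q assume q: "q \<in> uhp \<times> uhp"
  define c where "c = min (Im (fst q)) (Im (snd q)) / 2"
  define R where "R = norm (fst q) + norm (snd q) + 1"
  define U where "U = ({\<tau>. Im \<tau> > c} \<inter> ball 0 R) \<times> ({w. Im w > c} \<inter> ball 0 R)"
  have c: "c > 0" "c < Im (fst q)" "c < Im (snd q)" using q by (auto simp: c_def uhp_def)
  have "open U" unfolding U_def by (intro open_Times open_Int open_halfspace_Im_gt open_ball)
  moreover have "q \<in> U" using c by (simp add: U_def mem_Times_iff R_def add_pos_nonneg add_nonneg_pos)
  moreover have "\<forall>n\<in>A. \<forall>y\<in>U \<inter> uhp \<times> uhp. norm (f n y) \<le> M c R n"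
    using assms(2)[OF c(1)] by (auto simp: U_def)
  ultimately show "\<exists>U M. open U \<and> q \<in> U \<and> M summable_on A \<and> (\<forall>n\<in>A. \<forall>y\<in>U \<inter> uhp \<times> uhp. norm (f n y) \<le> M n)"
    using assms(1)[OF c(1), of R] by (intro exI[of _ U] exI[of _ "M c R"] conjI)
qed

lemma Qr_ge: "Qr a b \<ge> (a\<^sup>2 + b\<^sup>2) / 2"
  using zero_le_power2[of "a - b"] by (simp add: Qr_def power2_diff)

lemma Q2_eq: "Q2 n = Qr (n $ 1) (n $ 2)"
  by (simp add: quad_form_def A2_gram_def Qr_def sum_2 vector_2 power2_eq_square field_simps)

definition A2_term :: "nat \<Rightarrow> real^2 \<Rightarrow> complex \<Rightarrow> complex \<Rightarrow> complex" where
  "A2_term p n \<tau> w = gE p (n $ 1) (n $ 2) (\<i> * (w - \<tau>)) * qpow \<tau> (of_nat p * Q2 n)"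

lemma psihat_A2_eq:
  assumes "p > 0"
  shows "psihat_A2 p s \<tau> w = (\<Sum>\<^sub>\<infinity>n\<in>int2_coset (mu2 p s). A2_term p n \<tau> w)"
  unfolding psihat_A2_def A2_term_def gE_def A2E_def gen_error_A2[OF assms] by simp

lemma norm_qpow_Q2_le:
  assumes "Im \<tau> \<ge> c" "c > 0"
  shows "norm (qpow \<tau> (of_nat p * Q2 n)) \<le> exp (- (pi * p * c) * ((n $ 1)\<^sup>2 + (n $ 2)\<^sup>2))"
proof -
  have Q: "Q2 n \<ge> ((n $ 1)\<^sup>2 + (n $ 2)\<^sup>2) / 2" unfolding Q2_eq by (rule Qr_ge)
  have Q0: "Q2 n \<ge> 0" by (rule order_trans[OF _ Q]) simp
  have "2 * pi * p * (((n $ 1)\<^sup>2 + (n $ 2)\<^sup>2) / 2 * c) \<le> 2 * pi * p * (Q2 n * Im \<tau>)"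
    using assms Q Q0 by (intro mult_left_mono mult_mono) auto
  moreover have e1: "- (pi * p * c) * ((n $ 1)\<^sup>2 + (n $ 2)\<^sup>2) = - (2 * pi * p * (((n $ 1)\<^sup>2 + (n $ 2)\<^sup>2) / 2 * c))" by simp
  moreover have e2: "- 2 * pi * (of_nat p * Q2 n) * Im \<tau> = - (2 * pi * p * (Q2 n * Im \<tau>))" by simp
  ultimately show ?thesis unfolding norm_qpow exp_le_cancel_iff e1 e2 neg_le_iff_le by simp
qed

text \<open>As in rank one, the growth of \<open>gE\<close> for $\mathrm{Im}\, w < \mathrm{Im}\,\tau$ is absorbed by $q^{pQ_2(n)}$; the
polynomial factor costs only linear terms in the exponent.\<close>

lemma norm_A2_term_le:
  assumes p: "p > 0" and c: "c > 0" "Im \<tau> > c" "Im w > c" and R: "norm \<tau> < R" "norm w < R"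
  shows "norm (A2_term p n \<tau> w) \<le> (1 / 3 + 8 * R * sqrt 3 * p) * exp (2 * (\<bar>n $ 1\<bar> + \<bar>n $ 2\<bar>) - (pi * p * c) * ((n $ 1)\<^sup>2 + (n $ 2)\<^sup>2))"
proof -
  define S where "S = \<bar>n $ 1\<bar> + \<bar>n $ 2\<bar>"
  define z where "z = \<i> * (w - \<tau>)"
  define Q where "Q = Q2 n"
  define N where "N = (n $ 1)\<^sup>2 + (n $ 2)\<^sup>2"
  have Q: "Q \<ge> N / 2" "Q = Qr (n $ 1) (n $ 2)" unfolding Q_def N_def Q2_eq by (rule Qr_ge) simp
  have N0: "N \<ge> 0" unfolding N_def by simp
  have Q0: "Q \<ge> 0" using Q N0 by simp
  have R0: "R > 0" using R(1) norm_ge_zero[of \<tau>] by linarith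
  have S0: "S \<ge> 0" unfolding S_def by simp
  have "S \<le> exp S" using exp_ge_add_one_self[of S] by linarith
  then have "S\<^sup>2 \<le> (exp S)\<^sup>2" using S0 by (intro power_mono)
  also have "(exp S)\<^sup>2 = exp (2 * S)" by (simp add: power2_eq_square flip: exp_add)
  finally have S2: "S\<^sup>2 \<le> exp (2 * S)" .
  have S1: "1 \<le> exp (2 * S)" using S0 by simp
  have nz: "norm z \<le> 2 * R"
    using norm_triangle_ineq4[of w \<tau>] R unfolding z_def norm_mult by simp
  have mx: "max 0 (Re z) \<le> Im \<tau> - c" using c by (simp add: z_def)
  define K where "K = 2 * pi * p * Q"
  have K0: "K \<ge> 0" unfolding K_def using Q0 by simp
  have E: "exp (K * max 0 (Re z)) * exp (- K * Im \<tau>) \<le> exp (- (pi * p * c) * N)"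
  proof -
    have "K * max 0 (Re z) \<le> K * (Im \<tau> - c)" using mx K0 by (rule mult_left_mono)
    moreover have "pi * p * c * N \<le> K * c"
    proof -
      have "2 * pi * p * c * (N / 2) \<le> 2 * pi * p * c * Q" using Q c by (intro mult_left_mono) auto
      then show ?thesis by (simp add: K_def mult_ac)
    qed
    ultimately show ?thesis unfolding exp_add[symmetric] by (simp add: algebra_simps)
  qed
  have E1: "exp (- K * Im \<tau>) \<le> exp (- (pi * p * c) * N)"
  proof (rule order_trans[OF _ E])
    have "1 \<le> exp (K * max 0 (Re z))" using K0 by simp
    then show "exp (- K * Im \<tau>) \<le> exp (K * max 0 (Re z)) * exp (- K * Im \<tau>)" by simp
  qed
  have "norm (A2_term p n \<tau> w) = norm (gE p (n $ 1) (n $ 2) z) * exp (- K * Im \<tau>)"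
    unfolding A2_term_def norm_mult norm_qpow K_def Q_def z_def by (simp add: mult_ac)
  also have "\<dots> \<le> (1 / 3 + norm z * (4 * sqrt 3 * p * S\<^sup>2 * exp (K * max 0 (Re z)))) * exp (- K * Im \<tau>)"
    using norm_gE_le[OF p, of "n $ 1" "n $ 2" z] unfolding S_def K_def Q(2) by (intro mult_right_mono) auto
  also have "\<dots> = 1 / 3 * exp (- K * Im \<tau>) + norm z * (4 * sqrt 3 * p * S\<^sup>2 * (exp (K * max 0 (Re z)) * exp (- K * Im \<tau>)))"
    by (simp add: algebra_simps)
  also have "\<dots> \<le> 1 / 3 * exp (- (pi * p * c) * N) + 2 * R * (4 * sqrt 3 * p * exp (2 * S) * exp (- (pi * p * c) * N))"
    using R0 by (intro add_mono mult_mono E E1 nz S2) auto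
  also have "\<dots> \<le> 1 / 3 * (exp (2 * S) * exp (- (pi * p * c) * N)) + 2 * R * (4 * sqrt 3 * p * exp (2 * S) * exp (- (pi * p * c) * N))"
    using S1 R0 by (intro add_mono mult_left_mono) auto
  also have "\<dots> = (1 / 3 + 8 * R * sqrt 3 * p) * exp (2 * S - (pi * p * c) * N)"
    by (simp add: exp_diff exp_minus field_simps)
  finally show ?thesis unfolding S_def N_def .
qed

lemma A2_term_dominated:
  assumes p: "p > 0"
  shows "locally_dominated (int2_coset \<mu>) (uhp \<times> uhp) (\<lambda>n q. A2_term p n (fst q) (snd q))"
proof (rule locally_dominated_uhp2_bounded)
  show "(\<lambda>n. (1 / 3 + 8 * R * sqrt 3 * p) * exp (2 * (\<bar>n $ 1\<bar> + \<bar>n $ 2\<bar>) - (pi * p * c) * ((n $ 1)\<^sup>2 + (n $ 2)\<^sup>2))) summable_on int2_coset \<mu>" if "c > 0" for c R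
    using p that by (intro summable_on_cmult_right summable_on_gauss_int2_coset) auto
  show "norm (A2_term p n (fst (\<tau>, w)) (snd (\<tau>, w))) \<le> (1 / 3 + 8 * R * sqrt 3 * p) * exp (2 * (\<bar>n $ 1\<bar> + \<bar>n $ 2\<bar>) - (pi * p * c) * ((n $ 1)\<^sup>2 + (n $ 2)\<^sup>2))"
    if "c > 0" "Im \<tau> > c" "Im w > c" "norm \<tau> < R" "norm w < R" for c R n \<tau> w
    using norm_A2_term_le[OF p that] by simp
qed

lemma gE_holomorphic: "p > 0 \<Longrightarrow> gE p a b holomorphic_on S"
  unfolding holomorphic_on_def field_differentiable_def
  by (intro ballI exI, rule has_field_derivative_at_within, rule gE_has_field_derivative(1))

lemma gE_compose_holomorphic: "p > 0 \<Longrightarrow> f holomorphic_on S \<Longrightarrow> (\<lambda>x. gE p a b (f x)) holomorphic_on S"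
  using holomorphic_on_compose_gen[OF _ gE_holomorphic[of p a b UNIV], of f S] by (simp add: o_def)

lemma gE_continuous: "p > 0 \<Longrightarrow> continuous_on S f \<Longrightarrow> continuous_on S (\<lambda>x. gE p a b (f x))"
  by (rule continuous_on_compose2[OF holomorphic_on_imp_continuous_on[OF gE_holomorphic[of p a b UNIV]]]) auto

lemma psihat_A2_continuous:
  assumes p: "p > 0"
  shows "continuous_on (uhp \<times> uhp) (\<lambda>(\<tau>, w). psihat_A2 p s \<tau> w)"
  unfolding psihat_A2_eq[OF p] case_prod_unfold
  by (intro continuous_on_infsum A2_term_dominated p, unfold A2_term_def)
     (intro continuous_intros gE_continuous qpow_continuous p)

lemma psihat_A2_holomorphic:
  assumes p: "p > 0"
  shows "w \<in> uhp \<Longrightarrow> (\<lambda>\<tau>. psihat_A2 p s \<tau> w) holomorphic_on uhp"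
    and "\<tau> \<in> uhp \<Longrightarrow> (\<lambda>w. psihat_A2 p s \<tau> w) holomorphic_on uhp"
proof -
  show "(\<lambda>\<tau>. psihat_A2 p s \<tau> w) holomorphic_on uhp" if "w \<in> uhp"
    unfolding psihat_A2_eq[OF p]
  proof (rule holomorphic_infsum[OF open_uhp locally_dominated_slice1[OF A2_term_dominated[OF p] that]])
    show "(\<lambda>\<tau>. A2_term p n \<tau> w) holomorphic_on uhp" for n
      unfolding A2_term_def by (intro holomorphic_intros gE_compose_holomorphic qpow_holomorphic p)
  qed
  show "(\<lambda>w. psihat_A2 p s \<tau> w) holomorphic_on uhp" if "\<tau> \<in> uhp"
    unfolding psihat_A2_eq[OF p]
  proof (rule holomorphic_infsum[OF open_uhp locally_dominated_slice2[OF A2_term_dominated[OF p] that]])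
    show "(\<lambda>w. A2_term p n \<tau> w) holomorphic_on uhp" for n
      unfolding A2_term_def by (intro holomorphic_intros gE_compose_holomorphic p)
  qed
qed

section \<open>Splitting $A_2$ into two orthogonal lines\<close>

text \<open>For characteristics \<open>a\<close> and \<open>b\<close> of the lines with forms $3pN^2$ and $pm^2$, the component at the
label \<open>s\<close> of the product restricted to $A_2$. The sum over $\delta$ is the gluing: $N = n_1/2$ and
$m = n_2 - n_1/2$ are both integral or both half-integral relative to the base point.\<close>

definition A2_split :: "nat \<Rightarrow> (int \<Rightarrow> 'a) \<Rightarrow> (int \<Rightarrow> 'a) \<Rightarrow> int \<times> int \<Rightarrow> 'a::comm_ring" where
  "A2_split p a b s = (\<Sum>\<delta>\<in>{0, 1}. a (2 * fst s + snd s + 3 * int p * \<delta>) * b (snd s - int p * \<delta>))"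

lemma mu2_nth: "mu2 p s $ 1 = of_int (2 * fst s + snd s) / (3 * of_nat p)" "mu2 p s $ 2 = of_int (fst s + 2 * snd s) / (3 * of_nat p)"
  by (simp_all add: mu2_def beta1_def beta2_def vector_2 add_divide_distrib)

text \<open>The parity of $n_1 - \mu_1$ decides in which of the two glued cosets $(n_1/2,\, n_2 - n_1/2)$ lies.\<close>

lemma has_sum_int2_split:
  fixes F G :: "real \<Rightarrow> complex"
  assumes p: "p > 0"
    and F: "\<And>x. (\<lambda>n. norm (F n)) summable_on int_coset x" and G: "\<And>x. (\<lambda>n. norm (G n)) summable_on int_coset x"
  shows "((\<lambda>n. F (n $ 1 / 2) * G (n $ 2 - n $ 1 / 2)) has_sum
      A2_split p (\<lambda>r. infsum F (int_coset (of_int r / (2 * of_nat (3 * p))))) (\<lambda>r. infsum G (int_coset (of_int r / (2 * of_nat p)))) s)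
     (int2_coset (mu2 p s))"
proof -
  define A where "A = (\<lambda>\<delta>. int_coset (of_int (2 * fst s + snd s + 3 * int p * \<delta>) / (2 * of_nat (3 * p))))"
  define B where "B = (\<lambda>\<delta>. int_coset (of_int (snd s - int p * \<delta>) / (2 * of_nat p)))"
  have Ax: "x \<in> A \<delta> \<longleftrightarrow> x - mu2 p s $ 1 / 2 - of_int \<delta> / 2 \<in> \<int>" for x \<delta>
  proof -
    have e: "x - of_int (2 * fst s + snd s + 3 * int p * \<delta>) / (2 * of_nat (3 * p)) = x - mu2 p s $ 1 / 2 - of_int \<delta> / 2"
      using p unfolding mu2_nth by (simp add: field_simps)
    show ?thesis unfolding A_def int_coset_def mem_Collect_eq e ..
  qed
  have Bx: "x \<in> B \<delta> \<longleftrightarrow> x - (mu2 p s $ 2 - mu2 p s $ 1 / 2) + of_int \<delta> / 2 \<in> \<int>" for x \<delta>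
  proof -
    have e: "x - of_int (snd s - int p * \<delta>) / (2 * of_nat p) = x - (mu2 p s $ 2 - mu2 p s $ 1 / 2) + of_int \<delta> / 2"
      using p unfolding mu2_nth by (simp add: field_simps)
    show ?thesis unfolding B_def int_coset_def mem_Collect_eq e ..
  qed
  define U where "U = A 0 \<times> B 0 \<union> A 1 \<times> B 1"
  define g where "g = (\<lambda>n::real^2. (n $ 1 / 2, n $ 2 - n $ 1 / 2))"
  have inj: "inj_on g (int2_coset (mu2 p s))"
    by (auto simp: inj_on_def g_def vec_eq_iff forall_2)
  have sub: "g n \<in> U" if "n \<in> int2_coset (mu2 p s)" for n
  proof -
    have h: "n $ 1 - mu2 p s $ 1 \<in> \<int>" "n $ 2 - mu2 p s $ 2 \<in> \<int>"
      using that by (simp_all add: int2_coset_def forall_2)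
    obtain a where a: "n $ 1 - mu2 p s $ 1 = of_int a" using h(1) by (rule Ints_cases)
    obtain b where b: "n $ 2 - mu2 p s $ 2 = of_int b" using h(2) by (rule Ints_cases)
    note ab = a b
    define \<delta> where "\<delta> = a mod 2"
    have a: "a = \<delta> + 2 * (a div 2)" unfolding \<delta>_def by simp
    have "real_of_int a = of_int \<delta> + 2 * of_int (a div 2)" by (subst a) (simp only: of_int_add of_int_mult of_int_numeral)
    then have "n $ 1 / 2 - mu2 p s $ 1 / 2 - of_int \<delta> / 2 = of_int (a div 2)"
      and "(n $ 2 - n $ 1 / 2) - (mu2 p s $ 2 - mu2 p s $ 1 / 2) + of_int \<delta> / 2 = of_int (b - a div 2)"
      using ab by (simp_all add: field_simps)
    then have "g n \<in> A \<delta> \<times> B \<delta>" unfolding g_def by (simp add: Ax Bx)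
    moreover have "\<delta> = 0 \<or> \<delta> = 1" unfolding \<delta>_def by auto
    ultimately show ?thesis unfolding U_def by auto
  qed
  have sup: "q \<in> g ` int2_coset (mu2 p s)" if "q \<in> A \<delta> \<times> B \<delta>" for q \<delta>
  proof (rule image_eqI)
    have h: "fst q - mu2 p s $ 1 / 2 - of_int \<delta> / 2 \<in> \<int>" "snd q - (mu2 p s $ 2 - mu2 p s $ 1 / 2) + of_int \<delta> / 2 \<in> \<int>"
      using that by (simp_all add: mem_Times_iff Ax Bx)
    obtain a where a: "fst q - mu2 p s $ 1 / 2 - of_int \<delta> / 2 = of_int a" using h(1) by (rule Ints_cases)
    obtain b where b: "snd q - (mu2 p s $ 2 - mu2 p s $ 1 / 2) + of_int \<delta> / 2 = of_int b" using h(2) by (rule Ints_cases)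
    note ab = a b
    show "q = g (vector [2 * fst q, snd q + fst q])" by (simp add: g_def vector_2)
    have "2 * fst q - mu2 p s $ 1 = of_int (2 * a + \<delta>)" "snd q + fst q - mu2 p s $ 2 = of_int (a + b)"
      using ab by (simp_all add: field_simps)
    then show "vector [2 * fst q, snd q + fst q] \<in> int2_coset (mu2 p s)"
      unfolding int2_coset_def by (simp add: forall_2 vector_2 del: of_int_add of_int_mult)
  qed
  have bij: "bij_betw g (int2_coset (mu2 p s)) U"
    unfolding bij_betw_def
  proof (rule conjI[OF inj], rule equalityI)
    show "g ` int2_coset (mu2 p s) \<subseteq> U" using sub by (rule image_subsetI)
    show "U \<subseteq> g ` int2_coset (mu2 p s)" unfolding U_def using sup[of _ 0] sup[of _ 1] by (intro Un_least subsetI)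
  qed
  have disj: "(A 0 \<times> B 0) \<inter> (A 1 \<times> B 1) = {}"
  proof -
    have False if "x \<in> A 0" "x \<in> A 1" for x
    proof -
      have "(x - mu2 p s $ 1 / 2) - (x - mu2 p s $ 1 / 2 - 1 / 2) \<in> \<int>"
        by (rule Ints_diff) (use that in \<open>simp_all add: Ax\<close>)
      then have "(1 / 2 :: real) \<in> \<int>" by simp
      then obtain k :: int where "1 / 2 = real_of_int k" by (auto elim: Ints_cases)
      then have "of_int (2 * k) = real_of_int 1" by simp
      then have "2 * k = 1" by (simp only: of_int_eq_iff)
      then show False by presburger
    qed
    then show ?thesis by auto
  qed
  have "((\<lambda>q. F (fst q) * G (snd q)) has_sum (infsum F (A 0) * infsum G (B 0) + infsum F (A 1) * infsum G (B 1))) U"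
    unfolding U_def by (intro has_sum_Un_disjoint has_sum_product disj) (unfold A_def B_def, (rule F G)+)
  then have "((\<lambda>n. F (fst (g n)) * G (snd (g n))) has_sum (infsum F (A 0) * infsum G (B 0) + infsum F (A 1) * infsum G (B 1))) (int2_coset (mu2 p s))"
    using has_sum_reindex_bij_betw[OF bij, of "\<lambda>q. F (fst q) * G (snd q)"] by simp
  then show ?thesis unfolding g_def A2_split_def A_def B_def by simp
qed

text \<open>The same splitting with the roles of the coordinates exchanged, that is, along the other root.\<close>

lemma has_sum_int2_split':
  fixes F G :: "real \<Rightarrow> complex"
  assumes p: "p > 0"
    and F: "\<And>x. (\<lambda>n. norm (F n)) summable_on int_coset x" and G: "\<And>x. (\<lambda>n. norm (G n)) summable_on int_coset x"
  shows "((\<lambda>n. F (n $ 2 / 2) * G (n $ 1 - n $ 2 / 2)) has_sum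
      A2_split p (\<lambda>r. infsum F (int_coset (of_int r / (2 * of_nat (3 * p))))) (\<lambda>r. infsum G (int_coset (of_int r / (2 * of_nat p)))) (prod.swap s))
     (int2_coset (mu2 p s))"
proof -
  define g where "g = (\<lambda>n::real^2. vector [n $ 2, n $ 1] :: real^2)"
  have g1: "g n $ 1 = n $ 2" "g n $ 2 = n $ 1" for n by (simp_all add: g_def vector_2)
  have gg: "g (g n) = n" for n by (simp add: vec_eq_iff forall_2 g1)
  have mem: "g n \<in> int2_coset (mu2 p (prod.swap s))" if "n \<in> int2_coset (mu2 p s)" for n s
    using that by (simp add: int2_coset_def forall_2 g1 mu2_nth add.commute conj_commute)
  have bij: "bij_betw g (int2_coset (mu2 p s)) (int2_coset (mu2 p (prod.swap s)))"
    by (rule bij_betwI[where g = g]) (use mem[of _ s] mem[of _ "prod.swap s"] gg in auto)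
  show ?thesis
    using has_sum_int2_split[OF p F G, of "prod.swap s"]
    unfolding has_sum_reindex_bij_betw[OF bij, symmetric] by (simp add: g1)
qed

section \<open>The derivative of the completion\<close>

lemma locally_dominated_norm_summable:
  fixes f :: "'n \<Rightarrow> 'a::topological_space \<Rightarrow> 'b::banach"
  assumes "locally_dominated A X f" "x \<in> X"
  shows "(\<lambda>n. norm (f n x)) summable_on A"
proof -
  obtain U M where "x \<in> U" "M summable_on A" "\<And>n y. n \<in> A \<Longrightarrow> y \<in> U \<inter> X \<Longrightarrow> norm (f n y) \<le> M n"
    using locally_dominatedE[OF assms] by metis
  then have "M summable_on A" "\<And>n. n \<in> A \<Longrightarrow> norm (f n x) \<le> M n"
    using assms(2) by auto
  then show ?thesis by (rule Infinite_Sum.abs_summable_on_comparison_test')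
qed

lemma phi_term_norm_summable: "p > 0 \<Longrightarrow> \<tau> \<in> uhp \<Longrightarrow> w \<in> uhp \<Longrightarrow> (\<lambda>n. norm (phi_term p n \<tau> w)) summable_on int_coset x"
  using locally_dominated_norm_summable[OF phi_term_dominated, of p "(\<tau>, w)" x] by simp

lemma theta1_term_norm_summable: "m > 0 \<Longrightarrow> \<tau> \<in> uhp \<Longrightarrow> (\<lambda>n. norm (of_real n * qpow \<tau> (of_nat m * n\<^sup>2))) summable_on int_coset x"
  using locally_dominated_norm_summable[OF theta1_dominated, of m \<tau> x] by simp

text \<open>The derivative of \<open>psihat_A2\<close> in \<open>w\<close> up to a constant. The two summands come from the two summands of
\<open>A2D\<close>; exchanging the two simple roots exchanges the entries of the label.\<close>

definition A2_deriv :: "nat \<Rightarrow> int \<times> int \<Rightarrow> complex \<Rightarrow> complex \<Rightarrow> complex" where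
  "A2_deriv p s \<tau> w = A2_split p (\<lambda>r. theta1 (3 * p) r w) (\<lambda>r. phi p r \<tau> w) s +
     A2_split p (\<lambda>r. theta1 (3 * p) r w) (\<lambda>r. phi p r \<tau> w) (prod.swap s)"

text \<open>Termwise by \<open>A2D\<close>: the exponential turns part of $q^{pQ_2(n)}$ into a power of $e^{2\pi i w}$, and the
remaining product of functions of $n_1/2$ and $n_2 - n_1/2$ is summed by \<open>has_sum_int2_split\<close>.\<close>

lemma psihat_A2_has_field_derivative:
  assumes p: "p > 0" and \<tau>: "\<tau> \<in> uhp" and w: "w \<in> uhp"
  shows "((\<lambda>w. psihat_A2 p s \<tau> w) has_field_derivative - 4 * \<i> * of_real (sqrt 3 * p) * A2_deriv p s \<tau> w) (at w)"
proof -
  let ?A = "int2_coset (mu2 p s)"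
  define C where "C = - 4 * \<i> * of_real (sqrt 3 * p)"
  define f' where "f' = (\<lambda>n::real^2. \<lambda>w. A2D p (n $ 1) (n $ 2) (\<i> * (w - \<tau>)) * \<i> * qpow \<tau> (of_nat p * Q2 n))"
  define F where "F = (\<lambda>N::real. of_real N * qpow w (of_nat (3 * p) * N\<^sup>2))"
  define G where "G = (\<lambda>m::real. phi_term p m \<tau> w)"
  have dom: "locally_dominated ?A uhp (\<lambda>n w. A2_term p n \<tau> w)"
    by (rule locally_dominated_slice2[OF A2_term_dominated[OF p] \<tau>])
  have der: "((\<lambda>w. A2_term p n \<tau> w) has_field_derivative f' n w) (at w)" for n w
  proof -
    have "((\<lambda>w. \<i> * (w - \<tau>)) has_field_derivative \<i>) (at w)" by (auto intro!: derivative_eq_intros)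
    from DERIV_cmult_right[OF DERIV_chain2[where f = "gE p (n $ 1) (n $ 2)", OF gE_has_field_derivative(1)[OF p] this]]
    show ?thesis unfolding A2_term_def f'_def .
  qed
  have D: "((\<lambda>w. psihat_A2 p s \<tau> w) has_field_derivative (\<Sum>\<^sub>\<infinity>n\<in>?A. f' n w)) (at w)"
    unfolding psihat_A2_eq[OF p] by (rule has_field_derivative_infsum(1)[OF open_uhp dom w der])
  have half: "of_real (a * (b - a / 2)) * (exp (of_real (3/2 * pi * p * a\<^sup>2) * (\<i> * (w - \<tau>))) * eg (of_real (2 * pi * p * (b - a / 2)\<^sup>2) * (\<i> * (w - \<tau>)))) * qpow \<tau> (of_nat p * Qr a b)
     = 2 * (F (a / 2) * G (b - a / 2))" for a b :: real
  proof -
    have h: "exp (of_real (3/2 * pi * p * a\<^sup>2) * (\<i> * (w - \<tau>))) * qpow \<tau> (of_nat p * Qr a b) =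
      qpow w (of_nat (3 * p) * (a / 2)\<^sup>2) * qpow \<tau> (of_nat p * (b - a / 2)\<^sup>2)"
      unfolding qpow_def exp_add[symmetric] Qr_def
      by (rule arg_cong[where f = exp]) (simp add: power2_eq_square field_simps)
    have r: "X * E * Y = E * (X * Y)" for X E Y :: complex by simp
    have e: "exp (of_real (3/2 * pi * p * a\<^sup>2) * (\<i> * (w - \<tau>))) * E * qpow \<tau> (of_nat p * Qr a b) =
      E * (qpow w (of_nat (3 * p) * (a / 2)\<^sup>2) * qpow \<tau> (of_nat p * (b - a / 2)\<^sup>2))" for E
      unfolding r h ..
    show ?thesis unfolding F_def G_def phi_term_def mult.assoc[of "of_real (a * (b - a / 2))"] e
      by simp
  qed
  have eq: "f' n w = C * (F (n $ 1 / 2) * G (n $ 2 - n $ 1 / 2) + F (n $ 2 / 2) * G (n $ 1 - n $ 2 / 2))" for n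
  proof -
    have Qs: "Qr (n $ 1) (n $ 2) = Qr (n $ 2) (n $ 1)" by (simp add: Qr_def algebra_simps)
    have r: "(K * (X + Y)) * \<i> * q = K * \<i> * (X * q + Y * q)" for K X Y q :: complex by (simp add: algebra_simps)
    have "f' n w = - of_real (2 * sqrt 3 * p) * \<i> * (2 * (F (n $ 1 / 2) * G (n $ 2 - n $ 1 / 2)) + 2 * (F (n $ 2 / 2) * G (n $ 1 - n $ 2 / 2)))"
      unfolding f'_def A2D_def r Q2_eq half by (subst Qs) (simp only: half)
    then show ?thesis unfolding C_def by simp
  qed
  have th: "infsum F (int_coset (of_int r / (2 * of_nat (3 * p)))) = theta1 (3 * p) r w" for r
    unfolding F_def theta1_def ..
  have ph: "infsum G (int_coset (of_int r / (2 * of_nat p))) = phi p r \<tau> w" for r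
    unfolding G_def phi_def ..
  have Fs: "(\<lambda>n. norm (F n)) summable_on int_coset x" for x
    unfolding F_def using p w by (intro theta1_term_norm_summable) auto
  have Gs: "(\<lambda>n. norm (G n)) summable_on int_coset x" for x
    unfolding G_def by (rule phi_term_norm_summable[OF p \<tau> w])
  have "((\<lambda>n. f' n w) has_sum C * A2_deriv p s \<tau> w) ?A"
    unfolding eq A2_deriv_def
    using has_sum_cmult_right[OF has_sum_add[OF has_sum_int2_split[OF p Fs Gs, of s] has_sum_int2_split'[OF p Fs Gs, of s]], of C]
    unfolding th ph .
  then have "(\<Sum>\<^sub>\<infinity>n\<in>?A. f' n w) = C * A2_deriv p s \<tau> w" by (rule infsumI)
  with D show ?thesis unfolding C_def by simp
qed

lemma psihat_A2_diag:
  assumes p: "p > 0" shows "psihat_A2 p s \<tau> \<tau> = 1 / 3 * Theta_A2 p (mu2 p s) \<tau>"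
  unfolding psihat_A2_eq[OF p] A2_term_def Theta_A2_def
  by (simp only: diff_self mult_zero_right gE_has_field_derivative(2)[OF p] infsum_cmult_right')

lemma h_A2_eq:
  assumes p: "p > 0"
  shows "h_A2 p s \<tau> w = - 2 * \<i> * of_real (sqrt (2 * p)) * csqrt (\<i> * (w - \<tau>)) * A2_deriv p s \<tau> w"
proof -
  have r: "(\<Sum>\<delta>\<in>{0, 1::int}. a \<delta> * (K * b \<delta>) + a' \<delta> * (K * b' \<delta>)) = K * ((\<Sum>\<delta>\<in>{0, 1}. a \<delta> * b \<delta>) + (\<Sum>\<delta>\<in>{0, 1}. a' \<delta> * b' \<delta>))"
    for a b a' b' :: "int \<Rightarrow> complex" and K by (simp add: algebra_simps)
  show ?thesis
    unfolding h_A2_def A2_deriv_def A2_split_def psihat_A1_eq_phi[OF p] r fst_swap snd_swap ..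
qed

lemma sqrt_6p_2p: "of_real (sqrt (6 * real p)) * (- 2 * \<i> * of_real (sqrt (2 * real p))) = - 4 * \<i> * of_real (sqrt 3 * p)"
proof -
  have "sqrt (6 * p) = sqrt 3 * sqrt (2 * p)" by (simp flip: real_sqrt_mult)
  then have "sqrt (6 * p) * sqrt (2 * p) = sqrt 3 * (2 * p)" by simp
  then have "complex_of_real (sqrt (6 * p) * sqrt (2 * p)) = of_real (sqrt 3 * (2 * p))" by (rule arg_cong)
  then have "complex_of_real (sqrt (6 * p)) * of_real (sqrt (2 * p)) = of_real (sqrt 3 * (2 * p))" by simp
  then have "(complex_of_real (sqrt (6 * p)) * of_real (sqrt (2 * p))) * (- 2 * \<i>) = of_real (sqrt 3 * (2 * p)) * (- 2 * \<i>)"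
    by (rule arg_cong)
  then show ?thesis by (simp add: mult_ac)
qed

lemma A2_deriv_h:
  assumes p: "p > 0" and w: "w \<noteq> \<tau>"
  shows "of_real (sqrt (6 * p)) * (h_A2 p s \<tau> w / csqrt (\<i> * (w - \<tau>))) = - 4 * \<i> * of_real (sqrt 3 * p) * A2_deriv p s \<tau> w"
proof -
  have "csqrt (\<i> * (w - \<tau>)) \<noteq> 0" using w by simp
  then have "h_A2 p s \<tau> w / csqrt (\<i> * (w - \<tau>)) = - 2 * \<i> * of_real (sqrt (2 * p)) * A2_deriv p s \<tau> w"
    unfolding h_A2_eq[OF p] by (simp del: csqrt.simps)
  then have "of_real (sqrt (6 * p)) * (h_A2 p s \<tau> w / csqrt (\<i> * (w - \<tau>))) =
     (of_real (sqrt (6 * p)) * (- 2 * \<i> * of_real (sqrt (2 * p)))) * A2_deriv p s \<tau> w"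
    by (simp only: mult.assoc)
  then show ?thesis unfolding of_nat_mult of_nat_numeral sqrt_6p_2p .
qed

section \<open>Integration along geodesics\<close>

text \<open>Both angles of the arc lie strictly between $0$ and $\pi$, so the arc stays above its centre on the
real line; the angle is an injective function of the parameter.\<close>

lemma geodesic_props:
  assumes \<tau>: "\<tau> \<in> uhp" and w: "w \<in> uhp" and ne: "\<tau> \<noteq> w"
  shows "valid_path (geodesic \<tau> w)" "path_image (geodesic \<tau> w) \<subseteq> uhp"
    "pathstart (geodesic \<tau> w) = \<tau>" "pathfinish (geodesic \<tau> w) = w"
    "\<And>t. t \<in> {0<..1} \<Longrightarrow> geodesic \<tau> w t \<noteq> \<tau>"
proof -
  have "valid_path (geodesic \<tau> w) \<and> path_image (geodesic \<tau> w) \<subseteq> uhp \<and> pathstart (geodesic \<tau> w) = \<tau> \<and>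
     pathfinish (geodesic \<tau> w) = w \<and> (\<forall>t\<in>{0<..1}. geodesic \<tau> w t \<noteq> \<tau>)"
  proof (cases "Re \<tau> = Re w")
    case True
    then have g: "geodesic \<tau> w = linepath \<tau> w" by (simp add: geodesic_def)
    have "linepath \<tau> w t \<noteq> \<tau>" if "t \<in> {0<..1}" for t
    proof
      assume "linepath \<tau> w t = \<tau>"
      then have "t *\<^sub>R (w - \<tau>) = 0" by (simp add: linepath_def algebra_simps)
      then show False using that ne by simp
    qed
    moreover have "closed_segment \<tau> w \<subseteq> uhp" using \<tau> w by (intro closed_segment_subset convex_uhp)
    ultimately show ?thesis unfolding g by simp
  next
    case False
    define c0 where "c0 = ((cmod w)\<^sup>2 - (cmod \<tau>)\<^sup>2) / (2 * (Re w - Re \<tau>))"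
    define c where "c = complex_of_real c0"
    define r where "r = cmod (\<tau> - c)"
    define \<alpha> where "\<alpha> = Arg (\<tau> - c)"
    define \<beta> where "\<beta> = Arg (w - c)"
    have g: "geodesic \<tau> w = part_circlepath c r \<alpha> \<beta>"
      using False by (simp add: geodesic_def c_def c0_def r_def \<alpha>_def \<beta>_def Let_def)
    have im: "Im (\<tau> - c) > 0" "Im (w - c) > 0" using \<tau> w by (auto simp: c_def uhp_def)
    then have nz: "\<tau> - c \<noteq> 0" "w - c \<noteq> 0" by auto
    have "2 * c0 * (Re w - Re \<tau>) = (cmod w)\<^sup>2 - (cmod \<tau>)\<^sup>2"
    proof -
      have "2 * (X / (2 * d)) * d = X" if "d \<noteq> 0" for X d :: real using that by simp
      from this[of "Re w - Re \<tau>"] show ?thesis unfolding c0_def using False by (simp only: diff_eq_eq)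
    qed
    then have "(cmod (w - c))\<^sup>2 = (cmod (\<tau> - c))\<^sup>2"
    proof -
      assume e: "2 * c0 * (Re w - Re \<tau>) = (cmod w)\<^sup>2 - (cmod \<tau>)\<^sup>2"
      have "(a - k)\<^sup>2 + x\<^sup>2 = (b - k)\<^sup>2 + y\<^sup>2" if "2 * k * (a - b) = (a\<^sup>2 + x\<^sup>2) - (b\<^sup>2 + y\<^sup>2)" for a b k x y :: real
        using that by algebra
      from this[OF e[unfolded cmod_power2]] show ?thesis unfolding cmod_power2 c_def by simp
    qed
    then have rw: "cmod (w - c) = r" unfolding r_def by (simp add: power2_eq_iff_nonneg)
    have r0: "r > 0" unfolding r_def using nz by simp
    have \<tau>e: "\<tau> = c + of_real r * exp (\<i> * of_real \<alpha>)" using Arg_eq[OF nz(1)] by (simp add: r_def \<alpha>_def)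
    have we: "w = c + of_real r * exp (\<i> * of_real \<beta>)" using Arg_eq[OF nz(2)] by (simp add: rw \<beta>_def)
    have ang: "0 < \<alpha>" "\<alpha> < pi" "0 < \<beta>" "\<beta> < pi"
      using im Arg_lt_pi[of "\<tau> - c"] Arg_lt_pi[of "w - c"] unfolding \<alpha>_def \<beta>_def by auto
    have lp: "0 < linepath \<alpha> \<beta> t \<and> linepath \<alpha> \<beta> t < pi" if "t \<in> {0..1}" for t
    proof -
      have "linepath \<alpha> \<beta> t \<in> closed_segment \<alpha> \<beta>" using that by (rule linepath_in_path)
      moreover have "closed_segment \<alpha> \<beta> \<subseteq> {0<..<pi}" using ang by (intro closed_segment_subset) auto
      ultimately show ?thesis by auto
    qed
    have pc: "part_circlepath c r \<alpha> \<beta> t = c + of_real r * exp (\<i> * of_real (linepath \<alpha> \<beta> t))" for t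
      by (simp add: part_circlepath_def)
    have img: "path_image (part_circlepath c r \<alpha> \<beta>) \<subseteq> uhp"
    proof
      fix z assume "z \<in> path_image (part_circlepath c r \<alpha> \<beta>)"
      then obtain t where t: "t \<in> {0..1}" "z = part_circlepath c r \<alpha> \<beta> t" by (auto simp: path_image_def)
      have "Im z = r * sin (linepath \<alpha> \<beta> t)"
        unfolding t(2) pc by (simp add: c_def cis_conv_exp[symmetric])
      moreover have "sin (linepath \<alpha> \<beta> t) > 0" using lp[OF t(1)] by (intro sin_gt_zero) auto
      ultimately show "z \<in> uhp" using r0 by (simp add: uhp_def)
    qed
    have ab: "\<alpha> \<noteq> \<beta>"
    proof
      assume "\<alpha> = \<beta>"
      then have "c + of_real r * exp (\<i> * of_real \<alpha>) = c + of_real r * exp (\<i> * of_real \<beta>)" by (rule arg_cong)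
      from trans[OF trans[OF \<tau>e this] we[symmetric]] ne show False by contradiction
    qed
    have neq: "part_circlepath c r \<alpha> \<beta> t \<noteq> \<tau>" if t: "t \<in> {0<..1}" for t
    proof
      assume A: "part_circlepath c r \<alpha> \<beta> t = \<tau>"
      have "of_real r * exp (\<i> * of_real (linepath \<alpha> \<beta> t)) = of_real r * exp (\<i> * of_real \<alpha>)"
        using trans[OF trans[OF pc[of t, symmetric] A] \<tau>e] unfolding add_left_cancel .
      then have "of_real r * cis (linepath \<alpha> \<beta> t) = of_real r * cis \<alpha>" unfolding cis_conv_exp .
      then have c: "cis (linepath \<alpha> \<beta> t) = cis \<alpha>"
        by (rule mult_left_cancel[THEN iffD1, rotated]) (use r0 in simp)
      have "cos (linepath \<alpha> \<beta> t) = cos \<alpha>" using arg_cong[where f = Re, OF c] by simp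
      moreover have "0 < linepath \<alpha> \<beta> t" "linepath \<alpha> \<beta> t < pi" using lp[of t] t by simp_all
      ultimately have l: "linepath \<alpha> \<beta> t = \<alpha>" using cos_inj_pi[of "linepath \<alpha> \<beta> t" \<alpha>] ang by simp
      have "linepath \<alpha> \<beta> t = \<alpha> + t * (\<beta> - \<alpha>)" by (simp add: linepath_def algebra_simps)
      then have "t * (\<beta> - \<alpha>) = 0" unfolding l by simp
      then show False using t ab by simp
    qed
    have "pathstart (part_circlepath c r \<alpha> \<beta>) = \<tau>" "pathfinish (part_circlepath c r \<alpha> \<beta>) = w"
      unfolding pathstart_part_circlepath pathfinish_part_circlepath by (rule \<tau>e[symmetric], rule we[symmetric])
    moreover have "valid_path (part_circlepath c r \<alpha> \<beta>)" by simp
    ultimately show ?thesis unfolding g using img neq by (intro conjI ballI)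
  qed
  then show "valid_path (geodesic \<tau> w)" "path_image (geodesic \<tau> w) \<subseteq> uhp"
    "pathstart (geodesic \<tau> w) = \<tau>" "pathfinish (geodesic \<tau> w) = w"
    "\<And>t. t \<in> {0<..1} \<Longrightarrow> geodesic \<tau> w t \<noteq> \<tau>" by auto
qed

text \<open>\<open>psihat_A2\<close> is a primitive of the regular function \<open>A2_deriv\<close>. The integrand of the statement differs
from this function only at the initial point, where it is $0/0$.\<close>

lemma psihat_A2_integral:
  assumes p: "p > 0" and \<tau>: "\<tau> \<in> uhp" and w: "w \<in> uhp" and ne: "\<tau> \<noteq> w"
  shows "(\<lambda>w1. h_A2 p s \<tau> w1 / csqrt (\<i> * (w1 - \<tau>))) contour_integrable_on geodesic \<tau> w"
    and "psihat_A2 p s \<tau> w = of_real (sqrt (6 * of_nat p)) *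
           contour_integral (geodesic \<tau> w) (\<lambda>w1. h_A2 p s \<tau> w1 / csqrt (\<i> * (w1 - \<tau>))) + 1 / 3 * Theta_A2 p (mu2 p s) \<tau>"
proof -
  note g = geodesic_props[OF \<tau> w ne]
  let ?H = "\<lambda>w1. - 4 * \<i> * of_real (sqrt 3 * p) * A2_deriv p s \<tau> w1"
  let ?h = "\<lambda>w1. h_A2 p s \<tau> w1 / csqrt (\<i> * (w1 - \<tau>))"
  have "(?H has_contour_integral (psihat_A2 p s \<tau> (pathfinish (geodesic \<tau> w)) - psihat_A2 p s \<tau> (pathstart (geodesic \<tau> w)))) (geodesic \<tau> w)"
  proof (rule contour_integral_primitive[OF _ g(1,2)])
    show "((\<lambda>w. psihat_A2 p s \<tau> w) has_field_derivative ?H x) (at x within uhp)" if "x \<in> uhp" for x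
      by (rule has_field_derivative_at_within[OF psihat_A2_has_field_derivative[OF p \<tau> that]])
  qed
  then have H: "(?H has_contour_integral (psihat_A2 p s \<tau> w - psihat_A2 p s \<tau> \<tau>)) (geodesic \<tau> w)"
    unfolding g(3,4) .
  have "((\<lambda>w1. of_real (sqrt (6 * p)) * ?h w1) has_contour_integral (psihat_A2 p s \<tau> w - psihat_A2 p s \<tau> \<tau>)) (geodesic \<tau> w)"
    unfolding has_contour_integral
  proof (rule has_integral_spike_finite[of "{0}", OF _ _ H[unfolded has_contour_integral]])
    fix t assume t: "t \<in> {0..1} - {0::real}"
    then have "geodesic \<tau> w t \<noteq> \<tau>" by (intro g(5)) auto
    from A2_deriv_h[OF p this, of s]
    show "of_real (sqrt (6 * p)) * ?h (geodesic \<tau> w t) * vector_derivative (geodesic \<tau> w) (at t) =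
      ?H (geodesic \<tau> w t) * vector_derivative (geodesic \<tau> w) (at t)" by simp
  qed simp
  then have "((\<lambda>w1. inverse (of_real (sqrt (6 * p))) * (of_real (sqrt (6 * p)) * ?h w1)) has_contour_integral
      inverse (of_real (sqrt (6 * p))) * (psihat_A2 p s \<tau> w - psihat_A2 p s \<tau> \<tau>)) (geodesic \<tau> w)"
    by (rule has_contour_integral_lmul)
  moreover have nz: "complex_of_real (sqrt (6 * p)) \<noteq> 0" using p by simp
  ultimately have h: "(?h has_contour_integral inverse (of_real (sqrt (6 * p))) * (psihat_A2 p s \<tau> w - psihat_A2 p s \<tau> \<tau>)) (geodesic \<tau> w)"
    by (simp add: mult.assoc[symmetric] del: csqrt.simps)
  then show "?h contour_integrable_on geodesic \<tau> w" unfolding contour_integrable_on_def by blast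
  have "contour_integral (geodesic \<tau> w) ?h = inverse (of_real (sqrt (6 * p))) * (psihat_A2 p s \<tau> w - psihat_A2 p s \<tau> \<tau>)"
    by (rule contour_integral_unique[OF h])
  then show "psihat_A2 p s \<tau> w = of_real (sqrt (6 * of_nat p)) * contour_integral (geodesic \<tau> w) ?h + 1 / 3 * Theta_A2 p (mu2 p s) \<tau>"
    using nz psihat_A2_diag[OF p, of s \<tau>] by (simp add: mult.assoc[symmetric] del: csqrt.simps)
qed

section \<open>The limit towards the cusp\<close>

lemma csqrt_minus_real: "t \<ge> 0 \<Longrightarrow> csqrt (- of_real t) = \<i> * of_real (sqrt t)"
  by (rule csqrt_unique) (auto simp: power_mult_distrib simp flip: of_real_power)

lemma qpow_Q2_norm_summable:
  assumes p: "p > 0" and \<tau>: "\<tau> \<in> uhp"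
  shows "(\<lambda>n. norm (qpow \<tau> (of_nat p * Q2 n))) summable_on int2_coset \<mu>"
proof (rule summable_on_comparison_test)
  show "(\<lambda>n::real^2. exp (0 * (\<bar>n $ 1\<bar> + \<bar>n $ 2\<bar>) - (pi * p * Im \<tau>) * ((n $ 1)\<^sup>2 + (n $ 2)\<^sup>2))) summable_on int2_coset \<mu>"
    using p \<tau> by (intro summable_on_gauss_int2_coset) (simp add: uhp_def)
  show "norm (qpow \<tau> (of_nat p * Q2 n)) \<le> exp (0 * (\<bar>n $ 1\<bar> + \<bar>n $ 2\<bar>) - (pi * p * Im \<tau>) * ((n $ 1)\<^sup>2 + (n $ 2)\<^sup>2))" for n
    using norm_qpow_Q2_le[of "Im \<tau>" \<tau> p n] \<tau> by (simp add: uhp_def)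
qed auto

lemma zero_in_coset_iff:
  assumes "(s1, s2) \<in> A2_labels p" "p > 0"
  shows "0 \<in> int2_coset (mu2 p (s1, s2)) \<longleftrightarrow> (s1, s2) = (0, 0)"
proof
  assume "0 \<in> int2_coset (mu2 p (s1, s2))"
  then have h: "- mu2 p (s1, s2) $ 1 \<in> \<int>" "- mu2 p (s1, s2) $ 2 \<in> \<int>"
    by (simp_all add: int2_coset_def forall_2)
  obtain a where a: "- mu2 p (s1, s2) $ 1 = of_int a" using h(1) by (rule Ints_cases)
  obtain b where b: "- mu2 p (s1, s2) $ 2 = of_int b" using h(2) by (rule Ints_cases)
  have "real_of_int (2 * s1 + s2) = of_int (- a * (3 * int p))" "real_of_int (s1 + 2 * s2) = of_int (- b * (3 * int p))"
    using a b assms(2) unfolding mu2_nth by (simp_all add: field_simps)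
  then have e: "2 * s1 + s2 = - a * (3 * int p)" "s1 + 2 * s2 = - b * (3 * int p)"
    by (simp_all only: of_int_eq_iff)
  have r: "0 \<le> s1" "s1 < 3 * int p" "0 \<le> s2" "s2 < int p" using assms(1) by (auto simp: A2_labels_def)
  have "3 * s2 = 3 * (int p * (a - 2 * b))" using e by algebra
  then have "s2 = int p * (a - 2 * b)" by simp
  moreover have "a - 2 * b = 0"
  proof (rule ccontr)
    assume "a - 2 * b \<noteq> 0"
    then consider "a - 2 * b \<ge> 1" | "a - 2 * b \<le> -1" by linarith
    then show False
    proof cases
      case 1
      then have "int p * 1 \<le> int p * (a - 2 * b)" by (intro mult_left_mono) auto
      then show False using r \<open>s2 = _\<close> by simp
    next
      case 2
      then have "int p * (a - 2 * b) \<le> int p * -1" by (intro mult_left_mono) auto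
      then show False using r \<open>s2 = _\<close> assms(2) by simp
    qed
  qed
  ultimately have s2: "s2 = 0" by simp
  then have s1: "s1 = (3 * int p) * (- b)" using e(2) by simp
  have "- b = 0"
  proof (rule ccontr)
    assume "- b \<noteq> 0"
    then consider "- b \<ge> 1" | "- b \<le> -1" by linarith
    then show False
    proof cases
      case 1
      then have "(3 * int p) * 1 \<le> (3 * int p) * (- b)" by (intro mult_left_mono) auto
      then show False using r s1 by simp
    next
      case 2
      then have "(3 * int p) * (- b) \<le> (3 * int p) * -1" by (intro mult_left_mono) auto
      then have "s1 \<le> (3 * int p) * -1" by (subst s1)
      then show False using r assms(2) by simp
    qed
  qed
  then show "(s1, s2) = (0, 0)" using s1 s2 by simp
qed (simp add: int2_coset_def mu2_def forall_2)

text \<open>For $w = \tau + it$ the arguments of the error functions are real, so the terms are bounded by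
$|q^{pQ_2(n)}|$ and the limit may be taken termwise. Only the zero vector, which occurs for
$s = 0$ alone, contributes an additional $\frac13$.\<close>

lemma psihat_A2_limit:
  assumes p: "p > 0" and \<tau>: "\<tau> \<in> uhp" and s: "(s1, s2) \<in> A2_labels p"
  shows "((\<lambda>t::real. psihat_A2 p (s1, s2) \<tau> (\<tau> + \<i> * of_real t)) \<longlongrightarrow>
      1 / 3 * of_bool ((s1, s2) = (0, 0)) + (\<Sum>\<^sub>\<infinity>n\<in>int2_coset (mu2 p (s1, s2)). of_real (sgn (n $ 1) * sgn (n $ 2)) * qpow \<tau> (of_nat p * Q2 n))) at_top"
proof -
  let ?A = "int2_coset (mu2 p (s1, s2))"
  define l where "l = (\<lambda>n::real^2. (if n $ 1 = 0 \<and> n $ 2 = 0 then 1 / 3 else of_real (sgn (n $ 1) * sgn (n $ 2))) * qpow \<tau> (of_nat p * Q2 n))"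
  have trm: "A2_term p n \<tau> (\<tau> + \<i> * of_real t) = A2E p (n $ 1) (n $ 2) (of_real (sqrt t)) * qpow \<tau> (of_nat p * Q2 n)" if "t \<ge> 0" for t n
  proof -
    have "\<i> * (\<tau> + \<i> * of_real t - \<tau>) = - of_real t" by simp
    then show ?thesis unfolding A2_term_def gE_def using csqrt_minus_real[OF that] by (simp add: mult.assoc[symmetric])
  qed
  have "((\<lambda>t::real. \<Sum>\<^sub>\<infinity>n\<in>?A. A2_term p n \<tau> (\<tau> + \<i> * of_real t)) \<longlongrightarrow> (\<Sum>\<^sub>\<infinity>n\<in>?A. l n)) at_top"
  proof (rule tendsto_infsum_dominated[OF _ _ qpow_Q2_norm_summable[OF p \<tau>]])
    fix n :: "real^2"
    have "((\<lambda>t. A2E p (n $ 1) (n $ 2) (of_real (sqrt t)) * qpow \<tau> (of_nat p * Q2 n)) \<longlongrightarrow> l n) at_top"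
      unfolding l_def by (intro tendsto_mult tendsto_const tendsto_A2E p)
    moreover have "\<forall>\<^sub>F t in at_top. A2E p (n $ 1) (n $ 2) (of_real (sqrt t)) * qpow \<tau> (of_nat p * Q2 n) = A2_term p n \<tau> (\<tau> + \<i> * of_real t)"
      using eventually_ge_at_top[of 0] by eventually_elim (simp add: trm)
    ultimately show "((\<lambda>t. A2_term p n \<tau> (\<tau> + \<i> * of_real t)) \<longlongrightarrow> l n) at_top"
      by (rule Lim_transform_eventually)
  next
    show "\<forall>\<^sub>F t in at_top. \<forall>n\<in>?A. norm (A2_term p n \<tau> (\<tau> + \<i> * of_real t)) \<le> norm (qpow \<tau> (of_nat p * Q2 n))"
      using eventually_ge_at_top[of 0]
    proof eventually_elim
      case (elim t)
      show ?case
      proof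
        fix n
        show "norm (A2_term p n \<tau> (\<tau> + \<i> * of_real t)) \<le> norm (qpow \<tau> (of_nat p * Q2 n))"
          unfolding trm[OF elim] norm_mult using norm_A2E_real_le[OF p, of "n $ 1" "n $ 2" "sqrt t"]
          by (simp add: mult_left_le_one_le)
      qed
    qed
  qed simp
  moreover have "(\<Sum>\<^sub>\<infinity>n\<in>?A. l n) = 1 / 3 * of_bool ((s1, s2) = (0, 0)) + (\<Sum>\<^sub>\<infinity>n\<in>?A. of_real (sgn (n $ 1) * sgn (n $ 2)) * qpow \<tau> (of_nat p * Q2 n))"
  proof -
    have l: "l n = (if n = 0 then 1 / 3 else 0) + of_real (sgn (n $ 1) * sgn (n $ 2)) * qpow \<tau> (of_nat p * Q2 n)" for n
    proof (cases "n = 0")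
      case True
      then show ?thesis by (simp add: l_def Q2_eq Qr_def qpow_def)
    next
      case False
      then have "\<not> (n $ 1 = 0 \<and> n $ 2 = 0)" by (simp add: vec_eq_iff forall_2)
      then show ?thesis using False by (simp add: l_def)
    qed
    have h1: "((\<lambda>n::real^2. if n = 0 then 1 / 3 else 0 :: complex) has_sum (if 0 \<in> ?A then 1 / 3 else 0)) ?A"
    proof (cases "0 \<in> ?A")
      case True
      then show ?thesis by (intro has_sum_finite_neutralI[of "{0}"]) auto
    next
      case False
      then show ?thesis by (intro has_sum_finite_neutralI[of "{}"]) auto
    qed
    have s2: "(\<lambda>n. of_real (sgn (n $ 1) * sgn (n $ 2)) * qpow \<tau> (of_nat p * Q2 n)) summable_on ?A"
      by (rule abs_summable_summable[OF Infinite_Sum.abs_summable_on_comparison_test'[OF qpow_Q2_norm_summable[OF p \<tau>]]])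
        (auto simp: norm_mult abs_mult sgn_if)
    have "((\<lambda>n. l n) has_sum ((if 0 \<in> ?A then 1 / 3 else 0) + (\<Sum>\<^sub>\<infinity>n\<in>?A. of_real (sgn (n $ 1) * sgn (n $ 2)) * qpow \<tau> (of_nat p * Q2 n)))) ?A"
      unfolding l by (intro has_sum_add h1 has_sum_infsum s2)
    then show ?thesis unfolding zero_in_coset_iff[OF s p] by (simp add: infsumI)
  qed
  ultimately show ?thesis unfolding psihat_A2_eq[OF p] by simp
qed

lemma psi_A2_eq:
  assumes p: "p > 0" and \<tau>: "\<tau> \<in> uhp" and s: "(s1, s2) \<in> A2_labels p"
  shows "psi_A2 p (s1, s2) \<tau> = 1 / 3 * of_bool ((s1, s2) = (0, 0)) + (\<Sum>\<^sub>\<infinity>n\<in>int2_coset (mu2 p (s1, s2)). of_real (sgn (n $ 1) * sgn (n $ 2)) * qpow \<tau> (of_nat p * Q2 n))"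
  unfolding psi_A2_def by (rule tendsto_Lim[OF _ psihat_A2_limit[OF assms]]) simp

lemma psi_A2_holomorphic:
  assumes p: "p > 0" and s: "(s1, s2) \<in> A2_labels p"
  shows "psi_A2 p (s1, s2) holomorphic_on uhp"
proof -
  let ?A = "int2_coset (mu2 p (s1, s2))"
  have "locally_dominated ?A (uhp \<times> uhp) (\<lambda>n q. of_real (sgn (n $ 1) * sgn (n $ 2)) * qpow (fst q) (of_nat p * Q2 n))"
  proof (rule locally_dominated_uhp2)
    show "(\<lambda>n::real^2. exp (0 * (\<bar>n $ 1\<bar> + \<bar>n $ 2\<bar>) - (pi * p * c) * ((n $ 1)\<^sup>2 + (n $ 2)\<^sup>2))) summable_on ?A" if "c > 0" for c
      using p that by (intro summable_on_gauss_int2_coset) simp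
    show "norm (of_real (sgn (n $ 1) * sgn (n $ 2)) * qpow (fst (\<tau>, w)) (of_nat p * Q2 n)) \<le> exp (0 * (\<bar>n $ 1\<bar> + \<bar>n $ 2\<bar>) - (pi * p * c) * ((n $ 1)\<^sup>2 + (n $ 2)\<^sup>2))"
      if "c > 0" "Im \<tau> > c" for c n \<tau> and w :: complex
    proof -
      have "norm (of_real (sgn (n $ 1) * sgn (n $ 2)) * qpow (fst (\<tau>, w)) (of_nat p * Q2 n)) \<le> norm (qpow \<tau> (of_nat p * Q2 n))"
        by (auto simp: norm_mult abs_mult sgn_if)
      then show ?thesis using norm_qpow_Q2_le[of c \<tau> p n] that by simp
    qed
  qed
  from locally_dominated_slice1[OF this, of \<i>]
  have d: "locally_dominated ?A uhp (\<lambda>n \<tau>. of_real (sgn (n $ 1) * sgn (n $ 2)) * qpow \<tau> (of_nat p * Q2 n))"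
    by (simp add: uhp_def)
  have "(\<lambda>\<tau>. 1 / 3 * of_bool ((s1, s2) = (0, 0)) + (\<Sum>\<^sub>\<infinity>n\<in>?A. of_real (sgn (n $ 1) * sgn (n $ 2)) * qpow \<tau> (of_nat p * Q2 n))) holomorphic_on uhp"
    by (intro holomorphic_on_add holomorphic_on_const holomorphic_infsum[OF open_uhp d] holomorphic_on_mult qpow_holomorphic)
  then show ?thesis
    by (rule holomorphic_transform) (simp add: psi_A2_eq[OF p _ s])
qed

lemma qpow_norm_summable:
  assumes p: "p > 0" and \<tau>: "\<tau> \<in> uhp"
  shows "(\<lambda>n. norm (qpow \<tau> (of_nat p * n\<^sup>2))) summable_on int_coset x"
proof -
  have "(\<lambda>n. exp (0 * \<bar>n\<bar> - (2 * pi * p * Im \<tau>) * n\<^sup>2)) summable_on int_coset x"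
    using p \<tau> by (intro summable_on_gauss_int_coset) (simp add: uhp_def)
  then show ?thesis by (simp add: norm_qpow mult_ac)
qed

text \<open>The limit of \<open>psihat_A1\<close> for $w \to \tau + i\infty$, a false theta function.\<close>

definition psi_A1 :: "nat \<Rightarrow> int \<Rightarrow> complex \<Rightarrow> complex" where
  "psi_A1 p s \<tau> = (\<Sum>\<^sub>\<infinity>n\<in>int_coset (of_int s / (2 * of_nat p)). of_real (sgn n) * qpow \<tau> (of_nat p * n\<^sup>2))"

lemma psihat_A1_limit:
  assumes p: "p > 0" and \<tau>: "\<tau> \<in> uhp"
  shows "((\<lambda>t::real. psihat_A1 p s \<tau> (\<tau> + \<i> * of_real t)) \<longlongrightarrow> psi_A1 p s \<tau>) at_top"
proof -
  let ?A = "int_coset (of_int s / (2 * of_nat p))"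
  have trm: "cerf (- \<i> * csqrt (2 * of_real pi * \<i> * of_nat p * (\<tau> + \<i> * of_real t - \<tau>)) * of_real n) * qpow \<tau> (of_nat p * n\<^sup>2) =
     cerf (of_real (sqrt ((2 * pi * p) * t) * n)) * qpow \<tau> (of_nat p * n\<^sup>2)" if "t \<ge> 0" for t n
  proof -
    have "2 * of_real pi * \<i> * of_nat p * (\<tau> + \<i> * of_real t - \<tau>) = - complex_of_real ((2 * pi * p) * t)" by simp
    moreover have "csqrt (- complex_of_real ((2 * pi * p) * t)) = \<i> * of_real (sqrt ((2 * pi * p) * t))"
      using that by (intro csqrt_minus_real) simp
    ultimately have "csqrt (2 * of_real pi * \<i> * of_nat p * (\<tau> + \<i> * of_real t - \<tau>)) = \<i> * of_real (sqrt ((2 * pi * p) * t))" by (simp only:)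
    then show ?thesis by (simp only: of_real_mult mult.assoc[symmetric]) (simp add: mult.assoc)
  qed
  show ?thesis
    unfolding psihat_A1_def psi_A1_def
  proof (rule tendsto_infsum_dominated[OF _ _ qpow_norm_summable[OF p \<tau>]])
    fix n :: real
    have "((\<lambda>t. cerf (of_real (sqrt ((2 * pi * p) * t) * n)) * qpow \<tau> (of_nat p * n\<^sup>2)) \<longlongrightarrow> of_real (sgn n) * qpow \<tau> (of_nat p * n\<^sup>2)) at_top"
      using p by (intro tendsto_mult tendsto_const tendsto_cerf_real) simp
    moreover have "\<forall>\<^sub>F t in at_top. cerf (of_real (sqrt ((2 * pi * p) * t) * n)) * qpow \<tau> (of_nat p * n\<^sup>2) =
       cerf (- \<i> * csqrt (2 * of_real pi * \<i> * of_nat p * (\<tau> + \<i> * of_real t - \<tau>)) * of_real n) * qpow \<tau> (of_nat p * n\<^sup>2)"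
      using eventually_ge_at_top[of 0] by eventually_elim (simp only: trm)
    ultimately show "((\<lambda>t::real. cerf (- \<i> * csqrt (2 * of_real pi * \<i> * of_nat p * (\<tau> + \<i> * of_real t - \<tau>)) * of_real n) * qpow \<tau> (of_nat p * n\<^sup>2)) \<longlongrightarrow> of_real (sgn n) * qpow \<tau> (of_nat p * n\<^sup>2)) at_top"
      by (rule Lim_transform_eventually)
  next
    show "\<forall>\<^sub>F t::real in at_top. \<forall>n\<in>?A. norm (cerf (- \<i> * csqrt (2 * of_real pi * \<i> * of_nat p * (\<tau> + \<i> * of_real t - \<tau>)) * of_real n) * qpow \<tau> (of_nat p * n\<^sup>2)) \<le> norm (qpow \<tau> (of_nat p * n\<^sup>2))"
      using eventually_ge_at_top[of 0]
    proof eventually_elim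
      case (elim t)
      show ?case
        unfolding trm[OF elim] norm_mult by (intro ballI mult_left_le_one_le norm_cerf_real_le) auto
    qed
  qed simp
qed

lemma psi_A1_holomorphic:
  assumes p: "p > 0"
  shows "psi_A1 p s holomorphic_on uhp"
proof -
  let ?A = "int_coset (of_int s / (2 * of_nat p))"
  have "locally_dominated ?A (uhp \<times> uhp) (\<lambda>n q. of_real (sgn n) * qpow (fst q) (of_nat p * n\<^sup>2))"
  proof (rule locally_dominated_uhp2)
    show "(\<lambda>n. exp (0 * \<bar>n\<bar> - (2 * pi * p * c) * n\<^sup>2)) summable_on ?A" if "c > 0" for c
      using p that by (intro summable_on_gauss_int_coset) simp
    show "norm (of_real (sgn n) * qpow (fst (\<tau>, w)) (of_nat p * n\<^sup>2)) \<le> exp (0 * \<bar>n\<bar> - (2 * pi * p * c) * n\<^sup>2)"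
      if "c > 0" "Im \<tau> > c" for c n \<tau> and w :: complex
    proof -
      have "norm (of_real (sgn n) * qpow (fst (\<tau>, w)) (of_nat p * n\<^sup>2)) \<le> norm (qpow \<tau> (of_nat p * n\<^sup>2))"
        by (auto simp: norm_mult sgn_if)
      also have "\<dots> = exp (- (2 * pi * p * n\<^sup>2 * Im \<tau>))" by (simp add: norm_qpow mult_ac)
      also have "\<dots> \<le> exp (- (2 * pi * p * n\<^sup>2 * c))"
        using that by (auto intro!: mult_left_mono)
      finally show ?thesis by (simp add: mult_ac)
    qed
  qed
  from locally_dominated_slice1[OF this, of \<i>]
  have d: "locally_dominated ?A uhp (\<lambda>n \<tau>. of_real (sgn n) * qpow \<tau> (of_nat p * n\<^sup>2))"
    by (simp add: uhp_def)
  show ?thesis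
    unfolding psi_A1_def[abs_def]
    by (intro holomorphic_infsum[OF open_uhp d] holomorphic_on_mult holomorphic_on_const qpow_holomorphic)
qed

section \<open>Poisson summation for Gaussians\<close>

text \<open>A rescaling of the characteristic function of the normal distribution.\<close>

lemma integral_gauss_e2:
  assumes t: "t > 0"
  shows "(LINT v|lborel. exp (- of_real (pi * t) * (of_real v)\<^sup>2) * e2 (of_real (\<xi> * v))) = of_real (exp (- pi * \<xi>\<^sup>2 / t) / sqrt t)"
proof -
  define s where "s = 1 / sqrt (2 * pi * t)"
  have s0: "s > 0" using t by (simp add: s_def)
  have s2: "s\<^sup>2 = 1 / (2 * pi * t)" using t by (simp add: s_def power_divide)
  have "(LINT x|density lborel std_normal_density. iexp (2 * pi * \<xi> * s * x)) = (LINT x|lborel. std_normal_density x *\<^sub>R iexp (2 * pi * \<xi> * s * x))"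
    by (rule integral_density) (auto simp: normal_density_nonneg)
  then have c: "(LINT x|lborel. std_normal_density x *\<^sub>R iexp (2 * pi * \<xi> * s * x)) = of_real (exp (- ((2 * pi * \<xi> * s)\<^sup>2) / 2))"
    using fun_cong[OF char_std_normal_distribution, of "2 * pi * \<xi> * s"] unfolding char_def by simp
  let ?f = "\<lambda>v. exp (- of_real (pi * t) * (of_real v)\<^sup>2) * e2 (of_real (\<xi> * v))"
  have "(LINT v|lborel. ?f v) = \<bar>s\<bar> *\<^sub>R (LINT x|lborel. ?f (0 + s * x))"
    using s0 by (intro lborel_integral_real_affine) simp
  also have "(LINT x|lborel. ?f (0 + s * x)) = (LINT x|lborel. of_real (sqrt (2 * pi)) * (std_normal_density x *\<^sub>R iexp (2 * pi * \<xi> * s * x)))"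
  proof (rule Bochner_Integration.integral_cong[OF refl])
    fix x :: real
    have "pi * t * (s * x)\<^sup>2 = x\<^sup>2 / 2" using t s2 by (simp add: power_mult_distrib)
    then have "exp (- of_real (pi * t) * (of_real (0 + s * x))\<^sup>2) = complex_of_real (exp (- (x\<^sup>2 / 2)))"
      by (simp only: add_0 exp_of_real[symmetric] of_real_minus[symmetric] of_real_mult[symmetric] of_real_power[symmetric] mult_minus_left)
    moreover have "complex_of_real (exp (- (x\<^sup>2 / 2))) = of_real (sqrt (2 * pi)) * of_real (std_normal_density x)"
      by (simp add: std_normal_density_def)
    moreover have "e2 (of_real (\<xi> * (0 + s * x))) = iexp (2 * pi * \<xi> * s * x)"
      unfolding e2_def by (rule arg_cong[where f = exp]) simp
    ultimately show "?f (0 + s * x) = of_real (sqrt (2 * pi)) * (std_normal_density x *\<^sub>R iexp (2 * pi * \<xi> * s * x))"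
      by (simp only: scaleR_conv_of_real mult.assoc)
  qed
  also have "\<dots> = of_real (sqrt (2 * pi)) * of_real (exp (- ((2 * pi * \<xi> * s)\<^sup>2) / 2))"
    by (simp only: Bochner_Integration.integral_mult_right_zero c)
  also have "\<bar>s\<bar> *\<^sub>R (of_real (sqrt (2 * pi)) * of_real (exp (- ((2 * pi * \<xi> * s)\<^sup>2) / 2))) = complex_of_real (\<bar>s\<bar> * (sqrt (2 * pi) * exp (- ((2 * pi * \<xi> * s)\<^sup>2) / 2)))"
    by (simp add: scaleR_conv_of_real)
  also have "(2 * pi * \<xi> * s)\<^sup>2 / 2 = pi * \<xi>\<^sup>2 / t"
    unfolding power_mult_distrib s2 using t by (simp add: power2_eq_square)
  then have "- ((2 * pi * \<xi> * s)\<^sup>2) / 2 = - pi * \<xi>\<^sup>2 / t" by simp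
  also have "\<bar>s\<bar> * (sqrt (2 * pi) * exp (- pi * \<xi>\<^sup>2 / t)) = exp (- pi * \<xi>\<^sup>2 / t) / sqrt t"
    using t by (simp add: s_def real_sqrt_mult)
  finally show ?thesis .
qed

lemma filterlim_symmetric_intervals: "filterlim (\<lambda>N::nat. {- int N..int N}) (finite_subsets_at_top UNIV) sequentially"
  unfolding filterlim_finite_subsets_at_top
proof (intro allI impI)
  fix X :: "int set" assume X: "finite X \<and> X \<subseteq> UNIV"
  define B where "B = nat (Max (insert 0 (abs ` X)))"
  have "\<bar>x\<bar> \<le> int B" if "x \<in> X" for x
  proof -
    have "\<bar>x\<bar> \<le> Max (insert 0 (abs ` X))" using X that by (intro Max_ge) auto
    moreover have "0 \<le> Max (insert 0 (abs ` X))" using X by (intro Max_ge) auto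
    ultimately show ?thesis unfolding B_def by simp
  qed
  then have "X \<subseteq> {- int N..int N}" if "N \<ge> B" for N
    using that by force
  then show "\<forall>\<^sub>F N in sequentially. finite {- int N..int N} \<and> X \<subseteq> {- int N..int N} \<and> {- int N..int N} \<subseteq> UNIV"
    by (auto intro!: eventually_sequentiallyI[of B])
qed

lemma e2_eq_1_small:
  assumes "e2 z = 1" "norm z < 1" shows "z = 0"
proof -
  have "exp (2 * of_real pi * \<i> * z) = 1" using assms(1) by (simp add: e2_def)
  then obtain n :: int where re: "Re (2 * of_real pi * \<i> * z) = 0" and im: "Im (2 * of_real pi * \<i> * z) = of_int (2 * n) * pi"
    unfolding exp_eq_1 by auto
  from re have "Im z = 0" by simp
  moreover from im have "Re z = of_int n" by simp
  ultimately have z: "z = of_int n" by (simp add: complex_eq_iff)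
  with assms(2) have "\<bar>n\<bar> < 1" by (simp flip: of_int_abs)
  then show ?thesis using z by simp
qed

text \<open>The characters of the circle. Fourier coefficients are integrals over $[-\frac12, \frac12]$, a segment that
contains no integer except $0$.\<close>

abbreviation ek :: "int \<Rightarrow> real \<Rightarrow> complex" where
  "ek k x \<equiv> e2 (- of_int k * of_real x)"

lemma ek_continuous: "continuous_on S (ek k)"
  unfolding e2_def by (intro continuous_intros)

lemma ek_has_vector_derivative: "(ek k has_vector_derivative - 2 * of_real pi * \<i> * of_int k * ek k x) (at x within S)"
proof -
  have "((\<lambda>z. - of_int k * z) has_field_derivative - of_int k) (at (of_real x))" by (auto intro!: derivative_eq_intros)
  from has_vector_derivative_real_field[OF DERIV_chain2[where f = e2, OF e2_has_field_derivative this]]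
  show ?thesis by (simp add: mult_ac)
qed

lemma ek_half: "ek k (1/2) = ek k (-1/2)"
proof -
  have "- of_int k * complex_of_real (-1/2) = - of_int k * complex_of_real (1/2) + of_int k" by (simp add: field_simps)
  then show ?thesis by (simp only: e2_add e2_of_int mult_1_right)
qed

lemma ek_has_integral: "(ek k has_integral (if k = 0 then 1 else 0)) {-1/2..1/2}"
proof (cases "k = 0")
  case True
  have "((\<lambda>x::real. 1::complex) has_integral of_real (1/2 - (-1/2))) {-1/2..1/2}"
    using has_integral_const_real[of "1::complex" "-1/2" "1/2"] by (simp add: scaleR_conv_of_real)
  then show ?thesis using True by simp
next
  case False
  define K where "K = - 2 * of_real pi * \<i> * of_int k"
  have K: "K \<noteq> 0" using False by (simp add: K_def)
  \<comment> \<open>The character itself is a primitive up to the factor $K \neq 0$.\<close>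
  have "((\<lambda>x. K * ek k x) has_integral (ek k (1/2) - ek k (-1/2))) {-1/2..1/2}"
    unfolding K_def by (rule fundamental_theorem_of_calculus) (use ek_has_vector_derivative in auto)
  then have "((\<lambda>x. inverse K * (K * ek k x)) has_integral inverse K * 0) {-1/2..1/2}"
    unfolding ek_half diff_self by (rule has_integral_mult_right)
  then show ?thesis using False K by (simp add: mult.assoc[symmetric])
qed

text \<open>Integration by parts: the boundary terms at $\pm\frac12$ and the integral of $g'$ are bounded, and both are
divided by $2\pi i k$.\<close>

lemma fourier_coefficient_decay:
  assumes U: "open U" and g: "g holomorphic_on U" and seg: "\<And>x::real. x \<in> {-1/2..1/2} \<Longrightarrow> of_real x \<in> U"
  obtains C where "\<And>k. k \<noteq> 0 \<Longrightarrow> norm (integral {-1/2..1/2} (\<lambda>x. g (of_real x) * ek k x)) \<le> C / \<bar>of_int k\<bar>"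
proof -
  let ?I = "{-1/2..1/2::real}"
  have on_segment: "continuous_on ?I (\<lambda>x. h (of_real x))" if "h holomorphic_on U" for h
    by (rule continuous_on_compose2[OF holomorphic_on_imp_continuous_on[OF that]]) (auto intro!: continuous_intros seg)
  note gc = on_segment[OF g] and g'c = on_segment[OF holomorphic_deriv[OF g U]]
  have bounded: "\<exists>B. \<forall>x\<in>?I. norm (h x) \<le> B" if "continuous_on ?I h" for h :: "real \<Rightarrow> complex"
    using compact_imp_bounded[OF compact_continuous_image[OF that compact_Icc]] unfolding bounded_iff by auto
  obtain B where B: "\<And>x. x \<in> ?I \<Longrightarrow> norm (g (of_real x)) \<le> B" using bounded[OF gc] by blast
  obtain B' where B': "\<And>x. x \<in> ?I \<Longrightarrow> norm (deriv g (of_real x)) \<le> B'" using bounded[OF g'c] by blast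
  have bound: "norm (integral ?I (\<lambda>x. g (of_real x) * ek k x)) \<le> ((2 * B + B') / (2 * pi)) / \<bar>of_int k\<bar>" if k: "k \<noteq> 0" for k
  proof -
    define K where "K = - 2 * of_real pi * \<i> * of_int k"
    have K: "K \<noteq> 0" and nK: "norm K = 2 * pi * \<bar>of_int k\<bar>" using k by (simp_all add: K_def norm_mult)
    have ne: "norm (ek k x) = 1" for x by (simp add: norm_e2)
    let ?J = "integral ?I (\<lambda>x. deriv g (of_real x) * ek k x)" and ?G = "integral ?I (\<lambda>x. g (of_real x) * ek k x)"
    let ?X = "g (of_real (1/2)) * ek k (1/2)" and ?Y = "g (of_real (-1/2)) * ek k (-1/2)"
    have "((\<lambda>x. g (of_real x) * (K * ek k x) + deriv g (of_real x) * ek k x) has_integral (?X - ?Y)) ?I"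
    proof (rule fundamental_theorem_of_calculus)
      fix x assume x: "x \<in> ?I"
      have "((\<lambda>x. g (of_real x)) has_vector_derivative deriv g (of_real x)) (at x within ?I)"
        by (rule has_vector_derivative_real_field[OF holomorphic_derivI[OF g U seg[OF x]]])
      from has_vector_derivative_mult[OF this ek_has_vector_derivative]
      show "((\<lambda>x. g (of_real x) * ek k x) has_vector_derivative g (of_real x) * (K * ek k x) + deriv g (of_real x) * ek k x) (at x within ?I)"
        unfolding K_def .
    qed simp
    moreover have "((\<lambda>x. K * (g (of_real x) * ek k x) + deriv g (of_real x) * ek k x) has_integral (K * ?G + ?J)) ?I"
      by (intro has_integral_add has_integral_mult_right integrable_integral integrable_continuous_real continuous_intros gc g'c ek_continuous)
    ultimately have "K * ?G + ?J = ?X - ?Y"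
      by (intro has_integral_unique[of "\<lambda>x. K * (g (of_real x) * ek k x) + deriv g (of_real x) * ek k x"]) (simp_all only: mult.left_commute)
    then have "K * ?G = ?X - ?Y - ?J" by (simp only: eq_diff_eq)
    then have "norm K * norm ?G = norm (?X - ?Y - ?J)" by (simp only: norm_mult[symmetric])
    also have "\<dots> \<le> norm ?X + norm ?Y + norm ?J"
      by (rule order_trans[OF norm_triangle_ineq4 add_right_mono[OF norm_triangle_ineq4]])
    also have "\<dots> \<le> B + B + B'"
    proof (intro add_mono)
      show "norm ?X \<le> B" "norm ?Y \<le> B" unfolding norm_mult ne using B[of "1/2"] B[of "-1/2"] by auto
      have "norm ?J \<le> B' * (1/2 - (-1/2))"
      proof (rule integral_bound)
        show "norm (deriv g (of_real x) * ek k x) \<le> B'" if "x \<in> ?I" for x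
          unfolding norm_mult ne using B'[OF that] by simp
      qed (simp, intro continuous_intros g'c ek_continuous)
      then show "norm ?J \<le> B'" by simp
    qed
    finally show ?thesis using k unfolding nK by (simp add: field_simps)
  qed
  then show ?thesis by (rule that)
qed

text \<open>Chernoff's argument. Write $f(z) = f(0) + (e^{2\pi i z} - 1) g(z)$ with \<open>g\<close> holomorphic near the segment.
Then the $k$-th coefficient of \<open>f\<close> is a difference of consecutive coefficients of \<open>g\<close>, apart from $f(0)$ at
$k = 0$, and the symmetric partial sums telescope to $f(0)$ plus two coefficients of \<open>g\<close>, which tend to
$0$.\<close>

lemma fourier_series_at_0:
  assumes f: "f holomorphic_on UNIV"
  shows "(\<lambda>N::nat. \<Sum>k\<in>{- int N..int N}. integral {-1/2..1/2} (\<lambda>x. f (of_real x) * ek k x)) \<longlonglongrightarrow> f 0"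
proof -
  define c where "c = (\<lambda>k. integral {-1/2..1/2} (\<lambda>x. f (of_real x) * ek k x))"
  \<comment> \<open>Contains the segment, and $0$ is its only integer.\<close>
  define U where "U = ball (0::complex) (3/4)"
  define P where "P = (\<lambda>z. if z = 0 then deriv f 0 else (f z - f 0) / (z - 0))"
  define D where "D = (\<lambda>z. if z = 0 then deriv e2 0 else (e2 z - e2 0) / (z - 0))"
  define g where "g = (\<lambda>z. P z / D z)"
  have U: "open U" "0 \<in> interior U" unfolding U_def by auto
  have e2h: "e2 holomorphic_on S" for S unfolding e2_def[abs_def] by (intro holomorphic_intros)
  have Ph: "P holomorphic_on U" unfolding P_def by (rule pole_lemma[OF holomorphic_on_subset[OF f] U(2)]) simp
  have Dh: "D holomorphic_on U" unfolding D_def by (rule pole_lemma[OF e2h U(2)])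
  have e2U: "e2 z \<noteq> 1" if "z \<in> U" "z \<noteq> 0" for z
    using e2_eq_1_small[of z] that by (auto simp: U_def)
  have D0: "D z \<noteq> 0" if "z \<in> U" for z
    using e2U[OF that] DERIV_imp_deriv[OF e2_has_field_derivative[of 0]] by (simp add: D_def)
  have gh: "g holomorphic_on U" unfolding g_def by (intro holomorphic_on_divide Ph Dh D0)
  have eq: "f z = f 0 + (e2 z - 1) * g z" if "z \<in> U" for z
  proof (cases "z = 0")
    case False
    then have "(e2 z - 1) * g z = f z - f 0" using e2U[OF that] by (simp add: g_def P_def D_def)
    then show ?thesis by simp
  qed simp
  have seg: "of_real x \<in> U" if "x \<in> {-1/2..1/2}" for x :: real
    using that by (auto simp: U_def)
  have gc: "continuous_on {-1/2..1/2} (\<lambda>x::real. g (of_real x))"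
    by (rule continuous_on_compose2[OF holomorphic_on_imp_continuous_on[OF gh]]) (auto intro!: continuous_intros seg)
  define d where "d = (\<lambda>k. integral {-1/2..1/2} (\<lambda>x. g (of_real x) * ek k x))"
  have ck: "c k = (if k = 0 then f 0 else 0) + (d (k - 1) - d k)" for k
  proof -
    have "((\<lambda>x. f 0 * ek k x + (g (of_real x) * ek (k - 1) x - g (of_real x) * ek k x))
       has_integral (f 0 * (if k = 0 then 1 else 0) + (d (k - 1) - d k))) {-1/2..1/2}"
      unfolding d_def by (intro has_integral_add has_integral_diff has_integral_mult_right ek_has_integral integrable_integral integrable_continuous_real continuous_on_mult gc ek_continuous)
    then have "((\<lambda>x. f (of_real x) * ek k x) has_integral (f 0 * (if k = 0 then 1 else 0) + (d (k - 1) - d k))) {-1/2..1/2}"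
    proof (rule has_integral_eq[rotated])
      fix x :: real assume x: "x \<in> {-1/2..1/2}"
      have "- of_int (k - 1) * complex_of_real x = of_real x + - of_int k * of_real x" by (simp add: algebra_simps)
      then have e: "ek (k - 1) x = e2 (of_real x) * ek k x" by (simp only: e2_add)
      show "f 0 * ek k x + (g (of_real x) * ek (k - 1) x - g (of_real x) * ek k x) = f (of_real x) * ek k x"
        unfolding eq[OF seg[OF x]] e by (simp add: algebra_simps)
    qed
    then show ?thesis unfolding c_def by (simp add: integral_unique)
  qed
  have tele: "(\<Sum>k\<in>{- int N..int N}. c k) = f 0 + (d (- int N - 1) - d (int N))" for N
  proof -
    have "(\<Sum>k\<in>{- int N..int N}. d (k - 1) - d k) = d (- int N - 1) - d (int N)"
    proof (induction N)
      case (Suc N)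
      have "{- int (Suc N)..int (Suc N)} = insert (- int (Suc N)) (insert (int (Suc N)) {- int N..int N})" by auto
      moreover have "- int N - 1 = -1 - int N" by simp
      ultimately show ?case using Suc by (simp only: of_nat_Suc) (simp add: \<open>- int N - 1 = -1 - int N\<close>)
    qed simp
    then show ?thesis unfolding ck sum.distrib by simp
  qed
  obtain C where C: "\<And>k. k \<noteq> 0 \<Longrightarrow> norm (d k) \<le> C / \<bar>of_int k\<bar>"
    unfolding d_def using fourier_coefficient_decay[OF U(1) gh seg] by blast
  have l1: "(\<lambda>N. d (- int N - 1)) \<longlonglongrightarrow> 0"
  proof (rule Lim_null_comparison)
    have "norm (d (- int N - 1)) \<le> C / (real N + 1)" for N using C[of "- int N - 1"] by (simp add: add.commute)
    then show "\<forall>\<^sub>F N in sequentially. norm (d (- int N - 1)) \<le> C / (real N + 1)" by simp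
    show "(\<lambda>N. C / (real N + 1)) \<longlonglongrightarrow> 0" by real_asymp
  qed
  have l2: "(\<lambda>N. d (int N)) \<longlonglongrightarrow> 0"
  proof (rule Lim_null_comparison)
    show "\<forall>\<^sub>F N in sequentially. norm (d (int N)) \<le> C / real N"
      using eventually_gt_at_top[of 0] by eventually_elim (use C[of "int _"] in auto)
    show "(\<lambda>N. C / real N) \<longlonglongrightarrow> 0" by real_asymp
  qed
  show ?thesis
    using tendsto_add[OF tendsto_const[of "f 0"] tendsto_diff[OF l1 l2]] unfolding tele[unfolded c_def] by simp
qed

text \<open>The summand of the theta series with characteristics, $e^{-\pi t (z+x)^2 + 2\pi i (z+x) y}$.\<close>

definition pg :: "real \<Rightarrow> real \<Rightarrow> real \<Rightarrow> complex \<Rightarrow> complex" where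
  "pg t x y z = exp (- of_real (pi * t) * (z + of_real x)\<^sup>2) * e2 ((z + of_real x) * of_real y)"

lemma norm_pg_le:
  assumes "t > 0" "norm z \<le> R"
  shows "norm (pg t x y (of_real u + z)) \<le> exp (pi * t * (R + \<bar>x\<bar>)\<^sup>2) * exp (2 * pi * \<bar>y\<bar> * R) * exp (2 * (pi * t) * (R + \<bar>x\<bar>) * \<bar>u\<bar> - (pi * t) * u\<^sup>2)"
proof -
  have "norm (- (z + of_real x)) \<le> R + \<bar>x\<bar>"
    using norm_triangle_ineq[of z "of_real x"] assms(2) by (simp only: norm_minus_cancel norm_of_real)
  note n = norm_gauss_shift_le[OF _ this, of "pi * t" u]
  have "of_real u - - (z + of_real x) = of_real u + z + of_real x" by simp
  from n[unfolded this] assms(1)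
  have 1: "norm (exp (- of_real (pi * t) * (of_real u + z + of_real x)\<^sup>2)) \<le> exp (pi * t * (R + \<bar>x\<bar>)\<^sup>2) * exp (2 * (pi * t) * (R + \<bar>x\<bar>) * \<bar>u\<bar> - (pi * t) * u\<^sup>2)"
    by simp
  have "- (Im z * y) \<le> \<bar>Im z\<bar> * \<bar>y\<bar>" by (simp add: abs_mult[symmetric])
  also have "\<dots> \<le> R * \<bar>y\<bar>" using abs_Im_le_cmod[of z] assms(2) by (intro mult_right_mono) auto
  finally have "2 * pi * (- (Im z * y)) \<le> 2 * pi * (R * \<bar>y\<bar>)" by (intro mult_left_mono) auto
  then have 2: "norm (e2 ((of_real u + z + of_real x) * of_real y)) \<le> exp (2 * pi * \<bar>y\<bar> * R)"
    unfolding norm_e2 by (simp add: mult_ac)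
  have "norm (pg t x y (of_real u + z)) \<le> (exp (pi * t * (R + \<bar>x\<bar>)\<^sup>2) * exp (2 * (pi * t) * (R + \<bar>x\<bar>) * \<bar>u\<bar> - (pi * t) * u\<^sup>2)) * exp (2 * pi * \<bar>y\<bar> * R)"
    unfolding pg_def norm_mult by (intro mult_mono 1 2) auto
  then show ?thesis by (simp add: mult_ac)
qed

lemma summable_on_gauss_int: "c > 0 \<Longrightarrow> (\<lambda>k::int. exp (b * \<bar>of_int k :: real\<bar> - c * (of_int k)\<^sup>2)) summable_on UNIV"
  using summable_on_gauss_int_coset[of c b 0] summable_on_reindex_bij_betw[OF bij_betw_int_coset[of 0], of "\<lambda>n. exp (b * \<bar>n\<bar> - c * n\<^sup>2)"]
  by simp

lemma pg_dominated:
  assumes t: "t > 0"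
  shows "locally_dominated (UNIV :: int set) UNIV (\<lambda>k z. pg t x y (of_int k + z))"
  unfolding locally_dominated_def
proof
  fix z :: complex
  define R where "R = norm z + 1"
  define M where "M = (\<lambda>k::int. exp (pi * t * (R + \<bar>x\<bar>)\<^sup>2) * exp (2 * pi * \<bar>y\<bar> * R) * exp ((2 * (pi * t) * (R + \<bar>x\<bar>)) * \<bar>of_int k\<bar> - (pi * t) * (of_int k)\<^sup>2))"
  have "M summable_on UNIV" unfolding M_def using t by (intro summable_on_cmult_right summable_on_gauss_int) simp
  moreover have "norm (pg t x y (of_int k + z')) \<le> M k" if "z' \<in> ball 0 R" for k z'
    using norm_pg_le[OF t, of z' R x y "of_int k"] that unfolding M_def by simp
  ultimately show "\<exists>U M. open U \<and> z \<in> U \<and> M summable_on UNIV \<and> (\<forall>k\<in>UNIV. \<forall>z'\<in>U \<inter> UNIV. norm (pg t x y (of_int k + z')) \<le> M k)"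
    by (intro exI[of _ "ball 0 R"] exI[of _ M]) (simp add: R_def)
qed

lemma pg_holomorphic: "f holomorphic_on S \<Longrightarrow> (\<lambda>z. pg t x y (f z)) holomorphic_on S"
  unfolding pg_def e2_def by (intro holomorphic_intros)

lemma pg_continuous: "continuous_on S f \<Longrightarrow> continuous_on S (\<lambda>z. pg t x y (f z))"
  unfolding pg_def e2_def by (intro continuous_intros)

text \<open>Unfolding: the integrals over $[-\frac12, \frac12]$ of the shifted Gaussians add up to the integral over the
line.\<close>

lemma poisson_gauss_coeff:
  fixes k :: int and x y :: real
  assumes t: "t > 0"
  defines "f \<equiv> (\<lambda>z. \<Sum>\<^sub>\<infinity>n::int. pg t x y (of_int n + z))"
  shows "integral {-1/2..1/2} (\<lambda>u::real. f (of_real u) * ek k u) = e2 (of_int k * of_real x) * of_real (exp (- pi * (y - of_int k)\<^sup>2 / t) / sqrt t)"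
proof -
  define h where "h = (\<lambda>u::real. pg t x y (of_real u) * ek k u)"
  have hc: "continuous_on S h" for S unfolding h_def e2_def by (intro continuous_intros pg_continuous)
  have hi: "h integrable_on {a..b}" for a b by (intro integrable_continuous_real hc)
  let ?R = "1/2 :: real"
  define M where "M = (\<lambda>n::int. exp (pi * t * (?R + \<bar>x\<bar>)\<^sup>2) * exp (2 * pi * \<bar>y\<bar> * ?R) * exp ((2 * (pi * t) * (?R + \<bar>x\<bar>)) * \<bar>of_int n\<bar> - (pi * t) * (of_int n)\<^sup>2))"
  have Ms: "M summable_on UNIV" unfolding M_def using t by (intro summable_on_cmult_right summable_on_gauss_int) simp
  have hn: "h (of_int n + u) = pg t x y (of_int n + of_real u) * ek k u" for n :: int and u
  proof -
    have "- of_int k * complex_of_real (of_int n + u) = of_int (- k * n) + - of_int k * of_real u" by (simp add: algebra_simps)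
    then have "e2 (- of_int k * complex_of_real (of_int n + u)) = ek k u" by (simp only: e2_add e2_of_int mult_1_left)
    then show ?thesis unfolding h_def by simp
  qed
  have ul: "uniform_limit {-1/2..1/2} (\<lambda>F u. \<Sum>n\<in>F. h (of_int n + u)) (\<lambda>u. \<Sum>\<^sub>\<infinity>n::int. h (of_int n + u)) (finite_subsets_at_top UNIV)"
  proof (rule Weierstrass_m_test_general[OF _ Ms])
    fix n :: int and u :: real assume u: "u \<in> {-1/2..1/2}"
    have "norm (pg t x y (of_int n + of_real u)) \<le> M n"
      using norm_pg_le[OF t, of "of_real u" "1/2" x y "of_int n"] u unfolding M_def by auto
    then show "norm (h (of_int n + u)) \<le> M n" unfolding hn norm_mult by (simp add: norm_e2)
  qed
  have shc: "continuous_on {-1/2..1/2} (\<lambda>u. \<Sum>n\<in>F. h (of_int n + u))" for F :: "int set"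
    by (intro continuous_on_sum continuous_on_compose2[OF hc[of UNIV]] continuous_intros) auto
  obtain I J where I: "\<And>F. ((\<lambda>u. \<Sum>n\<in>F. h (of_int n + u)) has_integral I F) {-1/2..1/2}"
    and J: "((\<lambda>u. \<Sum>\<^sub>\<infinity>n::int. h (of_int n + u)) has_integral J) {-1/2..1/2}" and IJ: "(I \<longlongrightarrow> J) (finite_subsets_at_top UNIV)"
    using uniform_limit_integral[OF ul shc] by auto
  have shift: "((\<lambda>u. h (of_int n + u)) has_integral integral {of_int n - 1/2..of_int n + 1/2} h) {-1/2..1/2}" for n :: int
  proof -
    have "(h has_integral integral {of_int n - 1/2..of_int n + 1/2} h) {of_int n - 1/2..of_int n + 1/2}"
      by (rule integrable_integral[OF hi])
    then have "(h has_integral integral {of_int n - 1/2..of_int n + 1/2} h) {-1/2 + of_int n..1/2 + of_int n}"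
      by (simp add: add.commute)
    then have "(h \<circ> ((+) (of_int n)) has_integral integral {of_int n - 1/2..of_int n + 1/2} h) {-1/2..1/2}"
      unfolding has_integral_shift_Icc_real .
    then show ?thesis by (simp add: o_def)
  qed
  have IN: "I {- int N..int N} = integral {- of_int N - 1/2..of_int N + 1/2} h" for N :: nat
  proof -
    have "((\<lambda>u. \<Sum>n\<in>{- int N..int N}. h (of_int n + u)) has_integral (\<Sum>n\<in>{- int N..int N}. integral {of_int n - 1/2..of_int n + 1/2} h)) {-1/2..1/2}"
      by (intro has_integral_sum shift) auto
    then have "I {- int N..int N} = (\<Sum>n\<in>{- int N..int N}. integral {of_int n - 1/2..of_int n + 1/2} h)"
      using I by (rule has_integral_unique[rotated])
    also have "\<dots> = integral {- of_int N - 1/2..of_int N + 1/2} h"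
    proof (induction N)
      case (Suc N)
      have "{- int (Suc N)..int (Suc N)} = insert (- int (Suc N)) (insert (int (Suc N)) {- int N..int N})" by auto
      moreover have "integral {- of_int (Suc N) - 1/2..of_int (Suc N) + 1/2} h = integral {- of_int (Suc N) - 1/2..- of_int (Suc N) + 1/2} h + (integral {- of_int N - 1/2..of_int N + 1/2} h + integral {of_int (Suc N) - 1/2..of_int (Suc N) + 1/2} h)"
      proof -
        have e: "- real_of_int (int (Suc N)) + 1/2 = - of_int N - 1/2" "real_of_int (int N) + 1/2 = of_int (Suc N) - 1/2" by simp_all
        have "integral {- of_int N - 1/2..of_int N + 1/2} h + integral {of_int N + 1/2..of_int (Suc N) + 1/2} h = integral {- of_int N - 1/2..of_int (Suc N) + 1/2} h"
          by (intro Henstock_Kurzweil_Integration.integral_combine hi) auto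
        moreover have "integral {- of_int (Suc N) - 1/2..- of_int N - 1/2} h + integral {- of_int N - 1/2..of_int (Suc N) + 1/2} h = integral {- of_int (Suc N) - 1/2..of_int (Suc N) + 1/2} h"
          by (intro Henstock_Kurzweil_Integration.integral_combine hi) auto
        ultimately show ?thesis unfolding e by simp
      qed
      ultimately show ?case using Suc by (simp add: add_ac)
    qed simp
    finally show ?thesis .
  qed
  have hL: "integrable lborel h"
  proof (rule Bochner_Integration.integrable_bound)
    show "integrable lborel (\<lambda>u. exp (pi * t * (0 + \<bar>x\<bar>)\<^sup>2) * exp (2 * pi * \<bar>y\<bar> * 0) * exp (2 * (pi * t) * (0 + \<bar>x\<bar>) * \<bar>u\<bar> - (pi * t) * u\<^sup>2))"
      using t by (intro integrable_mult_right integrable_gauss) simp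
    show "h \<in> borel_measurable lborel" using borel_measurable_continuous_onI[OF hc] by simp
    show "AE u in lborel. norm (h u) \<le> norm (exp (pi * t * (0 + \<bar>x\<bar>)\<^sup>2) * exp (2 * pi * \<bar>y\<bar> * 0) * exp (2 * (pi * t) * (0 + \<bar>x\<bar>) * \<bar>u\<bar> - (pi * t) * u\<^sup>2))"
      using norm_pg_le[OF t, of 0 0 x y] unfolding h_def norm_mult[of "pg t x y (of_real u)" for u] by (intro AE_I2) (simp add: norm_e2 norm_mult)
  qed
  have lim: "(\<lambda>N::nat. integral {- of_int N - 1/2..of_int N + 1/2} h) \<longlonglongrightarrow> (LINT u|lborel. h u)"
  proof -
    have "(\<lambda>N::nat. LINT u|lborel. indicator {- of_int N - 1/2..of_int N + 1/2} u *\<^sub>R h u) \<longlonglongrightarrow> (LINT u|lborel. h u)"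
    proof (rule integral_dominated_convergence[where w = "\<lambda>u. norm (h u)"])
      show "AE u in lborel. (\<lambda>N::nat. indicator {- of_int N - 1/2..of_int N + 1/2} u *\<^sub>R h u) \<longlonglongrightarrow> h u"
      proof (rule AE_I2)
        fix u :: real
        obtain N0 :: nat where "\<bar>u\<bar> \<le> N0" using real_arch_simple by blast
        then have "indicator {- of_int N - 1/2..of_int N + 1/2} u *\<^sub>R h u = h u" if "N \<ge> N0" for N :: nat
          using that by (auto simp: indicator_def)
        then show "(\<lambda>N::nat. indicator {- of_int N - 1/2..of_int N + 1/2} u *\<^sub>R h u) \<longlonglongrightarrow> h u"
          by (intro tendsto_eventually eventually_sequentiallyI[of N0])
      qed
    qed (use hL in \<open>auto simp: indicator_def\<close>)
    moreover have "(LINT u|lborel. indicator {a..b} u *\<^sub>R h u) = integral {a..b} h" for a b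
      using set_borel_integral_eq_integral(2)[of "{a..b}" h] integrable_mult_indicator[OF _ hL, of "{a..b}"]
      unfolding set_integrable_def set_lebesgue_integral_def by simp
    ultimately show ?thesis by simp
  qed
  have "(\<lambda>N::nat. I {- int N..int N}) \<longlonglongrightarrow> J"
    by (rule filterlim_compose[OF IJ filterlim_symmetric_intervals])
  then have JL: "J = (LINT u|lborel. h u)"
    unfolding IN using lim by (rule LIMSEQ_unique)
  have "(LINT u|lborel. h u) = (LINT v|lborel. h (- x + 1 * v))"
    using lborel_integral_real_affine[of 1 h "- x"] by simp
  also have "\<dots> = (LINT v|lborel. e2 (of_int k * of_real x) * (exp (- of_real (pi * t) * (of_real v)\<^sup>2) * e2 (of_real ((y - of_int k) * v))))"
  proof (rule Bochner_Integration.integral_cong[OF refl])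
    fix v :: real
    have "complex_of_real v * of_real y + - of_int k * of_real (- x + 1 * v) = of_int k * of_real x + of_real ((y - of_int k) * v)"
      by (simp add: algebra_simps)
    then have "e2 (complex_of_real v * of_real y) * e2 (- of_int k * of_real (- x + 1 * v)) = e2 (of_int k * of_real x) * e2 (of_real ((y - of_int k) * v))"
      by (simp only: e2_add[symmetric])
    then show "h (- x + 1 * v) = e2 (of_int k * of_real x) * (exp (- of_real (pi * t) * (of_real v)\<^sup>2) * e2 (of_real ((y - of_int k) * v)))"
      unfolding h_def pg_def by (simp add: mult_ac)
  qed
  also have "\<dots> = e2 (of_int k * of_real x) * of_real (exp (- pi * (y - of_int k)\<^sup>2 / t) / sqrt t)"
    by (simp only: Bochner_Integration.integral_mult_right_zero integral_gauss_e2[OF t])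
  finally have L: "(LINT u|lborel. h u) = e2 (of_int k * of_real x) * of_real (exp (- pi * (y - of_int k)\<^sup>2 / t) / sqrt t)" .
  have "integral {-1/2..1/2} (\<lambda>u::real. f (of_real u) * ek k u) = J"
  proof (rule integral_unique, rule has_integral_eq[OF _ J])
    fix u :: real
    show "(\<Sum>\<^sub>\<infinity>n::int. h (of_int n + u)) = f (of_real u) * ek k u"
      unfolding hn f_def by (rule infsum_cmult_left')
  qed
  then show ?thesis unfolding JL L .
qed

text \<open>\<open>fourier_series_at_0\<close> for the periodization of \<open>pg\<close>.\<close>

lemma poisson_gauss:
  assumes t: "t > 0"
  shows "(\<Sum>\<^sub>\<infinity>n::int. pg t x y (of_int n)) = (\<Sum>\<^sub>\<infinity>k::int. e2 (of_int k * of_real x) * of_real (exp (- pi * (y - of_int k)\<^sup>2 / t) / sqrt t))"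
proof -
  define f where "f = (\<lambda>z. \<Sum>\<^sub>\<infinity>n::int. pg t x y (of_int n + z))"
  have fh: "f holomorphic_on UNIV"
    unfolding f_def by (intro holomorphic_infsum pg_dominated t pg_holomorphic holomorphic_intros open_UNIV)
  define b where "b = (\<lambda>k::int. e2 (of_int k * of_real x) * of_real (exp (- pi * (y - of_int k)\<^sup>2 / t) / sqrt t))"
  have 1: "(\<lambda>N::nat. \<Sum>k\<in>{- int N..int N}. b k) \<longlonglongrightarrow> f 0"
    using fourier_series_at_0[OF fh] unfolding f_def poisson_gauss_coeff[OF t] b_def .
  have "(\<lambda>k::int. norm (b k)) summable_on UNIV"
  proof (rule summable_on_comparison_test)
    show "(\<lambda>k::int. (exp (- pi * y\<^sup>2 / t) / sqrt t) * exp ((2 * pi * \<bar>y\<bar> / t) * \<bar>of_int k\<bar> - (pi / t) * (of_int k)\<^sup>2)) summable_on UNIV"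
      using t by (intro summable_on_cmult_right summable_on_gauss_int) simp
    show "norm (b k) \<le> (exp (- pi * y\<^sup>2 / t) / sqrt t) * exp ((2 * pi * \<bar>y\<bar> / t) * \<bar>of_int k\<bar> - (pi / t) * (of_int k)\<^sup>2)" for k
    proof -
      have "norm (b k) = exp (- pi * (y - of_int k)\<^sup>2 / t) / sqrt t"
        using t unfolding b_def norm_mult norm_of_real by (simp add: norm_e2)
      also have "- pi * (y - of_int k)\<^sup>2 / t = - pi * y\<^sup>2 / t + ((2 * pi / t) * (y * of_int k) - (pi / t) * (of_int k)\<^sup>2)"
        using t by (simp add: power2_diff field_simps)
      also have "exp \<dots> \<le> exp (- pi * y\<^sup>2 / t + ((2 * pi / t) * (\<bar>y\<bar> * \<bar>of_int k\<bar>) - (pi / t) * (of_int k)\<^sup>2))"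
      proof -
        have "y * of_int k \<le> \<bar>y\<bar> * \<bar>of_int k\<bar>" by (simp add: abs_mult[symmetric])
        then have "(2 * pi / t) * (y * of_int k) \<le> (2 * pi / t) * (\<bar>y\<bar> * \<bar>of_int k\<bar>)" using t by (intro mult_left_mono) auto
        then show ?thesis by simp
      qed
      finally show ?thesis using t unfolding exp_add by (simp add: divide_right_mono mult_ac)
    qed
  qed auto
  then have "(b has_sum infsum b UNIV) UNIV" by (intro has_sum_infsum) (rule abs_summable_summable)
  then have "(\<lambda>N::nat. \<Sum>k\<in>{- int N..int N}. b k) \<longlonglongrightarrow> infsum b UNIV"
    unfolding has_sum_def by (rule filterlim_compose[OF _ filterlim_symmetric_intervals])
  with 1 have "f 0 = infsum b UNIV" by (rule LIMSEQ_unique)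
  then show ?thesis unfolding f_def b_def by simp
qed

section \<open>Inversion of the rank one functions\<close>

definition c8 :: complex where "c8 = exp (- \<i> * of_real pi / 4)"

text \<open>The scalar $e^{-i\pi/4}/\sqrt{2m}$, chosen so that \<open>S1\<close> is unitary and the factor of automorphy is the
principal square root of $\tau$.\<close>

definition Sfac :: "nat \<Rightarrow> complex" where "Sfac m = c8 / of_real (sqrt (2 * m))"

definition S1 :: "nat \<Rightarrow> int \<Rightarrow> int \<Rightarrow> complex" where
  "S1 m s r = Sfac m * e2 (- of_int (r * s) / (2 * of_nat m))"

abbreviation residues :: "nat \<Rightarrow> int set" where
  "residues m \<equiv> {0..<2 * int m}"

lemma csqrt_i_real: "t > 0 \<Longrightarrow> c8 * csqrt (\<i> * of_real t) = of_real (sqrt t)"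
proof -
  assume t: "t > 0"
  have "csqrt (\<i> * of_real t) = of_real (sqrt t) * csqrt \<i>"
    using csqrt_of_real_mult[OF t, of \<i>] by (simp add: mult.commute)
  moreover have "csqrt \<i> = exp (\<i> * of_real pi / 4)"
  proof (rule csqrt_unique)
    have "(exp (\<i> * of_real pi / 4))\<^sup>2 = exp (\<i> * of_real pi / 2)" by (simp flip: exp_double)
    also have "\<dots> = \<i>" using cis_conv_exp[of "pi / 2"] by (simp add: cis.ctr complex_eq_iff)
    finally show "(exp (\<i> * of_real pi / 4))\<^sup>2 = \<i>" .
    have "exp (\<i> * of_real pi / 4) = cis (pi / 4)" by (simp add: cis_conv_exp)
    then show "0 < Re (exp (\<i> * of_real pi / 4)) \<or> Re (exp (\<i> * of_real pi / 4)) = 0 \<and> 0 \<le> Im (exp (\<i> * of_real pi / 4))"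
      by (simp add: cos_45)
  qed
  moreover have "c8 * exp (\<i> * of_real pi / 4) = 1" unfolding c8_def by (simp flip: exp_add)
  ultimately show ?thesis by (metis mult.left_commute mult.right_neutral)
qed

lemma jt_holomorphic_compose:
  assumes m: "m > 0" and S: "open S" and f: "f holomorphic_on S" "f ` S \<subseteq> uhp" and g: "g holomorphic_on S"
  shows "(\<lambda>x. jt m s (f x) (g x)) holomorphic_on S"
  unfolding jt_def
proof (rule holomorphic_infsum[OF S])
  have c: "continuous_on S (\<lambda>x. (f x, g x))"
    by (intro continuous_on_Pair holomorphic_on_imp_continuous_on f g)
  show "locally_dominated (int_coset (of_int s / (2 * of_nat m))) S (\<lambda>n x. jt_term m n (f x) (g x))"
    by (rule locally_dominated_compose[OF jt_term_dominated[OF m] c, unfolded fst_conv snd_conv]) (use f(2) in auto)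
  show "(\<lambda>x. jt_term m n (f x) (g x)) holomorphic_on S" for n by (intro jt_term_holomorphic f g)
qed

lemma bij_betw_residues:
  assumes M: "M > (0::int)"
  shows "bij_betw (\<lambda>(r, j). M * j + r) ({0..<M} \<times> UNIV) UNIV"
proof (rule bij_betwI[where g = "\<lambda>k. (k mod M, k div M)"])
  show "(\<lambda>k. (k mod M, k div M)) \<in> UNIV \<rightarrow> {0..<M} \<times> UNIV" using M by auto
qed (use M in auto)

text \<open>For $\tau = it$ this is \<open>poisson_gauss\<close>, with the dual sum sorted by residues modulo $2m$.\<close>

lemma jt_S_real:
  assumes m: "m > 0" and t: "t > 0"
  shows "jt m s (\<i> / of_real t) (of_real y) = of_real (sqrt t / sqrt (2 * m)) *
     e2 (of_nat m * (\<i> * of_real t) * (of_real y)\<^sup>2) * (\<Sum>r\<in>residues m. e2 (- of_int (r * s) / (2 * of_nat m)) * jt m r (\<i> * of_real t) (\<i> * of_real t * of_real y))"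
proof -
  define x where "x = of_int s / (2 * of_nat m :: real)"
  define t' where "t' = 2 * m / t"
  define y' where "y' = 2 * m * y"
  define M where "M = 2 * int m"
  have t': "t' > 0" unfolding t'_def using m t by simp
  have M: "M > 0" using m by (simp add: M_def)
  have Mr: "complex_of_int M = 2 * of_nat m" "real_of_int M = 2 * of_nat m" by (simp_all add: M_def)
  have "jt m s (\<i> / of_real t) (of_real y) = (\<Sum>\<^sub>\<infinity>k::int. jt_term m (of_int k + x) (\<i> / of_real t) (of_real y))"
    unfolding jt_def x_def by (rule infsum_reindex_bij_betw[OF bij_betw_int_coset, symmetric])
  also have "\<dots> = (\<Sum>\<^sub>\<infinity>k::int. pg t' x y' (of_int k))"
  proof (rule infsum_cong)
    fix k :: int
    show "jt_term m (of_int k + x) (\<i> / of_real t) (of_real y) = pg t' x y' (of_int k)"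
      unfolding jt_term_def pg_def e2_def exp_add[symmetric]
      by (rule arg_cong[where f = exp]) (use t in \<open>simp add: t'_def y'_def field_simps power2_eq_square\<close>)
  qed
  also have "\<dots> = (\<Sum>\<^sub>\<infinity>k::int. e2 (of_int k * of_real x) * of_real (exp (- pi * (y' - of_int k)\<^sup>2 / t') / sqrt t'))"
    by (rule poisson_gauss[OF t'])
  also have "\<dots> = (\<Sum>\<^sub>\<infinity>k::int. e2 (of_int (- k) * of_real x) * of_real (exp (- pi * (y' - of_int (- k))\<^sup>2 / t') / sqrt t'))"
    by (rule infsum_reindex_bij_betw[symmetric]) (rule bij_uminus)
  also have "\<dots> = of_real (sqrt t / sqrt (2 * m)) * e2 (of_nat m * (\<i> * of_real t) * (of_real y)\<^sup>2) * (\<Sum>r\<in>{0..<M}. e2 (- of_int (r * s) / (2 * of_nat m)) * jt m r (\<i> * of_real t) (\<i> * of_real t * of_real y))"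
  proof -
    define F where "F = (\<lambda>k::int. e2 (of_int (- k) * of_real x) * of_real (exp (- pi * (y' - of_int (- k))\<^sup>2 / t') / sqrt t'))"
    define C where "C = of_real (sqrt t / sqrt (2 * m)) * e2 (of_nat m * (\<i> * of_real t) * (of_real y)\<^sup>2)"
    have tau: "\<i> * of_real t \<in> uhp" using t by (simp add: uhp_def)
    have F: "F (M * j + r) = C * (e2 (- of_int (r * s) / (2 * of_nat m)) * jt_term m (of_int j + of_int r / (2 * of_nat m)) (\<i> * of_real t) (\<i> * of_real t * of_real y))" for j r
    proof -
      have "of_int (- (M * j + r)) * complex_of_real x = of_int (- (j * s)) + - of_int (r * s) / (2 * of_nat m)"
        unfolding x_def using m by (simp add: Mr field_simps)
      then have 1: "e2 (of_int (- (M * j + r)) * of_real x) = e2 (- of_int (r * s) / (2 * of_nat m))"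
        by (simp only: e2_add e2_of_int mult_1_left)
      have sq: "1 / sqrt t' = sqrt t / sqrt (2 * m)" unfolding t'_def by (simp add: real_sqrt_divide)
      have 2: "complex_of_real (exp (- pi * (y' - of_int (- (M * j + r)))\<^sup>2 / t')) = e2 (of_nat m * (\<i> * of_real t) * (of_real y)\<^sup>2) *
          jt_term m (of_int j + of_int r / (2 * of_nat m)) (\<i> * of_real t) (\<i> * of_real t * of_real y)"
      proof -
        have "complex_of_real (exp (- pi * (y' - of_int (- (M * j + r)))\<^sup>2 / t')) = exp (of_real (- pi * (y' - of_int (- (M * j + r)))\<^sup>2 / t'))"
          by (simp only: exp_of_real)
        also have "\<dots> = e2 (of_nat m * (\<i> * of_real t) * (of_real y)\<^sup>2) * jt_term m (of_int j + of_int r / (2 * of_nat m)) (\<i> * of_real t) (\<i> * of_real t * of_real y)"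
          unfolding jt_term_def e2_def exp_add[symmetric]
          by (rule arg_cong[where f = exp]) (use t m in \<open>simp add: t'_def y'_def Mr field_simps power2_eq_square\<close>)
        finally show ?thesis .
      qed
      have "F (M * j + r) = e2 (of_int (- (M * j + r)) * of_real x) * (of_real (exp (- pi * (y' - of_int (- (M * j + r)))\<^sup>2 / t')) * of_real (1 / sqrt t'))"
        unfolding F_def by simp
      then show ?thesis unfolding 1 2 sq C_def by (simp only: mult_ac)
    qed
    have inner: "((\<lambda>j. F (M * j + r)) has_sum C * (e2 (- of_int (r * s) / (2 * of_nat m)) * jt m r (\<i> * of_real t) (\<i> * of_real t * of_real y))) UNIV" for r
    proof -
      have "((\<lambda>n. jt_term m n (\<i> * of_real t) (\<i> * of_real t * of_real y)) has_sum jt m r (\<i> * of_real t) (\<i> * of_real t * of_real y)) (int_coset (of_int r / (2 * of_nat m)))"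
        unfolding jt_def by (rule has_sum_infsum[OF jt_summable[OF m tau]])
      then have "((\<lambda>j::int. jt_term m (of_int j + of_int r / (2 * of_nat m)) (\<i> * of_real t) (\<i> * of_real t * of_real y)) has_sum jt m r (\<i> * of_real t) (\<i> * of_real t * of_real y)) UNIV"
        by (rule has_sum_reindex_bij_betw[OF bij_betw_int_coset, where f = "\<lambda>n. jt_term m n (\<i> * of_real t) (\<i> * of_real t * of_real y)", THEN iffD2])
      then show ?thesis unfolding F by (intro has_sum_cmult_right)
    qed
    have "F summable_on UNIV"
    proof -
      have "(\<lambda>k::int. norm (F k)) summable_on UNIV"
      proof (rule summable_on_comparison_test)
        show "(\<lambda>k::int. exp (- pi * y'\<^sup>2 / t') / sqrt t' * exp ((2 * pi * \<bar>y'\<bar> / t') * \<bar>of_int k\<bar> - (pi / t') * (of_int k)\<^sup>2)) summable_on UNIV"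
          using t' by (intro summable_on_cmult_right summable_on_gauss_int) simp
        show "norm (F k) \<le> exp (- pi * y'\<^sup>2 / t') / sqrt t' * exp ((2 * pi * \<bar>y'\<bar> / t') * \<bar>of_int k\<bar> - (pi / t') * (of_int k)\<^sup>2)" for k
        proof -
          have "norm (F k) = exp (- pi * (y' - of_int (- k))\<^sup>2 / t') / sqrt t'"
            using t' unfolding F_def norm_mult norm_of_real by (simp add: norm_e2)
          also have "- pi * (y' - of_int (- k))\<^sup>2 / t' = - pi * y'\<^sup>2 / t' + ((2 * pi / t') * (- (y' * of_int k)) - (pi / t') * (of_int k)\<^sup>2)"
            using t' by (simp add: power2_sum field_simps)
          also have "exp \<dots> \<le> exp (- pi * y'\<^sup>2 / t' + ((2 * pi / t') * (\<bar>y'\<bar> * \<bar>of_int k\<bar>) - (pi / t') * (of_int k)\<^sup>2))"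
          proof -
            have "- (y' * of_int k) \<le> \<bar>y'\<bar> * \<bar>of_int k\<bar>" by (simp add: abs_mult[symmetric])
            then have "(2 * pi / t') * (- (y' * of_int k)) \<le> (2 * pi / t') * (\<bar>y'\<bar> * \<bar>of_int k\<bar>)" using t' by (intro mult_left_mono) auto
            then show ?thesis by simp
          qed
          finally show ?thesis using t' unfolding exp_add by (simp add: divide_right_mono mult_ac)
        qed
      qed auto
      then show ?thesis by (rule abs_summable_summable)
    qed
    then have Fs: "(\<lambda>(r, j). F (M * j + r)) summable_on ({0..<M} \<times> UNIV)"
      using summable_on_reindex_bij_betw[OF bij_betw_residues[OF M], of F] by (simp add: case_prod_unfold)
    have "((\<lambda>(r, j). F (M * j + r)) has_sum (\<Sum>r\<in>{0..<M}. C * (e2 (- of_int (r * s) / (2 * of_nat m)) * jt m r (\<i> * of_real t) (\<i> * of_real t * of_real y)))) ({0..<M} \<times> UNIV)"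
      by (rule has_sum_SigmaI[OF _ has_sum_finite Fs]) (use inner in auto)
    then have "(F has_sum (\<Sum>r\<in>{0..<M}. C * (e2 (- of_int (r * s) / (2 * of_nat m)) * jt m r (\<i> * of_real t) (\<i> * of_real t * of_real y)))) UNIV"
      using has_sum_reindex_bij_betw[OF bij_betw_residues[OF M], of F] by (simp add: case_prod_unfold)
    then show ?thesis unfolding F_def[symmetric] C_def[symmetric] sum_distrib_left by (rule infsumI)
  qed
  finally show ?thesis unfolding M_def .
qed

lemma uhp_S: "\<tau> \<in> uhp \<Longrightarrow> - 1 / \<tau> \<in> uhp"
  by (auto simp: uhp_def Im_divide power2_eq_square intro!: divide_pos_pos add_nonneg_pos)

lemma uhp_nz: "\<tau> \<in> uhp \<Longrightarrow> \<tau> \<noteq> 0" by (auto simp: uhp_def)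

lemma uhp_not_nonpos: "\<tau> \<in> uhp \<Longrightarrow> \<tau> \<notin> \<real>\<^sub>\<le>\<^sub>0" by (auto simp: uhp_def complex_nonpos_Reals_iff)

lemma jt_S_imag:
  assumes m: "m > 0" and t: "t > 0"
  shows "jt m s (- 1 / (\<i> * of_real t)) v = csqrt (\<i> * of_real t) * e2 (of_nat m * (\<i> * of_real t) * v\<^sup>2) * (\<Sum>r\<in>residues m. S1 m s r * jt m r (\<i> * of_real t) (\<i> * of_real t * v))"
proof -
  let ?\<tau> = "\<i> * of_real t"
  have tau: "?\<tau> \<in> uhp" using t by (simp add: uhp_def)
  have inv: "- 1 / ?\<tau> = \<i> / of_real t" using t by (simp add: field_simps)
  have tau': "\<i> / of_real t \<in> uhp" using t by (simp add: uhp_def)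
  define R where "R = (\<lambda>v. of_real (sqrt t / sqrt (2 * m)) * e2 (of_nat m * ?\<tau> * v\<^sup>2) * (\<Sum>r\<in>residues m. e2 (- of_int (r * s) / (2 * of_nat m)) * jt m r ?\<tau> (?\<tau> * v)))"
  have "jt m s (\<i> / of_real t) v - R v = 0"
  proof (rule analytic_continuation[where f = "\<lambda>v. jt m s (\<i> / of_real t) v - R v" and S = UNIV and U = "of_real ` {0<..}" and \<xi> = 0])
    show "(\<lambda>v. jt m s (\<i> / of_real t) v - R v) holomorphic_on UNIV"
      unfolding R_def e2_def
      by (intro holomorphic_intros jt_holomorphic_compose m open_UNIV) (use tau tau' in auto)
    show "(0::complex) islimpt of_real ` {0<..}"
      unfolding islimpt_approachable
    proof (intro allI impI)
      fix e :: real assume "e > 0"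
      then show "\<exists>x'\<in>of_real ` {0<..}. x' \<noteq> 0 \<and> dist x' (0::complex) < e"
        by (intro bexI[of _ "of_real (e / 2)"] imageI) auto
    qed
    show "jt m s (\<i> / of_real t) v - R v = 0" if "v \<in> of_real ` {0<..}" for v
    proof -
      from that obtain y where y: "v = of_real y" by auto
      show ?thesis unfolding R_def y jt_S_real[OF m t] by (rule diff_self)
    qed
  qed auto
  then have "jt m s (- 1 / ?\<tau>) v = R v" unfolding inv by simp
  also have "\<dots> = csqrt ?\<tau> * e2 (of_nat m * ?\<tau> * v\<^sup>2) * (\<Sum>r\<in>residues m. S1 m s r * jt m r ?\<tau> (?\<tau> * v))"
  proof -
    have "complex_of_real (sqrt t / sqrt (2 * m)) = csqrt ?\<tau> * Sfac m"
      unfolding Sfac_def using csqrt_i_real[OF t] by (simp add: mult.commute del: csqrt.simps)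
    then have 1: "R v = csqrt ?\<tau> * Sfac m * e2 (of_nat m * ?\<tau> * v\<^sup>2) * (\<Sum>r\<in>residues m. e2 (- of_int (r * s) / (2 * of_nat m)) * jt m r ?\<tau> (?\<tau> * v))"
      unfolding R_def by (simp only:)
    have 2: "(\<Sum>r\<in>residues m. S1 m s r * jt m r ?\<tau> (?\<tau> * v)) = Sfac m * (\<Sum>r\<in>residues m. e2 (- of_int (r * s) / (2 * of_nat m)) * jt m r ?\<tau> (?\<tau> * v))"
      unfolding S1_def sum_distrib_left by (simp only: mult.assoc)
    show ?thesis unfolding 1 2 by (simp only: mult_ac)
  qed
  finally show ?thesis .
qed

text \<open>Both sides are holomorphic in $z$ and in $\tau$, so the case $\tau = it$, \<open>z\<close> real, suffices.\<close>

lemma jt_S: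
  assumes m: "m > 0" and \<tau>: "\<tau> \<in> uhp"
  shows "jt m s (- 1 / \<tau>) v = csqrt \<tau> * e2 (of_nat m * \<tau> * v\<^sup>2) * (\<Sum>r\<in>residues m. S1 m s r * jt m r \<tau> (\<tau> * v))"
proof -
  define R where "R = (\<lambda>\<tau>. csqrt \<tau> * e2 (of_nat m * \<tau> * v\<^sup>2) * (\<Sum>r\<in>residues m. S1 m s r * jt m r \<tau> (\<tau> * v)))"
  have "jt m s (- 1 / \<tau>) v - R \<tau> = 0"
  proof (rule analytic_continuation[where f = "\<lambda>\<tau>. jt m s (- 1 / \<tau>) v - R \<tau>" and S = uhp and U = "(\<lambda>t. \<i> * of_real t) ` {1<..}" and \<xi> = \<i>])
    show "(\<lambda>\<tau>. jt m s (- 1 / \<tau>) v - R \<tau>) holomorphic_on uhp"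
      unfolding R_def e2_def
      by (intro holomorphic_intros jt_holomorphic_compose m open_uhp)
         (use uhp_S in \<open>auto simp: uhp_nz uhp_not_nonpos\<close>)
    show "\<i> islimpt (\<lambda>t. \<i> * of_real t) ` {1<..}"
      unfolding islimpt_approachable
    proof (intro allI impI)
      fix e :: real assume e: "e > 0"
      have "dist (\<i> * of_real (1 + e / 2)) \<i> = e / 2"
        using e by (simp add: dist_norm algebra_simps norm_mult)
      then show "\<exists>x'\<in>(\<lambda>t. \<i> * of_real t) ` {1<..}. x' \<noteq> \<i> \<and> dist x' \<i> < e"
        using e by (intro bexI[of _ "\<i> * of_real (1 + e / 2)"]) (auto simp del: of_real_add)
    qed
    show "jt m s (- 1 / \<tau>) v - R \<tau> = 0" if "\<tau> \<in> (\<lambda>t. \<i> * of_real t) ` {1<..}" for \<tau>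
    proof -
      from that obtain t where t: "t > 1" "\<tau> = \<i> * of_real t" by auto
      then have "t > 0" by simp
      from jt_S_imag[OF m this, of s v] show ?thesis unfolding R_def t(2) by simp
    qed
  qed (use \<tau> open_uhp connected_uhp in \<open>auto simp: uhp_def\<close>)
  then show ?thesis unfolding R_def by simp
qed

text \<open>The $z$-derivative of \<open>jt_S\<close> at $0$. The Gaussian prefactor is stationary there.\<close>

lemma theta1_S:
  assumes m: "m > 0" and \<tau>: "\<tau> \<in> uhp"
  shows "theta1 m s (- 1 / \<tau>) = \<tau> * csqrt \<tau> * (\<Sum>r\<in>residues m. S1 m s r * theta1 m r \<tau>)"
proof -
  let ?K = "4 * of_real pi * \<i> * of_nat m :: complex"
  have K: "?K \<noteq> 0" using m by simp
  have D1: "((\<lambda>v. jt m s (- 1 / \<tau>) v) has_field_derivative ?K * theta1 m s (- 1 / \<tau>)) (at 0)"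
    by (rule jt_deriv_0[OF m uhp_S[OF \<tau>]])
  have A: "((\<lambda>v. \<Sum>r\<in>residues m. S1 m s r * jt m r \<tau> (\<tau> * v)) has_field_derivative (\<Sum>r\<in>residues m. S1 m s r * (?K * theta1 m r \<tau> * \<tau>))) (at 0)"
  proof (intro DERIV_sum DERIV_cmult)
    fix r
    have l: "((\<lambda>v. \<tau> * v) has_field_derivative \<tau>) (at 0)" by (auto intro!: derivative_eq_intros)
    have "((\<lambda>z. jt m r \<tau> z) has_field_derivative ?K * theta1 m r \<tau>) (at (\<tau> * 0))"
      using jt_deriv_0[OF m \<tau>] by simp
    from DERIV_chain2[OF this l] show "((\<lambda>v. jt m r \<tau> (\<tau> * v)) has_field_derivative ?K * theta1 m r \<tau> * \<tau>) (at 0)" .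
  qed
  have B: "((\<lambda>v. csqrt \<tau> * e2 (of_nat m * \<tau> * v\<^sup>2)) has_field_derivative 0) (at 0)"
  proof -
    have "((\<lambda>v. of_nat m * \<tau> * v\<^sup>2) has_field_derivative 0) (at 0)" by (auto intro!: derivative_eq_intros)
    from DERIV_cmult[OF DERIV_chain2[where f = e2, OF e2_has_field_derivative this], of "csqrt \<tau>"] show ?thesis by simp
  qed
  have "((\<lambda>v. jt m s (- 1 / \<tau>) v) has_field_derivative csqrt \<tau> * (\<Sum>r\<in>residues m. S1 m s r * (?K * theta1 m r \<tau> * \<tau>))) (at 0)"
    unfolding jt_S[OF m \<tau>] using DERIV_mult[OF B A] by (simp add: mult.commute del: csqrt.simps)
  from DERIV_unique[OF D1 this]
  have "?K * theta1 m s (- 1 / \<tau>) = csqrt \<tau> * (\<Sum>r\<in>residues m. S1 m s r * (?K * theta1 m r \<tau> * \<tau>))" .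
  also have "\<dots> = ?K * (\<tau> * csqrt \<tau> * (\<Sum>r\<in>residues m. S1 m s r * theta1 m r \<tau>))"
    by (simp add: sum_distrib_left mult_ac del: csqrt.simps)
  finally show ?thesis using K unfolding mult_cancel_left by blast
qed

text \<open>By \<open>phi_ode\<close> and \<open>theta1_S\<close> the difference \<open>F\<close> of the two sides solves the homogeneous equation
$F + 2(w-\tau)\frac{w}{\tau} F_w = 0$. Then $F^2 (w-\tau)/w$ is constant, and it vanishes at $w = \tau$.\<close>

lemma phi_S:
  assumes m: "m > 0" and \<tau>: "\<tau> \<in> uhp" and w: "w \<in> uhp"
  shows "phi m s (- 1 / \<tau>) (- 1 / w) = \<tau> * csqrt w * (\<Sum>r\<in>residues m. S1 m s r * phi m r \<tau> w)"
proof -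
  define P where "P = (\<lambda>w. \<Sum>r\<in>residues m. S1 m s r * phi m r \<tau> w)"
  define F where "F = (\<lambda>w. phi m s (- 1 / \<tau>) (- 1 / w) - \<tau> * csqrt w * P w)"
  have tn: "\<tau> \<noteq> 0" by (rule uhp_nz[OF \<tau>])
  have key: "\<exists>d. (F has_field_derivative d) (at w) \<and> F w + 2 * (w - \<tau>) * (w / \<tau>) * d = 0" if w: "w \<in> uhp" for w
  proof -
    have wn: "w \<noteq> 0" by (rule uhp_nz[OF w])
    obtain d1 where d1: "((\<lambda>w. phi m s (- 1 / \<tau>) w) has_field_derivative d1) (at (- 1 / w))"
      "phi m s (- 1 / \<tau>) (- 1 / w) + 2 * (- 1 / w - - 1 / \<tau>) * d1 = theta1 m s (- 1 / w)"
      by (rule phi_ode[OF m uhp_S[OF \<tau>] uhp_S[OF w]])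
    have "\<exists>d. ((\<lambda>w. phi m r \<tau> w) has_field_derivative d) (at w) \<and> phi m r \<tau> w + 2 * (w - \<tau>) * d = theta1 m r w" for r
      by (rule phi_ode[OF m \<tau> w, of r]) blast
    then obtain d where d: "\<And>r. ((\<lambda>w. phi m r \<tau> w) has_field_derivative d r) (at w)" "\<And>r. phi m r \<tau> w + 2 * (w - \<tau>) * d r = theta1 m r w"
      by metis
    define D where "D = (\<Sum>r\<in>residues m. S1 m s r * d r)"
    define u where "u = csqrt w"
    have un: "u \<noteq> 0" using wn by (simp add: u_def)
    have u2: "w = u * u" unfolding u_def by (simp flip: power2_eq_square)
    have PD: "(P has_field_derivative D) (at w)" unfolding P_def D_def by (intro DERIV_sum DERIV_cmult d)
    have PT: "P w + 2 * (w - \<tau>) * D = (\<Sum>r\<in>residues m. S1 m s r * theta1 m r w)"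
      unfolding P_def D_def sum_distrib_left sum.distrib[symmetric]
      by (rule sum.cong[OF refl]) (simp add: d(2)[symmetric] algebra_simps)
    have i: "((\<lambda>w. - 1 / w) has_field_derivative 1 / w\<^sup>2) (at w)"
      using wn by (auto intro!: derivative_eq_intros simp: power2_eq_square)
    have F1: "((\<lambda>w. phi m s (- 1 / \<tau>) (- 1 / w)) has_field_derivative d1 * (1 / w\<^sup>2)) (at w)"
      by (rule DERIV_chain2[OF d1(1) i])
    have F2: "((\<lambda>w. \<tau> * csqrt w) has_field_derivative \<tau> * inverse (2 * u)) (at w)"
      unfolding u_def by (intro DERIV_cmult has_field_derivative_csqrt uhp_not_nonpos w)
    have FD: "(F has_field_derivative d1 * (1 / w\<^sup>2) - (\<tau> * inverse (2 * u) * P w + D * (\<tau> * csqrt w))) (at w)"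
      unfolding F_def by (intro DERIV_diff F1 DERIV_mult F2 PD)
    have T: "phi m s (- 1 / \<tau>) (- 1 / w) + 2 * (- 1 / w - - 1 / \<tau>) * d1 = w * u * (P w + 2 * (w - \<tau>) * D)"
      unfolding d1(2) theta1_S[OF m w] PT u_def ..
    have "F w + 2 * (w - \<tau>) * (w / \<tau>) * (d1 * (1 / w\<^sup>2) - (\<tau> * inverse (2 * u) * P w + D * (\<tau> * csqrt w))) = 0"
    proof -
      have T': "phi m s (- 1 / \<tau>) (- 1 / w) = w * u * (P w + 2 * (w - \<tau>) * D) - 2 * ((w - \<tau>) / (w * \<tau>)) * d1"
        using T wn tn by (simp add: field_simps)
      have "w * u * (X + 2 * (w - \<tau>) * D) - 2 * ((w - \<tau>) / (w * \<tau>)) * d1 - \<tau> * u * X + 2 * (w - \<tau>) * (w / \<tau>) * (d1 * (1 / w\<^sup>2) - (\<tau> * inverse (2 * u) * X + D * (\<tau> * u))) = 0" for X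
      proof -
        have "2 * (w - \<tau>) * (w / \<tau>) * (d1 * (1 / w\<^sup>2)) = 2 * ((w - \<tau>) / (w * \<tau>)) * d1"
          using wn tn by (simp add: power2_eq_square field_simps)
        moreover have "2 * (w - \<tau>) * (w / \<tau>) * (\<tau> * inverse (2 * u) * X) = (w - \<tau>) * u * X"
          using tn un by (subst (2) u2) (simp add: field_simps)
        moreover have "2 * (w - \<tau>) * (w / \<tau>) * (D * (\<tau> * u)) = 2 * (w - \<tau>) * w * D * u" using tn by simp
        moreover have "w * u * (X + 2 * (w - \<tau>) * D) - \<beta> - \<tau> * u * X + a * (A - (B + C)) = 0"
          if "a * A = \<beta>" "a * B = (w - \<tau>) * u * X" "a * C = 2 * (w - \<tau>) * w * D * u" for a A B C \<beta>
          unfolding right_diff_distrib[of a] distrib_left[of a] that by (simp add: algebra_simps)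
        ultimately show ?thesis by blast
      qed
      then show ?thesis unfolding F_def T' u_def[symmetric] .
    qed
    then show ?thesis using FD by blast
  qed
  then obtain F' where F': "\<And>w. w \<in> uhp \<Longrightarrow> (F has_field_derivative F' w) (at w)" "\<And>w. w \<in> uhp \<Longrightarrow> F w + 2 * (w - \<tau>) * (w / \<tau>) * F' w = 0"
    by metis
  define G where "G = (\<lambda>w. (F w)\<^sup>2 * ((w - \<tau>) / w))"
  have "(G has_field_derivative 0) (at w within uhp)" if w: "w \<in> uhp" for w
  proof -
    have wn: "w \<noteq> 0" by (rule uhp_nz[OF w])
    have q: "((\<lambda>w. (w - \<tau>) / w) has_field_derivative \<tau> / w\<^sup>2) (at w)"
      using wn by (auto intro!: derivative_eq_intros simp: field_simps power2_eq_square)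
    have "((\<lambda>w. F w * F w * ((w - \<tau>) / w)) has_field_derivative (F' w * F w + F' w * F w) * ((w - \<tau>) / w) + \<tau> / w\<^sup>2 * (F w * F w)) (at w)"
      by (rule DERIV_mult[OF DERIV_mult[OF F'(1)[OF w] F'(1)[OF w]] q])
    moreover have "(F' w * F w + F' w * F w) * ((w - \<tau>) / w) + \<tau> / w\<^sup>2 * (F w * F w) = (\<tau> / w\<^sup>2) * F w * (F w + 2 * (w - \<tau>) * (w / \<tau>) * F' w)"
      using wn tn by (simp add: field_simps power2_eq_square)
    ultimately show ?thesis unfolding G_def power2_eq_square F'(2)[OF w] by (simp add: has_field_derivative_at_within)
  qed
  then obtain k where k: "\<And>w. w \<in> uhp \<Longrightarrow> G w = k"
    using has_field_derivative_zero_constant[OF convex_uhp, of G] by blast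
  have k0: "k = 0" using k[OF \<tau>] by (simp add: G_def)
  have "F w = 0"
  proof (cases "w = \<tau>")
    case True then show ?thesis using F'(2)[OF \<tau>] by simp
  next
    case False then show ?thesis using k[OF w] uhp_nz[OF w] unfolding k0 G_def by simp
  qed
  then show ?thesis unfolding F_def P_def by simp
qed

section \<open>The finite Fourier transform on the labels\<close>

lemma sum_periodic_shift:
  fixes g :: "int \<Rightarrow> 'a::comm_monoid_add"
  assumes N: "N > 0" and g: "\<And>x y. N dvd x - y \<Longrightarrow> g x = g y"
  shows "(\<Sum>x\<in>{0..<N}. g (x + c)) = (\<Sum>x\<in>{0..<N}. g x)"
proof (rule sum.reindex_bij_witness[where i = "\<lambda>x. (x - c) mod N" and j = "\<lambda>x. (x + c) mod N"])
  fix x assume x: "x \<in> {0..<N}"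
  show "((x + c) mod N - c) mod N = x" "((x - c) mod N + c) mod N = x"
    using x by (simp_all add: mod_diff_left_eq mod_add_left_eq)
  show "(x + c) mod N \<in> {0..<N}" "(x - c) mod N \<in> {0..<N}" using N by simp_all
  show "g ((x + c) mod N) = g (x + c)" by (rule g) (simp add: minus_mod_eq_mult_div[symmetric] mod_eq_dvd_iff[symmetric])
qed

lemma sum_even:
  fixes h :: "int \<Rightarrow> 'a::semiring_1"
  shows "(\<Sum>x\<in>{0..<2 * N}. of_bool (even x) * h x) = (\<Sum>x\<in>{0..<N}. h (2 * x))"
proof -
  have "(\<Sum>x\<in>{0..<N}. h (2 * x)) = sum h ((\<lambda>x. 2 * x) ` {0..<N})" by (simp add: sum.reindex inj_on_def)
  also have "(\<lambda>x. 2 * x) ` {0..<N} = {x\<in>{0..<2 * N}. even x}" by (auto simp: image_iff elim!: evenE)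
  also have "sum h \<dots> = (\<Sum>x\<in>{0..<2 * N}. if even x then h x else 0)" by (rule sum.inter_filter) simp
  also have "\<dots> = (\<Sum>x\<in>{0..<2 * N}. of_bool (even x) * h x)" by (rule sum.cong) auto
  finally show ?thesis ..
qed

lemma sum_periodic_split:
  fixes g :: "int \<Rightarrow> 'a::comm_monoid_add"
  assumes N: "N > 0" and g: "\<And>x y. 2 * N dvd x - y \<Longrightarrow> g x = g y"
  shows "(\<Sum>x\<in>{0..<2 * N}. g x) = (\<Sum>x\<in>{0..<N}. \<Sum>\<delta>\<in>{0, 1}. g (x - N * \<delta>))"
proof -
  have "(\<Sum>x\<in>{0..<2 * N}. g x) = (\<Sum>x\<in>{0..<N}. g x) + (\<Sum>x\<in>{N..<2 * N}. g x)"
    using N by (subst sum.union_disjoint[symmetric]) (auto intro!: sum.cong)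
  also have "(\<Sum>x\<in>{N..<2 * N}. g x) = (\<Sum>x\<in>{0..<N}. g (x - N))"
    by (rule sum.reindex_bij_witness[where i = "\<lambda>x. x + N" and j = "\<lambda>x. x - N"]) (auto intro!: g)
  finally show ?thesis by (simp add: sum.distrib)
qed

text \<open>The pairing of the labels \<open>r\<close> and \<open>s\<close> modulo integers, $e^{-2\pi i p B_2(\mu_2(r), \mu_2(s))}$.\<close>

definition A2_char :: "nat \<Rightarrow> int \<times> int \<Rightarrow> int \<times> int \<Rightarrow> complex" where
  "A2_char p s r = e2 (- of_int (2 * fst r * fst s + snd r * fst s + fst r * snd s + 2 * snd r * snd s) / (3 * of_nat p))"

lemma A2_labels_eq: "A2_labels p = {0..<3 * int p} \<times> {0..<int p}"
  by (auto simp: A2_labels_def)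

lemma finite_A2_labels: "finite (A2_labels p)" by (simp add: A2_labels_eq)

lemma e2_add_int: "e2 (x + of_int k) = e2 x" by (simp add: e2_add)

lemma e2_half: "e2 (- of_int k / 2) = (if even k then 1 else - 1)"
proof (cases "even k")
  case True then show ?thesis by (elim evenE) (simp flip: of_int_minus)
next
  case False
  then obtain l where l: "k = 2 * l + 1" by (elim oddE)
  have "e2 (- of_int k / 2) = e2 (- 1 / 2 + of_int (- l))" unfolding l by (rule arg_cong[where f = e2]) (simp add: field_simps)
  also have "\<dots> = e2 (- 1 / 2)" by (rule e2_add_int)
  also have "\<dots> = inverse (exp (of_real pi * \<i>))" by (simp add: e2_def exp_minus)
  finally show ?thesis using False by simp
qed

text \<open>The Fourier transform of a glued product is the glued product of the Fourier transforms. The sum over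
$\delta$ annihilates the pairs of residues $(R, \rho)$ of different parity; the others are exactly
$(2r_1 + r_2 + 3p\delta,\; r_2 - p\delta)$ for labels \<open>r\<close> and $\delta \in \{0, 1\}$, each once.\<close>

lemma A2_split_fourier:
  assumes p: "p > 0"
    and a: "\<And>r s. 6 * int p dvd r - s \<Longrightarrow> a r = a s" and b: "\<And>r s. 2 * int p dvd r - s \<Longrightarrow> b r = b s"
  shows "A2_split p (\<lambda>s. \<Sum>r\<in>residues (3 * p). S1 (3 * p) s r * a r) (\<lambda>s. \<Sum>r\<in>residues p. S1 p s r * b r) s =
     2 * Sfac (3 * p) * Sfac p * (\<Sum>r\<in>A2_labels p. A2_char p s r * A2_split p a b r)"
proof -
  \<comment> \<open>The summand at a pair of residues. It is periodic, so residues may be represented as convenient.\<close>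
  define K where "K = (\<lambda>R \<rho>. e2 (- of_int (R * (2 * fst s + snd s) + 3 * \<rho> * snd s) / (6 * of_nat p)) * (a R * b \<rho>))"
  have Kper: "K R \<rho> = K R' \<rho>'" if "6 * int p dvd R - R'" "2 * int p dvd \<rho> - \<rho>'" for R R' \<rho> \<rho>'
  proof -
    from that(1) obtain k where k: "R - R' = 6 * int p * k" by (rule dvdE)
    from that(2) obtain l where l: "\<rho> - \<rho>' = 2 * int p * l" by (rule dvdE)
    have R: "R = R' + 6 * int p * k" "\<rho> = \<rho>' + 2 * int p * l" using k l by simp_all
    have "- complex_of_int (R * (2 * fst s + snd s) + 3 * \<rho> * snd s) / (6 * of_nat p) =
        - of_int (R' * (2 * fst s + snd s) + 3 * \<rho>' * snd s) / (6 * of_nat p) + of_int (- (k * (2 * fst s + snd s) + l * snd s))"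
      unfolding R using p by (simp add: field_simps)
    then show ?thesis unfolding K_def a[OF that(1)] b[OF that(2)] by (simp only: e2_add_int)
  qed
  have "A2_split p (\<lambda>s. \<Sum>r\<in>residues (3 * p). S1 (3 * p) s r * a r) (\<lambda>s. \<Sum>r\<in>residues p. S1 p s r * b r) s =
      (\<Sum>\<delta>\<in>{0, 1}. \<Sum>R\<in>residues (3 * p). \<Sum>\<rho>\<in>residues p. Sfac (3 * p) * Sfac p * (e2 (- of_int ((R - \<rho>) * \<delta>) / 2) * K R \<rho>))"
    unfolding A2_split_def sum_product
  proof (intro sum.cong refl)
    fix \<delta> R \<rho>
    have "- complex_of_int (R * (2 * fst s + snd s + 3 * int p * \<delta>)) / (2 * of_nat (3 * p)) + - of_int (\<rho> * (snd s - int p * \<delta>)) / (2 * of_nat p)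
        = - of_int ((R - \<rho>) * \<delta>) / 2 + - of_int (R * (2 * fst s + snd s) + 3 * \<rho> * snd s) / (6 * of_nat p)"
      using p by (simp add: field_simps)
    then have "e2 (- complex_of_int (R * (2 * fst s + snd s + 3 * int p * \<delta>)) / (2 * of_nat (3 * p))) * e2 (- of_int (\<rho> * (snd s - int p * \<delta>)) / (2 * of_nat p))
        = e2 (- of_int ((R - \<rho>) * \<delta>) / 2) * e2 (- of_int (R * (2 * fst s + snd s) + 3 * \<rho> * snd s) / (6 * of_nat p))"
      by (simp only: e2_add[symmetric])
    then show "S1 (3 * p) (2 * fst s + snd s + 3 * int p * \<delta>) R * a R * (S1 p (snd s - int p * \<delta>) \<rho> * b \<rho>) =
        Sfac (3 * p) * Sfac p * (e2 (- of_int ((R - \<rho>) * \<delta>) / 2) * K R \<rho>)"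
      unfolding S1_def K_def by algebra
  qed
  also have "\<dots> = (\<Sum>R\<in>residues (3 * p). \<Sum>\<rho>\<in>residues p. Sfac (3 * p) * Sfac p * ((1 + e2 (- of_int (R - \<rho>) / 2)) * K R \<rho>))"
    by (simp add: sum.distrib distrib_left distrib_right del: of_int_diff)
  also have "\<dots> = (\<Sum>R\<in>residues (3 * p). \<Sum>\<rho>\<in>residues p. 2 * Sfac (3 * p) * Sfac p * (of_bool (even (R - \<rho>)) * K R \<rho>))"
    by (intro sum.cong refl) (simp only: e2_half, simp)
  also have "\<dots> = 2 * Sfac (3 * p) * Sfac p * (\<Sum>\<rho>\<in>residues p. \<Sum>R\<in>residues (3 * p). of_bool (even (R - \<rho>)) * K R \<rho>)"
    unfolding sum_distrib_left by (rule sum.swap)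
  also have "(\<Sum>\<rho>\<in>residues p. \<Sum>R\<in>residues (3 * p). of_bool (even (R - \<rho>)) * K R \<rho>) =
      (\<Sum>r2\<in>{0..<int p}. \<Sum>\<delta>\<in>{0, 1}. \<Sum>R\<in>residues (3 * p). of_bool (even (R - (r2 - int p * \<delta>))) * K R (r2 - int p * \<delta>))"
  proof (rule sum_periodic_split)
    fix x y assume xy: "2 * int p dvd x - y"
    then have "even (x - y)" by (rule dvd_trans[rotated]) simp
    then have "even (R - x) = even (R - y)" for R by auto
    then show "(\<Sum>R\<in>residues (3 * p). of_bool (even (R - x)) * K R x) = (\<Sum>R\<in>residues (3 * p). of_bool (even (R - y)) * K R y)"
      using xy by (intro sum.cong refl arg_cong2[where f = "(*)"] Kper arg_cong[where f = of_bool]) auto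
  qed (use p in simp)
  also have "\<dots> = (\<Sum>r2\<in>{0..<int p}. \<Sum>\<delta>\<in>{0, 1}. \<Sum>r1\<in>{0..<3 * int p}. K (2 * r1 + r2 + 3 * int p * \<delta>) (r2 - int p * \<delta>))"
  proof (rule sum.cong[OF refl], rule sum.cong[OF refl])
    fix r2 \<delta> :: int
    define c where "c = r2 + 3 * int p * \<delta>"
    define g where "g = (\<lambda>R. of_bool (even (R - (r2 - int p * \<delta>))) * K R (r2 - int p * \<delta>))"
    have "(\<Sum>R\<in>residues (3 * p). g R) = (\<Sum>R\<in>residues (3 * p). g (R + c))"
    proof (rule sum_periodic_shift[symmetric])
      fix x y assume xy: "2 * int (3 * p) dvd x - y"
      then have "even (x - y)" by (rule dvd_trans[rotated]) simp
      then have "even (x - R) = even (y - R)" for R by auto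
      then show "g x = g y" unfolding g_def using xy
        by (intro arg_cong2[where f = "(*)"] Kper arg_cong[where f = of_bool]) auto
    qed (use p in simp)
    also have "\<dots> = (\<Sum>R\<in>{0..<2 * (3 * int p)}. of_bool (even R) * K (R + c) (r2 - int p * \<delta>))"
    proof (rule sum.cong)
      fix R
      have "R + c - (r2 - int p * \<delta>) = R + 2 * (2 * int p * \<delta>)" unfolding c_def by simp
      then have "even (R + c - (r2 - int p * \<delta>)) = even R" by (simp only: dvd_add_left_iff dvd_triv_left)
      then show "g (R + c) = of_bool (even R) * K (R + c) (r2 - int p * \<delta>)" unfolding g_def by (simp only:)
    qed simp
    also have "\<dots> = (\<Sum>r1\<in>{0..<3 * int p}. K (2 * r1 + c) (r2 - int p * \<delta>))" by (rule sum_even)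
    finally show "(\<Sum>R\<in>residues (3 * p). of_bool (even (R - (r2 - int p * \<delta>))) * K R (r2 - int p * \<delta>)) =
        (\<Sum>r1\<in>{0..<3 * int p}. K (2 * r1 + r2 + 3 * int p * \<delta>) (r2 - int p * \<delta>))"
      unfolding g_def c_def by (simp only: add.assoc)
  qed
  also have "\<dots> = (\<Sum>r2\<in>{0..<int p}. \<Sum>r1\<in>{0..<3 * int p}. A2_char p s (r1, r2) * A2_split p a b (r1, r2))"
  proof (rule sum.cong[OF refl])
    fix r2
    show "(\<Sum>\<delta>\<in>{0, 1}. \<Sum>r1\<in>{0..<3 * int p}. K (2 * r1 + r2 + 3 * int p * \<delta>) (r2 - int p * \<delta>)) =
      (\<Sum>r1\<in>{0..<3 * int p}. A2_char p s (r1, r2) * A2_split p a b (r1, r2))"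
      unfolding A2_split_def sum_distrib_left
    proof (subst sum.swap, rule sum.cong[OF refl], rule sum.cong[OF refl])
      fix r1 \<delta> :: int
      have "- complex_of_int ((2 * r1 + r2 + 3 * int p * \<delta>) * (2 * fst s + snd s) + 3 * (r2 - int p * \<delta>) * snd s) / (6 * of_nat p) =
        - of_int (2 * r1 * fst s + r2 * fst s + r1 * snd s + 2 * r2 * snd s) / (3 * of_nat p) + of_int (- (\<delta> * fst s))"
        using p by (simp add: field_simps)
      then show "K (2 * r1 + r2 + 3 * int p * \<delta>) (r2 - int p * \<delta>) =
        A2_char p s (r1, r2) * (a (2 * fst (r1, r2) + snd (r1, r2) + 3 * int p * \<delta>) * b (snd (r1, r2) - int p * \<delta>))"
        unfolding K_def A2_char_def fst_conv snd_conv by (simp only: e2_add_int)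
    qed
  qed
  also have "\<dots> = (\<Sum>r\<in>A2_labels p. A2_char p s r * A2_split p a b r)"
    unfolding A2_labels_eq by (subst sum.swap) (simp only: sum.cartesian_product case_prod_unfold prod.collapse)
  finally show ?thesis .
qed

text \<open>The square $[0, 3p)^2$ consists of three translates of the label set by multiples of $(0, p)$, which
periodicity under $(p, p)$ and $(3p, 0)$ moves back.\<close>

lemma sum_A2_labels_square:
  fixes f :: "int \<times> int \<Rightarrow> complex"
  assumes p: "p > 0"
    and f1: "\<And>x x' y. 3 * int p dvd x - x' \<Longrightarrow> f (x, y) = f (x', y)"
    and f3: "\<And>x y k. f (x + int p * k, y + int p * k) = f (x, y)"
  shows "3 * (\<Sum>r\<in>A2_labels p. f r) = (\<Sum>x\<in>{0..<3 * int p}. \<Sum>y\<in>{0..<3 * int p}. f (x, y))"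
proof -
  have "(\<Sum>y\<in>{0..<3 * int p}. g y) = (\<Sum>y\<in>{0..<int p}. g y + g (y + int p) + g (y + int p * 2))" for g :: "int \<Rightarrow> complex"
  proof -
    have "{0..<3 * int p} = ({0..<int p} \<union> {int p..<2 * int p}) \<union> {2 * int p..<3 * int p}" by auto
    then have "(\<Sum>y\<in>{0..<3 * int p}. g y) = (\<Sum>y\<in>{0..<int p}. g y) + (\<Sum>y\<in>{int p..<2 * int p}. g y) + (\<Sum>y\<in>{2 * int p..<3 * int p}. g y)"
      using p by (subst sum.union_disjoint[symmetric], simp, simp, force)+ simp
    also have "(\<Sum>y\<in>{int p..<2 * int p}. g y) = (\<Sum>y\<in>{0..<int p}. g (y + int p))"
      by (rule sum.reindex_bij_witness[where i = "\<lambda>x. x + int p" and j = "\<lambda>x. x - int p"]) auto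
    also have "(\<Sum>y\<in>{2 * int p..<3 * int p}. g y) = (\<Sum>y\<in>{0..<int p}. g (y + int p * 2))"
      by (rule sum.reindex_bij_witness[where i = "\<lambda>x. x + int p * 2" and j = "\<lambda>x. x - int p * 2"]) auto
    finally show ?thesis by (simp only: sum.distrib)
  qed
  note split3 = this
  have "(\<Sum>x\<in>{0..<3 * int p}. \<Sum>y\<in>{0..<3 * int p}. f (x, y)) =
      (\<Sum>y\<in>{0..<int p}. \<Sum>x\<in>{0..<3 * int p}. f (x, y) + f (x, y + int p) + f (x, y + int p * 2))"
    by (subst sum.swap) (simp only: split3[of "\<lambda>y. \<Sum>x\<in>{0..<3 * int p}. f (x, y)"] sum.distrib)
  also have "\<dots> = (\<Sum>y\<in>{0..<int p}. 3 * (\<Sum>x\<in>{0..<3 * int p}. f (x, y)))"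
  proof (rule sum.cong[OF refl])
    fix y
    have "(\<Sum>x\<in>{0..<3 * int p}. f (x, y + int p * k)) = (\<Sum>x\<in>{0..<3 * int p}. f (x, y))" for k
    proof -
      have "(\<Sum>x\<in>{0..<3 * int p}. f (x, y + int p * k)) = (\<Sum>x\<in>{0..<3 * int p}. f (x + int p * k, y + int p * k))"
        by (rule sum_periodic_shift[symmetric]) (use p f1 in auto)
      then show ?thesis by (simp only: f3)
    qed
    from this[of 1] this[of 2]
    show "(\<Sum>x\<in>{0..<3 * int p}. f (x, y) + f (x, y + int p) + f (x, y + int p * 2)) = 3 * (\<Sum>x\<in>{0..<3 * int p}. f (x, y))"
      by (simp add: sum.distrib)
  qed
  also have "\<dots> = 3 * (\<Sum>r\<in>A2_labels p. f r)"
    unfolding A2_labels_eq sum_distrib_left[symmetric]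
    by (subst sum.swap) (simp only: sum.cartesian_product case_prod_unfold prod.collapse)
  finally show ?thesis ..
qed

text \<open>The label set is not symmetric, but the square is.\<close>

lemma sum_A2_labels_swap:
  fixes f :: "int \<times> int \<Rightarrow> complex"
  assumes p: "p > 0"
    and f1: "\<And>x x' y. 3 * int p dvd x - x' \<Longrightarrow> f (x, y) = f (x', y)"
    and f2: "\<And>x y y'. 3 * int p dvd y - y' \<Longrightarrow> f (x, y) = f (x, y')"
    and f3: "\<And>x y k. f (x + int p * k, y + int p * k) = f (x, y)"
  shows "(\<Sum>r\<in>A2_labels p. f r) = (\<Sum>r\<in>A2_labels p. f (prod.swap r))"
proof -
  have "3 * (\<Sum>r\<in>A2_labels p. f r) = (\<Sum>x\<in>{0..<3 * int p}. \<Sum>y\<in>{0..<3 * int p}. f (x, y))"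
    by (rule sum_A2_labels_square[OF p f1 f3])
  also have "\<dots> = (\<Sum>x\<in>{0..<3 * int p}. \<Sum>y\<in>{0..<3 * int p}. f (prod.swap (x, y)))" by (subst sum.swap) simp
  also have "\<dots> = 3 * (\<Sum>r\<in>A2_labels p. f (prod.swap r))"
    by (rule sum_A2_labels_square[OF p, of "\<lambda>r. f (prod.swap r)", symmetric]) (simp_all add: f2 f3)
  finally show ?thesis by simp
qed

text \<open>The glued product depends on \<open>s\<close> only through $\mu_2(s)$ modulo the lattice; $3p\beta_1$, $3p\beta_2$ and
$p(\beta_1 + \beta_2)$, divided by \<open>p\<close>, are lattice vectors.\<close>

lemma A2_split_periodic:
  assumes p: "p > 0"
    and a: "\<And>r s. 6 * int p dvd r - s \<Longrightarrow> a r = a s" and b: "\<And>r s. 2 * int p dvd r - s \<Longrightarrow> b r = b s"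
  shows "3 * int p dvd x - x' \<Longrightarrow> A2_split p a b (x, y) = A2_split p a b (x', y)"
    "3 * int p dvd y - y' \<Longrightarrow> A2_split p a b (x, y) = A2_split p a b (x, y')"
    "A2_split p a b (x + int p * k, y + int p * k) = A2_split p a b (x, y)"
proof -
  show "A2_split p a b (x, y) = A2_split p a b (x', y)" if x: "3 * int p dvd x - x'"
  proof -
    from x obtain k where k: "x - x' = 3 * int p * k" by (rule dvdE)
    have "a (2 * x + y + 3 * int p * \<delta>) = a (2 * x' + y + 3 * int p * \<delta>)" for \<delta>
    proof (rule a, rule dvdI)
      show "2 * x + y + 3 * int p * \<delta> - (2 * x' + y + 3 * int p * \<delta>) = 6 * int p * k" using k by simp
    qed
    then show ?thesis unfolding A2_split_def by simp
  qed
  have par: "A2_split p a b s = A2_split p a b t" if k: "2 * fst s + snd s = 2 * fst t + snd t + 3 * int p * k + 6 * int p * l" "snd s = snd t + int p * k + 2 * int p * l'" for s t k l l'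
  proof (cases "even k")
    case True
    then obtain h where h: "k = 2 * h" by (elim evenE)
    have "a (2 * fst s + snd s + 3 * int p * \<delta>) = a (2 * fst t + snd t + 3 * int p * \<delta>)" for \<delta>
      by (rule a) (simp add: k(1) h)
    moreover have "b (snd s - int p * \<delta>) = b (snd t - int p * \<delta>)" for \<delta> by (rule b) (simp add: k(2) h)
    ultimately show ?thesis unfolding A2_split_def by simp
  next
    case False
    then obtain h where h: "k = 2 * h + 1" by (elim oddE)
    have "a (2 * fst s + snd s) = a (2 * fst t + snd t + 3 * int p)"
    proof (rule a, rule dvdI)
      show "2 * fst s + snd s - (2 * fst t + snd t + 3 * int p) = 6 * int p * (h + l)" using k(1) h by (simp add: algebra_simps)
    qed
    moreover have "b (snd s) = b (snd t - int p)"
    proof (rule b, rule dvdI)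
      show "snd s - (snd t - int p) = 2 * int p * (h + l' + 1)" using k(2) h by (simp add: algebra_simps)
    qed
    moreover have "a (2 * fst s + snd s + 3 * int p) = a (2 * fst t + snd t)"
    proof (rule a, rule dvdI)
      show "2 * fst s + snd s + 3 * int p - (2 * fst t + snd t) = 6 * int p * (h + l + 1)" using k(1) h by (simp add: algebra_simps)
    qed
    moreover have "b (snd s - int p) = b (snd t)" by (rule b) (simp add: k(2) h algebra_simps)
    ultimately show ?thesis unfolding A2_split_def by (simp add: add.commute)
  qed
  show "A2_split p a b (x, y) = A2_split p a b (x, y')" if "3 * int p dvd y - y'"
  proof -
    from that obtain k where "y - y' = 3 * int p * k" by (rule dvdE)
    then have "y = y' + 3 * int p * k" by simp
    then show ?thesis by (intro par[of _ _ k 0 k]) (simp_all add: algebra_simps)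
  qed
  show "A2_split p a b (x + int p * k, y + int p * k) = A2_split p a b (x, y)"
    by (rule par[of _ _ k 0 0]) (simp_all add: algebra_simps)
qed

lemma A2_char_periodic:
  assumes p: "p > 0"
  shows "3 * int p dvd x - x' \<Longrightarrow> A2_char p s (x, y) = A2_char p s (x', y)"
    "3 * int p dvd y - y' \<Longrightarrow> A2_char p s (x, y) = A2_char p s (x, y')"
    "A2_char p s (x + int p * k, y + int p * k) = A2_char p s (x, y)"
proof -
  have e: "A2_char p s r = A2_char p s t"
    if "2 * fst r * fst s + snd r * fst s + fst r * snd s + 2 * snd r * snd s = 2 * fst t * fst s + snd t * fst s + fst t * snd s + 2 * snd t * snd s + 3 * int p * l" for r t l
  proof -
    have "- complex_of_int (2 * fst r * fst s + snd r * fst s + fst r * snd s + 2 * snd r * snd s) / (3 * of_nat p) =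
       - of_int (2 * fst t * fst s + snd t * fst s + fst t * snd s + 2 * snd t * snd s) / (3 * of_nat p) + of_int (- l)"
      unfolding that using p by (simp add: field_simps)
    then show ?thesis unfolding A2_char_def by (simp only: e2_add_int)
  qed
  show "A2_char p s (x, y) = A2_char p s (x', y)" if "3 * int p dvd x - x'"
  proof -
    from that obtain k where "x - x' = 3 * int p * k" by (rule dvdE)
    then have "x = x' + 3 * int p * k" by simp
    then show ?thesis by (intro e[of _ _ "2 * k * fst s + k * snd s"]) (simp add: algebra_simps)
  qed
  show "A2_char p s (x, y) = A2_char p s (x, y')" if "3 * int p dvd y - y'"
  proof -
    from that obtain k where "y - y' = 3 * int p * k" by (rule dvdE)
    then have "y = y' + 3 * int p * k" by simp
    then show ?thesis by (intro e[of _ _ "k * fst s + 2 * k * snd s"]) (simp add: algebra_simps)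
  qed
  show "A2_char p s (x + int p * k, y + int p * k) = A2_char p s (x, y)"
    by (rule e[of _ _ "k * fst s + k * snd s"]) (simp add: algebra_simps)
qed

lemma A2_split_fourier_swap:
  assumes p: "p > 0"
    and a: "\<And>r s. 6 * int p dvd r - s \<Longrightarrow> a r = a s" and b: "\<And>r s. 2 * int p dvd r - s \<Longrightarrow> b r = b s"
  shows "(\<Sum>r\<in>A2_labels p. A2_char p (prod.swap s) r * A2_split p a b r) = (\<Sum>r\<in>A2_labels p. A2_char p s r * A2_split p a b (prod.swap r))"
proof -
  have "(\<Sum>r\<in>A2_labels p. A2_char p (prod.swap s) r * A2_split p a b r) = (\<Sum>r\<in>A2_labels p. A2_char p (prod.swap s) (prod.swap r) * A2_split p a b (prod.swap r))"
  proof (rule sum_A2_labels_swap[OF p])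
    show "A2_char p (prod.swap s) (x, y) * A2_split p a b (x, y) = A2_char p (prod.swap s) (x', y) * A2_split p a b (x', y)" if "3 * int p dvd x - x'" for x x' y
      by (simp only: A2_char_periodic(1)[OF p that] A2_split_periodic(1)[of p a b, OF p a b that])
    show "A2_char p (prod.swap s) (x, y) * A2_split p a b (x, y) = A2_char p (prod.swap s) (x, y') * A2_split p a b (x, y')" if "3 * int p dvd y - y'" for x y y'
      by (simp only: A2_char_periodic(2)[OF p that] A2_split_periodic(2)[of p a b, OF p a b that])
    show "A2_char p (prod.swap s) (x + int p * k, y + int p * k) * A2_split p a b (x + int p * k, y + int p * k) = A2_char p (prod.swap s) (x, y) * A2_split p a b (x, y)" for x y k
      by (simp only: A2_char_periodic(3)[OF p] A2_split_periodic(3)[of p a b, OF p a b])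
  qed
  moreover have "A2_char p (prod.swap s) (prod.swap r) = A2_char p s r" for r
    unfolding A2_char_def by (simp add: algebra_simps)
  ultimately show ?thesis by (simp only:)
qed

section \<open>Translation and inversion in rank two\<close>

definition T2 :: "nat \<Rightarrow> int \<times> int \<Rightarrow> complex" where
  "T2 p s = e2 (of_int ((fst s)\<^sup>2 + fst s * snd s + (snd s)\<^sup>2) / (3 * of_nat p))"

text \<open>Equals $-\frac{i}{p\sqrt3}$ times the character, see \<open>Sfac_product\<close>.\<close>

definition S2 :: "nat \<Rightarrow> int \<times> int \<Rightarrow> int \<times> int \<Rightarrow> complex" where
  "S2 p s r = 2 * Sfac (3 * p) * Sfac p * A2_char p s r"

lemma Sfac_product:
  assumes p: "p > 0" shows "2 * Sfac (3 * p) * Sfac p = - \<i> / (of_nat p * of_real (sqrt 3))"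
proof -
  have c: "c8 * c8 = - \<i>"
  proof -
    have "c8 * c8 = cis (- pi / 2)" unfolding c8_def by (simp add: cis_conv_exp mult_exp_exp)
    also have "\<dots> = - \<i>" by (simp add: cis.ctr complex_eq_iff)
    finally show ?thesis .
  qed
  have "sqrt (2 * real (3 * p)) * sqrt (2 * p) = sqrt (3 * (2 * real p)\<^sup>2)"
    unfolding real_sqrt_mult[symmetric] by (simp add: power2_eq_square)
  also have "\<dots> = 2 * (p * sqrt 3)" by (simp only: real_sqrt_mult real_sqrt_abs) simp
  finally have s: "complex_of_real (sqrt (2 * real (3 * p))) * of_real (sqrt (2 * p)) = 2 * (of_nat p * of_real (sqrt 3))"
    unfolding of_real_mult[symmetric] by simp
  have "2 * Sfac (3 * p) * Sfac p = 2 * (c8 * c8) / (complex_of_real (sqrt (2 * real (3 * p))) * of_real (sqrt (2 * p)))"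
    unfolding Sfac_def by simp
  then show ?thesis unfolding c s by simp
qed

lemma A2_split_S:
  assumes p: "p > 0"
    and a: "\<And>r s. 6 * int p dvd r - s \<Longrightarrow> a r = a s" and b: "\<And>r s. 2 * int p dvd r - s \<Longrightarrow> b r = b s"
    and A: "\<And>s. A s = c * (\<Sum>r\<in>residues (3 * p). S1 (3 * p) s r * a r)"
    and B: "\<And>s. B s = d * (\<Sum>r\<in>residues p. S1 p s r * b r)"
  shows "A2_split p A B s = c * d * (\<Sum>r\<in>A2_labels p. S2 p s r * A2_split p a b r)"
proof -
  define A' where "A' = (\<lambda>s. \<Sum>r\<in>residues (3 * p). S1 (3 * p) s r * a r)"
  define B' where "B' = (\<lambda>s. \<Sum>r\<in>residues p. S1 p s r * b r)"
  have "A2_split p A B s = c * d * A2_split p A' B' s"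
  proof -
    have "A t = c * A' t" "B t = d * B' t" for t by (simp_all only: A A'_def B B'_def)
    then show ?thesis unfolding A2_split_def by (simp add: algebra_simps)
  qed
  also have "A2_split p A' B' s = 2 * Sfac (3 * p) * Sfac p * (\<Sum>r\<in>A2_labels p. A2_char p s r * A2_split p a b r)"
    unfolding A'_def B'_def by (rule A2_split_fourier[OF p a b])
  finally show ?thesis unfolding S2_def sum_distrib_left by (simp only: mult.assoc)
qed

lemma csqrt_mult_self: "csqrt z * csqrt z = z"
  by (simp flip: power2_eq_square)

text \<open>\<open>A2_split_S\<close> for both summands; in the second one the sum over the labels is transposed by
\<open>A2_split_fourier_swap\<close>.\<close>

lemma A2_deriv_S:
  assumes p: "p > 0" and \<tau>: "\<tau> \<in> uhp" and w: "w \<in> uhp"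
  shows "A2_deriv p s (- 1 / \<tau>) (- 1 / w) = \<tau> * w\<^sup>2 * (\<Sum>r\<in>A2_labels p. S2 p s r * A2_deriv p r \<tau> w)"
proof -
  have p3: "3 * p > 0" using p by simp
  let ?a = "\<lambda>r. theta1 (3 * p) r w" and ?b = "\<lambda>r. phi p r \<tau> w"
  have a: "?a r = ?a t" if "6 * int p dvd r - t" for r t using theta1_dvd[OF p3, of r t] that by simp
  have b: "?b r = ?b t" if "2 * int p dvd r - t" for r t using phi_dvd[OF p, of r t] that by simp
  have u: "(w * csqrt w) * (\<tau> * csqrt w) = \<tau> * w\<^sup>2"
  proof -
    have "(w * csqrt w) * (\<tau> * csqrt w) = \<tau> * w * (csqrt w * csqrt w)" by (simp only: mult_ac)
    then show ?thesis unfolding csqrt_mult_self by (simp only: power2_eq_square mult.assoc)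
  qed
  have e: "A2_split p (\<lambda>r. theta1 (3 * p) r (- 1 / w)) (\<lambda>r. phi p r (- 1 / \<tau>) (- 1 / w)) t =
      (w * csqrt w) * (\<tau> * csqrt w) * (\<Sum>r\<in>A2_labels p. S2 p t r * A2_split p ?a ?b r)" for t
    by (rule A2_split_S[OF p a b theta1_S[OF p3 w] phi_S[OF p \<tau> w]])
  have S: "(\<Sum>r\<in>A2_labels p. S2 p (prod.swap s) r * A2_split p ?a ?b r) = (\<Sum>r\<in>A2_labels p. S2 p s r * A2_split p ?a ?b (prod.swap r))"
    unfolding S2_def mult.assoc sum_distrib_left[symmetric] by (simp only: A2_split_fourier_swap[OF p a b])
  show ?thesis
    unfolding A2_deriv_def e u S distrib_left sum.distrib ..
qed

lemma Theta_A2_split: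
  assumes p: "p > 0" and \<tau>: "\<tau> \<in> uhp"
  shows "Theta_A2 p (mu2 p s) \<tau> = A2_split p (\<lambda>r. jt (3 * p) r \<tau> 0) (\<lambda>r. jt p r \<tau> 0) s"
proof -
  have p3: "3 * p > 0" using p by simp
  have e: "qpow \<tau> (of_nat (3 * p) * (a / 2)\<^sup>2) * qpow \<tau> (of_nat p * (b - a / 2)\<^sup>2) = qpow \<tau> (of_nat p * Qr a b)" for a b
    unfolding qpow_def exp_add[symmetric] Qr_def by (rule arg_cong[where f = exp]) (simp add: power2_eq_square field_simps)
  have j: "jt_term m n \<tau> 0 = qpow \<tau> (of_nat m * n\<^sup>2)" for m n by (simp add: jt_term_def qpow_e2)
  show ?thesis
    unfolding Theta_A2_def jt_def j
    using infsumI[OF has_sum_int2_split[OF p qpow_norm_summable[OF p3 \<tau>] qpow_norm_summable[OF p \<tau>], of s]]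
    unfolding e Q2_eq[symmetric] .
qed

lemma Theta_A2_S:
  assumes p: "p > 0" and \<tau>: "\<tau> \<in> uhp"
  shows "Theta_A2 p (mu2 p s) (- 1 / \<tau>) = \<tau> * (\<Sum>r\<in>A2_labels p. S2 p s r * Theta_A2 p (mu2 p r) \<tau>)"
proof -
  have p3: "3 * p > 0" using p by simp
  let ?a = "\<lambda>r. jt (3 * p) r \<tau> 0" and ?b = "\<lambda>r. jt p r \<tau> 0"
  have a: "?a r = ?a t" if "6 * int p dvd r - t" for r t using jt_dvd[OF p3, of r t] that by simp
  have b: "?b r = ?b t" if "2 * int p dvd r - t" for r t using jt_dvd[OF p, of r t] that by simp
  have j: "jt m s (- 1 / \<tau>) 0 = csqrt \<tau> * (\<Sum>r\<in>residues m. S1 m s r * jt m r \<tau> 0)" if "m > 0" for m s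
    using jt_S[OF that \<tau>, of s 0] by simp
  have "Theta_A2 p (mu2 p s) (- 1 / \<tau>) = csqrt \<tau> * csqrt \<tau> * (\<Sum>r\<in>A2_labels p. S2 p s r * A2_split p ?a ?b r)"
    unfolding Theta_A2_split[OF p uhp_S[OF \<tau>]] by (rule A2_split_S[OF p a b j[OF p3] j[OF p]])
  then show ?thesis unfolding Theta_A2_split[OF p \<tau>] csqrt_mult_self .
qed

text \<open>Compare both sides as functions of \<open>w\<close>: equal derivatives by \<open>A2_deriv_S\<close>, equal values at
$w = \tau$ by the inversion formula of the theta series.\<close>

lemma psihat_A2_S:
  assumes p: "p > 0" and \<tau>: "\<tau> \<in> uhp" and w: "w \<in> uhp"
  shows "psihat_A2 p s (- 1 / \<tau>) (- 1 / w) = \<tau> * (\<Sum>r\<in>A2_labels p. S2 p s r * psihat_A2 p r \<tau> w)"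
proof -
  let ?C = "- 4 * \<i> * of_real (sqrt 3 * p) :: complex"
  define f where "f = (\<lambda>w. psihat_A2 p s (- 1 / \<tau>) (- 1 / w) - \<tau> * (\<Sum>r\<in>A2_labels p. S2 p s r * psihat_A2 p r \<tau> w))"
  have "(f has_field_derivative 0) (at w within uhp)" if w: "w \<in> uhp" for w
  proof -
    have wn: "w \<noteq> 0" by (rule uhp_nz[OF w])
    have i: "((\<lambda>w. - 1 / w) has_field_derivative 1 / w\<^sup>2) (at w)"
      using wn by (auto intro!: derivative_eq_intros simp: power2_eq_square)
    have 1: "((\<lambda>w. psihat_A2 p s (- 1 / \<tau>) (- 1 / w)) has_field_derivative ?C * A2_deriv p s (- 1 / \<tau>) (- 1 / w) * (1 / w\<^sup>2)) (at w)"
      by (rule DERIV_chain2[OF psihat_A2_has_field_derivative[OF p uhp_S[OF \<tau>] uhp_S[OF w]] i])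
    have 2: "((\<lambda>w. \<tau> * (\<Sum>r\<in>A2_labels p. S2 p s r * psihat_A2 p r \<tau> w)) has_field_derivative
        \<tau> * (\<Sum>r\<in>A2_labels p. S2 p s r * (?C * A2_deriv p r \<tau> w))) (at w)"
      by (intro DERIV_cmult DERIV_sum psihat_A2_has_field_derivative p \<tau> w)
    have "\<tau> * (\<Sum>r\<in>A2_labels p. S2 p s r * (?C * A2_deriv p r \<tau> w)) = ?C * (\<tau> * (\<Sum>r\<in>A2_labels p. S2 p s r * A2_deriv p r \<tau> w))"
      unfolding sum_distrib_left by (simp only: mult_ac)
    moreover have "?C * A2_deriv p s (- 1 / \<tau>) (- 1 / w) * (1 / w\<^sup>2) = ?C * (\<tau> * (\<Sum>r\<in>A2_labels p. S2 p s r * A2_deriv p r \<tau> w))"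
      unfolding A2_deriv_S[OF p \<tau> w] using wn by simp
    ultimately show ?thesis using DERIV_diff[OF 1 2] unfolding f_def by (simp only: diff_self has_field_derivative_at_within)
  qed
  then obtain k where k: "\<And>w. w \<in> uhp \<Longrightarrow> f w = k"
    using has_field_derivative_zero_constant[OF convex_uhp, of f] by blast
  have "f \<tau> = 0"
    unfolding f_def psihat_A2_diag[OF p] Theta_A2_S[OF p \<tau>] sum_distrib_left by (simp add: mult_ac)
  then have "f w = 0" using k[OF \<tau>] k[OF w] by simp
  then show ?thesis unfolding f_def by simp
qed

lemma qpow_Q2_shift:
  assumes p: "p > 0" and n: "n \<in> int2_coset (mu2 p s)"
  shows "qpow (\<tau> + 1) (of_nat p * Q2 n) = T2 p s * qpow \<tau> (of_nat p * Q2 n)"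
proof -
  have h: "n $ 1 - mu2 p s $ 1 \<in> \<int>" "n $ 2 - mu2 p s $ 2 \<in> \<int>"
    using n by (simp_all add: int2_coset_def forall_2)
  from h(1) obtain a where "n $ 1 - mu2 p s $ 1 = of_int a" by (rule Ints_cases)
  then have a: "n $ 1 = of_int a + of_int (2 * fst s + snd s) / (3 * of_nat p)" unfolding mu2_nth by simp
  from h(2) obtain b where "n $ 2 - mu2 p s $ 2 = of_int b" by (rule Ints_cases)
  then have b: "n $ 2 = of_int b + of_int (fst s + 2 * snd s) / (3 * of_nat p)" unfolding mu2_nth by simp
  have "of_nat p * Q2 n = of_int ((fst s)\<^sup>2 + fst s * snd s + (snd s)\<^sup>2) / (3 * of_nat p) +
      of_int (fst s * a + snd s * b + int p * (a\<^sup>2 + b\<^sup>2 - a * b))"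
    unfolding Q2_eq Qr_def a b using p by (simp add: field_simps power2_eq_square)
  then have "complex_of_real (of_nat p * Q2 n) = of_int ((fst s)\<^sup>2 + fst s * snd s + (snd s)\<^sup>2) / (3 * of_nat p) +
      of_int (fst s * a + snd s * b + int p * (a\<^sup>2 + b\<^sup>2 - a * b))" by simp
  then have "e2 (of_real (of_nat p * Q2 n)) = T2 p s" unfolding T2_def by (simp only: e2_add_int)
  then show ?thesis unfolding qpow_e2 distrib_left e2_add mult_1_right by (simp only: mult.commute)
qed

lemma psihat_A2_T:
  assumes p: "p > 0"
  shows "psihat_A2 p s (\<tau> + 1) (w + 1) = T2 p s * psihat_A2 p s \<tau> w"
  unfolding psihat_A2_eq[OF p] A2_term_def infsum_cmult_right'[symmetric]
  by (rule infsum_cong) (simp add: qpow_Q2_shift[OF p])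

section \<open>Theta functions with real characteristics\<close>

text \<open>The Jacobi theta function at $z = \tau x + y$, normalized so that the modular group acts on the
characteristics $(x, y)$ linearly and only the factor $\sqrt{c\tau+d}$ remains. The characteristics
are the additional freedom that makes the components linearly independent.\<close>

definition th :: "nat \<Rightarrow> int \<Rightarrow> complex \<Rightarrow> real \<Rightarrow> real \<Rightarrow> complex" where
  "th m s \<tau> x y = e2 (of_nat m * of_real x * (\<tau> * of_real x + of_real y)) * jt m s \<tau> (\<tau> * of_real x + of_real y)"

lemma th_dvd: "m > 0 \<Longrightarrow> 2 * int m dvd s - r \<Longrightarrow> th m s = th m r"
  unfolding th_def[abs_def] by (simp only: jt_dvd)

lemma th_T: "m > 0 \<Longrightarrow> th m s (\<tau> + 1) x (y - x) = T1 m s * th m s \<tau> x y"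
proof -
  assume m: "m > 0"
  have "(\<tau> + 1) * of_real x + of_real (y - x) = \<tau> * of_real x + of_real y" by (simp add: algebra_simps)
  then show ?thesis unfolding th_def jt_T[OF m] by (simp only: mult_ac)
qed

text \<open>The exponential factors of \<open>jt_S\<close> and of the normalization cancel.\<close>

lemma th_S:
  assumes m: "m > 0" and \<tau>: "\<tau> \<in> uhp"
  shows "th m s (- 1 / \<tau>) (- y) x = csqrt \<tau> * (\<Sum>r\<in>residues m. S1 m s r * th m r \<tau> x y)"
proof -
  define z where "z = \<tau> * of_real x + of_real y"
  have tn: "\<tau> \<noteq> 0" by (rule uhp_nz[OF \<tau>])
  have z: "- 1 / \<tau> * of_real (- y) + of_real x = z / \<tau>" unfolding z_def using tn by (simp add: field_simps)
  have tz: "\<tau> * (z / \<tau>) = z" using tn by simp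
  have "e2 (of_nat m * of_real (- y) * (z / \<tau>)) * e2 (of_nat m * \<tau> * (z / \<tau>)\<^sup>2) = e2 (of_nat m * of_real x * z)"
  proof -
    have "of_nat m * of_real (- y) * (z / \<tau>) + of_nat m * \<tau> * (z / \<tau>)\<^sup>2 = of_nat m * of_real x * z"
    proof -
      have "of_nat m * of_real (- y) * (z / \<tau>) + of_nat m * \<tau> * (z / \<tau>)\<^sup>2 = of_nat m * (z / \<tau>) * (z - of_real y)"
        using tn by (simp add: power2_eq_square field_simps)
      also have "z - of_real y = \<tau> * of_real x" unfolding z_def by simp
      finally show ?thesis using tn by simp
    qed
    then show ?thesis by (simp only: e2_add[symmetric])
  qed
  then have "th m s (- 1 / \<tau>) (- y) x = csqrt \<tau> * (e2 (of_nat m * of_real x * z) * (\<Sum>r\<in>residues m. S1 m s r * jt m r \<tau> z))"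
    unfolding th_def z jt_S[OF m \<tau>] tz by (simp add: mult_ac del: csqrt.simps)
  then show ?thesis unfolding th_def z_def[symmetric] sum_distrib_left by (simp only: mult_ac)
qed

definition Th2 :: "nat \<Rightarrow> int \<times> int \<Rightarrow> complex \<Rightarrow> real \<Rightarrow> real \<Rightarrow> real \<Rightarrow> real \<Rightarrow> complex" where
  "Th2 p s \<tau> x1 y1 x2 y2 = A2_split p (\<lambda>r. th (3 * p) r \<tau> x1 y1) (\<lambda>r. th p r \<tau> x2 y2) s"

lemma Th2_T:
  assumes p: "p > 0"
  shows "Th2 p s (\<tau> + 1) x1 (y1 - x1) x2 (y2 - x2) = T2 p s * Th2 p s \<tau> x1 y1 x2 y2"
proof -
  have p3: "3 * p > 0" using p by simp
  have e: "e2 (of_int ((2 * fst s + snd s + 3 * int p * \<delta>)\<^sup>2) / (4 * of_nat (3 * p))) * e2 (of_int ((snd s - int p * \<delta>)\<^sup>2) / (4 * of_nat p)) = T2 p s" for \<delta>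
  proof -
    have "complex_of_int ((2 * fst s + snd s + 3 * int p * \<delta>)\<^sup>2) / (4 * of_nat (3 * p)) + of_int ((snd s - int p * \<delta>)\<^sup>2) / (4 * of_nat p) =
      of_int ((fst s)\<^sup>2 + fst s * snd s + (snd s)\<^sup>2) / (3 * of_nat p) + of_int (\<delta> * fst s + int p * \<delta>\<^sup>2)"
      using p by (simp add: field_simps power2_eq_square)
    then show ?thesis unfolding T2_def e2_add[symmetric] by (simp only: e2_add_int)
  qed
  have e: "(e2 (of_int ((2 * fst s + snd s + 3 * int p * \<delta>)\<^sup>2) / (4 * of_nat (3 * p))) * x) * (e2 (of_int ((snd s - int p * \<delta>)\<^sup>2) / (4 * of_nat p)) * y) = T2 p s * (x * y)" for x y \<delta>
    unfolding e[of \<delta>, symmetric] by (simp only: mult_ac)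
  show ?thesis
    unfolding Th2_def th_T[OF p] th_T[OF p3] A2_split_def sum_distrib_left by (intro sum.cong refl) (simp only: e)
qed

lemma Th2_S:
  assumes p: "p > 0" and \<tau>: "\<tau> \<in> uhp"
  shows "Th2 p s (- 1 / \<tau>) (- y1) x1 (- y2) x2 = \<tau> * (\<Sum>r\<in>A2_labels p. S2 p s r * Th2 p r \<tau> x1 y1 x2 y2)"
proof -
  have p3: "3 * p > 0" using p by simp
  let ?a = "\<lambda>r. th (3 * p) r \<tau> x1 y1" and ?b = "\<lambda>r. th p r \<tau> x2 y2"
  have a: "?a r = ?a t" if "6 * int p dvd r - t" for r t using th_dvd[OF p3, of r t] that by simp
  have b: "?b r = ?b t" if "2 * int p dvd r - t" for r t using th_dvd[OF p, of r t] that by simp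
  have "Th2 p s (- 1 / \<tau>) (- y1) x1 (- y2) x2 = csqrt \<tau> * csqrt \<tau> * (\<Sum>r\<in>A2_labels p. S2 p s r * A2_split p ?a ?b r)"
    unfolding Th2_def by (rule A2_split_S[OF p a b th_S[OF p3 \<tau>] th_S[OF p \<tau>]])
  then show ?thesis unfolding csqrt_mult_self Th2_def .
qed

section \<open>Unitarity of the inversion matrices\<close>

lemma e2_eq_1_iff: "e2 (of_real x) = 1 \<longleftrightarrow> x \<in> \<int>"
proof
  assume "e2 (of_real x) = 1"
  then obtain n :: int where "2 * pi * x = of_int (2 * n) * pi" unfolding e2_def exp_eq_1 by auto
  then have "x = of_int n" by simp
  then show "x \<in> \<int>" by simp
next
  assume "x \<in> \<int>" then show "e2 (of_real x) = 1" by (elim Ints_cases) simp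
qed

text \<open>Shifting the summation variable multiplies the sum by $e^{2\pi i k/N}$.\<close>

lemma sum_roots_of_unity:
  assumes N: "N > (0::int)"
  shows "(\<Sum>l\<in>{0..<N}. e2 (of_int (l * k) / of_int N)) = of_int N * of_bool (N dvd k)"
proof (cases "N dvd k")
  case True
  then obtain j where "k = N * j" by (rule dvdE)
  then have "e2 (of_int (l * k) / of_int N) = 1" for l
    using N e2_of_int[of "l * j"] by (simp add: field_simps)
  then show ?thesis using True N by simp
next
  case False
  let ?g = "\<lambda>l. e2 (of_int (l * k) / of_int N)"
  have "(\<Sum>l\<in>{0..<N}. ?g (l + 1)) = (\<Sum>l\<in>{0..<N}. ?g l)"
  proof (rule sum_periodic_shift[OF N])
    fix x y assume "N dvd x - y"
    then obtain j where "x - y = N * j" by (rule dvdE)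
    then have x: "x = y + N * j" by simp
    have "complex_of_int (x * k) / of_int N = of_int (y * k) / of_int N + of_int (j * k)"
      unfolding x using N by (simp add: field_simps)
    then show "?g x = ?g y" by (simp only: e2_add_int)
  qed
  moreover have "?g (l + 1) = e2 (of_real (of_int k / of_int N)) * ?g l" for l
    unfolding e2_add[symmetric] by (rule arg_cong[where f = e2]) (use N in \<open>simp add: field_simps\<close>)
  ultimately have "e2 (of_real (of_int k / of_int N)) * (\<Sum>l\<in>{0..<N}. ?g l) = (\<Sum>l\<in>{0..<N}. ?g l)"
    by (simp only: sum_distrib_left)
  moreover have "e2 (of_real (of_int k / of_int N)) \<noteq> 1"
  proof
    assume "e2 (of_real (of_int k / of_int N)) = 1"
    then obtain j :: int where "real_of_int k / of_int N = of_int j" unfolding e2_eq_1_iff by (rule Ints_cases)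
    then have "real_of_int k = of_int (N * j)" using N by (simp add: field_simps)
    then have "k = N * j" by (simp only: of_int_eq_iff)
    then show False using False by simp
  qed
  ultimately show ?thesis using False by simp
qed

definition unitary_on :: "'i set \<Rightarrow> ('i \<Rightarrow> 'i \<Rightarrow> complex) \<Rightarrow> bool" where
  "unitary_on I M \<longleftrightarrow> (\<forall>i\<in>I. \<forall>j\<in>I. (\<Sum>l\<in>I. M i l * cnj (M j l)) = of_bool (i = j))"

lemma cnj_e2: "Im x = 0 \<Longrightarrow> cnj (e2 x) = e2 (- x)"
  using complex_is_Real_iff[of x] by (auto simp: e2_def exp_cnj elim!: Reals_cases)

lemma norm_c8: "c8 * cnj c8 = 1"
proof -
  have "cmod c8 = 1" unfolding c8_def by simp
  then show ?thesis by (simp add: complex_norm_square[symmetric])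
qed

lemma Sfac_norm: "m > 0 \<Longrightarrow> Sfac m * cnj (Sfac m) = 1 / (2 * of_nat m)"
proof -
  assume "m > 0"
  have "complex_of_real (sqrt (2 * m)) * of_real (sqrt (2 * m)) = 2 * of_nat m"
    unfolding of_real_mult[symmetric] by simp
  moreover have "Sfac m * cnj (Sfac m) = (c8 * cnj c8) / (complex_of_real (sqrt (2 * m)) * of_real (sqrt (2 * m)))"
    unfolding Sfac_def by simp
  ultimately show ?thesis unfolding norm_c8 by simp
qed

lemma unitary_S1:
  assumes m: "m > 0"
  shows "unitary_on (residues m) (S1 m)"
  unfolding unitary_on_def
proof (intro ballI)
  fix i j assume ij: "i \<in> residues m" "j \<in> residues m"
  have "S1 m i l * cnj (S1 m j l) = 1 / (2 * of_nat m) * e2 (of_int (l * (j - i)) / of_int (2 * int m))" for l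
  proof -
    have "cnj (e2 (- of_int (l * j) / (2 * of_nat m))) = e2 (- (- of_int (l * j) / (2 * of_nat m)))"
      by (rule cnj_e2) (simp add: Im_divide)
    moreover have "e2 (- of_int (l * i) / (2 * of_nat m)) * e2 (- (- of_int (l * j) / (2 * of_nat m))) = e2 (of_int (l * (j - i)) / of_int (2 * int m))"
      unfolding e2_add[symmetric] by (rule arg_cong[where f = e2]) (use m in \<open>simp add: field_simps\<close>)
    ultimately show ?thesis unfolding S1_def complex_cnj_mult Sfac_norm[OF m, symmetric] by (simp only: mult_ac)
  qed
  then have "(\<Sum>l\<in>residues m. S1 m i l * cnj (S1 m j l)) = 1 / (2 * of_nat m) * (of_int (2 * int m) * of_bool (2 * int m dvd j - i))"
    using sum_roots_of_unity[of "2 * int m" "j - i"] m by (simp only: sum_distrib_left[symmetric])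
  also have "(2 * int m dvd j - i) = (i = j)"
  proof
    assume "2 * int m dvd j - i"
    then have "j mod (2 * int m) = i mod (2 * int m)" by (simp only: mod_eq_dvd_iff)
    then show "i = j" using ij by simp
  qed simp
  finally show "(\<Sum>l\<in>residues m. S1 m i l * cnj (S1 m j l)) = of_bool (i = j)" using m by simp
qed

text \<open>The two divisibilities say that the labels have the same image under \<open>mu2 p\<close> modulo the lattice.\<close>

lemma A2_labels_inj:
  assumes p: "p > 0" and i: "i \<in> A2_labels p" and j: "j \<in> A2_labels p"
    and 1: "3 * int p dvd 2 * (fst j - fst i) + (snd j - snd i)" and 2: "int p dvd fst j - fst i"
  shows "i = j"
proof -
  obtain l where l: "fst j - fst i = int p * l" using 2 by (rule dvdE)
  have "int p dvd 2 * (fst j - fst i) + (snd j - snd i)" by (rule dvd_trans[OF _ 1]) simp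
  then have "int p dvd snd j - snd i" using dvd_mult[OF 2, of 2] by (simp only: dvd_add_right_iff)
  then have "snd j mod int p = snd i mod int p" by (simp only: mod_eq_dvd_iff)
  then have s: "snd j = snd i" using i j by (simp add: A2_labels_eq mem_Times_iff)
  then have "int p * 3 dvd int p * (2 * l)" using 1 l by (simp add: mult_ac)
  then have "3 dvd 2 * l" using p by (simp only: dvd_mult_cancel_left) simp
  then have "3 dvd l" by presburger
  then have "3 * int p dvd fst j - fst i" unfolding l by (simp add: mult.commute)
  then have "fst j mod (3 * int p) = fst i mod (3 * int p)" by (simp only: mod_eq_dvd_iff)
  then have "fst j = fst i" using i j by (simp add: A2_labels_eq mem_Times_iff)
  with s show ?thesis by (simp add: prod_eq_iff)
qed

text \<open>Orthogonality of characters: the sum over $r_1$ restricts to $3p \mid 2u + v$ for the difference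
$(u, v)$ of the labels, and then the sum over $r_2$ restricts to $p \mid u$.\<close>

lemma unitary_S2:
  assumes p: "p > 0"
  shows "unitary_on (A2_labels p) (S2 p)"
  unfolding unitary_on_def
proof (intro ballI)
  fix i j assume ij: "i \<in> A2_labels p" "j \<in> A2_labels p"
  define u where "u = fst j - fst i"
  define v where "v = snd j - snd i"
  have p3: "3 * p > 0" using p by simp
  have fac: "(2 * Sfac (3 * p) * Sfac p) * cnj (2 * Sfac (3 * p) * Sfac p) = 1 / (3 * of_nat p * of_nat p)"
  proof -
    have "(2 * Sfac (3 * p) * Sfac p) * cnj (2 * Sfac (3 * p) * Sfac p) = 4 * (Sfac (3 * p) * cnj (Sfac (3 * p))) * (Sfac p * cnj (Sfac p))"
      by simp
    then show ?thesis unfolding Sfac_norm[OF p] Sfac_norm[OF p3] using p by simp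
  qed
  have t: "S2 p i r * cnj (S2 p j r) = 1 / (3 * of_nat p * of_nat p) *
      (e2 (of_int (fst r * (2 * u + v)) / of_int (3 * int p)) * e2 (of_int (snd r * (u + 2 * v)) / of_int (3 * int p)))" for r
  proof -
    have "cnj (A2_char p j r) = e2 (- (- of_int (2 * fst r * fst j + snd r * fst j + fst r * snd j + 2 * snd r * snd j) / (3 * of_nat p)))"
      unfolding A2_char_def by (rule cnj_e2) (simp add: Im_divide)
    then have "A2_char p i r * cnj (A2_char p j r) = e2 (of_int (fst r * (2 * u + v)) / of_int (3 * int p)) * e2 (of_int (snd r * (u + 2 * v)) / of_int (3 * int p))"
      unfolding A2_char_def u_def v_def e2_add[symmetric]
      by (simp only: e2_add[symmetric]) (rule arg_cong[where f = e2], use p in \<open>simp add: field_simps\<close>)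
    then show ?thesis unfolding S2_def complex_cnj_mult[of "2 * Sfac (3 * p) * Sfac p"] fac[symmetric] by algebra
  qed
  have "(\<Sum>r\<in>A2_labels p. S2 p i r * cnj (S2 p j r)) = 1 / (3 * of_nat p * of_nat p) *
      ((\<Sum>r1\<in>{0..<3 * int p}. e2 (of_int (r1 * (2 * u + v)) / of_int (3 * int p))) * (\<Sum>r2\<in>{0..<int p}. e2 (of_int (r2 * (u + 2 * v)) / of_int (3 * int p))))"
    unfolding t sum_distrib_left[symmetric] A2_labels_eq by (simp only: sum_product sum.cartesian_product case_prod_unfold)
  also have "(\<Sum>r1\<in>{0..<3 * int p}. e2 (of_int (r1 * (2 * u + v)) / of_int (3 * int p))) = of_int (3 * int p) * of_bool (3 * int p dvd 2 * u + v)"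
    by (rule sum_roots_of_unity) (use p in simp)
  also have "\<dots> * (\<Sum>r2\<in>{0..<int p}. e2 (of_int (r2 * (u + 2 * v)) / of_int (3 * int p))) = of_int (3 * int p) * of_int (int p) * of_bool (i = j)"
  proof (cases "3 * int p dvd 2 * u + v")
    case False
    then have "i \<noteq> j" unfolding u_def v_def by auto
    then show ?thesis using False by simp
  next
    case True
    then obtain k where "2 * u + v = 3 * int p * k" by (rule dvdE)
    then have v: "v = 3 * int p * k - 2 * u" by simp
    have "e2 (of_int (r2 * (u + 2 * v)) / of_int (3 * int p)) = e2 (of_int (r2 * - u) / of_int (int p))" for r2
    proof -
      have "complex_of_int (r2 * (u + 2 * v)) / of_int (3 * int p) = of_int (r2 * - u) / of_int (int p) + of_int (2 * r2 * k)"
        unfolding v using p by (simp add: field_simps)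
      then show ?thesis by (simp only: e2_add_int)
    qed
    then have "(\<Sum>r2\<in>{0..<int p}. e2 (of_int (r2 * (u + 2 * v)) / of_int (3 * int p))) = of_int (int p) * of_bool (int p dvd - u)"
      using sum_roots_of_unity[of "int p" "- u"] p by simp
    moreover have "int p dvd - u \<longleftrightarrow> i = j"
    proof
      assume "int p dvd - u"
      then have "int p dvd u" by simp
      then show "i = j" using A2_labels_inj[OF p ij] True unfolding u_def v_def by blast
    qed (simp add: u_def)
    ultimately show ?thesis using True by simp
  qed
  finally show "(\<Sum>r\<in>A2_labels p. S2 p i r * cnj (S2 p j r)) = of_bool (i = j)" using p by simp
qed

section \<open>Generators of the modular group\<close>

text \<open>Matrices by their entries, so that products can be computed by rewriting.\<close>

definition mat22 :: "int \<Rightarrow> int \<Rightarrow> int \<Rightarrow> int \<Rightarrow> int^2^2" where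
  "mat22 a b c d = vector [vector [a, b], vector [c, d]]"

lemma mat22_nth [simp]: "mat22 a b c d $ 1 $ 1 = a" "mat22 a b c d $ 1 $ 2 = b" "mat22 a b c d $ 2 $ 1 = c" "mat22 a b c d $ 2 $ 2 = d"
  by (simp_all add: mat22_def vector_2)

lemma mat22_eta: "mat22 (g $ 1 $ 1) (g $ 1 $ 2) (g $ 2 $ 1) (g $ 2 $ 2) = g"
  by (simp add: vec_eq_iff forall_2)

lemma mat22_mult: "mat22 a b c d ** mat22 a' b' c' d' = mat22 (a * a' + b * c') (a * b' + b * d') (c * a' + d * c') (c * b' + d * d')"
  by (simp add: vec_eq_iff forall_2 matrix_matrix_mult_def sum_2)

lemma mult_nth: "((g :: int^2^2) ** g') $ i $ j = g $ i $ 1 * g' $ 1 $ j + g $ i $ 2 * g' $ 2 $ j"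
  by (simp add: matrix_matrix_mult_def sum_2)

lemma mat_1_mat22: "(mat 1 :: int^2^2) = mat22 1 0 0 1"
  by (simp add: vec_eq_iff forall_2 mat_def)

lemma det_mat22: "det (mat22 a b c d) = a * d - b * c"
  by (simp add: det_2)

definition S_mat :: "int^2^2" where "S_mat = mat22 0 (- 1) 1 0"
definition T_mat :: "int^2^2" where "T_mat = mat22 1 1 0 1"

lemma det_S: "det S_mat = 1" and det_T: "det T_mat = 1"
  by (simp_all add: S_mat_def T_mat_def det_mat22)

lemma S_mult: "S_mat ** mat22 a b c d = mat22 (- c) (- d) a b"
  and T_mult: "T_mat ** mat22 a b c d = mat22 (a + c) (b + d) c d"
  by (simp_all add: S_mat_def T_mat_def mat22_mult)

text \<open>Euclid's algorithm on the first column: subtracting a multiple of the second row makes $|a| < |c|$, and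
\<open>S_mat\<close> exchanges the rows. The inverse of \<open>T_mat\<close> is a word in \<open>S_mat\<close> and \<open>T_mat\<close>, so steps by these two
matrices suffice.\<close>

lemma SL2Z_induct:
  assumes det: "det g = 1"
    and 1: "P (mat 1)"
    and S: "\<And>g. det g = 1 \<Longrightarrow> P g \<Longrightarrow> P (S_mat ** g)"
    and T: "\<And>g. det g = 1 \<Longrightarrow> P g \<Longrightarrow> P (T_mat ** g)"
  shows "P g"
proof -
  define Q where "Q = (\<lambda>a b c d. a * d - b * c = 1 \<and> P (mat22 a b c d))"
  have QS: "Q (- c) (- d) a b" if "Q a b c d" for a b c d
    using that S[of "mat22 a b c d"] unfolding Q_def S_mult det_mat22 by (simp add: mult.commute)
  have QT: "Q (a + c) (b + d) c d" if "Q a b c d" for a b c d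
    using that T[of "mat22 a b c d"] unfolding Q_def T_mult det_mat22 by (simp add: algebra_simps)
  \<comment> \<open>$STSTS = -T^{-1}$ and $S^2 = -1$.\<close>
  have QT': "Q (a - c) (b - d) c d" if "Q a b c d" for a b c d
  proof -
    have "Q (c - a) (d - b) (- c) (- d)"
      using QS[OF QT[OF QS[OF QT[OF QS[OF that]]]]] by simp
    from QS[OF QS[OF this]] show ?thesis by simp
  qed
  have Qn: "Q (a + int n * c) (b + int n * d) c d \<and> Q (a - int n * c) (b - int n * d) c d" if "Q a b c d" for a b c d n
  proof (induction n)
    case (Suc n)
    have "Q (a + int (Suc n) * c) (b + int (Suc n) * d) c d"
      using QT[OF conjunct1[OF Suc.IH]] by (simp add: algebra_simps)
    moreover have "Q (a - int (Suc n) * c) (b - int (Suc n) * d) c d"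
      using QT'[OF conjunct2[OF Suc.IH]] by (simp add: algebra_simps)
    ultimately show ?case ..
  qed (use that in simp)
  have Qk: "Q (a + k * c) (b + k * d) c d" if "Q a b c d" for a b c d k
    using Qn[OF that, of "nat \<bar>k\<bar>"] by (cases "k \<ge> 0") auto
  have "Q a b c d" if "a * d - b * c = 1" for a b c d
    using that
  proof (induction "nat \<bar>c\<bar>" arbitrary: a b c d rule: less_induct)
    case less
    show ?case
    proof (cases "c = 0")
      case True
      have I: "Q 1 0 0 1" using 1 unfolding Q_def mat_1_mat22 by simp
      have "a * d = 1" using less.prems True by simp
      then consider "a = 1" "d = 1" | "a = - 1" "d = - 1" by (auto simp: zmult_eq_1_iff)
      then show ?thesis
      proof cases
        case 1 then show ?thesis using Qk[OF I, of b] True by simp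
      next
        case 2 then show ?thesis using QS[OF QS[OF Qk[OF I, of "- b"]]] True by simp
      qed
    next
      case False
      define q where "q = a div c"
      define r where "r = a mod c"
      have r: "\<bar>r\<bar> < \<bar>c\<bar>" unfolding r_def using False by (rule abs_mod_less)
      have a: "a = r + q * c" unfolding q_def r_def by simp
      \<comment> \<open>The induction hypothesis applies after one more exchange of rows, which puts the remainder below.\<close>
      have "Q (- c) (- d) r (b - q * d)"
      proof (rule less.hyps)
        show "nat \<bar>r\<bar> < nat \<bar>c\<bar>" using r by simp
        show "- c * (b - q * d) - - d * r = 1" using less.prems unfolding a by (simp add: algebra_simps)
      qed
      from QS[OF this] have "Q (- r) (- (b - q * d)) (- c) (- d)" .
      from QS[OF QS[OF this]] have "Q r (b - q * d) c d" by simp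
      from Qk[OF this, of q] show ?thesis using a by simp
    qed
  qed
  then have "Q (g $ 1 $ 1) (g $ 1 $ 2) (g $ 2 $ 1) (g $ 2 $ 2)" using det by (simp add: det_2)
  then show ?thesis unfolding Q_def mat22_eta by simp
qed

lemma carrier_SL2Z: "g \<in> carrier SL2Z \<longleftrightarrow> det g = 1"
  by (simp add: SL2Z_def)

lemma group_SL2Z: "group SL2Z"
proof (rule groupI)
  fix x assume x: "x \<in> carrier SL2Z"
  define y where "y = mat22 (x $ 2 $ 2) (- (x $ 1 $ 2)) (- (x $ 2 $ 1)) (x $ 1 $ 1)"
  have d: "x $ 1 $ 1 * x $ 2 $ 2 - x $ 1 $ 2 * x $ 2 $ 1 = 1" using x by (simp add: carrier_SL2Z det_2)
  have "det y = 1" unfolding y_def det_mat22 using d by (simp add: mult.commute)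
  moreover have "y ** x = mat 1"
    unfolding y_def mat_1_mat22 using d by (simp add: vec_eq_iff forall_2 mult_nth algebra_simps)
  ultimately show "\<exists>y\<in>carrier SL2Z. y \<otimes>\<^bsub>SL2Z\<^esub> x = \<one>\<^bsub>SL2Z\<^esub>"
    unfolding carrier_SL2Z Bex_def by (intro exI[of _ y]) (simp add: SL2Z_def)
qed (simp_all add: SL2Z_def det_mul matrix_mul_assoc)

lemma fin_index_SL2Z: "fin_index_subgroup (carrier SL2Z)"
proof -
  have s: "subgroup (carrier SL2Z) SL2Z" by (rule group.subgroup_self[OF group_SL2Z])
  have "rcosets\<^bsub>SL2Z\<^esub> carrier SL2Z \<subseteq> {carrier SL2Z}"
    unfolding RCOSETS_def using group.coset_join2[OF group_SL2Z _ s] by auto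
  then have "finite (rcosets\<^bsub>SL2Z\<^esub> carrier SL2Z)" by (rule finite_subset) simp
  with s show ?thesis unfolding fin_index_subgroup_def ..
qed

section \<open>The factor of automorphy\<close>

lemma jfac_nz:
  assumes d: "det g = 1" and \<tau>: "\<tau> \<in> uhp" shows "jfac g \<tau> \<noteq> 0"
proof
  assume j: "jfac g \<tau> = 0"
  then have "Im (jfac g \<tau>) = 0" by simp
  then have "g $ 2 $ 1 = 0" using \<tau> by (simp add: jfac_def uhp_def)
  moreover with j have "g $ 2 $ 2 = 0" by (simp add: jfac_def)
  ultimately show False using d by (simp add: det_2)
qed

lemma moeb_diff:
  assumes d: "det g = 1" and \<tau>: "\<tau> \<in> uhp" and w: "w \<in> uhp"
  shows "moeb g w - moeb g \<tau> = (w - \<tau>) / (jfac g \<tau> * jfac g w)"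
proof -
  have n: "jfac g \<tau> \<noteq> 0" "jfac g w \<noteq> 0" by (rule jfac_nz[OF d \<tau>] jfac_nz[OF d w])+
  have "complex_of_int (g $ 1 $ 1) * of_int (g $ 2 $ 2) - of_int (g $ 1 $ 2) * of_int (g $ 2 $ 1) = 1"
    using d unfolding det_2 by (simp flip: of_int_mult of_int_diff)
  then have "(of_int (g $ 1 $ 1) * w + of_int (g $ 1 $ 2)) * jfac g \<tau> - (of_int (g $ 1 $ 1) * \<tau> + of_int (g $ 1 $ 2)) * jfac g w = w - \<tau>"
    unfolding jfac_def by algebra
  then show ?thesis unfolding moeb_def using n by (simp add: field_simps)
qed

lemma moeb_uhp:
  assumes d: "det g = 1" and \<tau>: "\<tau> \<in> uhp" shows "moeb g \<tau> \<in> uhp"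
proof -
  have n: "jfac g \<tau> \<noteq> 0" by (rule jfac_nz[OF d \<tau>])
  have d': "g $ 1 $ 1 * g $ 2 $ 2 - g $ 1 $ 2 * g $ 2 $ 1 = 1" using d by (simp add: det_2)
  have "Im (moeb g \<tau>) = (of_int (g $ 1 $ 1 * g $ 2 $ 2 - g $ 1 $ 2 * g $ 2 $ 1)) * Im \<tau> / (cmod (jfac g \<tau>))\<^sup>2"
    unfolding moeb_def Im_divide cmod_power2 by (simp add: jfac_def algebra_simps)
  also have "\<dots> > 0" unfolding d' using \<tau> n by (simp add: uhp_def)
  finally show ?thesis by (simp add: uhp_def)
qed

lemma jfac_mult:
  assumes d: "det g' = 1" and \<tau>: "\<tau> \<in> uhp"
  shows "jfac (g ** g') \<tau> = jfac g (moeb g' \<tau>) * jfac g' \<tau>"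
proof -
  have n: "jfac g' \<tau> \<noteq> 0" by (rule jfac_nz[OF d \<tau>])
  have "jfac g (moeb g' \<tau>) * jfac g' \<tau> = of_int (g $ 2 $ 1) * (of_int (g' $ 1 $ 1) * \<tau> + of_int (g' $ 1 $ 2)) + of_int (g $ 2 $ 2) * jfac g' \<tau>"
    unfolding jfac_def[of g] moeb_def using n by (simp add: distrib_right)
  also have "\<dots> = jfac (g ** g') \<tau>" unfolding jfac_def mult_nth by (simp add: algebra_simps)
  finally show ?thesis ..
qed

lemma moeb_mult:
  assumes d: "det g = 1" "det g' = 1" and \<tau>: "\<tau> \<in> uhp"
  shows "moeb (g ** g') \<tau> = moeb g (moeb g' \<tau>)"
proof -
  have n: "jfac g' \<tau> \<noteq> 0" "jfac g (moeb g' \<tau>) \<noteq> 0" by (intro jfac_nz d \<tau> moeb_uhp)+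
  have "moeb (g ** g') \<tau> = (of_int (g $ 1 $ 1) * (of_int (g' $ 1 $ 1) * \<tau> + of_int (g' $ 1 $ 2)) + of_int (g $ 1 $ 2) * jfac g' \<tau>) / (jfac g (moeb g' \<tau>) * jfac g' \<tau>)"
    unfolding moeb_def[of "g ** g'"] jfac_mult[OF d(2) \<tau>] mult_nth by (simp add: jfac_def[of g'] algebra_simps)
  also have "\<dots> = (of_int (g $ 1 $ 1) * moeb g' \<tau> + of_int (g $ 1 $ 2)) / jfac g (moeb g' \<tau>)"
  proof -
    have "(A * N + B * j) / (J * j) = (A * (N / j) + B) / J" if "j \<noteq> 0" "J \<noteq> 0" for A B N J j :: complex
      using that by (simp add: field_simps)
    from this[OF n] show ?thesis by (simp only: moeb_def[of g' \<tau>])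
  qed
  finally show ?thesis unfolding moeb_def[of g] .
qed

lemma jfac_S: "jfac S_mat \<tau> = \<tau>" and jfac_T: "jfac T_mat \<tau> = 1"
  and moeb_S: "moeb S_mat \<tau> = - 1 / \<tau>" and moeb_T: "moeb T_mat \<tau> = \<tau> + 1"
  by (simp_all add: jfac_def moeb_def S_mat_def T_mat_def)

lemma jfac_one: "jfac (mat 1) \<tau> = 1" and moeb_one: "moeb (mat 1) \<tau> = \<tau>"
  by (simp_all add: jfac_def moeb_def mat_1_mat22)

lemma csqrt_jfac_continuous: "continuous_on uhp (\<lambda>\<tau>. csqrt (jfac g \<tau>))"
proof (cases "g $ 2 $ 1 = 0")
  case True then show ?thesis by (simp add: jfac_def)
next
  case False
  have "jfac g \<tau> \<notin> \<real>\<^sub>\<le>\<^sub>0" if "\<tau> \<in> uhp" for \<tau>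
    using that False by (auto simp: jfac_def uhp_def complex_nonpos_Reals_iff)
  then have "(\<lambda>\<tau>. csqrt (jfac g \<tau>)) holomorphic_on uhp"
    unfolding jfac_def by (intro holomorphic_intros) auto
  then show ?thesis by (rule holomorphic_on_imp_continuous_on)
qed

lemma moeb_continuous: "det g = 1 \<Longrightarrow> continuous_on uhp (moeb g)"
  unfolding moeb_def[abs_def] using jfac_nz[of g] by (intro continuous_intros) (auto simp: jfac_def intro!: continuous_intros)

text \<open>The quotient of the two sides is continuous on the half-plane and its square is $1$, so the sign does
not depend on $\tau$. The same sign therefore serves for every function that carries this root.\<close>

lemma csqrt_jfac_mult:
  assumes d: "det g = 1" "det g' = 1"
  obtains \<epsilon> :: complex where "\<epsilon> = 1 \<or> \<epsilon> = - 1"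
    "\<And>\<tau>. \<tau> \<in> uhp \<Longrightarrow> csqrt (jfac g (moeb g' \<tau>)) * csqrt (jfac g' \<tau>) = \<epsilon> * csqrt (jfac (g ** g') \<tau>)"
proof -
  define q where "q = (\<lambda>\<tau>. csqrt (jfac g (moeb g' \<tau>)) * csqrt (jfac g' \<tau>) / csqrt (jfac (g ** g') \<tau>))"
  have dd: "det (g ** g') = 1" by (simp add: det_mul d)
  have n: "csqrt (jfac (g ** g') \<tau>) \<noteq> 0" if "\<tau> \<in> uhp" for \<tau> using jfac_nz[OF dd that] by simp
  have "q \<tau> = 1 \<or> q \<tau> = - 1" if \<tau>: "\<tau> \<in> uhp" for \<tau>
  proof -
    have "(q \<tau>)\<^sup>2 = jfac g (moeb g' \<tau>) * jfac g' \<tau> / jfac (g ** g') \<tau>"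
      unfolding q_def power_divide power_mult_distrib by (simp only: power2_csqrt)
    also have "\<dots> = 1" using jfac_nz[OF dd \<tau>] unfolding jfac_mult[OF d(2) \<tau>] by simp
    finally show ?thesis unfolding power2_eq_1_iff .
  qed
  then have r: "q ` uhp \<subseteq> {1, - 1}" by auto
  have "continuous_on uhp (\<lambda>\<tau>. csqrt (jfac g (moeb g' \<tau>)))"
    by (rule continuous_on_compose2[OF csqrt_jfac_continuous moeb_continuous[OF d(2)]]) (auto intro: moeb_uhp[OF d(2)])
  then have "continuous_on uhp q"
    unfolding q_def using n by (intro continuous_on_divide continuous_on_mult csqrt_jfac_continuous) auto
  then have "q constant_on uhp"
    by (rule continuous_finite_range_constant[OF connected_uhp]) (rule finite_subset[OF r], simp)
  then obtain \<epsilon> where \<epsilon>: "\<And>\<tau>. \<tau> \<in> uhp \<Longrightarrow> q \<tau> = \<epsilon>" unfolding constant_on_def by blast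
  have i: "\<i> \<in> uhp" by (simp add: uhp_def)
  show ?thesis
  proof (rule that)
    show "\<epsilon> = 1 \<or> \<epsilon> = - 1" using r i \<epsilon>[OF i] by auto
    show "csqrt (jfac g (moeb g' \<tau>)) * csqrt (jfac g' \<tau>) = \<epsilon> * csqrt (jfac (g ** g') \<tau>)" if \<tau>: "\<tau> \<in> uhp" for \<tau>
      using \<epsilon>[OF \<tau>] n[OF \<tau>] unfolding q_def by (simp add: field_simps)
  qed
qed

lemma jpow_half: "jpow g (1 / 2) \<tau> = csqrt (jfac g \<tau>)"
  by (simp add: jpow_def csqrt_conv_powr)

lemma jpow_one: "jpow g 1 \<tau> = jfac g \<tau>"
  by (simp add: jpow_def powr_to_1)

lemma jpow_three_halves: "jpow g (3 / 2) \<tau> = jfac g \<tau> * csqrt (jfac g \<tau>)"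
proof -
  have "complex_of_real (3 / 2) = 1 + of_real (1 / 2)" by simp
  then show ?thesis unfolding jpow_half[symmetric] jpow_def by (simp only: powr_add powr_to_1)
qed

section \<open>Vectors of functions that transform by a matrix\<close>

text \<open>\<open>act\<close> is the action on the domain \<open>X\<close> and \<open>J\<close> the factor of automorphy; both vary between the families of
functions to which the same matrices apply.\<close>

definition transforms ::
  "'i set \<Rightarrow> 'x set \<Rightarrow> (int^2^2 \<Rightarrow> 'x \<Rightarrow> 'x) \<Rightarrow> (int^2^2 \<Rightarrow> 'x \<Rightarrow> complex) \<Rightarrow> ('i \<Rightarrow> 'x \<Rightarrow> complex) \<Rightarrow>
   int^2^2 \<Rightarrow> ('i \<Rightarrow> 'i \<Rightarrow> complex) \<Rightarrow> bool" where
  "transforms I X act J F g M \<longleftrightarrow> (\<forall>i\<in>I. \<forall>x\<in>X. F i (act g x) = J g x * (\<Sum>j\<in>I. M i j * F j x))"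

definition matprod :: "'i set \<Rightarrow> ('i \<Rightarrow> 'i \<Rightarrow> complex) \<Rightarrow> ('i \<Rightarrow> 'i \<Rightarrow> complex) \<Rightarrow> 'i \<Rightarrow> 'i \<Rightarrow> complex" where
  "matprod I M N i j = (\<Sum>l\<in>I. M i l * N l j)"

text \<open>The scalar $\varepsilon$ is the defect of \<open>J\<close> from being a cocycle.\<close>

lemma transforms_comp:
  assumes 1: "transforms I X act J F g M" and 2: "transforms I X act J F g' M'"
    and X: "\<And>x. x \<in> X \<Longrightarrow> act g' x \<in> X"
    and act: "\<And>x. x \<in> X \<Longrightarrow> act (g ** g') x = act g (act g' x)"
    and J: "\<And>x. x \<in> X \<Longrightarrow> J g (act g' x) * J g' x = \<epsilon> * J (g ** g') x"
  shows "transforms I X act J F (g ** g') (\<lambda>i j. \<epsilon> * matprod I M M' i j)"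
  unfolding transforms_def
proof (intro ballI)
  fix i x assume i: "i \<in> I" and x: "x \<in> X"
  have "F i (act (g ** g') x) = J g (act g' x) * (\<Sum>l\<in>I. M i l * F l (act g' x))"
    unfolding act[OF x] using 1 i X[OF x] unfolding transforms_def by simp
  also have "(\<Sum>l\<in>I. M i l * F l (act g' x)) = (\<Sum>l\<in>I. M i l * (J g' x * (\<Sum>j\<in>I. M' l j * F j x)))"
    using 2 x unfolding transforms_def by (intro sum.cong) auto
  also have "\<dots> = J g' x * (\<Sum>l\<in>I. \<Sum>j\<in>I. M i l * M' l j * F j x)"
    unfolding sum_distrib_left by (simp only: mult_ac)
  also have "(\<Sum>l\<in>I. \<Sum>j\<in>I. M i l * M' l j * F j x) = (\<Sum>j\<in>I. \<Sum>l\<in>I. M i l * M' l j * F j x)" by (rule sum.swap)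
  also have "\<dots> = (\<Sum>j\<in>I. matprod I M M' i j * F j x)" unfolding matprod_def sum_distrib_right ..
  also have "J g (act g' x) * (J g' x * (\<Sum>j\<in>I. matprod I M M' i j * F j x)) = (\<epsilon> * J (g ** g') x) * (\<Sum>j\<in>I. matprod I M M' i j * F j x)"
    unfolding J[OF x, symmetric] by (rule mult.assoc[symmetric])
  also have "\<dots> = J (g ** g') x * (\<Sum>j\<in>I. \<epsilon> * matprod I M M' i j * F j x)"
    unfolding sum_distrib_left by (simp only: mult_ac)
  finally show "F i (act (g ** g') x) = J (g ** g') x * (\<Sum>j\<in>I. \<epsilon> * matprod I M M' i j * F j x)" .
qed

lemma transforms_unique:
  assumes 1: "transforms I X act J F g M" and 2: "transforms I X act J F g M'"
    and J: "\<And>x. x \<in> X \<Longrightarrow> J g x \<noteq> 0"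
    and indep: "\<And>c j. (\<And>x. x \<in> X \<Longrightarrow> (\<Sum>j\<in>I. c j * F j x) = 0) \<Longrightarrow> j \<in> I \<Longrightarrow> c j = 0"
    and i: "i \<in> I" and j: "j \<in> I"
  shows "M i j = M' i j"
proof -
  have "(\<Sum>j\<in>I. (M i j - M' i j) * F j x) = 0" if x: "x \<in> X" for x
  proof -
    have "J g x * (\<Sum>j\<in>I. M i j * F j x) = J g x * (\<Sum>j\<in>I. M' i j * F j x)"
      using 1 2 i x unfolding transforms_def by metis
    then have "(\<Sum>j\<in>I. M i j * F j x) = (\<Sum>j\<in>I. M' i j * F j x)" using J[OF x] by simp
    then show ?thesis by (simp add: left_diff_distrib sum_subtractf)
  qed
  from indep[of "\<lambda>j. M i j - M' i j", OF this j] show ?thesis by simp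
qed

lemma unitary_on_matprod:
  assumes I: "finite I" and M: "unitary_on I M" and N: "unitary_on I N" and \<epsilon>: "\<epsilon> * cnj \<epsilon> = 1"
  shows "unitary_on I (\<lambda>i j. \<epsilon> * matprod I M N i j)"
  unfolding unitary_on_def
proof (intro ballI)
  fix i j assume ij: "i \<in> I" "j \<in> I"
  have "(\<Sum>l\<in>I. \<epsilon> * matprod I M N i l * cnj (\<epsilon> * matprod I M N j l)) = (\<epsilon> * cnj \<epsilon>) * (\<Sum>l\<in>I. matprod I M N i l * cnj (matprod I M N j l))"
    unfolding sum_distrib_left complex_cnj_mult by (simp only: mult_ac)
  also have "\<dots> = (\<Sum>l\<in>I. \<Sum>a\<in>I. \<Sum>b\<in>I. (M i a * cnj (M j b)) * (N a l * cnj (N b l)))"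
    unfolding \<epsilon> matprod_def cnj_sum sum_product complex_cnj_mult by (simp add: mult_ac)
  also have "\<dots> = (\<Sum>a\<in>I. \<Sum>b\<in>I. \<Sum>l\<in>I. (M i a * cnj (M j b)) * (N a l * cnj (N b l)))"
    by (subst sum.swap) (intro sum.cong refl sum.swap)
  also have "\<dots> = (\<Sum>a\<in>I. \<Sum>b\<in>I. (M i a * cnj (M j b)) * of_bool (a = b))"
    unfolding sum_distrib_left[symmetric] using N unfolding unitary_on_def by (intro sum.cong refl arg_cong2[where f = "(*)"]) auto
  also have "\<dots> = (\<Sum>a\<in>I. M i a * cnj (M j a))"
  proof (rule sum.cong[OF refl])
    fix a assume a: "a \<in> I"
    have "(\<Sum>b\<in>I. (M i a * cnj (M j b)) * of_bool (a = b)) = (\<Sum>b\<in>I. if a = b then M i a * cnj (M j b) else 0)"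
      by (rule sum.cong) auto
    also have "\<dots> = M i a * cnj (M j a)" using I a by (simp add: sum.delta)
    finally show "(\<Sum>b\<in>I. (M i a * cnj (M j b)) * of_bool (a = b)) = M i a * cnj (M j a)" .
  qed
  also have "\<dots> = of_bool (i = j)" using M ij unfolding unitary_on_def by blast
  finally show "(\<Sum>l\<in>I. \<epsilon> * matprod I M N i l * cnj (\<epsilon> * matprod I M N j l)) = of_bool (i = j)" .
qed

lemma unitary_on_diag:
  assumes I: "finite I" and c: "\<And>i. i \<in> I \<Longrightarrow> c i * cnj (c i) = 1"
  shows "unitary_on I (\<lambda>i j. c i * of_bool (i = j))"
  unfolding unitary_on_def
proof (intro ballI)
  fix i j assume ij: "i \<in> I" "j \<in> I"
  have "(\<Sum>l\<in>I. c i * of_bool (i = l) * cnj (c j * of_bool (j = l))) = (\<Sum>l\<in>I. if l = i then (if i = j then c i * cnj (c i) else 0) else 0)"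
    by (rule sum.cong) auto
  then show "(\<Sum>l\<in>I. c i * of_bool (i = l) * cnj (c j * of_bool (j = l))) = of_bool (i = j)"
    using I ij c by simp
qed

lemma sum_diag: "finite I \<Longrightarrow> i \<in> I \<Longrightarrow> (\<Sum>j\<in>I. c i * of_bool (i = j) * f j) = c i * (f i :: complex)"
proof -
  assume I: "finite I" "i \<in> I"
  have "(\<Sum>j\<in>I. c i * of_bool (i = j) * f j) = (\<Sum>j\<in>I. if i = j then c i * f j else 0)" by (rule sum.cong) auto
  then show ?thesis using I by simp
qed

section \<open>The rank one representation\<close>

definition act_th :: "int^2^2 \<Rightarrow> complex \<times> real \<times> real \<Rightarrow> complex \<times> real \<times> real" where
  "act_th g = (\<lambda>(\<tau>, x, y). (moeb g \<tau>, of_int (g $ 2 $ 2) * x - of_int (g $ 2 $ 1) * y, of_int (g $ 1 $ 1) * y - of_int (g $ 1 $ 2) * x))"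

definition act2 :: "int^2^2 \<Rightarrow> complex \<times> complex \<Rightarrow> complex \<times> complex" where
  "act2 g = (\<lambda>(\<tau>, w). (moeb g \<tau>, moeb g w))"

definition th_transforms :: "nat \<Rightarrow> int^2^2 \<Rightarrow> (int \<Rightarrow> int \<Rightarrow> complex) \<Rightarrow> bool" where
  "th_transforms m = transforms (residues m) (uhp \<times> UNIV) act_th (\<lambda>g (\<tau>, x, y). csqrt (jfac g \<tau>)) (\<lambda>s (\<tau>, x, y). th m s \<tau> x y)"

definition theta1_transforms :: "nat \<Rightarrow> int^2^2 \<Rightarrow> (int \<Rightarrow> int \<Rightarrow> complex) \<Rightarrow> bool" where
  "theta1_transforms m = transforms (residues m) uhp moeb (\<lambda>g \<tau>. jfac g \<tau> * csqrt (jfac g \<tau>)) (theta1 m)"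

definition phi_transforms :: "nat \<Rightarrow> int^2^2 \<Rightarrow> (int \<Rightarrow> int \<Rightarrow> complex) \<Rightarrow> bool" where
  "phi_transforms m = transforms (residues m) (uhp \<times> uhp) act2 (\<lambda>g (\<tau>, w). jfac g \<tau> * csqrt (jfac g w)) (\<lambda>s (\<tau>, w). phi m s \<tau> w)"

text \<open>One matrix for three families of functions. The theta functions \<open>th\<close> make it unique, the other two are
the ones of interest.\<close>

definition rank1_rep :: "nat \<Rightarrow> int^2^2 \<Rightarrow> (int \<Rightarrow> int \<Rightarrow> complex) \<Rightarrow> bool" where
  "rank1_rep m g M \<longleftrightarrow> unitary_on (residues m) M \<and> th_transforms m g M \<and> theta1_transforms m g M \<and> phi_transforms m g M"

lemma act_th_uhp: "det g = 1 \<Longrightarrow> x \<in> uhp \<times> UNIV \<Longrightarrow> act_th g x \<in> uhp \<times> UNIV"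
  by (auto simp: act_th_def intro: moeb_uhp)

lemma act_th_mult: "det g = 1 \<Longrightarrow> det g' = 1 \<Longrightarrow> x \<in> uhp \<times> UNIV \<Longrightarrow> act_th (g ** g') x = act_th g (act_th g' x)"
  by (auto simp: act_th_def moeb_mult mult_nth algebra_simps)

lemma act2_uhp: "det g = 1 \<Longrightarrow> x \<in> uhp \<times> uhp \<Longrightarrow> act2 g x \<in> uhp \<times> uhp"
  by (auto simp: act2_def intro: moeb_uhp)

lemma act2_mult: "det g = 1 \<Longrightarrow> det g' = 1 \<Longrightarrow> x \<in> uhp \<times> uhp \<Longrightarrow> act2 (g ** g') x = act2 g (act2 g' x)"
  by (auto simp: act2_def moeb_mult)

lemma th_transforms_comp:
  assumes d: "det g = 1" "det g' = 1" and 1: "th_transforms m g M" and 2: "th_transforms m g' M'"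
    and \<epsilon>: "\<And>\<tau>. \<tau> \<in> uhp \<Longrightarrow> csqrt (jfac g (moeb g' \<tau>)) * csqrt (jfac g' \<tau>) = \<epsilon> * csqrt (jfac (g ** g') \<tau>)"
  shows "th_transforms m (g ** g') (\<lambda>i j. \<epsilon> * matprod (residues m) M M' i j)"
  unfolding th_transforms_def
proof (rule transforms_comp[OF 1[unfolded th_transforms_def] 2[unfolded th_transforms_def]])
  fix x :: "complex \<times> real \<times> real" assume x: "x \<in> uhp \<times> UNIV"
  show "act_th g' x \<in> uhp \<times> UNIV" by (rule act_th_uhp[OF d(2) x])
  show "act_th (g ** g') x = act_th g (act_th g' x)" by (rule act_th_mult[OF d x])
  show "(case act_th g' x of (\<tau>, x, y) \<Rightarrow> csqrt (jfac g \<tau>)) * (case x of (\<tau>, x, y) \<Rightarrow> csqrt (jfac g' \<tau>)) =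
      \<epsilon> * (case x of (\<tau>, x, y) \<Rightarrow> csqrt (jfac (g ** g') \<tau>))"
    using x \<epsilon> by (cases x) (simp add: act_th_def del: csqrt.simps)
qed

text \<open>All three factors of automorphy contain exactly one square root, so the same sign works for
each of them.\<close>

lemma rank1_rep_comp:
  assumes d: "det g = 1" "det g' = 1" and 1: "rank1_rep m g M" and 2: "rank1_rep m g' M'"
  shows "\<exists>M. rank1_rep m (g ** g') M"
proof -
  obtain \<epsilon> :: complex where e: "\<epsilon> = 1 \<or> \<epsilon> = - 1" and
    \<epsilon>: "\<And>\<tau>. \<tau> \<in> uhp \<Longrightarrow> csqrt (jfac g (moeb g' \<tau>)) * csqrt (jfac g' \<tau>) = \<epsilon> * csqrt (jfac (g ** g') \<tau>)"
    using csqrt_jfac_mult[OF d] by blast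
  have e': "\<epsilon> * cnj \<epsilon> = 1" using e by auto
  note 1 = 1[unfolded rank1_rep_def] and 2 = 2[unfolded rank1_rep_def]
  let ?I = "(residues m)"
  let ?M = "\<lambda>i j. \<epsilon> * matprod ?I M M' i j"
  have u: "unitary_on ?I ?M" using 1 2 e' by (intro unitary_on_matprod) auto
  have t: "th_transforms m (g ** g') ?M" using 1 2 by (intro th_transforms_comp[OF d _ _ \<epsilon>]) auto
  have t1: "theta1_transforms m (g ** g') ?M"
    unfolding theta1_transforms_def
  proof (rule transforms_comp)
    show "transforms ?I uhp moeb (\<lambda>g \<tau>. jfac g \<tau> * csqrt (jfac g \<tau>)) (theta1 m) g M"
      "transforms ?I uhp moeb (\<lambda>g \<tau>. jfac g \<tau> * csqrt (jfac g \<tau>)) (theta1 m) g' M'"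
      using 1 2 unfolding theta1_transforms_def by blast+
    fix \<tau> assume \<tau>: "\<tau> \<in> uhp"
    show "moeb g' \<tau> \<in> uhp" by (rule moeb_uhp[OF d(2) \<tau>])
    show "moeb (g ** g') \<tau> = moeb g (moeb g' \<tau>)" by (rule moeb_mult[OF d \<tau>])
    have "jfac g (moeb g' \<tau>) * csqrt (jfac g (moeb g' \<tau>)) * (jfac g' \<tau> * csqrt (jfac g' \<tau>)) =
      (jfac g (moeb g' \<tau>) * jfac g' \<tau>) * (csqrt (jfac g (moeb g' \<tau>)) * csqrt (jfac g' \<tau>))" by (simp only: mult_ac)
    then show "jfac g (moeb g' \<tau>) * csqrt (jfac g (moeb g' \<tau>)) * (jfac g' \<tau> * csqrt (jfac g' \<tau>)) =
      \<epsilon> * (jfac (g ** g') \<tau> * csqrt (jfac (g ** g') \<tau>))"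
      unfolding \<epsilon>[OF \<tau>] jfac_mult[OF d(2) \<tau>, symmetric] by (simp only: mult_ac)
  qed
  have ph: "phi_transforms m (g ** g') ?M"
    unfolding phi_transforms_def
  proof (rule transforms_comp)
    show "transforms ?I (uhp \<times> uhp) act2 (\<lambda>g (\<tau>, w). jfac g \<tau> * csqrt (jfac g w)) (\<lambda>s (\<tau>, w). phi m s \<tau> w) g M"
      "transforms ?I (uhp \<times> uhp) act2 (\<lambda>g (\<tau>, w). jfac g \<tau> * csqrt (jfac g w)) (\<lambda>s (\<tau>, w). phi m s \<tau> w) g' M'"
      using 1 2 unfolding phi_transforms_def by blast+
    fix x assume x: "x \<in> uhp \<times> uhp"
    show "act2 g' x \<in> uhp \<times> uhp" by (rule act2_uhp[OF d(2) x])
    show "act2 (g ** g') x = act2 g (act2 g' x)" by (rule act2_mult[OF d x])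
    obtain \<tau> w where xx: "x = (\<tau>, w)" "\<tau> \<in> uhp" "w \<in> uhp" using x by blast
    have "jfac g (moeb g' \<tau>) * csqrt (jfac g (moeb g' w)) * (jfac g' \<tau> * csqrt (jfac g' w)) =
      (jfac g (moeb g' \<tau>) * jfac g' \<tau>) * (csqrt (jfac g (moeb g' w)) * csqrt (jfac g' w))" by (simp only: mult_ac)
    also have "\<dots> = \<epsilon> * (jfac (g ** g') \<tau> * csqrt (jfac (g ** g') w))"
      unfolding \<epsilon>[OF xx(3)] jfac_mult[OF d(2) xx(2), symmetric] by (simp only: mult_ac)
    finally show "(case act2 g' x of (\<tau>, w) \<Rightarrow> jfac g \<tau> * csqrt (jfac g w)) * (case x of (\<tau>, w) \<Rightarrow> jfac g' \<tau> * csqrt (jfac g' w)) =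
      \<epsilon> * (case x of (\<tau>, w) \<Rightarrow> jfac (g ** g') \<tau> * csqrt (jfac (g ** g') w))"
      unfolding xx(1) act2_def prod.case .
  qed
  show ?thesis unfolding rank1_rep_def using u t t1 ph by (intro exI[of _ ?M] conjI)
qed

lemma rank1_rep_S:
  assumes m: "m > 0" shows "rank1_rep m S_mat (S1 m)"
  unfolding rank1_rep_def
proof (intro conjI unitary_S1[OF m])
  show "th_transforms m S_mat (S1 m)"
    unfolding th_transforms_def transforms_def
    by (auto simp: act_th_def moeb_S jfac_S th_S[OF m, simplified] S_mat_def[THEN arg_cong[where f = "\<lambda>M. M $ i $ j" for i j]] simp del: csqrt.simps)
  show "theta1_transforms m S_mat (S1 m)"
    unfolding theta1_transforms_def transforms_def moeb_S jfac_S using theta1_S[OF m] by blast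
  show "phi_transforms m S_mat (S1 m)"
    unfolding phi_transforms_def transforms_def act2_def
    using phi_S[OF m] by (auto simp: moeb_S jfac_S simp del: csqrt.simps)
qed

lemma cnj_e2_mult: "Im x = 0 \<Longrightarrow> e2 x * cnj (e2 x) = 1"
  unfolding cnj_e2 by (simp flip: e2_add)

lemma rank1_rep_T:
  assumes m: "m > 0" shows "rank1_rep m T_mat (\<lambda>i j. T1 m i * of_bool (i = j))"
  unfolding rank1_rep_def
proof (intro conjI unitary_on_diag)
  show "T1 m i * cnj (T1 m i) = 1" for i
    by (rule cnj_e2_mult) (simp add: Im_divide)
  have fin: "finite (residues m)" by simp
  note d = sum_diag[OF fin, of _ "\<lambda>i. T1 m i"]
  show "th_transforms m T_mat (\<lambda>i j. T1 m i * of_bool (i = j))"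
    unfolding th_transforms_def transforms_def
  proof (intro ballI)
    fix i x assume i: "i \<in> residues m" and x: "x \<in> uhp \<times> (UNIV :: (real \<times> real) set)"
    obtain \<tau> u v where xx: "x = (\<tau>, u, v)" by (cases x)
    show "(case act_th T_mat x of (\<tau>, x, y) \<Rightarrow> th m i \<tau> x y) = (case x of (\<tau>, x, y) \<Rightarrow> csqrt (jfac T_mat \<tau>)) *
      (\<Sum>j\<in>residues m. T1 m i * of_bool (i = j) * (case x of (\<tau>, x, y) \<Rightarrow> th m j \<tau> x y))"
      unfolding d[OF i] using th_T[OF m] by (simp add: xx act_th_def moeb_T jfac_T) (simp add: T_mat_def)
  qed
  show "theta1_transforms m T_mat (\<lambda>i j. T1 m i * of_bool (i = j))"
    unfolding theta1_transforms_def transforms_def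
  proof (intro ballI)
    fix i x assume i: "i \<in> residues m"
    show "theta1 m i (moeb T_mat x) = jfac T_mat x * csqrt (jfac T_mat x) *
      (\<Sum>j\<in>residues m. T1 m i * of_bool (i = j) * theta1 m j x)"
      unfolding d[OF i] moeb_T jfac_T theta1_T[OF m] by simp
  qed
  show "phi_transforms m T_mat (\<lambda>i j. T1 m i * of_bool (i = j))"
    unfolding phi_transforms_def transforms_def
  proof (intro ballI)
    fix i x assume i: "i \<in> residues m" and x: "x \<in> uhp \<times> uhp"
    obtain \<tau> w where xx: "x = (\<tau>, w)" by (cases x)
    show "(case act2 T_mat x of (\<tau>, w) \<Rightarrow> phi m i \<tau> w) = (case x of (\<tau>, w) \<Rightarrow> jfac T_mat \<tau> * csqrt (jfac T_mat w)) *
      (\<Sum>j\<in>residues m. T1 m i * of_bool (i = j) * (case x of (\<tau>, w) \<Rightarrow> phi m j \<tau> w))"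
      unfolding d[OF i] by (simp add: xx act2_def moeb_T jfac_T phi_T[OF m])
  qed
qed simp

lemma rank1_rep_one:
  assumes m: "m > 0" shows "rank1_rep m (mat 1) (\<lambda>i j. 1 * of_bool (i = j))"
  unfolding rank1_rep_def
proof (intro conjI unitary_on_diag)
  have fin: "finite (residues m)" by simp
  note d = sum_diag[OF fin, of _ "\<lambda>i. 1"]
  have e: "(mat 1 :: int^2^2) $ 1 $ 1 = 1" "(mat 1 :: int^2^2) $ 1 $ 2 = 0" "(mat 1 :: int^2^2) $ 2 $ 1 = 0" "(mat 1 :: int^2^2) $ 2 $ 2 = 1"
    by (simp_all add: mat_1_mat22)
  show "th_transforms m (mat 1) (\<lambda>i j. 1 * of_bool (i = j))"
    unfolding th_transforms_def transforms_def
    by (intro ballI) (simp only: d, auto simp: act_th_def moeb_one jfac_one e)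
  show "theta1_transforms m (mat 1) (\<lambda>i j. 1 * of_bool (i = j))"
    unfolding theta1_transforms_def transforms_def
    by (intro ballI) (simp only: d, simp add: moeb_one jfac_one)
  show "phi_transforms m (mat 1) (\<lambda>i j. 1 * of_bool (i = j))"
    unfolding phi_transforms_def transforms_def
    by (intro ballI) (simp only: d, auto simp: act2_def moeb_one jfac_one)
qed simp_all

lemma rank1_rep_exists:
  assumes m: "m > 0" and d: "det g = 1"
  shows "\<exists>M. rank1_rep m g M"
proof (rule SL2Z_induct[OF d])
  show "\<exists>M. rank1_rep m (mat 1) M" using rank1_rep_one[OF m] by blast
  fix g :: "int^2^2" assume d: "det g = 1" and M: "\<exists>M. rank1_rep m g M"
  then obtain M where M: "rank1_rep m g M" by blast
  show "\<exists>M. rank1_rep m (S_mat ** g) M" by (rule rank1_rep_comp[OF det_S d rank1_rep_S[OF m] M])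
  show "\<exists>M. rank1_rep m (T_mat ** g) M" by (rule rank1_rep_comp[OF det_T d rank1_rep_T[OF m] M])
qed

text \<open>Chosen for every matrix; by \<open>th_independent\<close> there is only one choice on the labels.\<close>

definition rho1 :: "nat \<Rightarrow> int^2^2 \<Rightarrow> int \<Rightarrow> int \<Rightarrow> complex" where
  "rho1 m g = (SOME M. rank1_rep m g M)"

lemma rank1_rep_rho1: "m > 0 \<Longrightarrow> det g = 1 \<Longrightarrow> rank1_rep m g (rho1 m g)"
  unfolding rho1_def by (rule someI_ex[OF rank1_rep_exists])

section \<open>Independence of the rank one theta functions\<close>

text \<open>At $\tau = it$ and characteristics $(x, 0)$ the terms are $e^{-2\pi m t (n+x)^2}$. For $t \to \infty$ only the
term $n = -x$ survives.\<close>

lemma th_limit: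
  assumes m: "m > 0"
  shows "((\<lambda>t. th m s (\<i> * of_real t) (- of_int r / (2 * of_nat m)) 0) \<longlongrightarrow> of_bool (2 * int m dvd s - r)) at_top"
proof -
  define x where "x = - of_int r / (2 * of_nat m :: real)"
  define A where "A = int_coset (of_int s / (2 * of_nat m))"
  define g where "g = (\<lambda>n t. of_real (exp (- (2 * pi * m * (n + x)\<^sup>2) * t)) :: complex)"
  have trm: "e2 (of_nat m * of_real x * (\<i> * of_real t * of_real x)) * jt_term m n (\<i> * of_real t) (\<i> * of_real t * of_real x) = g n t" for n t
    unfolding jt_term_def e2_add[symmetric] unfolding e2_def g_def exp_of_real[symmetric]
    by (rule arg_cong[where f = exp]) (simp add: power2_eq_square algebra_simps)
  have th: "th m s (\<i> * of_real t) x 0 = (\<Sum>\<^sub>\<infinity>n\<in>A. g n t)" for t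
    unfolding th_def jt_def A_def trm[symmetric] by (simp only: infsum_cmult_right' of_real_0 add_0_right)
  have "((\<lambda>t. \<Sum>\<^sub>\<infinity>n\<in>A. g n t) \<longlongrightarrow> (\<Sum>\<^sub>\<infinity>n\<in>A. of_bool (n = - x))) at_top"
  proof (rule tendsto_infsum_dominated[where M = "\<lambda>n. norm (g n 1)"])
    fix n
    show "(g n \<longlongrightarrow> of_bool (n = - x)) at_top"
    proof (cases "n = - x")
      case False
      then have "2 * pi * m * (n + x)\<^sup>2 > 0" using m by (simp add: add_eq_0_iff)
      then have "((\<lambda>t. exp (- (2 * pi * m * (n + x)\<^sup>2) * t)) \<longlongrightarrow> 0) at_top"
        by (intro filterlim_compose[OF exp_at_bot] filterlim_tendsto_neg_mult_at_bot[OF tendsto_const _ filterlim_ident]) simp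
      then show ?thesis using False tendsto_of_real[where 'a = complex] unfolding g_def by fastforce
    qed (simp add: g_def)
  next
    show "\<forall>\<^sub>F t in at_top. \<forall>n\<in>A. norm (g n t) \<le> norm (g n 1)"
      using eventually_ge_at_top[of 1]
    proof eventually_elim
      case (elim t)
      have "2 * pi * m * (n + x)\<^sup>2 * 1 \<le> 2 * pi * m * (n + x)\<^sup>2 * t" for n using elim by (intro mult_left_mono) auto
      then show ?case by (simp add: g_def)
    qed
    have i: "\<i> \<in> uhp" by (simp add: uhp_def)
    have c: "e2 (of_nat m * of_real x * (\<i> * of_real x)) \<noteq> 0" by simp
    have "(\<lambda>n. exp ((4 * pi * m * \<bar>x\<bar>) * \<bar>n\<bar> - (2 * pi * m) * n\<^sup>2)) summable_on A"
      unfolding A_def by (rule summable_on_gauss_int_coset) (use m in simp)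
    then show "(\<lambda>n. norm (g n 1)) summable_on A"
    proof (rule summable_on_comparison_test)
      fix n
      have "- (n * x) \<le> \<bar>x\<bar> * \<bar>n\<bar>" by (simp add: abs_mult[symmetric] mult.commute)
      then have "(4 * pi * m) * (- (n * x)) \<le> (4 * pi * m) * (\<bar>x\<bar> * \<bar>n\<bar>)" by (rule mult_left_mono) simp
      moreover have "- (2 * pi * m * (n + x)\<^sup>2) * 1 = (4 * pi * m) * (- (n * x)) - 2 * pi * m * n\<^sup>2 - 2 * pi * m * x\<^sup>2"
        by (simp add: power2_sum algebra_simps)
      moreover have "2 * pi * m * x\<^sup>2 \<ge> 0" by simp
      ultimately have "- (2 * pi * m * (n + x)\<^sup>2) * 1 \<le> (4 * pi * m * \<bar>x\<bar>) * \<bar>n\<bar> - (2 * pi * m) * n\<^sup>2"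
        by (simp only: mult.assoc)
      then show "norm (g n 1) \<le> exp ((4 * pi * m * \<bar>x\<bar>) * \<bar>n\<bar> - (2 * pi * m) * n\<^sup>2)" by (simp add: g_def)
    qed simp
  qed simp
  also have "(\<Sum>\<^sub>\<infinity>n\<in>A. of_bool (n = - x)) = (of_bool (2 * int m dvd s - r) :: complex)"
  proof -
    have "- x \<in> A \<longleftrightarrow> 2 * int m dvd s - r"
    proof
      assume "- x \<in> A"
      then have "- x - of_int s / (2 * of_nat m) \<in> \<int>" by (simp add: A_def int_coset_def)
      then obtain k :: int where "- x - of_int s / (2 * of_nat m) = of_int k" by (rule Ints_cases)
      then have "real_of_int (s - r) = of_int (2 * int m * (- k))" using m unfolding x_def by (simp add: field_simps)
      then have "s - r = 2 * int m * (- k)" by (simp only: of_int_eq_iff)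
      then show "2 * int m dvd s - r" by simp
    next
      assume "2 * int m dvd s - r"
      then obtain k where "s - r = 2 * int m * k" by (rule dvdE)
      then have s: "s = r + 2 * int m * k" by simp
      have "- x - of_int s / (2 * of_nat m) = of_int (- k)" unfolding x_def s using m by (simp add: field_simps)
      then show "- x \<in> A" unfolding A_def int_coset_def by simp
    qed
    moreover have "(\<Sum>\<^sub>\<infinity>n\<in>A. of_bool (n = - x)) = (\<Sum>\<^sub>\<infinity>n\<in>A \<inter> {- x}. 1 :: complex)"
      by (rule infsum_cong_neutral) auto
    ultimately show ?thesis by (cases "- x \<in> A") auto
  qed
  finally show ?thesis unfolding th x_def[symmetric] .
qed

lemma th_independent:
  assumes m: "m > 0"
    and 0: "\<And>x. x \<in> uhp \<times> UNIV \<Longrightarrow> (\<Sum>j\<in>residues m. c j * (case x of (\<tau>, x, y) \<Rightarrow> th m j \<tau> x y)) = 0"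
    and r: "r \<in> residues m"
  shows "c r = 0"
proof -
  define x where "x = - of_int r / (2 * of_nat m :: real)"
  have "((\<lambda>t. \<Sum>j\<in>residues m. c j * th m j (\<i> * of_real t) x 0) \<longlongrightarrow> (\<Sum>j\<in>residues m. c j * of_bool (2 * int m dvd j - r))) at_top"
    unfolding x_def by (intro tendsto_sum tendsto_mult tendsto_const th_limit m)
  moreover have "\<forall>\<^sub>F t in at_top. (\<Sum>j\<in>residues m. c j * th m j (\<i> * of_real t) x 0) = 0"
    using eventually_gt_at_top[of 0]
  proof eventually_elim
    case (elim t)
    then show ?case using 0[of "(\<i> * of_real t, x, 0)"] by (simp add: uhp_def)
  qed
  ultimately have "((\<lambda>t::real. 0) \<longlongrightarrow> (\<Sum>j\<in>residues m. c j * of_bool (2 * int m dvd j - r))) at_top"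
    by (rule Lim_transform_eventually)
  then have "(\<Sum>j\<in>residues m. c j * of_bool (2 * int m dvd j - r)) = 0"
    by (intro tendsto_unique[OF _ _ tendsto_const]) simp_all
  also have "(\<Sum>j\<in>residues m. c j * of_bool (2 * int m dvd j - r)) = (\<Sum>j\<in>residues m. if j = r then c j else 0)"
  proof (rule sum.cong[OF refl])
    fix j assume j: "j \<in> residues m"
    have "2 * int m dvd j - r \<longleftrightarrow> j mod (2 * int m) = r mod (2 * int m)" by (simp only: mod_eq_dvd_iff)
    also have "\<dots> \<longleftrightarrow> j = r" using j r by simp
    finally show "c j * of_bool (2 * int m dvd j - r) = (if j = r then c j else 0)" by simp
  qed
  also have "\<dots> = c r" using r by simp
  finally show ?thesis .
qed

lemma rho1_mult:
  assumes m: "m > 0" and d: "det g = 1" "det g' = 1" and \<tau>: "\<tau> \<in> uhp" and ij: "i \<in> residues m" "j \<in> residues m"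
  shows "csqrt (jfac (g ** g') \<tau>) * rho1 m (g ** g') i j =
    csqrt (jfac g (moeb g' \<tau>)) * csqrt (jfac g' \<tau>) * matprod (residues m) (rho1 m g) (rho1 m g') i j"
proof -
  obtain \<epsilon> :: complex where e: "\<epsilon> = 1 \<or> \<epsilon> = - 1" and
    \<epsilon>: "\<And>\<tau>. \<tau> \<in> uhp \<Longrightarrow> csqrt (jfac g (moeb g' \<tau>)) * csqrt (jfac g' \<tau>) = \<epsilon> * csqrt (jfac (g ** g') \<tau>)"
    using csqrt_jfac_mult[OF d] by blast
  have dd: "det (g ** g') = 1" by (simp add: det_mul d)
  have t: "th_transforms m g (rho1 m g)" if "det g = 1" for g using rank1_rep_rho1[OF m that] unfolding rank1_rep_def by blast
  have "rho1 m (g ** g') i j = \<epsilon> * matprod (residues m) (rho1 m g) (rho1 m g') i j"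
  proof (rule transforms_unique[where g = "g ** g'" and X = "uhp \<times> UNIV" and F = "\<lambda>s (\<tau>, x, y). th m s \<tau> x y" and act = act_th
        and J = "\<lambda>g (\<tau>, x, y). csqrt (jfac g \<tau>)" and M' = "\<lambda>i j. \<epsilon> * matprod (residues m) (rho1 m g) (rho1 m g') i j", OF _ _ _ _ ij])
    show "transforms (residues m) (uhp \<times> UNIV) act_th (\<lambda>g (\<tau>, x, y). csqrt (jfac g \<tau>)) (\<lambda>s (\<tau>, x, y). th m s \<tau> x y) (g ** g') (rho1 m (g ** g'))"
      using t[OF dd] unfolding th_transforms_def .
    have "th_transforms m (g ** g') (\<lambda>i j. \<epsilon> * matprod (residues m) (rho1 m g) (rho1 m g') i j)"
      by (rule th_transforms_comp[OF d t[OF d(1)] t[OF d(2)]]) (rule \<epsilon>)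
    then show "transforms (residues m) (uhp \<times> UNIV) act_th (\<lambda>g (\<tau>, x, y). csqrt (jfac g \<tau>)) (\<lambda>s (\<tau>, x, y). th m s \<tau> x y) (g ** g')
      (\<lambda>i j. \<epsilon> * matprod (residues m) (rho1 m g) (rho1 m g') i j)" unfolding th_transforms_def .
    show "c j = 0" if "\<And>x. x \<in> uhp \<times> UNIV \<Longrightarrow> (\<Sum>j\<in>residues m. c j * (case x of (\<tau>, x, y) \<Rightarrow> th m j \<tau> x y)) = 0" "j \<in> residues m" for c j
      by (rule th_independent[OF m that])
    fix x :: "complex \<times> real \<times> real" assume "x \<in> uhp \<times> UNIV"
    then show "(case x of (\<tau>, x, y) \<Rightarrow> csqrt (jfac (g ** g') \<tau>)) \<noteq> 0" using jfac_nz[OF dd] by auto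
  qed
  then show ?thesis unfolding \<epsilon>[OF \<tau>] by (simp only: mult_ac)
qed

section \<open>The rank two representation\<close>

definition act_Th2 :: "int^2^2 \<Rightarrow> complex \<times> (real \<times> real) \<times> (real \<times> real) \<Rightarrow> complex \<times> (real \<times> real) \<times> (real \<times> real)" where
  "act_Th2 g = (\<lambda>(\<tau>, z1, z2). (moeb g \<tau>, snd (act_th g (\<tau>, z1)), snd (act_th g (\<tau>, z2))))"

text \<open>The theta functions as functions on the domain of \<open>act_Th2\<close>, with the characteristics of the two
lines in pairs.\<close>

definition Th2_at :: "nat \<Rightarrow> int \<times> int \<Rightarrow> complex \<times> (real \<times> real) \<times> (real \<times> real) \<Rightarrow> complex" where
  "Th2_at p s x = Th2 p s (fst x) (fst (fst (snd x))) (snd (fst (snd x))) (fst (snd (snd x))) (snd (snd (snd x)))"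

definition Th2_transforms :: "nat \<Rightarrow> int^2^2 \<Rightarrow> (int \<times> int \<Rightarrow> int \<times> int \<Rightarrow> complex) \<Rightarrow> bool" where
  "Th2_transforms p = transforms (A2_labels p) (uhp \<times> UNIV) act_Th2 (\<lambda>g x. jfac g (fst x)) (Th2_at p)"

definition psihat_A2_transforms :: "nat \<Rightarrow> int^2^2 \<Rightarrow> (int \<times> int \<Rightarrow> int \<times> int \<Rightarrow> complex) \<Rightarrow> bool" where
  "psihat_A2_transforms p = transforms (A2_labels p) (uhp \<times> uhp) act2 (\<lambda>g (\<tau>, w). jfac g \<tau>) (\<lambda>s (\<tau>, w). psihat_A2 p s \<tau> w)"

text \<open>As in rank one, the theta functions are there to make the matrix unique. The factor of automorphy is an
honest cocycle, so no signs occur.\<close>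

definition rank2_rep :: "nat \<Rightarrow> int^2^2 \<Rightarrow> (int \<times> int \<Rightarrow> int \<times> int \<Rightarrow> complex) \<Rightarrow> bool" where
  "rank2_rep p g M \<longleftrightarrow> unitary_on (A2_labels p) M \<and> Th2_transforms p g M \<and> psihat_A2_transforms p g M"

lemma snd_act_th: "snd (act_th g (\<tau>, z)) = (of_int (g $ 2 $ 2) * fst z - of_int (g $ 2 $ 1) * snd z, of_int (g $ 1 $ 1) * snd z - of_int (g $ 1 $ 2) * fst z)"
  by (simp add: act_th_def case_prod_unfold)

lemma act_Th2_uhp: "det g = 1 \<Longrightarrow> x \<in> uhp \<times> UNIV \<Longrightarrow> act_Th2 g x \<in> uhp \<times> UNIV"
  by (auto simp: act_Th2_def intro: moeb_uhp)

lemma act_Th2_mult: "det g = 1 \<Longrightarrow> det g' = 1 \<Longrightarrow> x \<in> uhp \<times> UNIV \<Longrightarrow> act_Th2 (g ** g') x = act_Th2 g (act_Th2 g' x)"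
  by (auto simp: act_Th2_def snd_act_th moeb_mult mult_nth algebra_simps)

lemma Th2_transforms_comp:
  assumes d: "det g = 1" "det g' = 1" and 1: "Th2_transforms p g M" and 2: "Th2_transforms p g' M'"
  shows "Th2_transforms p (g ** g') (\<lambda>i j. 1 * matprod (A2_labels p) M M' i j)"
  unfolding Th2_transforms_def
proof (rule transforms_comp[OF 1[unfolded Th2_transforms_def] 2[unfolded Th2_transforms_def]])
  fix x :: "complex \<times> (real \<times> real) \<times> (real \<times> real)" assume x: "x \<in> uhp \<times> UNIV"
  show "act_Th2 g' x \<in> uhp \<times> UNIV" by (rule act_Th2_uhp[OF d(2) x])
  show "act_Th2 (g ** g') x = act_Th2 g (act_Th2 g' x)" by (rule act_Th2_mult[OF d x])
  show "jfac g (fst (act_Th2 g' x)) * jfac g' (fst x) = 1 * jfac (g ** g') (fst x)"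
    using x by (cases x) (simp add: act_Th2_def jfac_mult[OF d(2)])
qed

lemma rank2_rep_comp:
  assumes d: "det g = 1" "det g' = 1" and 1: "rank2_rep p g M" and 2: "rank2_rep p g' M'"
  shows "\<exists>M. rank2_rep p (g ** g') M"
proof -
  note 1 = 1[unfolded rank2_rep_def] and 2 = 2[unfolded rank2_rep_def]
  let ?M = "\<lambda>i j. 1 * matprod (A2_labels p) M M' i j"
  have u: "unitary_on (A2_labels p) ?M" using 1 2 by (intro unitary_on_matprod finite_A2_labels) auto
  have t: "Th2_transforms p (g ** g') ?M" using 1 2 by (intro Th2_transforms_comp[OF d]) auto
  have ps: "psihat_A2_transforms p (g ** g') ?M"
    unfolding psihat_A2_transforms_def
  proof (rule transforms_comp)
    show "transforms (A2_labels p) (uhp \<times> uhp) act2 (\<lambda>g (\<tau>, w). jfac g \<tau>) (\<lambda>s (\<tau>, w). psihat_A2 p s \<tau> w) g M"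
      "transforms (A2_labels p) (uhp \<times> uhp) act2 (\<lambda>g (\<tau>, w). jfac g \<tau>) (\<lambda>s (\<tau>, w). psihat_A2 p s \<tau> w) g' M'"
      using 1 2 unfolding psihat_A2_transforms_def by blast+
    fix x assume x: "x \<in> uhp \<times> uhp"
    show "act2 g' x \<in> uhp \<times> uhp" by (rule act2_uhp[OF d(2) x])
    show "act2 (g ** g') x = act2 g (act2 g' x)" by (rule act2_mult[OF d x])
    show "(case act2 g' x of (\<tau>, w) \<Rightarrow> jfac g \<tau>) * (case x of (\<tau>, w) \<Rightarrow> jfac g' \<tau>) = 1 * (case x of (\<tau>, w) \<Rightarrow> jfac (g ** g') \<tau>)"
      using x by (cases x) (simp add: act2_def jfac_mult[OF d(2)])
  qed
  show ?thesis unfolding rank2_rep_def using u t ps by (intro exI[of _ ?M] conjI)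
qed

lemma rank2_rep_S:
  assumes p: "p > 0" shows "rank2_rep p S_mat (S2 p)"
  unfolding rank2_rep_def
proof (intro conjI unitary_S2[OF p])
  have e: "S_mat $ 1 $ 1 = 0" "S_mat $ 1 $ 2 = - 1" "S_mat $ 2 $ 1 = 1" "S_mat $ 2 $ 2 = 0" by (simp_all add: S_mat_def)
  show "Th2_transforms p S_mat (S2 p)"
    unfolding Th2_transforms_def transforms_def
  proof (intro ballI)
    fix i x assume i: "i \<in> A2_labels p" and x: "x \<in> uhp \<times> (UNIV :: ((real \<times> real) \<times> (real \<times> real)) set)"
    obtain \<tau> x1 y1 x2 y2 where xx: "x = (\<tau>, (x1, y1), (x2, y2))" by (metis surj_pair)
    have \<tau>: "\<tau> \<in> uhp" using x xx by simp
    show "Th2_at p i (act_Th2 S_mat x) = jfac S_mat (fst x) * (\<Sum>j\<in>A2_labels p. S2 p i j * Th2_at p j x)"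
      using Th2_S[OF p \<tau>, of i y1 x1 y2 x2] unfolding Th2_at_def xx act_Th2_def prod.case snd_act_th e moeb_S jfac_S by simp
  qed
  show "psihat_A2_transforms p S_mat (S2 p)"
    unfolding psihat_A2_transforms_def transforms_def act2_def
    using psihat_A2_S[OF p] by (auto simp: moeb_S jfac_S)
qed

lemma rank2_rep_T:
  assumes p: "p > 0" shows "rank2_rep p T_mat (\<lambda>i j. T2 p i * of_bool (i = j))"
  unfolding rank2_rep_def
proof (intro conjI unitary_on_diag finite_A2_labels)
  show "T2 p i * cnj (T2 p i) = 1" for i
    unfolding T2_def by (rule cnj_e2_mult) (simp add: Im_divide)
  note d = sum_diag[OF finite_A2_labels, of _ p "T2 p"]
  have e: "T_mat $ 1 $ 1 = 1" "T_mat $ 1 $ 2 = 1" "T_mat $ 2 $ 1 = 0" "T_mat $ 2 $ 2 = 1" by (simp_all add: T_mat_def)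
  show "Th2_transforms p T_mat (\<lambda>i j. T2 p i * of_bool (i = j))"
    unfolding Th2_transforms_def transforms_def
  proof (intro ballI)
    fix i x assume i: "i \<in> A2_labels p" and x: "x \<in> uhp \<times> (UNIV :: ((real \<times> real) \<times> (real \<times> real)) set)"
    obtain \<tau> x1 y1 x2 y2 where xx: "x = (\<tau>, (x1, y1), (x2, y2))" by (metis surj_pair)
    show "Th2_at p i (act_Th2 T_mat x) = jfac T_mat (fst x) * (\<Sum>j\<in>A2_labels p. T2 p i * of_bool (i = j) * Th2_at p j x)"
      using Th2_T[OF p, of i \<tau> x1 y1 x2 y2] unfolding d[OF i] Th2_at_def xx act_Th2_def prod.case snd_act_th e moeb_T jfac_T by simp
  qed
  show "psihat_A2_transforms p T_mat (\<lambda>i j. T2 p i * of_bool (i = j))"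
    unfolding psihat_A2_transforms_def transforms_def
  proof (intro ballI)
    fix i x assume i: "i \<in> A2_labels p" and x: "x \<in> uhp \<times> uhp"
    obtain \<tau> w where xx: "x = (\<tau>, w)" by (cases x)
    show "(case act2 T_mat x of (\<tau>, w) \<Rightarrow> psihat_A2 p i \<tau> w) = (case x of (\<tau>, w) \<Rightarrow> jfac T_mat \<tau>) *
      (\<Sum>j\<in>A2_labels p. T2 p i * of_bool (i = j) * (case x of (\<tau>, w) \<Rightarrow> psihat_A2 p j \<tau> w))"
      unfolding d[OF i] by (simp add: xx act2_def moeb_T jfac_T psihat_A2_T[OF p])
  qed
qed

lemma rank2_rep_one: "rank2_rep p (mat 1) (\<lambda>i j. 1 * of_bool (i = j))"
  unfolding rank2_rep_def
proof (intro conjI unitary_on_diag finite_A2_labels)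
  note d = sum_diag[OF finite_A2_labels, of _ p "\<lambda>i. 1"]
  have e: "(mat 1 :: int^2^2) $ 1 $ 1 = 1" "(mat 1 :: int^2^2) $ 1 $ 2 = 0" "(mat 1 :: int^2^2) $ 2 $ 1 = 0" "(mat 1 :: int^2^2) $ 2 $ 2 = 1"
    by (simp_all add: mat_1_mat22)
  show "Th2_transforms p (mat 1) (\<lambda>i j. 1 * of_bool (i = j))"
    unfolding Th2_transforms_def transforms_def
    by (intro ballI) (simp only: d, auto simp: Th2_at_def act_Th2_def snd_act_th moeb_one jfac_one e)
  show "psihat_A2_transforms p (mat 1) (\<lambda>i j. 1 * of_bool (i = j))"
    unfolding psihat_A2_transforms_def transforms_def
    by (intro ballI) (simp only: d, auto simp: act2_def moeb_one jfac_one)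
qed simp_all

lemma rank2_rep_exists:
  assumes p: "p > 0" and d: "det g = 1"
  shows "\<exists>M. rank2_rep p g M"
proof (rule SL2Z_induct[OF d])
  show "\<exists>M. rank2_rep p (mat 1) M" using rank2_rep_one by blast
  fix g :: "int^2^2" assume d: "det g = 1" and M: "\<exists>M. rank2_rep p g M"
  then obtain M where M: "rank2_rep p g M" by blast
  show "\<exists>M. rank2_rep p (S_mat ** g) M" by (rule rank2_rep_comp[OF det_S d rank2_rep_S[OF p] M])
  show "\<exists>M. rank2_rep p (T_mat ** g) M" by (rule rank2_rep_comp[OF det_T d rank2_rep_T[OF p] M])
qed

definition rho2 :: "nat \<Rightarrow> int^2^2 \<Rightarrow> int \<times> int \<Rightarrow> int \<times> int \<Rightarrow> complex" where
  "rho2 p g = (SOME M. rank2_rep p g M)"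

lemma rank2_rep_rho2: "p > 0 \<Longrightarrow> det g = 1 \<Longrightarrow> rank2_rep p g (rho2 p g)"
  unfolding rho2_def by (rule someI_ex[OF rank2_rep_exists])

lemma A2_split_two: "A2_split p a b s = a (2 * fst s + snd s) * b (snd s) + a (2 * fst s + snd s + 3 * int p) * b (snd s - int p)"
  unfolding A2_split_def by simp

text \<open>In the limit of \<open>th_limit\<close> at the characteristics of the label \<open>r\<close>, the gluing summand $\delta = 1$
vanishes because entries $s_2 - p$ and $r_2$ are never congruent modulo $2p$, and $\delta = 0$ singles out the
label \<open>r\<close>.\<close>

lemma Th2_independent:
  assumes p: "p > 0"
    and 0: "\<And>x. x \<in> uhp \<times> UNIV \<Longrightarrow> (\<Sum>j\<in>A2_labels p. c j * Th2_at p j x) = 0"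
    and r: "r \<in> A2_labels p"
  shows "c r = 0"
proof -
  have p3: "3 * p > 0" using p by simp
  \<comment> \<open>The characteristics that select the residues $2r_1 + r_2$ and $r_2$ in \<open>th_limit\<close>.\<close>
  define x1 where "x1 = - of_int (2 * fst r + snd r) / (2 * of_nat (3 * p) :: real)"
  define x2 where "x2 = - of_int (snd r) / (2 * of_nat p :: real)"
  define L where "L = A2_split p (\<lambda>s. of_bool (2 * int (3 * p) dvd s - (2 * fst r + snd r))) (\<lambda>s. of_bool (2 * int p dvd s - snd r) :: complex)"
  have lim: "((\<lambda>t. Th2 p j (\<i> * of_real t) x1 0 x2 0) \<longlongrightarrow> L j) at_top" for j
    unfolding Th2_def L_def A2_split_def x1_def x2_def
    by (intro tendsto_sum tendsto_mult th_limit p p3)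
  have "((\<lambda>t. \<Sum>j\<in>A2_labels p. c j * Th2 p j (\<i> * of_real t) x1 0 x2 0) \<longlongrightarrow> (\<Sum>j\<in>A2_labels p. c j * L j)) at_top"
    by (intro tendsto_sum tendsto_mult tendsto_const lim)
  moreover have "\<forall>\<^sub>F t in at_top. (\<Sum>j\<in>A2_labels p. c j * Th2 p j (\<i> * of_real t) x1 0 x2 0) = 0"
    using eventually_gt_at_top[of 0]
  proof eventually_elim
    case (elim t)
    then show ?case using 0[of "(\<i> * of_real t, (x1, 0), (x2, 0))"] by (simp add: uhp_def Th2_at_def)
  qed
  ultimately have "((\<lambda>t::real. 0) \<longlongrightarrow> (\<Sum>j\<in>A2_labels p. c j * L j)) at_top"
    by (rule Lim_transform_eventually)
  then have "(\<Sum>j\<in>A2_labels p. c j * L j) = 0"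
    by (intro tendsto_unique[OF _ _ tendsto_const]) simp_all
  also have "(\<Sum>j\<in>A2_labels p. c j * L j) = (\<Sum>j\<in>A2_labels p. if j = r then c j else 0)"
  proof (rule sum.cong[OF refl])
    fix j assume j: "j \<in> A2_labels p"
    have r': "0 \<le> fst r" "fst r < 3 * int p" "0 \<le> snd r" "snd r < int p" using r by (auto simp: A2_labels_eq)
    have j': "0 \<le> fst j" "fst j < 3 * int p" "0 \<le> snd j" "snd j < int p" using j by (auto simp: A2_labels_eq)
    have n1: "\<not> 2 * int p dvd snd j - int p - snd r"
    proof
      assume "2 * int p dvd snd j - int p - snd r"
      then have "2 * int p dvd - (snd j - int p - snd r)" by (simp only: dvd_minus_iff)
      moreover have "- (snd j - int p - snd r) = int p + snd r - snd j" by simp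
      ultimately have "2 * int p dvd int p + snd r - snd j" by (simp only:)
      then have "2 * int p \<le> int p + snd r - snd j" by (rule zdvd_imp_le) (use r' j' in linarith)
      then show False using r' j' by linarith
    qed
    have "L j = of_bool (2 * int (3 * p) dvd 2 * fst j + snd j - (2 * fst r + snd r)) * of_bool (2 * int p dvd snd j - snd r)"
      unfolding L_def A2_split_two using n1 by simp
    also have "\<dots> = of_bool (j = r)"
    proof (cases "2 * int (3 * p) dvd 2 * fst j + snd j - (2 * fst r + snd r) \<and> 2 * int p dvd snd j - snd r")
      case True
      then have "snd j mod (2 * int p) = snd r mod (2 * int p)" by (simp only: mod_eq_dvd_iff)
      then have s: "snd j = snd r" using r' j' by simp
      with True have "2 * (3 * int p) dvd 2 * (fst j - fst r)" by (simp add: algebra_simps)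
      then have "3 * int p dvd fst j - fst r" by (simp only: dvd_mult_cancel_left) simp
      then have "fst j mod (3 * int p) = fst r mod (3 * int p)" by (simp only: mod_eq_dvd_iff)
      then have "fst j = fst r" using r' j' by simp
      with s have "j = r" by (simp add: prod_eq_iff)
      with True show ?thesis by simp
    qed auto
    finally show "c j * L j = (if j = r then c j else 0)" by simp
  qed
  also have "\<dots> = c r" using r by (simp add: finite_A2_labels)
  finally show ?thesis .
qed

lemma rho2_mult:
  assumes p: "p > 0" and d: "det g = 1" "det g' = 1" and ij: "i \<in> A2_labels p" "j \<in> A2_labels p"
  shows "rho2 p (g ** g') i j = matprod (A2_labels p) (rho2 p g) (rho2 p g') i j"
proof -
  have dd: "det (g ** g') = 1" by (simp add: det_mul d)
  have t: "Th2_transforms p g (rho2 p g)" if "det g = 1" for g using rank2_rep_rho2[OF p that] unfolding rank2_rep_def by blast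
  let ?F = "Th2_at p"
  let ?J = "\<lambda>g x. jfac g (fst x)"
  let ?M = "\<lambda>i j. 1 * matprod (A2_labels p) (rho2 p g) (rho2 p g') i j"
  have "rho2 p (g ** g') i j = ?M i j"
  proof (rule transforms_unique[where g = "g ** g'" and X = "uhp \<times> UNIV" and F = ?F and act = act_Th2 and J = ?J and M' = ?M, OF _ _ _ _ ij])
    show "transforms (A2_labels p) (uhp \<times> UNIV) act_Th2 ?J ?F (g ** g') (rho2 p (g ** g'))"
      using t[OF dd] unfolding Th2_transforms_def .
    show "transforms (A2_labels p) (uhp \<times> UNIV) act_Th2 ?J ?F (g ** g') ?M"
      using Th2_transforms_comp[OF d t[OF d(1)] t[OF d(2)]] unfolding Th2_transforms_def .
    show "c j = 0" if "\<And>x. x \<in> uhp \<times> UNIV \<Longrightarrow> (\<Sum>j\<in>A2_labels p. c j * ?F j x) = 0" "j \<in> A2_labels p" for c j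
      by (rule Th2_independent[OF p that])
    fix x :: "complex \<times> (real \<times> real) \<times> (real \<times> real)" assume "x \<in> uhp \<times> UNIV"
    then show "?J (g ** g') x \<noteq> 0" using jfac_nz[OF dd] by auto
  qed
  then show ?thesis by simp
qed

lemma multiplier_system_rho2:
  assumes p: "p > 0" shows "multiplier_system 1 (carrier SL2Z) (A2_labels p) (rho2 p)"
  unfolding multiplier_system_def jpow_one carrier_SL2Z
proof (intro conjI ballI)
  fix g :: "int^2^2" and i j assume "g \<in> carrier SL2Z" and ij: "i \<in> A2_labels p" "j \<in> A2_labels p"
  then have d: "det g = 1" by (simp add: carrier_SL2Z)
  show "(\<Sum>l\<in>A2_labels p. rho2 p g i l * cnj (rho2 p g j l)) = of_bool (i = j)"
    using rank2_rep_rho2[OF p d] ij unfolding rank2_rep_def unitary_on_def by blast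
next
  fix g g' :: "int^2^2" and \<tau> i j assume "g \<in> carrier SL2Z" "g' \<in> carrier SL2Z" and \<tau>: "\<tau> \<in> uhp" and ij: "i \<in> A2_labels p" "j \<in> A2_labels p"
  then have d: "det g = 1" "det g' = 1" by (simp_all add: carrier_SL2Z)
  show "jfac (g ** g') \<tau> * rho2 p (g ** g') i j = jfac g (moeb g' \<tau>) * jfac g' \<tau> * (\<Sum>l\<in>A2_labels p. rho2 p g i l * rho2 p g' l j)"
    unfolding rho2_mult[OF p d ij] jfac_mult[OF d(2) \<tau>] matprod_def ..
qed

text \<open>Residues modulo $2m$ as labels.\<close>

definition rank1_labels :: "nat \<Rightarrow> label set" where
  "rank1_labels m = (residues m) \<times> {0}"

lemma sum_rank1_labels: "(\<Sum>l\<in>rank1_labels m. f (fst l)) = (\<Sum>l\<in>residues m. f l)"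
  unfolding rank1_labels_def
  by (rule sum.reindex_bij_witness[where i = "\<lambda>l. (l, 0)" and j = fst]) auto

lemma finite_rank1_labels: "finite (rank1_labels m)" by (simp add: rank1_labels_def)

lemma rank1_labels_fst: "i \<in> rank1_labels m \<Longrightarrow> fst i \<in> residues m"
  by (auto simp: rank1_labels_def)

text \<open>The weights $\frac12$ and $\frac32$ differ by the cocycle $c\tau + d$, hence share their multiplier systems.\<close>

lemma multiplier_system_rho1:
  assumes m: "m > 0" and k: "k = 1 / 2 \<or> k = 3 / 2"
  shows "multiplier_system k (carrier SL2Z) (rank1_labels m) (\<lambda>g i j. rho1 m g (fst i) (fst j))"
  unfolding multiplier_system_def
proof (intro conjI ballI)
  fix g :: "int^2^2" and i j assume "g \<in> carrier SL2Z" and ij: "i \<in> rank1_labels m" "j \<in> rank1_labels m"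
  then have d: "det g = 1" by (simp add: carrier_SL2Z)
  have "(i = j) = (fst i = fst j)" using ij by (auto simp: rank1_labels_def)
  then show "(\<Sum>l\<in>rank1_labels m. rho1 m g (fst i) (fst l) * cnj (rho1 m g (fst j) (fst l))) = of_bool (i = j)"
    using rank1_rep_rho1[OF m d] ij[THEN rank1_labels_fst] unfolding rank1_rep_def unitary_on_def
    by (subst sum_rank1_labels) simp
next
  fix g g' :: "int^2^2" and \<tau> i j assume "g \<in> carrier SL2Z" "g' \<in> carrier SL2Z" and \<tau>: "\<tau> \<in> uhp" and ij: "i \<in> rank1_labels m" "j \<in> rank1_labels m"
  then have d: "det g = 1" "det g' = 1" by (simp_all add: carrier_SL2Z)
  let ?P = "\<Sum>l\<in>rank1_labels m. rho1 m g (fst i) (fst l) * rho1 m g' (fst l) (fst j)"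
  have P: "?P = matprod (residues m) (rho1 m g) (rho1 m g') (fst i) (fst j)"
    unfolding matprod_def by (rule sum_rank1_labels)
  have half: "csqrt (jfac (g ** g') \<tau>) * rho1 m (g ** g') (fst i) (fst j) = csqrt (jfac g (moeb g' \<tau>)) * csqrt (jfac g' \<tau>) * ?P"
    unfolding P by (rule rho1_mult[OF m d \<tau> ij[THEN rank1_labels_fst]])
  show "jpow (g ** g') k \<tau> * rho1 m (g ** g') (fst i) (fst j) = jpow g k (moeb g' \<tau>) * jpow g' k \<tau> * ?P"
    using k
  proof
    assume k: "k = 1 / 2"
    show ?thesis unfolding k jpow_half by (rule half)
  next
    assume k: "k = 3 / 2"
    have "jpow (g ** g') k \<tau> * rho1 m (g ** g') (fst i) (fst j) = jfac (g ** g') \<tau> * (csqrt (jfac (g ** g') \<tau>) * rho1 m (g ** g') (fst i) (fst j))"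
      unfolding k jpow_three_halves by (rule mult.assoc)
    also have "\<dots> = jpow g k (moeb g' \<tau>) * jpow g' k \<tau> * ?P"
      unfolding half unfolding k jpow_three_halves jfac_mult[OF d(2) \<tau>] by (simp only: mult_ac)
    finally show ?thesis .
  qed
qed

lemma two_times_half_int: "2 * (3 / 2 :: real) \<in> \<int>" "2 * (1 / 2 :: real) \<in> \<int>" by simp_all

section \<open>Modular and false modular forms\<close>

lemma theta1_bounded:
  assumes m: "m > 0"
  obtains B where "\<And>\<tau>. Im \<tau> \<ge> 1 \<Longrightarrow> cmod (theta1 m r \<tau>) \<le> B"
proof
  fix \<tau> :: complex assume \<tau>: "Im \<tau> \<ge> 1"
  have i: "\<i> \<in> uhp" by (simp add: uhp_def)
  let ?A = "int_coset (of_int r / (2 * of_nat m))"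
  show "cmod (theta1 m r \<tau>) \<le> (\<Sum>\<^sub>\<infinity>n\<in>?A. norm (of_real n * qpow \<i> (of_nat m * n\<^sup>2)))"
    unfolding theta1_def
  proof (rule norm_infsum_le)
    show "((\<lambda>n. of_real n * qpow \<tau> (of_nat m * n\<^sup>2)) has_sum (\<Sum>\<^sub>\<infinity>n\<in>?A. of_real n * qpow \<tau> (of_nat m * n\<^sup>2))) ?A"
      by (intro has_sum_infsum abs_summable_summable[OF theta1_term_norm_summable[OF m]]) (use \<tau> in \<open>simp add: uhp_def\<close>)
    show "((\<lambda>n. norm (of_real n * qpow \<i> (of_nat m * n\<^sup>2))) has_sum (\<Sum>\<^sub>\<infinity>n\<in>?A. norm (of_real n * qpow \<i> (of_nat m * n\<^sup>2)))) ?A"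
      by (intro has_sum_infsum theta1_term_norm_summable[OF m i])
    fix n :: real
    have "2 * pi * (m * n\<^sup>2) * 1 \<le> 2 * pi * (m * n\<^sup>2) * Im \<tau>" using \<tau> by (intro mult_left_mono) auto
    then show "norm (of_real n * qpow \<tau> (of_nat m * n\<^sup>2)) \<le> norm (of_real n * qpow \<i> (of_nat m * n\<^sup>2))"
      by (simp add: norm_mult norm_qpow mult_left_mono)
  qed
qed

lemma theta1_moeb:
  assumes m: "m > 0" and d: "det g = 1" and i: "i \<in> rank1_labels m" and \<tau>: "\<tau> \<in> uhp"
  shows "theta1 m (fst i) (moeb g \<tau>) = jpow g (3 / 2) \<tau> * (\<Sum>j\<in>rank1_labels m. rho1 m g (fst i) (fst j) * theta1 m (fst j) \<tau>)"
proof -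
  have "theta1_transforms m g (rho1 m g)" using rank1_rep_rho1[OF m d] unfolding rank1_rep_def by blast
  then show ?thesis using rank1_labels_fst[OF i] \<tau>
    unfolding theta1_transforms_def transforms_def jpow_three_halves
    by (subst sum_rank1_labels) blast
qed

text \<open>The transformation reduces the growth at every cusp to the one at $i\infty$, where \<open>theta1\<close> is bounded.\<close>

lemma weakly_holomorphic_theta1:
  assumes m: "m > 0"
  shows "weakly_holomorphic_form (3 / 2) (rank1_labels m) (\<lambda>i \<tau>. C * theta1 m (fst i) \<tau>)"
  unfolding weakly_holomorphic_form_def
proof (intro conjI ballI)
  show "(\<lambda>\<tau>. C * theta1 m (fst i) \<tau>) holomorphic_on uhp" for i
    by (intro holomorphic_intros theta1_holomorphic m)
  have tr: "C * theta1 m (fst i) (moeb g \<tau>) = jpow g (3 / 2) \<tau> * (\<Sum>j\<in>rank1_labels m. rho1 m g (fst i) (fst j) * (C * theta1 m (fst j) \<tau>))"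
    if "det g = 1" "i \<in> rank1_labels m" "\<tau> \<in> uhp" for g i \<tau>
    unfolding theta1_moeb[OF m that] sum_distrib_left by (simp only: mult_ac)
  show "\<exists>\<Gamma> \<rho>. fin_index_subgroup \<Gamma> \<and> multiplier_system (3 / 2) \<Gamma> (rank1_labels m) \<rho> \<and>
      (\<forall>g\<in>\<Gamma>. \<forall>i\<in>rank1_labels m. \<forall>\<tau>\<in>uhp.
        C * theta1 m (fst i) (moeb g \<tau>) = jpow g (3 / 2) \<tau> * (\<Sum>j\<in>rank1_labels m. \<rho> g i j * (C * theta1 m (fst j) \<tau>)))"
  proof (intro exI conjI)
    show "fin_index_subgroup (carrier SL2Z)" by (rule fin_index_SL2Z)
    show "multiplier_system (3 / 2) (carrier SL2Z) (rank1_labels m) (\<lambda>g i j. rho1 m g (fst i) (fst j))"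
      by (rule multiplier_system_rho1[OF m]) simp
    show "\<forall>g\<in>carrier SL2Z. \<forall>i\<in>rank1_labels m. \<forall>\<tau>\<in>uhp.
        C * theta1 m (fst i) (moeb g \<tau>) = jpow g (3 / 2) \<tau> * (\<Sum>j\<in>rank1_labels m. rho1 m g (fst i) (fst j) * (C * theta1 m (fst j) \<tau>))"
      by (intro ballI tr) (simp_all only: carrier_SL2Z)
  qed
  fix g :: "int^2^2" and i assume "g \<in> carrier SL2Z" and i: "i \<in> rank1_labels m"
  then have d: "det g = 1" by (simp add: carrier_SL2Z)
  have "\<exists>B. \<forall>\<tau>. Im \<tau> \<ge> 1 \<longrightarrow> cmod (theta1 m r \<tau>) \<le> B" for r
    by (rule theta1_bounded[OF m, of r]) blast
  then obtain B where B: "\<And>r \<tau>. Im \<tau> \<ge> 1 \<Longrightarrow> cmod (theta1 m r \<tau>) \<le> B r" by metis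
  let ?K = "\<Sum>j\<in>rank1_labels m. cmod (rho1 m g (fst i) (fst j) * C) * B (fst j)"
  show "\<exists>C' N. \<forall>\<tau>. Im \<tau> \<ge> 1 \<longrightarrow> cmod (C * theta1 m (fst i) (moeb g \<tau>) / jpow g (3 / 2) \<tau>) \<le> C' * exp (N * Im \<tau>)"
  proof (rule exI[of _ ?K], rule exI[of _ 0], intro allI impI)
    fix \<tau> :: complex assume \<tau>1: "Im \<tau> \<ge> 1"
    then have \<tau>: "\<tau> \<in> uhp" by (simp add: uhp_def)
    have nz: "jpow g (3 / 2) \<tau> \<noteq> 0" unfolding jpow_three_halves using jfac_nz[OF d \<tau>] by simp
    have "C * theta1 m (fst i) (moeb g \<tau>) / jpow g (3 / 2) \<tau> = (\<Sum>j\<in>rank1_labels m. rho1 m g (fst i) (fst j) * C * theta1 m (fst j) \<tau>)"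
      unfolding tr[OF d i \<tau>] by (simp only: nonzero_mult_div_cancel_left[OF nz] mult.assoc)
    also have "cmod \<dots> \<le> ?K"
      by (rule sum_norm_le) (unfold norm_mult[of "_ * C"], intro mult_left_mono B \<tau>1 norm_ge_zero)
    finally show "cmod (C * theta1 m (fst i) (moeb g \<tau>) / jpow g (3 / 2) \<tau>) \<le> ?K * exp (0 * Im \<tau>)" by simp
  qed
qed (use two_times_half_int finite_rank1_labels in auto)

lemma jpow_zero: "det g = 1 \<Longrightarrow> \<tau> \<in> uhp \<Longrightarrow> jpow g 0 \<tau> = 1"
  using jfac_nz by (simp add: jpow_def)

text \<open>The constant function is the depth zero ingredient of \<open>psihat_A1\<close>.\<close>

lemma weakly_holomorphic_one: "weakly_holomorphic_form 0 {(0, 0)} (\<lambda>_ _. 1)"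
  unfolding weakly_holomorphic_form_def
proof (intro conjI ballI)
  show "\<exists>\<Gamma> \<rho>. fin_index_subgroup \<Gamma> \<and> multiplier_system 0 \<Gamma> {(0, 0)} \<rho> \<and>
      (\<forall>g\<in>\<Gamma>. \<forall>i\<in>{(0, 0)}. \<forall>\<tau>\<in>uhp. 1 = jpow g 0 \<tau> * (\<Sum>j\<in>{(0, 0)}. \<rho> g i j * 1))"
  proof (intro exI conjI)
    show "fin_index_subgroup (carrier SL2Z)" by (rule fin_index_SL2Z)
    show "multiplier_system 0 (carrier SL2Z) {(0, 0)} (\<lambda>_ _ _. 1)"
      unfolding multiplier_system_def carrier_SL2Z
      by (auto simp: jpow_zero moeb_uhp det_mul carrier_SL2Z)
    show "\<forall>g\<in>carrier SL2Z. \<forall>i\<in>{(0, 0)}. \<forall>\<tau>\<in>uhp. 1 = jpow g 0 \<tau> * (\<Sum>j\<in>{(0::int, 0::int)}. 1 * 1)"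
      by (simp add: jpow_zero carrier_SL2Z)
  qed
  fix g :: "int^2^2" assume "g \<in> carrier SL2Z"
  then have d: "det g = 1" by (simp add: carrier_SL2Z)
  show "\<exists>C N. \<forall>\<tau>. Im \<tau> \<ge> 1 \<longrightarrow> cmod (1 / jpow g 0 \<tau>) \<le> C * exp (N * Im \<tau>)"
    by (intro exI[of _ 1] exI[of _ 0]) (auto simp: jpow_zero[OF d] uhp_def)
qed auto

lemma off_diagonal_subset: "{(\<tau>, w). \<tau> \<in> uhp \<and> w \<in> uhp \<and> \<tau> \<noteq> w} \<subseteq> uhp \<times> uhp" by auto

text \<open>The transformation of \<open>phi\<close>, multiplied by the square root of $i(\gamma w - \gamma\tau) =
i(w-\tau)/((c\tau+d)(cw+d))$. The sign \<open>chi_fac\<close> measures the failure of the principal root to be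
multiplicative.\<close>

lemma psihat_A1_moeb:
  assumes p: "p > 0" and d: "det g = 1" and i: "i \<in> rank1_labels p" and \<tau>: "\<tau> \<in> uhp" and w: "w \<in> uhp" and ne: "\<tau> \<noteq> w"
  shows "psihat_A1 p (fst i) (moeb g \<tau>) (moeb g w) =
    chi_fac g \<tau> w * jpow g (1 / 2) \<tau> * (\<Sum>j\<in>rank1_labels p. rho1 p g (fst i) (fst j) * psihat_A1 p (fst j) \<tau> w)"
proof -
  let ?C = "- 2 * \<i> * of_real (sqrt (2 * p)) :: complex"
  let ?u = "csqrt (\<i> * (w - \<tau>))" and ?u' = "csqrt (\<i> * (w - \<tau>) / (jfac g \<tau> * jfac g w))"
  have "phi_transforms p g (rho1 p g)" using rank1_rep_rho1[OF p d] unfolding rank1_rep_def by blast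
  then have "phi p (fst i) (moeb g \<tau>) (moeb g w) = jfac g \<tau> * csqrt (jfac g w) * (\<Sum>j\<in>residues p. rho1 p g (fst i) j * phi p j \<tau> w)"
    using rank1_labels_fst[OF i] \<tau> w unfolding phi_transforms_def transforms_def act2_def by fastforce
  also have "(\<Sum>j\<in>residues p. rho1 p g (fst i) j * phi p j \<tau> w) = (\<Sum>j\<in>rank1_labels p. rho1 p g (fst i) (fst j) * phi p (fst j) \<tau> w)"
    by (rule sum_rank1_labels[symmetric])
  finally have ph: "phi p (fst i) (moeb g \<tau>) (moeb g w) = jfac g \<tau> * csqrt (jfac g w) * (\<Sum>j\<in>rank1_labels p. rho1 p g (fst i) (fst j) * phi p (fst j) \<tau> w)"
    (is "_ = _ * ?P") .
  have un: "?u \<noteq> 0" using ne by simp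
  have "csqrt (\<i> * (moeb g w - moeb g \<tau>)) = ?u'" unfolding moeb_diff[OF d \<tau> w] times_divide_eq_right ..
  then have "psihat_A1 p (fst i) (moeb g \<tau>) (moeb g w) = ?C * ?u' * ((csqrt (jfac g \<tau>) * csqrt (jfac g \<tau>)) * csqrt (jfac g w) * ?P)"
    unfolding psihat_A1_eq_phi[OF p] ph csqrt_mult_self by (simp only:)
  also have "\<dots> = (?u' * (csqrt (jfac g \<tau>) * csqrt (jfac g w) / ?u)) * csqrt (jfac g \<tau>) * (?C * ?u * ?P)"
    using un by (simp add: field_simps del: csqrt.simps)
  also have "?C * ?u * ?P = (\<Sum>j\<in>rank1_labels p. rho1 p g (fst i) (fst j) * psihat_A1 p (fst j) \<tau> w)"
    unfolding psihat_A1_eq_phi[OF p] sum_distrib_left by (simp only: mult_ac)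
  finally show ?thesis unfolding chi_fac_def jpow_half .
qed

lemma csqrt_psihat_A1_holomorphic2:
  assumes p: "p > 0"
  shows "holomorphic2_on (\<lambda>\<tau> w. csqrt (\<i> * (w - \<tau>)) ^ 1 * psihat_A1 p s \<tau> w) {(\<tau>, w). \<tau> \<in> uhp \<and> w \<in> uhp \<and> \<tau> \<noteq> w}"
proof -
  let ?C = "- 2 * \<i> * of_real (sqrt (2 * p)) :: complex"
  have "csqrt (\<i> * (w - \<tau>)) ^ 1 * psihat_A1 p s \<tau> w = ?C * (\<i> * (w - \<tau>)) * phi p s \<tau> w" for \<tau> w
  proof -
    have "csqrt (\<i> * (w - \<tau>)) ^ 1 * psihat_A1 p s \<tau> w = ?C * (csqrt (\<i> * (w - \<tau>)) * csqrt (\<i> * (w - \<tau>))) * phi p s \<tau> w"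
      unfolding psihat_A1_eq_phi[OF p] power_one_right by (simp only: mult_ac)
    then show ?thesis unfolding csqrt_mult_self .
  qed
  moreover have "holomorphic2_on (\<lambda>\<tau> w. ?C * (\<i> * (w - \<tau>)) * phi p s \<tau> w) {(\<tau>, w). \<tau> \<in> uhp \<and> w \<in> uhp \<and> \<tau> \<noteq> w}"
  proof (rule holomorphic2_on_Osgood[OF open_uhp open_uhp _ _ _ off_diagonal_subset])
    have "continuous_on (uhp \<times> uhp) (\<lambda>q. ?C * (\<i> * (snd q - fst q)) * (case q of (\<tau>, w) \<Rightarrow> phi p s \<tau> w))"
      by (intro continuous_intros phi_continuous p)
    then show "continuous_on (uhp \<times> uhp) (\<lambda>(x, y). ?C * (\<i> * (y - x)) * phi p s x y)"
      by (simp add: case_prod_unfold)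
    show "(\<lambda>x. ?C * (\<i> * (y - x)) * phi p s x y) holomorphic_on uhp" if "y \<in> uhp" for y
      by (intro holomorphic_intros phi_holomorphic p that)
    show "(\<lambda>y. ?C * (\<i> * (y - x)) * phi p s x y) holomorphic_on uhp" if "x \<in> uhp" for x
      by (intro holomorphic_intros phi_holomorphic p that)
  qed
  ultimately show ?thesis by simp
qed

lemma false_modular_psihat_A1:
  assumes p: "p > 0"
  shows "false_modular_form (Suc 0) (1 / 2) (rank1_labels p) (\<lambda>i. psi_A1 p (fst i)) (\<lambda>i. psihat_A1 p (fst i))"
  unfolding false_modular_form.simps(2)
proof (intro conjI ballI)
  show "psi_A1 p (fst i) holomorphic_on uhp" for i by (rule psi_A1_holomorphic[OF p])
  show "((\<lambda>t::real. psihat_A1 p (fst i) \<tau> (\<tau> + \<i> * of_real t)) \<longlongrightarrow> psi_A1 p (fst i) \<tau>) at_top" if "\<tau> \<in> uhp" for i \<tau>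
    by (rule psihat_A1_limit[OF p that])
  show "\<exists>l\<in>{0, 1::nat}.
        (\<forall>i\<in>rank1_labels p. holomorphic2_on (\<lambda>\<tau> w. csqrt (\<i> * (w - \<tau>)) ^ l * psihat_A1 p (fst i) \<tau> w) {(\<tau>, w). \<tau> \<in> uhp \<and> w \<in> uhp \<and> \<tau> \<noteq> w}) \<and>
        (\<exists>\<Gamma> \<rho>. fin_index_subgroup \<Gamma> \<and> multiplier_system (1 / 2) \<Gamma> (rank1_labels p) \<rho> \<and>
           (\<forall>g\<in>\<Gamma>. \<forall>i\<in>rank1_labels p. \<forall>\<tau>\<in>uhp. \<forall>w\<in>uhp. \<tau> \<noteq> w \<longrightarrow>
              psihat_A1 p (fst i) (moeb g \<tau>) (moeb g w) =
                chi_fac g \<tau> w ^ l * jpow g (1 / 2) \<tau> * (\<Sum>j\<in>rank1_labels p. \<rho> g i j * psihat_A1 p (fst j) \<tau> w)))"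
  proof (intro bexI[of _ 1] conjI exI[of _ "carrier SL2Z"] exI[of _ "\<lambda>g i j. rho1 p g (fst i) (fst j)"] ballI impI)
    show "holomorphic2_on (\<lambda>\<tau> w. csqrt (\<i> * (w - \<tau>)) ^ 1 * psihat_A1 p (fst i) \<tau> w) {(\<tau>, w). \<tau> \<in> uhp \<and> w \<in> uhp \<and> \<tau> \<noteq> w}" for i
      by (rule csqrt_psihat_A1_holomorphic2[OF p])
    show "multiplier_system (1 / 2) (carrier SL2Z) (rank1_labels p) (\<lambda>g i j. rho1 p g (fst i) (fst j))"
      by (rule multiplier_system_rho1[OF p]) simp
    fix g :: "int^2^2" and i \<tau> w assume "g \<in> carrier SL2Z" and h: "i \<in> rank1_labels p" "\<tau> \<in> uhp" "w \<in> uhp" "\<tau> \<noteq> w"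
    then have d: "det g = 1" by (simp add: carrier_SL2Z)
    show "psihat_A1 p (fst i) (moeb g \<tau>) (moeb g w) =
        chi_fac g \<tau> w ^ 1 * jpow g (1 / 2) \<tau> * (\<Sum>j\<in>rank1_labels p. rho1 p g (fst i) (fst j) * psihat_A1 p (fst j) \<tau> w)"
      unfolding power_one_right by (rule psihat_A1_moeb[OF p d h])
  qed (use fin_index_SL2Z in auto)
  fix i assume i: "i \<in> rank1_labels p"
  show "\<exists>(N::nat) r A G a B H b.
        (\<forall>m<N. (\<exists>g. false_modular_form 0 (1 / 2 + r m) (A m) g (G m)) \<and> a m \<in> A m \<and>
               weakly_holomorphic_form (2 + r m) (B m) (H m) \<and> b m \<in> B m) \<and>
        (\<forall>\<tau>\<in>uhp. \<forall>w\<in>uhp. \<i> * (w - \<tau>) \<notin> \<real>\<^sub>\<le>\<^sub>0 \<longrightarrow>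
           ((\<lambda>w. psihat_A1 p (fst i) \<tau> w) has_field_derivative
              (\<Sum>m<N. (\<i> * (w - \<tau>)) powr of_real (r m) * G m (a m) \<tau> w * H m (b m) w)) (at w))"
  proof (intro exI conjI allI ballI impI)
    show "false_modular_form 0 (1 / 2 + (\<lambda>_. - 1 / 2) m) ((\<lambda>_. {(0, 0)}) m) (\<lambda>_ _. 1) ((\<lambda>_ _ _ _. 1) m)" for m :: nat
      using weakly_holomorphic_one by simp
    show "(\<lambda>_::nat. (0, 0)) m \<in> (\<lambda>_. {(0, 0)}) m" for m by simp
    show "weakly_holomorphic_form (2 + (\<lambda>_. - 1 / 2) m) ((\<lambda>_. rank1_labels p) m) ((\<lambda>_ i \<tau>. of_real (sqrt (2 * p)) * theta1 p (fst i) \<tau>) m)" for m :: nat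
      using weakly_holomorphic_theta1[OF p, of "of_real (sqrt (2 * p))"] by simp
    show "(\<lambda>_::nat. i) m \<in> (\<lambda>_. rank1_labels p) m" for m using i by simp
    fix \<tau> w assume \<tau>: "\<tau> \<in> uhp" and w: "w \<in> uhp" and cut: "\<i> * (w - \<tau>) \<notin> \<real>\<^sub>\<le>\<^sub>0"
    show "((\<lambda>w. psihat_A1 p (fst i) \<tau> w) has_field_derivative
        (\<Sum>m<Suc 0. (\<i> * (w - \<tau>)) powr of_real ((\<lambda>_. - 1 / 2) m) * (\<lambda>_ _ _ _. 1) m ((\<lambda>_. (0, 0)) m) \<tau> w * (\<lambda>_ i \<tau>. of_real (sqrt (2 * p)) * theta1 p (fst i) \<tau>) m ((\<lambda>_. i) m) w)) (at w)"
      using psihat_A1_has_field_derivative[OF p \<tau> w cut, of "fst i"] by (simp add: mult_ac)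
  qed
qed (use two_times_half_int finite_rank1_labels in auto)

lemma psihat_A2_derivative_theta_psihat_A1:
  assumes p: "p > 0" and \<tau>: "\<tau> \<in> uhp" and w: "w \<in> uhp" and cut: "\<i> * (w - \<tau>) \<notin> \<real>\<^sub>\<le>\<^sub>0"
  shows "((\<lambda>w. psihat_A2 p s \<tau> w) has_field_derivative
    (\<i> * (w - \<tau>)) powr of_real (- 1 / 2) * (of_real (sqrt (6 * p)) * h_A2 p s \<tau> w)) (at w)"
proof -
  have ne: "w \<noteq> \<tau>" using cut by auto
  have "(\<i> * (w - \<tau>)) powr of_real (- 1 / 2) * (of_real (sqrt (6 * p)) * h_A2 p s \<tau> w) = - 4 * \<i> * of_real (sqrt 3 * p) * A2_deriv p s \<tau> w"
    unfolding A2_deriv_h[OF p ne, symmetric] not_nonpos_Reals_csqrt(1)[OF cut] by (simp del: csqrt.simps)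
  then show ?thesis using psihat_A2_has_field_derivative[OF p \<tau> w, of s] by (simp only:)
qed

text \<open>The indices of \<open>h_A2\<close>, reduced to the residues that label the vectors \<open>theta1\<close> and \<open>psihat_A1\<close>.\<close>

lemma h_A2_rank1_labels:
  assumes p: "p > 0"
  obtains a b :: "nat \<Rightarrow> label" where "\<And>m. a m \<in> rank1_labels p" "\<And>m. b m \<in> rank1_labels (3 * p)"
    "\<And>\<tau> w. h_A2 p s \<tau> w = (\<Sum>m<4. psihat_A1 p (fst (a m)) \<tau> w * theta1 (3 * p) (fst (b m)) w)"
proof
  define A where "A = (\<lambda>m::nat. [snd s, fst s, snd s - int p, fst s - int p] ! m)"
  define B where "B = (\<lambda>m::nat. [2 * fst s + snd s, 2 * snd s + fst s, 2 * fst s + snd s + 3 * int p, 2 * snd s + fst s + 3 * int p] ! m)"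
  show "(A m mod (2 * int p), 0) \<in> rank1_labels p" for m using p by (simp add: rank1_labels_def)
  show "(B m mod (2 * int (3 * p)), 0) \<in> rank1_labels (3 * p)" for m using p by (simp add: rank1_labels_def)
  fix \<tau> w
  have p3: "3 * p > 0" using p by simp
  have a: "psihat_A1 p (x mod (2 * int p)) = psihat_A1 p x" for x
    by (rule psihat_A1_dvd[OF p]) (simp add: mod_eq_dvd_iff[symmetric])
  have b: "theta1 (3 * p) (x mod (2 * int (3 * p))) = theta1 (3 * p) x" for x
    by (rule theta1_dvd[OF p3]) (simp add: mod_eq_dvd_iff[symmetric])
  show "h_A2 p s \<tau> w = (\<Sum>m<4. psihat_A1 p (fst (A m mod (2 * int p), 0)) \<tau> w * theta1 (3 * p) (fst (B m mod (2 * int (3 * p)), 0)) w)"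
    unfolding fst_conv a b by (simp add: h_A2_def A_def B_def eval_nat_numeral mult.commute)
qed

lemma psihat_A2_holomorphic2:
  assumes p: "p > 0"
  shows "holomorphic2_on (psihat_A2 p s) {(\<tau>, w). \<tau> \<in> uhp \<and> w \<in> uhp \<and> \<tau> \<noteq> w}"
  by (rule holomorphic2_on_Osgood[OF open_uhp open_uhp psihat_A2_continuous[OF p] psihat_A2_holomorphic[OF p] off_diagonal_subset])

text \<open>The completion is holomorphic and transforms without sign, so $\ell = 0$. Its derivative consists of four
terms with $r = -\frac12$, one for each summand of \<open>h_A2\<close>.\<close>

lemma false_modular_psihat_A2:
  assumes p: "p > 0"
  shows "false_modular_form (Suc (Suc 0)) 1 (A2_labels p) (psi_A2 p) (psihat_A2 p)"
  unfolding false_modular_form.simps(2)[of "Suc 0"]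
proof (intro conjI ballI)
  fix i assume i: "i \<in> A2_labels p"
  show "psi_A2 p i holomorphic_on uhp" using psi_A2_holomorphic[OF p, of "fst i" "snd i"] i by simp
next
  fix i \<tau> assume i: "i \<in> A2_labels p" and \<tau>: "\<tau> \<in> uhp"
  show "((\<lambda>t::real. psihat_A2 p i \<tau> (\<tau> + \<i> * of_real t)) \<longlongrightarrow> psi_A2 p i \<tau>) at_top"
    using psihat_A2_limit[OF p \<tau>, of "fst i" "snd i"] psi_A2_eq[OF p \<tau>, of "fst i" "snd i"] i by simp
next
  show "\<exists>l\<in>{0, 1::nat}.
        (\<forall>i\<in>A2_labels p. holomorphic2_on (\<lambda>\<tau> w. csqrt (\<i> * (w - \<tau>)) ^ l * psihat_A2 p i \<tau> w) {(\<tau>, w). \<tau> \<in> uhp \<and> w \<in> uhp \<and> \<tau> \<noteq> w}) \<and>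
        (\<exists>\<Gamma> \<rho>. fin_index_subgroup \<Gamma> \<and> multiplier_system 1 \<Gamma> (A2_labels p) \<rho> \<and>
           (\<forall>g\<in>\<Gamma>. \<forall>i\<in>A2_labels p. \<forall>\<tau>\<in>uhp. \<forall>w\<in>uhp. \<tau> \<noteq> w \<longrightarrow>
              psihat_A2 p i (moeb g \<tau>) (moeb g w) =
                chi_fac g \<tau> w ^ l * jpow g 1 \<tau> * (\<Sum>j\<in>A2_labels p. \<rho> g i j * psihat_A2 p j \<tau> w)))"
  proof (intro bexI[of _ 0] conjI exI[of _ "carrier SL2Z"] exI[of _ "rho2 p"] ballI impI)
    show "holomorphic2_on (\<lambda>\<tau> w. csqrt (\<i> * (w - \<tau>)) ^ 0 * psihat_A2 p i \<tau> w) {(\<tau>, w). \<tau> \<in> uhp \<and> w \<in> uhp \<and> \<tau> \<noteq> w}" for i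
      unfolding power_0 mult_1_left by (rule psihat_A2_holomorphic2[OF p])
    show "multiplier_system 1 (carrier SL2Z) (A2_labels p) (rho2 p)" by (rule multiplier_system_rho2[OF p])
    fix g :: "int^2^2" and i \<tau> w assume "g \<in> carrier SL2Z" and i: "i \<in> A2_labels p" and \<tau>: "\<tau> \<in> uhp" and w: "w \<in> uhp"
    then have d: "det g = 1" by (simp add: carrier_SL2Z)
    have "psihat_A2_transforms p g (rho2 p g)" using rank2_rep_rho2[OF p d] unfolding rank2_rep_def by blast
    then show "psihat_A2 p i (moeb g \<tau>) (moeb g w) =
        chi_fac g \<tau> w ^ 0 * jpow g 1 \<tau> * (\<Sum>j\<in>A2_labels p. rho2 p g i j * psihat_A2 p j \<tau> w)"
      using i \<tau> w unfolding psihat_A2_transforms_def transforms_def act2_def power_0 mult_1_left jpow_one by fastforce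
  qed (use fin_index_SL2Z in auto)
next
  fix i assume i: "i \<in> A2_labels p"
  have p3: "3 * p > 0" using p by simp
  obtain a b :: "nat \<Rightarrow> label" where a: "\<And>m. a m \<in> rank1_labels p" and b: "\<And>m. b m \<in> rank1_labels (3 * p)" and
    h: "\<And>\<tau> w. h_A2 p i \<tau> w = (\<Sum>m<4. psihat_A1 p (fst (a m)) \<tau> w * theta1 (3 * p) (fst (b m)) w)"
    by (rule h_A2_rank1_labels[OF p, where s = i]) (rule that)
  let ?r = "\<lambda>_::nat. - 1 / 2 :: real" and ?A = "\<lambda>_::nat. rank1_labels p" and ?G = "\<lambda>(_::nat) i. psihat_A1 p (fst i)"
  let ?B = "\<lambda>_::nat. rank1_labels (3 * p)" and ?H = "\<lambda>(_::nat) i w. of_real (sqrt (6 * p)) * theta1 (3 * p) (fst i) w"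
  show "\<exists>(N::nat) r A G a B H b.
        (\<forall>m<N. (\<exists>g. false_modular_form (Suc 0) (1 + r m) (A m) g (G m)) \<and> a m \<in> A m \<and>
               weakly_holomorphic_form (2 + r m) (B m) (H m) \<and> b m \<in> B m) \<and>
        (\<forall>\<tau>\<in>uhp. \<forall>w\<in>uhp. \<i> * (w - \<tau>) \<notin> \<real>\<^sub>\<le>\<^sub>0 \<longrightarrow>
           ((\<lambda>w. psihat_A2 p i \<tau> w) has_field_derivative
              (\<Sum>m<N. (\<i> * (w - \<tau>)) powr of_real (r m) * G m (a m) \<tau> w * H m (b m) w)) (at w))"
  proof (intro exI conjI allI ballI impI)
    show "false_modular_form (Suc 0) (1 + ?r m) (?A m) (\<lambda>i. psi_A1 p (fst i)) (?G m)" for m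
    proof -
      have "1 + (- 1 / 2) = (1 / 2 :: real)" by simp
      then show ?thesis using false_modular_psihat_A1[OF p] by (simp only:)
    qed
    show "a m \<in> ?A m" "b m \<in> ?B m" for m by (rule a b)+
    show "weakly_holomorphic_form (2 + ?r m) (?B m) (?H m)" for m
      using weakly_holomorphic_theta1[OF p3, of "of_real (sqrt (6 * p))"] by simp
    fix \<tau> w assume \<tau>: "\<tau> \<in> uhp" and w: "w \<in> uhp" and cut: "\<i> * (w - \<tau>) \<notin> \<real>\<^sub>\<le>\<^sub>0"
    have "(\<i> * (w - \<tau>)) powr of_real (- 1 / 2) * (of_real (sqrt (6 * p)) * h_A2 p i \<tau> w) =
      (\<Sum>m<4. (\<i> * (w - \<tau>)) powr of_real (?r m) * ?G m (a m) \<tau> w * ?H m (b m) w)"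
      unfolding h sum_distrib_left by (simp only: mult_ac)
    with psihat_A2_derivative_theta_psihat_A1[OF p \<tau> w cut, of i]
    show "((\<lambda>w. psihat_A2 p i \<tau> w) has_field_derivative
        (\<Sum>m<4. (\<i> * (w - \<tau>)) powr of_real (?r m) * ?G m (a m) \<tau> w * ?H m (b m) w)) (at w)" by (simp only:)
  qed
qed (use finite_A2_labels in auto)

lemma psihat_A2_S_labels:
  assumes p: "p > 0" and \<tau>: "\<tau> \<in> uhp" and w: "w \<in> uhp"
  shows "psihat_A2 p (s1, s2) (- 1 / \<tau>) (- 1 / w) =
             - (\<i> * \<tau> / (of_nat p * of_real (sqrt 3))) *
             (\<Sum>r1\<in>{0..3 * int p - 1}. \<Sum>r2\<in>{0..int p - 1}.
                exp (- (2 * of_real pi * \<i> / (3 * of_nat p)) *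
                     of_int (2 * r1 * s1 + r2 * s1 + r1 * s2 + 2 * r2 * s2)) *
                psihat_A2 p (r1, r2) \<tau> w)"
proof -
  have e: "A2_char p (s1, s2) (r1, r2) = exp (- (2 * of_real pi * \<i> / (3 * of_nat p)) * of_int (2 * r1 * s1 + r2 * s1 + r1 * s2 + 2 * r2 * s2))" for r1 r2
    unfolding A2_char_def e2_def
    by (rule arg_cong[where f = exp]) (simp only: times_divide_eq_right times_divide_eq_left mult_minus_right mult_minus_left minus_divide_left fst_conv snd_conv)
  have "psihat_A2 p (s1, s2) (- 1 / \<tau>) (- 1 / w) = \<tau> * (2 * Sfac (3 * p) * Sfac p) * (\<Sum>r\<in>A2_labels p. A2_char p (s1, s2) r * psihat_A2 p r \<tau> w)"
    unfolding psihat_A2_S[OF p \<tau> w] S2_def sum_distrib_left by (simp only: mult_ac)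
  also have "(\<Sum>r\<in>A2_labels p. A2_char p (s1, s2) r * psihat_A2 p r \<tau> w) = (\<Sum>r1\<in>{0..3 * int p - 1}. \<Sum>r2\<in>{0..int p - 1}. A2_char p (s1, s2) (r1, r2) * psihat_A2 p (r1, r2) \<tau> w)"
    unfolding A2_labels_def sum.cartesian_product by (simp only: case_prod_unfold prod.collapse)
  also have "\<tau> * (2 * Sfac (3 * p) * Sfac p) = - (\<i> * \<tau> / (of_nat p * of_real (sqrt 3)))"
    unfolding Sfac_product[OF p] by simp
  finally show ?thesis unfolding e .
qed

theorem proposition4p6:
  fixes p :: nat
  assumes "p \<ge> 2"
  shows
    "(\<forall>s1 s2. (s1, s2) \<in> A2_labels p \<longrightarrow>
        (\<forall>\<tau>\<in>uhp. \<forall>w\<in>uhp. \<tau> \<noteq> w \<longrightarrow>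
           psihat_A2 p (s1, s2) (\<tau> + 1) (w + 1) =
             exp (2 * of_real pi * \<i> / (3 * of_nat p) * of_int (s1\<^sup>2 + s1 * s2 + s2\<^sup>2)) *
             psihat_A2 p (s1, s2) \<tau> w \<and>
           psihat_A2 p (s1, s2) (- 1 / \<tau>) (- 1 / w) =
             - (\<i> * \<tau> / (of_nat p * of_real (sqrt 3))) *
             (\<Sum>r1\<in>{0..3 * int p - 1}. \<Sum>r2\<in>{0..int p - 1}.
                exp (- (2 * of_real pi * \<i> / (3 * of_nat p)) *
                     of_int (2 * r1 * s1 + r2 * s1 + r1 * s2 + 2 * r2 * s2)) *
                psihat_A2 p (r1, r2) \<tau> w)) \<and>
        (\<forall>\<tau>\<in>uhp.
           psi_A2 p (s1, s2) \<tau> =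
             1 / 3 * of_bool ((s1, s2) = (0, 0)) +
             (\<Sum>\<^sub>\<infinity>n\<in>int2_coset (mu2 p (s1, s2)).
                of_real (sgn (n $ 1) * sgn (n $ 2)) * qpow \<tau> (of_nat p * Q2 n))) \<and>
        (\<forall>\<tau>\<in>uhp. \<forall>w\<in>uhp. \<tau> \<noteq> w \<longrightarrow>
           (\<lambda>w1. h_A2 p (s1, s2) \<tau> w1 / csqrt (\<i> * (w1 - \<tau>))) contour_integrable_on geodesic \<tau> w \<and>
           psihat_A2 p (s1, s2) \<tau> w =
             of_real (sqrt (6 * of_nat p)) *
               contour_integral (geodesic \<tau> w) (\<lambda>w1. h_A2 p (s1, s2) \<tau> w1 / csqrt (\<i> * (w1 - \<tau>))) +
             1 / 3 * Theta_A2 p (mu2 p (s1, s2)) \<tau>)) \<and>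
     false_modular_form 2 1 (A2_labels p) (psi_A2 p) (psihat_A2 p)"
proof -
  have p: "p > 0" using assms by simp
  have T: "psihat_A2 p (s1, s2) (\<tau> + 1) (w + 1) =
      exp (2 * of_real pi * \<i> / (3 * of_nat p) * of_int (s1\<^sup>2 + s1 * s2 + s2\<^sup>2)) * psihat_A2 p (s1, s2) \<tau> w" for s1 s2 \<tau> w
    unfolding psihat_A2_T[OF p] T2_def e2_def by simp
  have F: "false_modular_form 2 1 (A2_labels p) (psi_A2 p) (psihat_A2 p)"
    using false_modular_psihat_A2[OF p] by (simp only: numeral_2_eq_2)
  show ?thesis
    by (intro conjI allI impI ballI F T psihat_A2_S_labels[OF p] psi_A2_eq[OF p] psihat_A2_integral[OF p])
qed

end
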